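(* Let $G = K\rtimes_f H$ be a finite Frobenius group with Frobenius kernel $K$ and Frobenius complement $H$, and assume that $H$ is a non-nilpotent $\{2,q\}$-group, where $q$ is an odd prime. Then $G$ has perfect order classes if, and only if, $q$ is equal either to $3$ or to $5$ and $G$ has one of the following forms, for some positive integer $k$: (1) $G\simeq \mathrm{C}_{5^k}^2\rtimes_f \mathrm{SL}(2,3)$; (2) $G\simeq \mathrm{C}_{5^k}^2\rtimes_f (\mathrm{C}_{3}\rtimes \mathrm{C}_{8})$; (3) $G\simeq \mathrm{C}_{7^k}^2\rtimes_f (\mathrm{C}_{3}\rtimes \mathrm{C}_{16})$; (4) $G\simeq \mathrm{C}_{17^k}^2\rtimes_f (\mathrm{C}_{9}\rtimes \mathrm{C}_{32})$; or (5) $G\simeq \mathrm{C}_{3^k}^4\rtimes_f (\mathrm{C}_{5}\rtimes \mathrm{C}_{16})$.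
   Context: All groups are finite. A finite group $G$ has perfect order classes if, for every positive integer $n$, the number of elements of order $n$ in $G$ is either zero or a divisor of $|G|$. A Frobenius group is a group $G$ with a proper non-trivial subgroup $H$ (a Frobenius complement) such that $H\cap H^g = 1$ for all $g\in G\setminus H$; its Frobenius kernel $K$ is the normal subgroup consisting of $1$ and all elements of $G$ lying in no conjugate of $H$, and $G$ is the semidirect product of $K$ by $H$. The notation $K\rtimes_f H$ denotes a semidirect product that is a Frobenius group with Frobenius kernel $K$ and Frobenius complement $H$. $\mathrm{C}_n$ is the cyclic group of order $n$, and $\mathrm{C}_n^r$ is the direct product of $r$ copies of it. $A\rtimes B$ denotes a semidirect product of $A$ and $B$ with $A$ normal (with some action of $B$ on $A$). A $\{2,q\}$-group is a group whose order has no prime divisors other than $2$ and $q$. *)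

theory Defs
  imports
    "HOL-Algebra.Algebra"
    "HOL-Analysis.Determinants"
    "HOL-Library.Numeral_Type"
begin

definition perfect_order_classes :: "('a, 'b) monoid_scheme \<Rightarrow> bool" where
  "perfect_order_classes G \<longleftrightarrow>
     (\<forall>n::nat. n > 0 \<longrightarrow>
        card {x \<in> carrier G. group.ord G x = n} = 0 \<or>
        card {x \<in> carrier G. group.ord G x = n} dvd Coset.order G)"

primrec lower_central_series :: "('a, 'b) monoid_scheme \<Rightarrow> nat \<Rightarrow> 'a set" where
  "lower_central_series G 0 = carrier G"
| "lower_central_series G (Suc n) =
     generate G (\<Union>x \<in> lower_central_series G n. \<Union>y \<in> carrier G.
       {x \<otimes>\<^bsub>G\<^esub> y \<otimes>\<^bsub>G\<^esub> inv\<^bsub>G\<^esub> x \<otimes>\<^bsub>G\<^esub> inv\<^bsub>G\<^esub> y})"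

definition nilpotent_group :: "('a, 'b) monoid_scheme \<Rightarrow> bool" where
  "nilpotent_group G \<longleftrightarrow> group G \<and> (\<exists>n. lower_central_series G n = {\<one>\<^bsub>G\<^esub>})"

definition conj_subgroup :: "('a, 'b) monoid_scheme \<Rightarrow> 'a set \<Rightarrow> 'a \<Rightarrow> 'a set" where
  "conj_subgroup G H g = (\<lambda>h. inv\<^bsub>G\<^esub> g \<otimes>\<^bsub>G\<^esub> h \<otimes>\<^bsub>G\<^esub> g) ` H"

definition frobenius_complement :: "('a, 'b) monoid_scheme \<Rightarrow> 'a set \<Rightarrow> bool" where
  "frobenius_complement G H \<longleftrightarrow>
     subgroup H G \<and> H \<noteq> {\<one>\<^bsub>G\<^esub>} \<and> H \<noteq> carrier G \<and>
     (\<forall>g \<in> carrier G - H. H \<inter> conj_subgroup G H g = {\<one>\<^bsub>G\<^esub>})"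

definition frobenius_kernel :: "('a, 'b) monoid_scheme \<Rightarrow> 'a set \<Rightarrow> 'a set" where
  "frobenius_kernel G H =
     {\<one>\<^bsub>G\<^esub>} \<union> (carrier G - (\<Union>g \<in> carrier G. conj_subgroup G H g))"

definition internal_semidirect :: "('a, 'b) monoid_scheme \<Rightarrow> 'a set \<Rightarrow> 'a set \<Rightarrow> bool" where
  "internal_semidirect G K H \<longleftrightarrow>
     K \<lhd> G \<and> subgroup H G \<and> K \<inter> H = {\<one>\<^bsub>G\<^esub>} \<and> K <#>\<^bsub>G\<^esub> H = carrier G"

definition frobenius_product :: "('a, 'b) monoid_scheme \<Rightarrow> 'a set \<Rightarrow> 'a set \<Rightarrow> bool" where
  "frobenius_product G K H \<longleftrightarrow>
     internal_semidirect G K H \<and> frobenius_complement G H \<and> K = frobenius_kernel G H"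

definition semidirect ::
  "('a, 'c) monoid_scheme \<Rightarrow> ('b, 'd) monoid_scheme \<Rightarrow> ('b \<Rightarrow> 'a \<Rightarrow> 'a) \<Rightarrow> ('a \<times> 'b) monoid" where
  "semidirect A B \<phi> =
     \<lparr>carrier = carrier A \<times> carrier B,
      monoid.mult = (\<lambda>(a, b) (a', b'). (a \<otimes>\<^bsub>A\<^esub> \<phi> b a', b \<otimes>\<^bsub>B\<^esub> b')),
      one = (\<one>\<^bsub>A\<^esub>, \<one>\<^bsub>B\<^esub>)\<rparr>"

text \<open>\<open>has_frobenius_form G A B\<close> renders \<open>G \<cong> A \<rtimes>\<^sub>f B\<close>, the action of \<open>B\<close> on \<open>A\<close> being
  left unspecified.\<close>

definition has_frobenius_form ::
  "('g, 'e) monoid_scheme \<Rightarrow> ('a, 'c) monoid_scheme \<Rightarrow> ('b, 'd) monoid_scheme \<Rightarrow> bool" where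
  "has_frobenius_form G A B \<longleftrightarrow>
     (\<exists>\<phi> \<in> hom B (AutoGroup A).
        frobenius_product (semidirect A B \<phi>)
          (carrier A \<times> {\<one>\<^bsub>B\<^esub>}) ({\<one>\<^bsub>A\<^esub>} \<times> carrier B) \<and>
        G \<cong> semidirect A B \<phi>)"

abbreviation cyclic_power :: "nat \<Rightarrow> nat \<Rightarrow> (nat \<Rightarrow> int) monoid" where
  "cyclic_power n r \<equiv> product_group {..<r} (\<lambda>_. integer_mod_group n)"

text \<open>The numeral type \<open>3\<close> is the ring of integers modulo 3, i.e. the field with three elements.\<close>

definition SL_2_3 :: "(3 ^ 2 ^ 2) monoid" where
  "SL_2_3 = \<lparr>carrier = {M. det M = 1}, monoid.mult = (**), one = mat 1\<rparr>"

end

theory Submission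
  imports Defs "HOL-Number_Theory.Number_Theory"
begin

text \<open>Since \<open>H\<close> is not nilpotent it has even order, so its unique involution inverts the kernel \<open>K\<close> and
  \<open>K\<close> is abelian. The complement acts freely on each order class of \<open>K\<close>, so \<open>|H|\<close> divides the size of
  every such class; perfect order classes then force \<open>K\<close> to be a homocyclic \<open>p\<close>-group of some rank \<open>r\<close>
  with \<open>|H| = p\<^sup>r - 1\<close>. Also \<open>q - 1\<close> divides \<open>|H| = 2\<^sup>a q\<^sup>b\<close>, so \<open>q\<close> is a Fermat prime, and \<open>r \<ge> 2\<close>, because
  the automorphism group of a cyclic group is abelian. The equation \<open>p\<^sup>r - 1 = 2\<^sup>a q\<^sup>b\<close> now has four solutions.
  A Sylow 2-subgroup of \<open>H\<close> is cyclic or generalized quaternion. In the first case a transfer argument gives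
  a normal 2-complement, which is cyclic. In the second case the number of elements of order 4 divides \<open>|H|\<close>,
  which forces the Sylow 2-subgroup to be normal, and then non-nilpotency leaves only \<open>SL(2,3)\<close>.

  Conversely, the order classes of \<open>H\<close> are counted directly, and \<open>|H| = p\<^sup>r - 1\<close> handles those inside \<open>K\<close>.
  For \<open>q = 5\<close> this needs that \<open>C\<^sub>5 \<rtimes> C\<^sub>1\<^sub>6\<close> is not abelian. As \<open>has_frobenius_form\<close> only provides some complement,
  possibly different from \<open>H\<close>, non-nilpotency has to be transferred to it: an abelian normal subgroup with
  abelian quotient meets \<open>H\<close> trivially, which would make \<open>H\<close> abelian.\<close>

subsection \<open>The equation \<open>p\<^sup>r - 1 = 2\<^sup>a q\<^sup>b\<close>\<close>

text \<open>The arithmetic table does more than list cases: it bounds the group theory. It gives b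
  <= 2, so a Sylow q-subgroup of H is abelian; it gives b = 2 only for q = 3, so that the only
  non-cyclic possibility to exclude is an elementary abelian group of order 9; and it gives q^b <=
  2^(a-2) + 1. This last bound decides the quaternion case. One quaternion Sylow subgroup already
  contains 2^(a-1) + 2 elements of order 4, while the total number is 2 modulo 4, divides |H|, and
  so is at most 2 q^b; nothing is left outside that subgroup. Transfer is light here because its
  target is the central group generated by the unique involution: it becomes a product of signs, and
  the cyclic Sylow generator gets an odd number of minus signs. The need for a non-abelian
  complement when q = 5 comes from the factor q - 1 = 4. Elements of order 5 times 2^i whose 2-part
  is central number 4 times 2^(i-1), which divides the order only if i < a; non-commutativity
  excludes i = a. For q = 3 the factor is 2 and every i <= a is harmless.\<close>

lemma consecutive_two_powers:
  fixes i j :: nat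
  assumes "2 ^ j = 2 ^ i + (2::nat)"
  shows "i = 1"
proof (cases i)
  case 0
  then have "2 ^ j = (3::nat)" using assms by simp
  then show ?thesis by (cases j) (auto, presburger)
next
  case (Suc i')
  then obtain j' where j: "j = Suc j'" using assms by (cases j) auto
  have e: "2 ^ j' = 2 ^ i' + (1::nat)" using assms Suc j by simp
  show ?thesis
  proof (cases i')
    case 0 then show ?thesis using Suc by simp
  next
    case (Suc k)
    then have "j' \<noteq> 0" using e by (intro notI) auto
    then have "even (2 ^ j' :: nat)" by simp
    moreover have "odd (2 ^ i' + (1::nat))" using Suc by simp
    ultimately show ?thesis using e by simp
  qed
qed

lemma geometric_sum_odd:
  fixes x n :: nat
  assumes "odd x" "odd n"
  shows "odd (\<Sum>i<n. x ^ i)"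
proof -
  have "even (\<Sum>i<n. x ^ i) \<longleftrightarrow> even n" for n
    by (induction n) (use assms(1) in auto)
  then show ?thesis using assms(2) by simp
qed

lemma power_minus_one_nat:
  fixes x n :: nat
  assumes "x \<ge> 1"
  shows "x ^ n - 1 = (x - 1) * (\<Sum>i<n. x ^ i)"
proof -
  have "int (x ^ n) - 1 = (int x - 1) * (\<Sum>i<n. int x ^ i)"
    using power_diff_1_eq[of "int x" n] by simp
  then have "int (x ^ n - 1) = int ((x - 1) * (\<Sum>i<n. x ^ i))"
    using assms by (simp add: of_nat_diff)
  then show ?thesis by (simp only: of_nat_eq_iff)
qed

lemma odd_dvd_two_power_mult:
  fixes d n :: nat
  assumes "odd d" "d dvd 2 ^ a * n"
  shows "d dvd n"
proof -
  have "coprime d (2 ^ a)" using assms(1) by simp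
  then show ?thesis using assms(2) by (simp add: coprime_dvd_mult_right_iff)
qed

text \<open>With p = 1 + qc, modulo q^2 the power p^i is 1 + iqc, and the exponents 0, ..., q - 1
  add up to a multiple of q because q is odd. So q divides this sum exactly once when q > 1.\<close>

lemma geometric_sum_mod_square:
  fixes p q :: nat
  assumes "odd q" "[p = 1] (mod q)"
  shows "[(\<Sum>i<q. p ^ i) = q] (mod q\<^sup>2)"
proof -
  have "\<exists>c. int p = 1 + int q * c"
    using assms(2) by (metis cong_iff_lin cong_int_iff cong_sym of_nat_1)
  then obtain c where c: "int p = 1 + int q * c" by blast
  have pw: "[int p ^ i = 1 + int i * (int q * c)] (mod (int q)\<^sup>2)" for i
  proof (induction i)
    case (Suc i)
    have "[int p * int p ^ i = (1 + int q * c) * (1 + int i * (int q * c))] (mod (int q)\<^sup>2)"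
      unfolding c[symmetric] by (intro cong_mult Suc) auto
    also have "(1 + int q * c) * (1 + int i * (int q * c)) = 1 + int (Suc i) * (int q * c) + (int q)\<^sup>2 * (int i * c * c)"
      by (simp add: algebra_simps power2_eq_square)
    also have "[\<dots> = 1 + int (Suc i) * (int q * c)] (mod (int q)\<^sup>2)"
      by (simp add: cong_iff_dvd_diff)
    finally show ?case by simp
  qed auto
  have s: "2 * (\<Sum>i<n. int i) = int n * (int n - 1)" for n
    by (induction n) (auto simp: algebra_simps)
  obtain h where h: "q = 2 * h + 1" using assms(1) by (elim oddE)
  have "(\<Sum>i<q. int i) = int q * int h" using s[of q] h by simp
  then have "(\<Sum>i<q. 1 + int i * (int q * c)) = int q + (int q)\<^sup>2 * (int h * c)"
    by (simp add: sum.distrib sum_distrib_right[symmetric] power2_eq_square)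
  moreover have "[(\<Sum>i<q. int p ^ i) = (\<Sum>i<q. 1 + int i * (int q * c))] (mod (int q)\<^sup>2)"
    by (intro cong_sum pw)
  ultimately have "[(\<Sum>i<q. int p ^ i) = int q] (mod (int q)\<^sup>2)"
    by (simp add: cong_def)
  then have "[int (\<Sum>i<q. p ^ i) = int q] (mod int (q\<^sup>2))" by simp
  then show ?thesis by (simp only: cong_int_iff)
qed

text \<open>For odd r the order of p modulo q divides both q - 1 = 2^e and r, so p = 1 modulo q. The
  odd factor S of p^r - 1 is then a power of q congruent to r, hence q divides r and the shorter sum
  T over q terms divides S. But a power of q that is q modulo q^2 is at most q, whereas T exceeds
  q.\<close>

lemma even_exponent:
  fixes p q r a b e :: nat
  assumes p: "Factorial_Ring.prime p" "odd p" and q: "Factorial_Ring.prime q" "q = 2 ^ e + 1" "odd q"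
    and eq: "p ^ r - 1 = 2 ^ a * q ^ b" and b: "b > 0" and r: "r \<ge> 2"
  shows "even r"
proof (rule ccontr)
  assume "odd r"
  have p1: "p > 1" using p prime_gt_1_nat by blast
  define S where "S = (\<Sum>i<r. p ^ i)"
  have oddS: "odd S" unfolding S_def by (rule geometric_sum_odd) fact+
  have pS: "p ^ r - 1 = (p - 1) * S" unfolding S_def by (rule power_minus_one_nat) (use p1 in simp)
  have "S dvd 2 ^ a * q ^ b" using pS eq by (metis dvd_triv_right)
  then have "S dvd q ^ b" using oddS by (rule odd_dvd_two_power_mult[rotated])
  have cop: "coprime p q"
  proof -
    have "\<not> q dvd p"
    proof
      assume "q dvd p"
      then have "q dvd p ^ r" using r by (simp add: dvd_power_same dvd_trans)
      moreover have "q dvd p ^ r - 1" using eq b by simp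
      ultimately have "q dvd 1" using p1 by (metis dvd_diffD1 one_le_power less_imp_le)
      then show False using q by simp
    qed
    then show ?thesis using q by (metis coprime_commute prime_imp_coprime)
  qed
  have pr1: "[p ^ r = 1] (mod q)"
  proof -
    have "q dvd p ^ r - 1" using eq b by simp
    then show ?thesis using p1 by (simp add: cong_altdef_nat)
  qed
  have "[p ^ (q - 1) = 1] (mod q)" using fermat_theorem[of q p] q cop
    by (metis coprime_commute coprime_absorb_left not_prime_unit prime_imp_coprime)
  then have "[p ^ (2 ^ e) = 1] (mod q)" using q(2) by simp
  then have d1: "Pocklington.ord q p dvd 2 ^ e" unfolding ord_divides .
  have d2: "Pocklington.ord q p dvd r" using pr1 unfolding ord_divides .
  have "coprime r (2 ^ e)" using \<open>odd r\<close> by simp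
  then have "Pocklington.ord q p = 1" using d1 d2 by (meson coprime_common_divisor_nat)
  then have pq: "[p = 1] (mod q)" using ord_works[of p q] by simp
  have Sr: "[S = r] (mod q)"
  proof -
    have "[S = (\<Sum>i<r. 1 ^ i)] (mod q)" unfolding S_def by (intro cong_sum cong_pow pq)
    then show ?thesis by simp
  qed
  have Sge: "S > 1"
  proof -
    have "{..<2} \<subseteq> {..<r}" using r by auto
    then have "(\<Sum>i<2. p ^ i) \<le> S" unfolding S_def by (intro sum_mono2) auto
    then show ?thesis using p1 by (simp add: numeral_2_eq_2)
  qed
  obtain s where s: "S = q ^ s" using \<open>S dvd q ^ b\<close> q(1) by (auto simp: divides_primepow_nat)
  then have "q dvd S" using Sge by (cases s) auto
  then have "q dvd r" using Sr by (simp add: cong_dvd_iff)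
  then obtain t where t: "r = q * t" by blast
  have t0: "t > 0" using t r by (cases t) auto
  define T where "T = (\<Sum>i<q. p ^ i)"
  have "p ^ r - 1 = (p - 1) * T * (\<Sum>i<t. (p ^ q) ^ i)"
    using power_minus_one_nat[of "p ^ q" t] power_minus_one_nat[of p q] p1 t
    unfolding T_def by (simp add: power_mult)
  then have "S = T * (\<Sum>i<t. (p ^ q) ^ i)" using pS p1 by simp
  then have "T dvd q ^ s" using s by (metis dvd_triv_left)
  then obtain u where u: "T = q ^ u" using q(1) by (auto simp: divides_primepow_nat)
  have Tq: "[T = q] (mod q\<^sup>2)" unfolding T_def by (rule geometric_sum_mod_square) fact+
  have q1: "q > 1" using q(1) prime_gt_1_nat by blast
  have "u < 2"
  proof (rule ccontr)
    assume "\<not> u < 2"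
    then have "q\<^sup>2 dvd T" using u by (simp add: le_imp_power_dvd)
    then have "q\<^sup>2 dvd q" using Tq by (simp add: cong_dvd_iff)
    then have "q\<^sup>2 \<le> q" using q1 by (simp add: dvd_imp_le)
    then show False using q1 by (simp add: power2_eq_square)
  qed
  then have "T \<le> q" using u q1 by (cases u) (auto simp: less_Suc_eq)
  moreover have "q < T"
  proof -
    have "(\<Sum>i<q. 1) < (\<Sum>i<q. p ^ i)"
      by (rule sum_strict_mono_ex1) (use p1 q1 in \<open>auto intro!: bexI[of _ 1]\<close>)
    then show ?thesis by (simp add: T_def)
  qed
  ultimately show False by simp
qed

text \<open>The cofactor of x - 1 in x^b - 1 is an odd divisor of a power of two, hence 1; two of
  its terms already exceed that.\<close>

lemma odd_power_not_two_power:
  fixes x b n :: nat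
  assumes "odd x" "odd b" "x > 1" "x ^ b = 2 ^ n + 1"
  shows "b = 1"
proof (rule ccontr)
  assume "b \<noteq> 1"
  then have b: "b \<ge> 2" using assms(2) by (cases b) auto
  have "(x - 1) * (\<Sum>i<b. x ^ i) = 2 ^ n"
    using power_minus_one_nat[of x b] assms by simp
  then have "(\<Sum>i<b. x ^ i) dvd 2 ^ n * 1" by (metis dvd_triv_right mult.right_neutral)
  moreover have "odd (\<Sum>i<b. x ^ i)" by (rule geometric_sum_odd) fact+
  ultimately have "(\<Sum>i<b. x ^ i) dvd 1" by (rule odd_dvd_two_power_mult[rotated])
  moreover have "(\<Sum>i<2. x ^ i) \<le> (\<Sum>i<b. x ^ i)" using b by (intro sum_mono2) auto
  ultimately show False using assms(3) by (simp add: numeral_2_eq_2)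
qed

text \<open>Both x - 1 and x + 1 are powers of two, at distance two, hence 2 and 4.\<close>

lemma square_eq_two_power_plus_one:
  fixes x n :: nat
  assumes "x\<^sup>2 = 2 ^ n + 1"
  shows "x = 3"
proof -
  have x: "x \<ge> 2" using assms by (cases x; cases "x - 1") (auto simp: power2_eq_square)
  have "(x - 1) * (x + 1) = 2 ^ n"
    using assms x by (simp add: power2_eq_square algebra_simps)
  then have "x - 1 dvd 2 ^ n" "x + 1 dvd 2 ^ n" by (metis dvd_triv_left, metis dvd_triv_right)
  then obtain i j where "x - 1 = 2 ^ i" "x + 1 = 2 ^ j"
    by (auto simp: divides_primepow_nat[OF two_is_prime_nat])
  then have "2 ^ j = 2 ^ i + (2::nat)" "x - 1 = 2 ^ i" using x by linarith+
  then show ?thesis using consecutive_two_powers[of j i] by simp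
qed

lemma prime_power_eq_prime:
  fixes p m l :: nat
  assumes "Factorial_Ring.prime l" "p ^ m = l"
  shows "p = l \<and> m = 1"
  using assms by (auto simp: prime_power_iff)

text \<open>The bound on \<open>n\<close> makes the right side 1 modulo 8, while odd powers of 3 are
  3 modulo 8; an even exponent reduces to the square case.\<close>

lemma three_power_eq_two_power_plus_one:
  fixes m n :: nat
  assumes "3 ^ m = 2 ^ n + (1::nat)" "n \<ge> 3"
  shows "m = 2 \<and> n = 3"
proof -
  have "even m"
  proof (rule ccontr)
    assume "odd m"
    then obtain h where h: "m = 2 * h + 1" by (elim oddE)
    have "(3::nat) ^ m mod 8 = 3"
    proof -
      have "[(9::nat) ^ h = 1 ^ h] (mod 8)" by (rule cong_pow) (simp add: cong_def)
      then have "[3 * (9::nat) ^ h = 3 * 1] (mod 8)" by (intro cong_mult) auto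
      then show ?thesis using h by (simp add: cong_def power_mult)
    qed
    moreover have "(2 ^ n + (1::nat)) mod 8 = 1"
    proof -
      have "(2::nat) ^ 3 dvd 2 ^ n" by (rule le_imp_power_dvd) fact
      then show ?thesis by (simp add: dvd_eq_mod_eq_0 mod_Suc)
    qed
    ultimately show False using assms by simp
  qed
  then obtain h where h: "m = h * 2" by (metis evenE mult.commute)
  then have "(3 ^ h)\<^sup>2 = (2 ^ n + 1 :: nat)" using assms by (simp add: power_mult)
  then have "(3::nat) ^ h = 3" by (rule square_eq_two_power_plus_one)
  then have "h = 1" by (simp add: power_eq_iff_eq_base power_inject_exp[of 3 h 1, simplified])
  then have "(2::nat) ^ n = 2 ^ 3" using assms h by simp
  then have "n = 3" by (metis power_inject_exp one_less_numeral_iff semiring_norm(76))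
  then show ?thesis using \<open>h = 1\<close> h by simp
qed

text \<open>With y = 2h + 1 the product is 4h(h + 1). Since h and h + 1 are coprime, q^b divides one
  of them; the other is a power of two, and parity forces the remaining cofactor to be 1. The two
  alternatives are q^b = h + 1 and q^b = h.\<close>

lemma odd_part_decomposition:
  fixes q y a b :: nat
  assumes q: "Factorial_Ring.prime q" "odd q" and y: "odd y" "y > 1" and eq: "(y - 1) * (y + 1) = 2 ^ a * q ^ b" and b: "b > 0"
  shows "\<exists>n\<ge>1. a = n + 2 \<and> (q ^ b = 2 ^ n + 1 \<and> y = 2 ^ (n + 1) + 1 \<or> q ^ b = 2 ^ n - 1 \<and> y = 2 ^ (n + 1) - 1)"
proof -
  obtain h where h: "y = 2 * h + 1" using y(1) by (elim oddE)
  have h1: "h \<ge> 1" using h y(2) by simp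
  have e4: "4 * (h * (h + 1)) = 2 ^ a * q ^ b" using eq h by (simp add: algebra_simps)
  have "\<not> (q dvd h \<and> q dvd h + 1)"
  proof
    assume "q dvd h \<and> q dvd h + 1"
    then have "q dvd 1" by (meson dvd_add_right_iff)
    then show False using q by simp
  qed
  then have cop: "coprime (q ^ b) h \<or> coprime (q ^ b) (h + 1)" using q(1) by (meson coprime_power_left_iff prime_imp_coprime)
  have "odd (q ^ b)" using q by simp
  have "q ^ b dvd 2 ^ 2 * (h * (h + 1))" using e4 by simp
  then have qd: "q ^ b dvd h * (h + 1)" by (rule odd_dvd_two_power_mult[rotated]) fact
  have q3: "q ^ b \<ge> 3"
  proof -
    have "q \<ge> 3" using q prime_ge_2_nat[of q] by (cases "q = 2") auto
    moreover have "q ^ 1 \<le> q ^ b" using b q by (intro power_increasing) (auto simp: Suc_leI prime_gt_0_nat)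
    ultimately show ?thesis by simp
  qed
  consider (A) "q ^ b dvd h + 1" | (B) "q ^ b dvd h"
    using cop qd by (meson coprime_dvd_mult_left_iff coprime_dvd_mult_right_iff)
  then show ?thesis
  proof cases
    case A
    then obtain c where c: "h + 1 = q ^ b * c" by blast
    have "4 * h * c * q ^ b = 2 ^ a * q ^ b" unfolding e4[symmetric] c by (simp only: mult_ac)
    then have e: "4 * h * c = 2 ^ a" using \<open>odd (q ^ b)\<close> by (metis even_zero mult_right_cancel)
    have "h dvd 2 ^ a" "c dvd 2 ^ a" using e by (metis dvd_triv_left dvd_mult2 dvd_triv_right, metis dvd_triv_right)
    then obtain n l where n: "h = 2 ^ n" and l: "c = 2 ^ l" by (auto simp: divides_primepow_nat[OF two_is_prime_nat])
    have n1: "n \<ge> 1"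
    proof (rule ccontr)
      assume "\<not> n \<ge> 1"
      then have "h = 1" using n by (cases n) auto
      then have "q ^ b dvd 2" using c by (metis dvd_triv_left one_add_one)
      then show False using q3 by (auto dest: dvd_imp_le)
    qed
    then have "odd (h + 1)" using n by simp
    then have "odd c" unfolding c by simp
    then have "c = 1" using l by (cases l) auto
    then have "q ^ b = 2 ^ n + 1" "2 ^ a = (2::nat) ^ (n + 2)" using c n e by auto
    then have "a = n + 2" by (meson power_inject_exp one_less_numeral_iff semiring_norm(76))
    then show ?thesis using n1 n h \<open>q ^ b = 2 ^ n + 1\<close> by auto
  next
    case B
    then obtain c where c: "h = q ^ b * c" by blast
    have "4 * (h + 1) * c * q ^ b = 2 ^ a * q ^ b"
      unfolding e4[symmetric] by (subst (2) c) (simp only: mult_ac)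
    then have e: "4 * (h + 1) * c = 2 ^ a" using \<open>odd (q ^ b)\<close> by (metis even_zero mult_right_cancel)
    have "h + 1 dvd 2 ^ a" "c dvd 2 ^ a" using e by (metis dvd_triv_left dvd_mult2 dvd_triv_right, metis dvd_triv_right)
    then obtain n l where n: "h + 1 = 2 ^ n" and l: "c = 2 ^ l" by (auto simp: divides_primepow_nat[OF two_is_prime_nat])
    have n1: "n \<ge> 1" using n h1 by (cases n) auto
    then have "even (h + 1)" unfolding n by simp
    then have "odd h" by simp
    then have "odd c" unfolding c by simp
    then have "c = 1" using l by (cases l) auto
    then have *: "q ^ b = h" "2 ^ a = (2::nat) ^ (n + 2)" using c n e by auto
    then have "a = n + 2" by (meson power_inject_exp one_less_numeral_iff semiring_norm(76))
    moreover have "q ^ b = 2 ^ n - 1" using * n by simp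
    moreover have "y = 2 ^ (n + 1) - 1" using h n by simp
    ultimately show ?thesis using n1 by blast
  qed
qed

text \<open>As r = 2m is even, p^r - 1 factors as (y - 1)(y + 1) with y = p^m, which ties both q^b
  and y to neighbouring powers of two. Each branch then asks when numbers next to a power of two are
  prime powers.\<close>

theorem two_prime_order_cases:
  fixes p q r a b :: nat
  assumes p: "Factorial_Ring.prime p" and q: "Factorial_Ring.prime q" "odd q"
    and eq: "p ^ r - 1 = 2 ^ a * q ^ b" and a: "a > 0" and b: "b > 0" and r: "r \<ge> 2"
    and dvd: "q - 1 dvd 2 ^ a * q ^ b"
  shows "(q, p, r, a, b) \<in> {(3, 5, 2, 3, 1), (3, 7, 2, 4, 1), (3, 17, 2, 5, 2), (5, 3, 4, 4, 1)}"
proof -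
  have q2: "q > 2" using q prime_ge_2_nat[of q] by (cases "q = 2") auto
  have "coprime (q - 1) (q ^ b)" using q2 coprime_diff_one_left_nat[of q] by (intro coprime_power_right_iff[THEN iffD2]) auto
  then have "q - 1 dvd 2 ^ a" using dvd by (simp add: coprime_dvd_mult_left_iff)
  then obtain e where "q - 1 = 2 ^ e" by (auto simp: divides_primepow_nat[OF two_is_prime_nat])
  then have e: "q = 2 ^ e + 1" using q2 by simp
  have e0: "e \<ge> 1" using e q2 by (cases e) auto
  have p1: "p > 1" using p prime_gt_1_nat by blast
  have "odd p"
  proof
    assume "even p"
    then have "even (p ^ r)" using r by simp
    moreover have "even (p ^ r - 1)" using eq a by simp
    moreover have "p ^ r \<ge> 1" using p1 by simp
    ultimately show False by presburger
  qed
  have "even r" by (rule even_exponent[OF p \<open>odd p\<close> q(1) e q(2) eq b r])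
  then obtain m where m: "r = m * 2" by (metis evenE mult.commute)
  have m1: "m \<ge> 1" using m r by simp
  define y where "y = p ^ m"
  have y: "odd y" "y > 1" unfolding y_def using \<open>odd p\<close> one_less_power[OF p1, of m] m1 by auto
  have "(y - 1) * (y + 1) = 2 ^ a * q ^ b"
  proof -
    have "p ^ r = y * y" by (simp add: y_def m power_mult power2_eq_square)
    then show ?thesis using eq y by (simp add: algebra_simps)
  qed
  then obtain n where n: "n \<ge> 1" "a = n + 2"
    and c: "q ^ b = 2 ^ n + 1 \<and> y = 2 ^ (n + 1) + 1 \<or> q ^ b = 2 ^ n - 1 \<and> y = 2 ^ (n + 1) - 1"
    using odd_part_decomposition[OF q y _ b] by metis
  from c show ?thesis
  proof
    assume A: "q ^ b = 2 ^ n + 1 \<and> y = 2 ^ (n + 1) + 1"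
    show ?thesis
    proof (cases "even b")
      \<comment> \<open>A square of the form 2^n + 1 is 9, which gives q = 3, b = 2 and p^m =
        17.\<close>
      case True
      then obtain h where h: "b = h * 2" by (metis evenE mult.commute)
      then have "(q ^ h)\<^sup>2 = 2 ^ n + 1" using A by (simp add: power_mult)
      then have "q ^ h = 3" by (rule square_eq_two_power_plus_one)
      then have q3: "q = 3" "h = 1" using prime_power_eq_prime[of 3 q h] by auto
      then have "(2::nat) ^ n = 2 ^ 3" using A h by simp
      then have n3: "n = 3" by (metis power_inject_exp one_less_numeral_iff semiring_norm(76))
      then have "p ^ m = 17" using A by (simp add: y_def)
      moreover have "Factorial_Ring.prime (17::nat)" by simp
      ultimately show ?thesis using prime_power_eq_prime[of 17 p m] q3 h n n3 m by auto
    next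
      case False
      then have b1: "b = 1" using odd_power_not_two_power[of q b n] q A q2 by simp
      then have "(2::nat) ^ n = 2 ^ e" using A e by simp
      then have en: "n = e" by simp
      show ?thesis
      proof (cases "n = 1")
        case True
        then have "p ^ m = 5" "q = 3" using A e en by (auto simp: y_def)
        moreover have "Factorial_Ring.prime (5::nat)" by simp
        ultimately show ?thesis using prime_power_eq_prime[of 5 p m] True b1 n m by auto
      next
        case False
        have three: "[(2::nat) ^ k = 1] (mod 3)" if ev: "even k" for k
        proof -
          obtain h where "k = 2 * h" using ev by (elim evenE)
          moreover have "[(4::nat) ^ h = 1 ^ h] (mod 3)" by (rule cong_pow) (simp add: cong_def)
          ultimately show ?thesis by (simp add: power_mult)
        qed
        have three': "3 dvd (2::nat) ^ k + 1" if od: "odd k" for k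
        proof -
          obtain h where h: "k = Suc h" "even h" using od by (cases k) auto
          have "[2 * (2::nat) ^ h + 1 = 2 * 1 + 1] (mod 3)" by (intro cong_add cong_mult three h) auto
          then show ?thesis using h by (simp add: cong_def dvd_eq_mod_eq_0)
        qed
        \<comment> \<open>For odd n > 1 the prime q = 2^n + 1 would be a proper multiple of 3. With
          n even, 3 divides y = 2^(n+1) + 1, so p = 3.\<close>
        have "even n"
        proof (rule ccontr)
          assume "odd n"
          then have "3 dvd q" using three' e en by blast
          then have "q = 3" using q(1) by (metis prime_nat_iff one_eq_numeral_iff semiring_norm(84) numeral_One)
          then have "(2::nat) ^ n = 2 ^ 1" using e en by simp
          then show False using False by (metis power_inject_exp one_less_numeral_iff semiring_norm(76))
        qed
        then have "3 dvd y" using three'[of "n + 1"] A by simp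
        then have "3 dvd p" unfolding y_def by (simp add: prime_dvd_power)
        then have p3: "p = 3" using p by (metis prime_nat_iff one_eq_numeral_iff semiring_norm(84) numeral_One)
        have "n \<ge> 2" using False n by simp
        then have "m = 2 \<and> n + 1 = 3"
          using three_power_eq_two_power_plus_one[of m "n + 1"] A p3 by (simp add: y_def)
        then show ?thesis using p3 e en b1 n m by auto
      qed
    qed
  next
    assume B: "q ^ b = 2 ^ n - 1 \<and> y = 2 ^ (n + 1) - 1"
    have n2: "n \<ge> 2"
    proof (rule ccontr)
      assume "\<not> n \<ge> 2"
      then have "n = 1" using n by simp
      then have "q ^ b = 1" using B by simp
      then show False using q2 b by simp
    qed
    \<comment> \<open>Modulo 4 the equation q^b = 2^n - 1 excludes q = 1, which leaves e = 1 and q =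
      3; modulo 8 it then excludes n > 2.\<close>
    have m4: "[q ^ b = 3] (mod 4)"
    proof -
      have "(2::nat) ^ 2 dvd 2 ^ n" by (rule le_imp_power_dvd) fact
      then obtain k where k: "(2::nat) ^ n = 4 * k" by (auto elim: dvdE)
      then have "k > 0" by (cases k) auto
      then have "q ^ b = 4 * (k - 1) + 3" using B k by simp
      then show ?thesis by (simp add: cong_def)
    qed
    have "e = 1"
    proof (rule ccontr)
      assume "e \<noteq> 1"
      then have "(2::nat) ^ 2 dvd 2 ^ e" using e0 by (intro le_imp_power_dvd) auto
      then have "[q = 1] (mod 4)" using e by (simp add: cong_def dvd_eq_mod_eq_0 mod_Suc)
      then have "[q ^ b = 1 ^ b] (mod 4)" by (rule cong_pow)
      then show False using m4 by (simp add: cong_def)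
    qed
    then have q3: "q = 3" using e by simp
    have "n = 2"
    proof (rule ccontr)
      assume "n \<noteq> 2"
      then have "(2::nat) ^ 3 dvd 2 ^ n" using n2 by (intro le_imp_power_dvd) auto
      then have "8 dvd q ^ b + 1" using B by simp
      moreover have "(3::nat) ^ k mod 8 = 1 \<or> (3::nat) ^ k mod 8 = 3" for k
      proof (induction k)
        case (Suc k)
        have "x mod 8 = 1 \<or> x mod 8 = 3 \<Longrightarrow> 3 * x mod 8 = 1 \<or> 3 * x mod 8 = 3" for x :: nat
          by presburger
        from this[OF Suc] show ?case by simp
      qed simp
      moreover have "8 dvd x + 1 \<Longrightarrow> \<not> (x mod 8 = 1 \<or> x mod 8 = 3)" for x :: nat
        by presburger
      ultimately show False using q3 by blast
    qed
    then have "q ^ b = 3" "p ^ m = 7" using B by (auto simp: y_def)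
    moreover have "Factorial_Ring.prime (7::nat)" "Factorial_Ring.prime (3::nat)" by simp_all
    ultimately show ?thesis
      using prime_power_eq_prime[of 7 p m] prime_power_eq_prime[of 3 q b] \<open>n = 2\<close> n m by auto
  qed
qed

subsection \<open>Conjugation and element orders\<close>

context group
begin

lemma inv_mult_cancel: "x \<in> carrier G \<Longrightarrow> y \<in> carrier G \<Longrightarrow> inv x \<otimes> (x \<otimes> y) = y"
  by (simp flip: m_assoc)

lemma mult_inv_cancel: "x \<in> carrier G \<Longrightarrow> y \<in> carrier G \<Longrightarrow> x \<otimes> (inv x \<otimes> y) = y"
  by (simp flip: m_assoc)

lemmas word_simps = m_assoc inv_mult_group inv_mult_cancel mult_inv_cancel

text \<open>Conjugation from this side is a left action, as orbit counting requires.
  \<open>conj_subgroup\<close> conjugates from the other side, which is why \<open>inv g\<close>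
  appears whenever the two meet.\<close>

definition conj_by :: "'a \<Rightarrow> 'a \<Rightarrow> 'a" where
  "conj_by g x = g \<otimes> x \<otimes> inv g"

lemma conj_by_closed [simp, intro]: "g \<in> carrier G \<Longrightarrow> x \<in> carrier G \<Longrightarrow> conj_by g x \<in> carrier G"
  by (simp add: conj_by_def)

lemma conj_by_mult:
  "g \<in> carrier G \<Longrightarrow> x \<in> carrier G \<Longrightarrow> y \<in> carrier G \<Longrightarrow> conj_by g (x \<otimes> y) = conj_by g x \<otimes> conj_by g y"
  by (simp add: conj_by_def word_simps)

lemma conj_by_conj_by:
  "g \<in> carrier G \<Longrightarrow> h \<in> carrier G \<Longrightarrow> x \<in> carrier G \<Longrightarrow> conj_by g (conj_by h x) = conj_by (g \<otimes> h) x"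
  by (simp add: conj_by_def word_simps)

lemma conj_by_one [simp]: "g \<in> carrier G \<Longrightarrow> conj_by g \<one> = \<one>"
  by (simp add: conj_by_def)

lemma one_conj_by [simp]: "x \<in> carrier G \<Longrightarrow> conj_by \<one> x = x"
  by (simp add: conj_by_def)

lemma conj_by_inv_left [simp]:
  "g \<in> carrier G \<Longrightarrow> x \<in> carrier G \<Longrightarrow> conj_by (inv g) (conj_by g x) = x"
  by (simp add: conj_by_conj_by)

lemma conj_by_inv_right [simp]:
  "g \<in> carrier G \<Longrightarrow> x \<in> carrier G \<Longrightarrow> conj_by g (conj_by (inv g) x) = x"
  by (simp add: conj_by_conj_by)

lemma conj_by_cancel [simp]:
  "g \<in> carrier G \<Longrightarrow> x \<in> carrier G \<Longrightarrow> y \<in> carrier G \<Longrightarrow> conj_by g x = conj_by g y \<longleftrightarrow> x = y"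
  by (metis conj_by_inv_left)

lemma conj_by_inv: "g \<in> carrier G \<Longrightarrow> x \<in> carrier G \<Longrightarrow> conj_by g (inv x) = inv (conj_by g x)"
  by (simp add: conj_by_def word_simps)

lemma conj_by_pow: "g \<in> carrier G \<Longrightarrow> x \<in> carrier G \<Longrightarrow> conj_by g (x [^] (n::nat)) = conj_by g x [^] n"
  by (induction n) (simp_all add: conj_by_mult)

lemma conj_by_eq_iff_commute:
  "g \<in> carrier G \<Longrightarrow> x \<in> carrier G \<Longrightarrow> conj_by g x = x \<longleftrightarrow> g \<otimes> x = x \<otimes> g"
  by (simp add: conj_by_def inv_solve_right')

lemma conj_by_eq_iff:
  "g \<in> carrier G \<Longrightarrow> x \<in> carrier G \<Longrightarrow> y \<in> carrier G \<Longrightarrow> conj_by g x = y \<longleftrightarrow> g \<otimes> x = y \<otimes> g"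
  by (simp add: conj_by_def inv_solve_right')

lemma ord_conj_by [simp]: "g \<in> carrier G \<Longrightarrow> x \<in> carrier G \<Longrightarrow> ord (conj_by g x) = ord x"
  by (simp add: ord_unique pow_eq_id flip: conj_by_pow)
    (metis conj_by_cancel conj_by_one nat_pow_closed one_closed pow_eq_id)

lemma commutes_imp_commutes_pow:
  assumes "x \<otimes> y = y \<otimes> x" "x \<in> carrier G" "y \<in> carrier G"
  shows "x \<otimes> y [^] (n::nat) = y [^] n \<otimes> x"
  using conj_by_pow[of x y n] assms by (metis conj_by_eq_iff_commute nat_pow_closed)

lemma ord_subgroup: "subgroup H G \<Longrightarrow> group.ord (G\<lparr>carrier := H\<rparr>) x = ord x"
  by (simp add: group.ord_def[OF subgroup.subgroup_is_group] ord_def nat_pow_consistent[symmetric])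

lemma conj_by_subgroup:
  "subgroup H G \<Longrightarrow> g \<in> H \<Longrightarrow> group.conj_by (G\<lparr>carrier := H\<rparr>) g x = conj_by g x"
  by (simp add: group.conj_by_def[OF subgroup.subgroup_is_group] conj_by_def)

lemma normal_conj_by_closed: "N \<lhd> G \<Longrightarrow> g \<in> carrier G \<Longrightarrow> x \<in> N \<Longrightarrow> conj_by g x \<in> N"
  by (simp add: conj_by_def normal.inv_op_closed2)

lemma normal_iff_conj_by: "N \<lhd> G \<longleftrightarrow> subgroup N G \<and> (\<forall>g\<in>carrier G. \<forall>x\<in>N. conj_by g x \<in> N)"
  by (simp add: conj_by_def normal_inv_iff)

lemma subgroup_pow_closed: "subgroup H G \<Longrightarrow> x \<in> H \<Longrightarrow> x [^] (n::nat) \<in> H"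
  by (induction n) (auto simp: subgroup.one_closed subgroup.m_closed)

lemma card_subgroup_dvd: "subgroup H G \<Longrightarrow> card H dvd order G"
  by (metis dvd_triv_right lagrange)

lemma pow_mod_ord: "x \<in> carrier G \<Longrightarrow> x [^] (n mod ord x) = x [^] n"
proof -
  assume x: "x \<in> carrier G"
  have "x [^] n = x [^] (ord x * (n div ord x) + n mod ord x)" by simp
  also have "\<dots> = (x [^] ord x) [^] (n div ord x) \<otimes> x [^] (n mod ord x)"
    using x by (simp add: nat_pow_mult nat_pow_pow del: mult_div_mod_eq pow_ord_eq_1)
  finally show ?thesis using x by simp
qed

lemma pow_eq_pow_iff:
  assumes "x \<in> carrier G"
  shows "x [^] m = x [^] n \<longleftrightarrow> [m = n] (mod ord x)"
proof -
  have "x [^] int m = x [^] int n \<longleftrightarrow> int (ord x) dvd int n - int m"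
    by (rule int_pow_eq) fact
  then show ?thesis
    by (metis cong_int_iff cong_iff_dvd_diff cong_sym_eq int_pow_int)
qed

text \<open>Cauchy's theorem: \<open>sylow_thm\<close> is applied with exponent 1, whatever power of
  \<open>p\<close> divides the order, and any non-trivial element of the subgroup of order
  \<open>p\<close> will do.\<close>

lemma exists_elem_of_prime_order:
  assumes "finite (carrier G)" "Factorial_Ring.prime p" "p dvd order G"
  shows "\<exists>x\<in>carrier G. ord x = p"
proof -
  obtain m where "order G = p ^ 1 * m" using assms(3) by (auto elim: dvdE)
  then obtain H where H: "subgroup H G" "card H = p ^ 1"
    using sylow_thm[OF assms(2) is_group _ assms(1)] by metis
  then interpret H: subgroup H G by simp
  have "H \<noteq> {\<one>}" using H assms(2) by auto
  then obtain x where x: "x \<in> H" "x \<noteq> \<one>" using H.one_closed by blast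
  have "group.ord (G\<lparr>carrier := H\<rparr>) x dvd order (G\<lparr>carrier := H\<rparr>)"
    by (rule group.ord_dvd_group_order) (use x H H.subgroup_is_group in auto)
  then have "ord x dvd p" using H by (simp add: ord_subgroup order_def)
  moreover have "ord x \<noteq> 1" using x ord_eq_1 H.subset by blast
  ultimately have "ord x = p" using assms(2) prime_nat_iff by blast
  then show ?thesis using x H.subset by blast
qed

lemma cardinality_set_mult:
  assumes "subgroup A G" "subgroup B G" "A \<inter> B = {\<one>}" "finite (carrier G)"
  shows "card (A <#> B) = card A * card B"
proof -
  have "inj_on (\<lambda>(a, b). a \<otimes> b) (A \<times> B)"
  proof (rule inj_onI, clarsimp)
    fix a b a' b' assume *: "a \<in> A" "b \<in> B" "a' \<in> A" "b' \<in> B" "a \<otimes> b = a' \<otimes> b'"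
    then have c: "a \<in> carrier G" "b \<in> carrier G" "a' \<in> carrier G" "b' \<in> carrier G"
      using assms subgroup.mem_carrier by metis+
    then have e: "inv a' \<otimes> a = b' \<otimes> inv b" using *(5)
      by (metis inv_closed inv_solve_right m_assoc m_closed inv_mult_cancel)
    then have "inv a' \<otimes> a \<in> A \<inter> B" using * assms(1,2)
      by (metis IntI subgroup.m_closed subgroup.m_inv_closed)
    then have "inv a' \<otimes> a = \<one>" "b' \<otimes> inv b = \<one>" using assms(3) e by auto
    then show "a = a' \<and> b = b'" using c
      by (metis inv_closed inv_equality inv_inv)
  qed
  moreover have "A <#> B = (\<lambda>(a, b). a \<otimes> b) ` (A \<times> B)" by (auto simp: set_mult_def)
  ultimately show ?thesis by (simp add: card_image card_cartesian_product)
qed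

subsection \<open>Actions given by functions\<close>

text \<open>Elements of \<open>BijGroup E\<close> are extensional, hence the
  \<open>restrict\<close>; this rule lets actions be given by plain total functions.\<close>

lemma group_actionI:
  assumes cl: "\<And>g x. g \<in> carrier G \<Longrightarrow> x \<in> E \<Longrightarrow> act g x \<in> E"
    and one: "\<And>x. x \<in> E \<Longrightarrow> act \<one> x = x"
    and mult: "\<And>g h x. g \<in> carrier G \<Longrightarrow> h \<in> carrier G \<Longrightarrow> x \<in> E \<Longrightarrow> act (g \<otimes> h) x = act g (act h x)"
  shows "group_action G E (\<lambda>g. restrict (act g) E)"
proof -
  have bij: "restrict (act g) E \<in> Bij E" if g: "g \<in> carrier G" for g
  proof -
    have "bij_betw (act g) E E"
      by (rule bij_betw_byWitness[where f' = "act (inv g)"])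
        (use g cl in \<open>auto simp: one simp flip: mult\<close>)
    then show ?thesis by (auto simp: Bij_def cong: bij_betw_cong)
  qed
  show ?thesis
    unfolding group_action_def group_hom_def group_hom_axioms_def
    using bij group_BijGroup[of E]
    by (auto simp: BijGroup_def hom_def compose_def mult cl intro!: restrict_ext)
qed

text \<open>In the last hypothesis \<open>c\<close> is the index of the stabilizer of
  \<open>x\<close>, so by orbit-stabilizer it is the length of the orbit of \<open>x\<close>;
  \<open>E\<close> is a disjoint union of such orbits.\<close>

lemma dvd_card_if_dvd_card_orbits:
  assumes fin: "finite E"
    and cl: "\<And>g x. g \<in> carrier G \<Longrightarrow> x \<in> E \<Longrightarrow> act g x \<in> E"
    and one: "\<And>x. x \<in> E \<Longrightarrow> act \<one> x = x"
    and mult: "\<And>g h x. g \<in> carrier G \<Longrightarrow> h \<in> carrier G \<Longrightarrow> x \<in> E \<Longrightarrow> act (g \<otimes> h) x = act g (act h x)"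
    and dvd: "\<And>x c. x \<in> E \<Longrightarrow> c * card {g \<in> carrier G. act g x = x} = order G \<Longrightarrow> d dvd c"
  shows "d dvd card E"
proof -
  let ?phi = "\<lambda>g. restrict (act g) E"
  interpret group_action G E ?phi by (rule group_actionI[OF cl one mult])
  have "d dvd card (\<Union> (orbits G E ?phi))"
  proof (rule dvd_partition)
    show "finite (\<Union> (orbits G E ?phi))" by (simp add: orbits_coverture fin)
    show "\<forall>c\<in>orbits G E ?phi. d dvd card c"
    proof
      fix c assume "c \<in> orbits G E ?phi"
      then obtain x where x: "x \<in> E" "c = orbit G ?phi x" by (auto simp: orbits_def)
      have "card (orbit G ?phi x) * card (stabilizer G ?phi x) = order G"
        by (rule orbit_stabilizer_theorem) fact
      moreover have "stabilizer G ?phi x = {g \<in> carrier G. act g x = x}"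
        using x by (auto simp: stabilizer_def)
      ultimately show "d dvd card c" using dvd x by auto
    qed
    show "\<forall>c1\<in>orbits G E ?phi. \<forall>c2\<in>orbits G E ?phi. c1 \<noteq> c2 \<longrightarrow> c1 \<inter> c2 = {}"
      using disjoint_union by blast
  qed
  then show ?thesis by (simp add: orbits_coverture)
qed

lemma order_dvd_card_if_free:
  assumes fin: "finite E"
    and cl: "\<And>g x. g \<in> carrier G \<Longrightarrow> x \<in> E \<Longrightarrow> act g x \<in> E"
    and one: "\<And>x. x \<in> E \<Longrightarrow> act \<one> x = x"
    and mult: "\<And>g h x. g \<in> carrier G \<Longrightarrow> h \<in> carrier G \<Longrightarrow> x \<in> E \<Longrightarrow> act (g \<otimes> h) x = act g (act h x)"
    and free: "\<And>g x. g \<in> carrier G \<Longrightarrow> x \<in> E \<Longrightarrow> act g x = x \<Longrightarrow> g = \<one>"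
  shows "order G dvd card E"
proof (rule dvd_card_if_dvd_card_orbits[of E act])
  fix x c assume x: "x \<in> E" and c: "c * card {g \<in> carrier G. act g x = x} = order G"
  have "{g \<in> carrier G. act g x = x} = {\<one>}" using free one x by auto
  then show "order G dvd c" using c by simp
qed (use assms in auto)

text \<open>The points that are not fixed form an invariant set, all of whose orbits have length a
  power of \<open>p\<close> greater than 1.\<close>

lemma prime_power_order_fixed_points:
  assumes p: "Factorial_Ring.prime p" "order G = p ^ m"
    and fin: "finite E"
    and cl: "\<And>g x. g \<in> carrier G \<Longrightarrow> x \<in> E \<Longrightarrow> act g x \<in> E"
    and one: "\<And>x. x \<in> E \<Longrightarrow> act \<one> x = x"
    and mult: "\<And>g h x. g \<in> carrier G \<Longrightarrow> h \<in> carrier G \<Longrightarrow> x \<in> E \<Longrightarrow> act (g \<otimes> h) x = act g (act h x)"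
  shows "[card {x \<in> E. \<forall>g\<in>carrier G. act g x = x} = card E] (mod p)"
proof -
  let ?F = "{x \<in> E. \<forall>g\<in>carrier G. act g x = x}"
  have "p dvd card (E - ?F)"
  proof (rule dvd_card_if_dvd_card_orbits[of "E - ?F" act])
    fix g x assume g: "g \<in> carrier G" and x: "x \<in> E - ?F"
    obtain h where h: "h \<in> carrier G" "act h x \<noteq> x" using x by auto
    show "act g x \<in> E - ?F"
    proof (rule ccontr)
      assume "\<not> ?thesis"
      then have fx: "\<forall>k\<in>carrier G. act k (act g x) = act g x" using x g cl by auto
      then have "act (inv g) (act g x) = act g x" using g by auto
      moreover have "act (inv g) (act g x) = x" using g x mult[of "inv g" g x] one by auto
      ultimately show False using fx h by metis
    qed
  next
    fix x c assume x: "x \<in> E - ?F" and c: "c * card {g \<in> carrier G. act g x = x} = order G"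
    show "p dvd c"
    proof (rule ccontr)
      assume n: "\<not> p dvd c"
      have "c dvd p ^ m" using c p(2) by (metis dvd_triv_left)
      then obtain i where "c = p ^ i" using p(1) by (auto simp: divides_primepow_nat)
      then have "c = 1" using n by (cases i) auto
      then have "card {g \<in> carrier G. act g x = x} = card (carrier G)" using c by (simp add: order_def)
      moreover have "finite (carrier G)" using p order_gt_0_iff_finite prime_gt_0_nat by (metis zero_less_power)
      ultimately have "{g \<in> carrier G. act g x = x} = carrier G" by (intro card_subset_eq) auto
      then show False using x by auto
    qed
  qed (use assms in auto)
  moreover have "card E = card (E - ?F) + card ?F"
    using fin by (subst card_Un_disjoint[symmetric]) (auto intro: arg_cong[where f=card])
  ultimately show ?thesis by (auto simp: cong_def elim!: dvdE)
qed

end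

subsection \<open>Semidirect products\<close>

lemma semidirect_simps [simp]:
  "carrier (semidirect A B \<phi>) = carrier A \<times> carrier B"
  "\<one>\<^bsub>semidirect A B \<phi>\<^esub> = (\<one>\<^bsub>A\<^esub>, \<one>\<^bsub>B\<^esub>)"
  "(a, b) \<otimes>\<^bsub>semidirect A B \<phi>\<^esub> (a', b') = (a \<otimes>\<^bsub>A\<^esub> \<phi> b a', b \<otimes>\<^bsub>B\<^esub> b')"
  by (simp_all add: semidirect_def)

lemma auto_hom_simps:
  assumes A: "group A" and B: "group B" and \<phi>: "\<phi> \<in> hom B (AutoGroup A)"
  shows "b \<in> carrier B \<Longrightarrow> a \<in> carrier A \<Longrightarrow> \<phi> b a \<in> carrier A"
    and "b \<in> carrier B \<Longrightarrow> a \<in> carrier A \<Longrightarrow> a' \<in> carrier A \<Longrightarrow> \<phi> b (a \<otimes>\<^bsub>A\<^esub> a') = \<phi> b a \<otimes>\<^bsub>A\<^esub> \<phi> b a'"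
    and "b \<in> carrier B \<Longrightarrow> b' \<in> carrier B \<Longrightarrow> a \<in> carrier A \<Longrightarrow> \<phi> (b \<otimes>\<^bsub>B\<^esub> b') a = \<phi> b (\<phi> b' a)"
    and "a \<in> carrier A \<Longrightarrow> \<phi> \<one>\<^bsub>B\<^esub> a = a"
    and "b \<in> carrier B \<Longrightarrow> \<phi> b \<one>\<^bsub>A\<^esub> = \<one>\<^bsub>A\<^esub>"
proof -
  interpret A: group A by fact
  have auto: "\<phi> b \<in> auto A" if "b \<in> carrier B" for b
    using hom_in_carrier[OF \<phi> that] by (simp add: AutoGroup_def)
  then have h: "\<phi> b \<in> hom A A" "\<phi> b \<in> Bij (carrier A)" if "b \<in> carrier B" for b
    using that by (auto simp: auto_def)
  show "b \<in> carrier B \<Longrightarrow> a \<in> carrier A \<Longrightarrow> \<phi> b a \<in> carrier A"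
    using h hom_in_carrier by metis
  show "b \<in> carrier B \<Longrightarrow> a \<in> carrier A \<Longrightarrow> a' \<in> carrier A \<Longrightarrow> \<phi> b (a \<otimes>\<^bsub>A\<^esub> a') = \<phi> b a \<otimes>\<^bsub>A\<^esub> \<phi> b a'"
    using h hom_mult by metis
  show "b \<in> carrier B \<Longrightarrow> b' \<in> carrier B \<Longrightarrow> a \<in> carrier A \<Longrightarrow> \<phi> (b \<otimes>\<^bsub>B\<^esub> b') a = \<phi> b (\<phi> b' a)"
    using hom_mult[OF \<phi>, of b b'] h by (simp add: AutoGroup_def BijGroup_def compose_def)
  have "\<phi> \<one>\<^bsub>B\<^esub> = \<one>\<^bsub>AutoGroup A\<^esub>"
    by (rule hom_one[OF \<phi> B A.AutoGroup])
  then show "a \<in> carrier A \<Longrightarrow> \<phi> \<one>\<^bsub>B\<^esub> a = a" by (simp add: AutoGroup_def BijGroup_def)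
  show "b \<in> carrier B \<Longrightarrow> \<phi> b \<one>\<^bsub>A\<^esub> = \<one>\<^bsub>A\<^esub>"
    using h hom_one A by metis
qed

lemma semidirect_group:
  assumes A: "group A" and B: "group B" and \<phi>: "\<phi> \<in> hom B (AutoGroup A)"
  shows "group (semidirect A B \<phi>)"
proof -
  interpret A: group A by fact
  interpret B: group B by fact
  note s = auto_hom_simps[OF A B \<phi>]
  show ?thesis
  proof (rule groupI)
    fix x assume "x \<in> carrier (semidirect A B \<phi>)"
    then obtain a b where x: "x = (a, b)" "a \<in> carrier A" "b \<in> carrier B" by auto
    show "\<exists>y\<in>carrier (semidirect A B \<phi>). y \<otimes>\<^bsub>semidirect A B \<phi>\<^esub> x = \<one>\<^bsub>semidirect A B \<phi>\<^esub>"
    proof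
      show "(\<phi> (inv\<^bsub>B\<^esub> b) (inv\<^bsub>A\<^esub> a), inv\<^bsub>B\<^esub> b) \<otimes>\<^bsub>semidirect A B \<phi>\<^esub> x = \<one>\<^bsub>semidirect A B \<phi>\<^esub>"
        using x by (simp flip: s(2) add: s(5))
    qed (use x s in auto)
  qed (auto simp: s A.m_assoc B.m_assoc)
qed

lemma semidirect_internal:
  assumes A: "group A" and B: "group B" and \<phi>: "\<phi> \<in> hom B (AutoGroup A)"
  shows "internal_semidirect (semidirect A B \<phi>) (carrier A \<times> {\<one>\<^bsub>B\<^esub>}) ({\<one>\<^bsub>A\<^esub>} \<times> carrier B)"
    and "(\<lambda>a. (a, \<one>\<^bsub>B\<^esub>)) \<in> iso A (semidirect A B \<phi>\<lparr>carrier := carrier A \<times> {\<one>\<^bsub>B\<^esub>}\<rparr>)"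
    and "(\<lambda>b. (\<one>\<^bsub>A\<^esub>, b)) \<in> iso B (semidirect A B \<phi>\<lparr>carrier := {\<one>\<^bsub>A\<^esub>} \<times> carrier B\<rparr>)"
proof -
  interpret A: group A by fact
  interpret B: group B by fact
  interpret S: group "semidirect A B \<phi>" by (rule semidirect_group) fact+
  note s = auto_hom_simps[OF A B \<phi>]
  have invA: "inv\<^bsub>semidirect A B \<phi>\<^esub> (a, \<one>\<^bsub>B\<^esub>) = (inv\<^bsub>A\<^esub> a, \<one>\<^bsub>B\<^esub>)" if "a \<in> carrier A" for a
    by (rule S.inv_equality) (use that in \<open>auto simp: s\<close>)
  have invB: "inv\<^bsub>semidirect A B \<phi>\<^esub> (\<one>\<^bsub>A\<^esub>, b) = (\<one>\<^bsub>A\<^esub>, inv\<^bsub>B\<^esub> b)" if "b \<in> carrier B" for b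
    by (rule S.inv_equality) (use that in \<open>auto simp: s\<close>)
  have sA: "subgroup (carrier A \<times> {\<one>\<^bsub>B\<^esub>}) (semidirect A B \<phi>)"
    by (rule S.subgroupI) (auto simp: invA s)
  have sB: "subgroup ({\<one>\<^bsub>A\<^esub>} \<times> carrier B) (semidirect A B \<phi>)"
    by (rule S.subgroupI) (auto simp: invB s)
  \<comment> \<open>The projection \<open>snd\<close> respects products and inverses, and the first
    factor is the part where it is trivial; this gives normality.\<close>
  have snd_mult: "snd (x \<otimes>\<^bsub>semidirect A B \<phi>\<^esub> y) = snd x \<otimes>\<^bsub>B\<^esub> snd y" for x y
    by (cases x; cases y) simp
  have snd_inv: "snd (inv\<^bsub>semidirect A B \<phi>\<^esub> x) = inv\<^bsub>B\<^esub> (snd x)" if x: "x \<in> carrier (semidirect A B \<phi>)" for x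
  proof -
    have "snd (inv\<^bsub>semidirect A B \<phi>\<^esub> x) \<otimes>\<^bsub>B\<^esub> snd x = \<one>\<^bsub>B\<^esub>"
      using S.l_inv[OF x] snd_mult[of "inv\<^bsub>semidirect A B \<phi>\<^esub> x" x] by (metis semidirect_simps(2) snd_conv)
    moreover have "snd x \<in> carrier B" "snd (inv\<^bsub>semidirect A B \<phi>\<^esub> x) \<in> carrier B"
      using x S.inv_closed[OF x] by (auto simp: mem_Times_iff)
    ultimately show ?thesis using B.inv_equality by metis
  qed
  have norm: "(carrier A \<times> {\<one>\<^bsub>B\<^esub>}) \<lhd> semidirect A B \<phi>"
    unfolding S.normal_inv_iff
  proof (intro conjI sA ballI)
    fix x h assume x: "x \<in> carrier (semidirect A B \<phi>)" and h: "h \<in> carrier A \<times> {\<one>\<^bsub>B\<^esub>}"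
    have hc: "h \<in> carrier (semidirect A B \<phi>)" using h by auto
    let ?y = "x \<otimes>\<^bsub>semidirect A B \<phi>\<^esub> h \<otimes>\<^bsub>semidirect A B \<phi>\<^esub> inv\<^bsub>semidirect A B \<phi>\<^esub> x"
    have "?y \<in> carrier (semidirect A B \<phi>)" using x hc by blast
    moreover have "snd ?y = \<one>\<^bsub>B\<^esub>"
      using x h by (auto simp: snd_mult snd_inv)
    ultimately show "?y \<in> carrier A \<times> {\<one>\<^bsub>B\<^esub>}" by (auto simp: mem_Times_iff)
  qed
  have "(carrier A \<times> {\<one>\<^bsub>B\<^esub>}) <#>\<^bsub>semidirect A B \<phi>\<^esub> ({\<one>\<^bsub>A\<^esub>} \<times> carrier B) = carrier (semidirect A B \<phi>)"
  proof
    show "carrier (semidirect A B \<phi>) \<subseteq> (carrier A \<times> {\<one>\<^bsub>B\<^esub>}) <#>\<^bsub>semidirect A B \<phi>\<^esub> ({\<one>\<^bsub>A\<^esub>} \<times> carrier B)"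
    proof
      fix x assume "x \<in> carrier (semidirect A B \<phi>)"
      then obtain a b where x: "x = (a, b)" "a \<in> carrier A" "b \<in> carrier B" by auto
      have "x = (a, \<one>\<^bsub>B\<^esub>) \<otimes>\<^bsub>semidirect A B \<phi>\<^esub> (\<one>\<^bsub>A\<^esub>, b)" using x by (simp add: s)
      then show "x \<in> (carrier A \<times> {\<one>\<^bsub>B\<^esub>}) <#>\<^bsub>semidirect A B \<phi>\<^esub> ({\<one>\<^bsub>A\<^esub>} \<times> carrier B)"
        using x unfolding set_mult_def by blast
    qed
  qed (auto simp: set_mult_def s)
  then show "internal_semidirect (semidirect A B \<phi>) (carrier A \<times> {\<one>\<^bsub>B\<^esub>}) ({\<one>\<^bsub>A\<^esub>} \<times> carrier B)"
    using norm sB by (auto simp: internal_semidirect_def)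
  show "(\<lambda>a. (a, \<one>\<^bsub>B\<^esub>)) \<in> iso A (semidirect A B \<phi>\<lparr>carrier := carrier A \<times> {\<one>\<^bsub>B\<^esub>}\<rparr>)"
    by (rule isoI) (auto simp: hom_def s bij_betw_def inj_on_def)
  show "(\<lambda>b. (\<one>\<^bsub>A\<^esub>, b)) \<in> iso B (semidirect A B \<phi>\<lparr>carrier := {\<one>\<^bsub>A\<^esub>} \<times> carrier B\<rparr>)"
    by (rule isoI) (auto simp: hom_def s bij_betw_def inj_on_def)
qed

text \<open>The action is conjugation in \<open>G\<close>, transported to \<open>A\<close> along \<open>f\<close>.\<close>

lemma (in group) internal_semidirect_iso:
  assumes S: "internal_semidirect G K H"
    and A: "group A" and B: "group B"
    and f: "f \<in> iso A (G\<lparr>carrier := K\<rparr>)" and g: "g \<in> iso B (G\<lparr>carrier := H\<rparr>)"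
  shows "\<exists>\<phi>\<in>hom B (AutoGroup A). (\<lambda>(a, b). f a \<otimes> g b) \<in> iso (semidirect A B \<phi>) G"
proof -
  interpret A: group A by fact
  interpret B: group B by fact
  have K: "K \<lhd> G" and H: "subgroup H G" and KH: "K \<inter> H = {\<one>}" "K <#> H = carrier G"
    using S by (auto simp: internal_semidirect_def)
  have sK: "subgroup K G" using K by (rule normal_imp_subgroup)
  have fb: "bij_betw f (carrier A) K" and fm: "\<And>a a'. a \<in> carrier A \<Longrightarrow> a' \<in> carrier A \<Longrightarrow> f (a \<otimes>\<^bsub>A\<^esub> a') = f a \<otimes> f a'"
    using f by (auto simp: iso_def hom_def)
  have gb: "bij_betw g (carrier B) H" and gm: "\<And>b b'. b \<in> carrier B \<Longrightarrow> b' \<in> carrier B \<Longrightarrow> g (b \<otimes>\<^bsub>B\<^esub> b') = g b \<otimes> g b'"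
    using g by (auto simp: iso_def hom_def)
  have fK: "f a \<in> K" "f a \<in> carrier G" if "a \<in> carrier A" for a
    using fb that sK subgroup.mem_carrier by (metis bij_betwE, metis bij_betwE)
  have gH: "g b \<in> H" "g b \<in> carrier G" if "b \<in> carrier B" for b
    using gb that H subgroup.mem_carrier by (metis bij_betwE, metis bij_betwE)
  define fi where "fi = inv_into (carrier A) f"
  have fi: "fi k \<in> carrier A" "f (fi k) = k" if "k \<in> K" for k
    using fb that unfolding fi_def by (metis bij_betw_def inv_into_into, metis bij_betw_inv_into_right)
  have fif: "fi (f a) = a" if "a \<in> carrier A" for a
    using fb that unfolding fi_def by (metis bij_betw_inv_into_left)
  \<comment> \<open>Restricting to the carrier makes each value extensional, as membership in
    \<open>Bij\<close> demands.\<close>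
  define \<phi> where "\<phi> b = (\<lambda>a\<in>carrier A. fi (conj_by (g b) (f a)))" for b
  have cK: "conj_by (g b) (f a) \<in> K" if "a \<in> carrier A" "b \<in> carrier B" for a b
    using normal_conj_by_closed[OF K] fK gH that by blast
  have f\<phi>: "f (\<phi> b a) = conj_by (g b) (f a)" "\<phi> b a \<in> carrier A" if "a \<in> carrier A" "b \<in> carrier B" for a b
    using that fi[OF cK[OF that]] by (auto simp: \<phi>_def)
  have finj: "a = a'" if "f a = f a'" "a \<in> carrier A" "a' \<in> carrier A" for a a'
    using that fif by metis
  have ginj: "b = b'" if "g b = g b'" "b \<in> carrier B" "b' \<in> carrier B" for b b'
    using that gb by (metis bij_betw_def inj_on_eq_iff)
  have g1: "g \<one>\<^bsub>B\<^esub> = \<one>" using gm[of "\<one>\<^bsub>B\<^esub>" "\<one>\<^bsub>B\<^esub>"] gH[of "\<one>\<^bsub>B\<^esub>"] by simp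
  have \<phi>mult: "\<phi> (b \<otimes>\<^bsub>B\<^esub> b') a = \<phi> b (\<phi> b' a)" if "a \<in> carrier A" "b \<in> carrier B" "b' \<in> carrier B" for a b b'
    by (rule finj) (use that in \<open>simp_all add: f\<phi> gm conj_by_conj_by fK gH\<close>)
  have \<phi>1: "\<phi> \<one>\<^bsub>B\<^esub> a = a" if "a \<in> carrier A" for a
    by (rule finj) (use that in \<open>simp_all add: f\<phi> g1 fK\<close>)
  have Bij: "\<phi> b \<in> Bij (carrier A)" if b: "b \<in> carrier B" for b
  proof -
    have "bij_betw (\<phi> b) (carrier A) (carrier A)"
      by (rule bij_betw_byWitness[where f' = "\<phi> (inv\<^bsub>B\<^esub> b)"])
        (use b f\<phi> in \<open>auto simp: \<phi>1 simp flip: \<phi>mult\<close>)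
    then show ?thesis by (simp add: Bij_def \<phi>_def)
  qed
  have hom: "\<phi> b \<in> hom A A" if b: "b \<in> carrier B" for b
  proof (rule homI)
    fix a a' assume "a \<in> carrier A" "a' \<in> carrier A"
    then show "\<phi> b (a \<otimes>\<^bsub>A\<^esub> a') = \<phi> b a \<otimes>\<^bsub>A\<^esub> \<phi> b a'"
      by (intro finj) (use b in \<open>simp_all add: f\<phi> fm conj_by_mult fK gH\<close>)
  qed (use f\<phi> b in auto)
  have \<phi>hom: "\<phi> \<in> hom B (AutoGroup A)"
  proof (rule homI)
    fix b b' assume b: "b \<in> carrier B" "b' \<in> carrier B"
    have "\<phi> (b \<otimes>\<^bsub>B\<^esub> b') = compose (carrier A) (\<phi> b) (\<phi> b')"
      by (rule extensionalityI[of _ "carrier A"]) (auto simp: b \<phi>mult compose_eq, auto simp: \<phi>_def)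
    then show "\<phi> (b \<otimes>\<^bsub>B\<^esub> b') = \<phi> b \<otimes>\<^bsub>AutoGroup A\<^esub> \<phi> b'"
      using b Bij by (simp add: AutoGroup_def BijGroup_def)
  qed (use Bij hom in \<open>auto simp: AutoGroup_def auto_def\<close>)
  let ?F = "\<lambda>(a, b). f a \<otimes> g b"
  have "?F \<in> iso (semidirect A B \<phi>) G"
  proof (rule isoI)
    show "?F \<in> hom (semidirect A B \<phi>) G"
    proof (rule homI)
      fix x y assume "x \<in> carrier (semidirect A B \<phi>)" "y \<in> carrier (semidirect A B \<phi>)"
      then obtain a b a' b' where *: "x = (a, b)" "y = (a', b')" "a \<in> carrier A" "b \<in> carrier B" "a' \<in> carrier A" "b' \<in> carrier B"
        by auto
      show "?F (x \<otimes>\<^bsub>semidirect A B \<phi>\<^esub> y) = ?F x \<otimes> ?F y"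
        using * by (simp add: fm gm f\<phi> fK gH conj_by_def word_simps)
    qed (auto simp: fK gH)
    show "bij_betw ?F (carrier (semidirect A B \<phi>)) (carrier G)"
      unfolding bij_betw_def
    proof
      show "inj_on ?F (carrier (semidirect A B \<phi>))"
      proof (rule inj_onI, clarsimp)
        fix a b a' b' assume *: "a \<in> carrier A" "b \<in> carrier B" "a' \<in> carrier A" "b' \<in> carrier B" "f a \<otimes> g b = f a' \<otimes> g b'"
        then have e: "inv f a' \<otimes> f a = g b' \<otimes> inv g b"
          by (metis fK(2) gH(2) inv_closed inv_solve_right m_assoc m_closed inv_mult_cancel)
        moreover have "inv f a' \<otimes> f a \<in> K" "g b' \<otimes> inv g b \<in> H"
          using * fK gH sK H subgroup.m_closed subgroup.m_inv_closed by metis+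
        ultimately have "inv f a' \<otimes> f a = \<one>" "g b' \<otimes> inv g b = \<one>" using KH by auto
        then have "f a' = f a" "g b = g b'"
          using * fK gH by (metis inv_closed inv_equality inv_inv)+
        then show "a = a' \<and> b = b'" using finj ginj * by metis
      qed
      show "?F ` carrier (semidirect A B \<phi>) = carrier G"
      proof
        show "carrier G \<subseteq> ?F ` carrier (semidirect A B \<phi>)"
        proof
          fix x assume "x \<in> carrier G"
          then have "x \<in> K <#> H" using KH(2) by simp
          then obtain k h where *: "k \<in> K" "h \<in> H" "x = k \<otimes> h" by (auto simp: set_mult_def)
          then obtain b where "b \<in> carrier B" "g b = h" using gb by (metis bij_betw_def imageE)
          then show "x \<in> ?F ` carrier (semidirect A B \<phi>)" using * fi[of k] by (auto intro!: image_eqI[of _ _ "(fi k, b)"])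
        qed
      qed (auto simp: fK gH)
    qed
  qed
  then show ?thesis using \<phi>hom by blast
qed

lemma frobenius_product_iso_image:
  assumes G: "group G" and G': "group G'" and F: "F \<in> iso G G'" and fr: "frobenius_product G K H"
  shows "frobenius_product G' (F ` K) (F ` H)"
    and "F \<in> iso (G\<lparr>carrier := K\<rparr>) (G'\<lparr>carrier := F ` K\<rparr>)"
    and "F \<in> iso (G\<lparr>carrier := H\<rparr>) (G'\<lparr>carrier := F ` H\<rparr>)"
proof -
  interpret G: group G by fact
  interpret G': group G' by fact
  interpret F: group_hom G G' F using F by unfold_locales (auto simp: iso_def)
  have inj: "inj_on F (carrier G)" and im: "F ` carrier G = carrier G'"
    using F by (auto simp: iso_def bij_betw_def)
  have K: "K \<lhd> G" and H: "subgroup H G" and KH: "K \<inter> H = {\<one>\<^bsub>G\<^esub>}" "K <#>\<^bsub>G\<^esub> H = carrier G"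
    and fc: "H \<noteq> {\<one>\<^bsub>G\<^esub>}" "H \<noteq> carrier G" "\<And>g. g \<in> carrier G - H \<Longrightarrow> H \<inter> conj_subgroup G H g = {\<one>\<^bsub>G\<^esub>}"
    and Keq: "K = frobenius_kernel G H"
    using fr by (auto simp: frobenius_product_def internal_semidirect_def frobenius_complement_def)
  have sK: "subgroup K G" using K by (rule normal_imp_subgroup)
  have sub: "K \<subseteq> carrier G" "H \<subseteq> carrier G" using sK H subgroup.subset by auto
  have conj: "conj_subgroup G' (F ` H) (F g) = F ` conj_subgroup G H g" if "g \<in> carrier G" for g
    using that sub by (auto simp: conj_subgroup_def image_image intro!: image_cong)
  have conjsub: "conj_subgroup G H g \<subseteq> carrier G" if "g \<in> carrier G" for g
    using that sub by (auto simp: conj_subgroup_def)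
  have "K <#>\<^bsub>G\<^esub> H = carrier G \<Longrightarrow> F ` K <#>\<^bsub>G'\<^esub> F ` H = carrier G'"
    using set_mult_hom[OF F.homh sub] im by metis
  moreover have "F ` K \<lhd> G'" using G.is_group K G' F iso_normal_subgroup by metis
  moreover have "subgroup (F ` H) G'" using H by (rule F.subgroup_img_is_subgroup)
  moreover have "F ` K \<inter> F ` H = {\<one>\<^bsub>G'\<^esub>}"
    using inj_on_image_Int[OF inj sub] KH(1) by simp
  moreover have "F ` H \<noteq> {\<one>\<^bsub>G'\<^esub>}"
  proof
    assume *: "F ` H = {\<one>\<^bsub>G'\<^esub>}"
    have "h = \<one>\<^bsub>G\<^esub>" if "h \<in> H" for h
    proof -
      have "F h = F \<one>\<^bsub>G\<^esub>" using * that by auto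
      then show ?thesis using inj sub that by (meson G.one_closed inj_onD subsetD)
    qed
    then show False using fc(1) H subgroup.one_closed by fastforce
  qed
  moreover have "F ` H \<noteq> carrier G'"
    using fc(2) im inj sub by (metis inj_on_image_eq_iff subset_refl)
  moreover have "F ` H \<inter> conj_subgroup G' (F ` H) g' = {\<one>\<^bsub>G'\<^esub>}" if g': "g' \<in> carrier G' - F ` H" for g'
  proof -
    obtain g where g: "g \<in> carrier G - H" "g' = F g" using g' im by auto
    then have "F ` H \<inter> F ` conj_subgroup G H g = F ` (H \<inter> conj_subgroup G H g)"
      using inj_on_image_Int[OF inj sub(2) conjsub] by auto
    then show ?thesis using g fc(3)[of g] conj[of g] by auto
  qed
  moreover have "F ` K = frobenius_kernel G' (F ` H)"
  proof -
    have "(\<Union>g\<in>carrier G'. conj_subgroup G' (F ` H) g) = (\<Union>g\<in>carrier G. F ` conj_subgroup G H g)"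
      using conj by (simp flip: im)
    then have "(\<Union>g\<in>carrier G'. conj_subgroup G' (F ` H) g) = F ` (\<Union>g\<in>carrier G. conj_subgroup G H g)"
      by (simp add: image_UN)
    moreover have "(\<Union>g\<in>carrier G. conj_subgroup G H g) \<subseteq> carrier G" using conjsub by auto
    ultimately have "carrier G' - (\<Union>g\<in>carrier G'. conj_subgroup G' (F ` H) g)
        = F ` (carrier G - (\<Union>g\<in>carrier G. conj_subgroup G H g))"
      using inj_on_image_set_diff[OF inj, of "carrier G" "\<Union>g\<in>carrier G. conj_subgroup G H g"] im
      by (simp add: Diff_subset)
    then show ?thesis by (simp add: Keq frobenius_kernel_def)
  qed
  ultimately show "frobenius_product G' (F ` K) (F ` H)"
    using KH by (simp add: frobenius_product_def internal_semidirect_def frobenius_complement_def)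
  show "F \<in> iso (G\<lparr>carrier := K\<rparr>) (G'\<lparr>carrier := F ` K\<rparr>)"
    using inj sub by (auto simp: iso_def hom_def bij_betw_def inj_on_subset subset_iff)
  show "F \<in> iso (G\<lparr>carrier := H\<rparr>) (G'\<lparr>carrier := F ` H\<rparr>)"
    using inj sub by (auto simp: iso_def hom_def bij_betw_def inj_on_subset subset_iff)
qed

text \<open>As the form leaves the action open, the isomorphism types of kernel and complement
  suffice: conjugation in \<open>G\<close> supplies the action. The Frobenius property is carried
  over by the inverse of the multiplication map, which sends \<open>K\<close> and \<open>H\<close>
  to the two factors.\<close>

lemma has_frobenius_formI:
  assumes G: "group G" and A: "group A" and B: "group B" and fr: "frobenius_product G K H"
    and isoA: "A \<cong> G\<lparr>carrier := K\<rparr>" and isoB: "B \<cong> G\<lparr>carrier := H\<rparr>"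
  shows "has_frobenius_form G A B"
proof -
  interpret G: group G by fact
  interpret A: group A by fact
  interpret B: group B by fact
  obtain f g where f: "f \<in> iso A (G\<lparr>carrier := K\<rparr>)" and g: "g \<in> iso B (G\<lparr>carrier := H\<rparr>)"
    using isoA isoB by (auto simp: is_iso_def)
  have "internal_semidirect G K H" using fr unfolding frobenius_product_def by blast
  then obtain \<phi> where \<phi>: "\<phi> \<in> hom B (AutoGroup A)" and F: "(\<lambda>(a, b). f a \<otimes>\<^bsub>G\<^esub> g b) \<in> iso (semidirect A B \<phi>) G"
    using G.internal_semidirect_iso[OF _ A B f g] by blast
  let ?S = "semidirect A B \<phi>" and ?F = "\<lambda>(a, b). f a \<otimes>\<^bsub>G\<^esub> g b"
  interpret S: group ?S by (rule semidirect_group) fact+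
  have K: "subgroup K G" and H: "subgroup H G"
    using fr by (auto simp: frobenius_product_def internal_semidirect_def normal_imp_subgroup)
  have f1: "f \<one>\<^bsub>A\<^esub> = \<one>\<^bsub>G\<^esub>"
    using hom_one[of f A "G\<lparr>carrier := K\<rparr>"] f A subgroup.subgroup_is_group[OF K G] by (simp add: iso_def)
  have g1: "g \<one>\<^bsub>B\<^esub> = \<one>\<^bsub>G\<^esub>"
    using hom_one[of g B "G\<lparr>carrier := H\<rparr>"] g B subgroup.subgroup_is_group[OF H G] by (simp add: iso_def)
  have fK: "f ` carrier A = K" "K \<subseteq> carrier G" using f subgroup.subset[OF K] by (auto simp: iso_def bij_betw_def)
  have gH: "g ` carrier B = H" "H \<subseteq> carrier G" using g subgroup.subset[OF H] by (auto simp: iso_def bij_betw_def)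
  have imK: "?F ` (carrier A \<times> {\<one>\<^bsub>B\<^esub>}) = K"
  proof -
    have "?F ` (carrier A \<times> {\<one>\<^bsub>B\<^esub>}) = (\<lambda>a. f a \<otimes>\<^bsub>G\<^esub> \<one>\<^bsub>G\<^esub>) ` carrier A" by (auto simp: g1 image_iff)
    also have "\<dots> = f ` carrier A" by (rule image_cong) (use fK in \<open>auto intro!: G.r_one\<close>)
    finally show ?thesis using fK by simp
  qed
  have imH: "?F ` ({\<one>\<^bsub>A\<^esub>} \<times> carrier B) = H"
  proof -
    have "?F ` ({\<one>\<^bsub>A\<^esub>} \<times> carrier B) = (\<lambda>b. \<one>\<^bsub>G\<^esub> \<otimes>\<^bsub>G\<^esub> g b) ` carrier B" by (auto simp: f1 image_iff)
    also have "\<dots> = g ` carrier B" by (rule image_cong) (use gH in \<open>auto intro!: G.l_one\<close>)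
    finally show ?thesis using gH by simp
  qed
  define Fi where "Fi = inv_into (carrier ?S) ?F"
  have Fi: "Fi \<in> iso G ?S" unfolding Fi_def by (rule S.iso_set_sym) fact
  have Fib: "Fi ` (?F ` U) = U" if "U \<subseteq> carrier ?S" for U
    using F that unfolding Fi_def iso_def bij_betw_def by (auto simp del: semidirect_simps simp: inv_into_image_cancel)
  have "Fi ` K = carrier A \<times> {\<one>\<^bsub>B\<^esub>}" "Fi ` H = {\<one>\<^bsub>A\<^esub>} \<times> carrier B"
    using Fib[of "carrier A \<times> {\<one>\<^bsub>B\<^esub>}"] Fib[of "{\<one>\<^bsub>A\<^esub>} \<times> carrier B"]
    unfolding imK imH by auto
  then have "frobenius_product ?S (carrier A \<times> {\<one>\<^bsub>B\<^esub>}) ({\<one>\<^bsub>A\<^esub>} \<times> carrier B)"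
    using frobenius_product_iso_image(1)[OF G S.is_group Fi fr] by simp
  then show ?thesis using \<phi> Fi by (auto simp: has_frobenius_form_def is_iso_def)
qed

lemma has_frobenius_formD:
  assumes G: "group G" and A: "group A" and B: "group B" and form: "has_frobenius_form G A B"
  obtains K H where "frobenius_product G K H" "A \<cong> G\<lparr>carrier := K\<rparr>" "B \<cong> G\<lparr>carrier := H\<rparr>"
proof -
  interpret G: group G by fact
  obtain \<phi> where \<phi>: "\<phi> \<in> hom B (AutoGroup A)"
    and fr: "frobenius_product (semidirect A B \<phi>) (carrier A \<times> {\<one>\<^bsub>B\<^esub>}) ({\<one>\<^bsub>A\<^esub>} \<times> carrier B)"
    and "G \<cong> semidirect A B \<phi>"
    using form by (auto simp: has_frobenius_form_def)
  let ?S = "semidirect A B \<phi>"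
  have S: "group ?S" by (rule semidirect_group) fact+
  obtain F where F: "F \<in> iso ?S G"
    using \<open>G \<cong> ?S\<close> G.iso_sym by (auto simp: is_iso_def)
  note im = frobenius_product_iso_image[OF S G F fr]
  note int = semidirect_internal(2,3)[OF A B \<phi>]
  show ?thesis
    by (rule that[OF im(1)]) (use iso_set_trans[OF int(1) im(2)] iso_set_trans[OF int(2) im(3)] in \<open>auto simp: is_iso_def\<close>)
qed

subsection \<open>Nilpotency\<close>

context group
begin

lemma commutator_eq_conj_by:
  "x \<in> carrier G \<Longrightarrow> y \<in> carrier G \<Longrightarrow> x \<otimes> y \<otimes> inv x \<otimes> inv y = inv (conj_by y x \<otimes> inv x)"
  by (simp add: conj_by_def word_simps)

lemma lower_central_series_normal: "lower_central_series G n \<lhd> G"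
proof (induction n)
  case 0
  then show ?case by (simp add: normal_self)
next
  case (Suc n)
  let ?L = "lower_central_series G n"
  let ?C = "\<Union>x\<in>?L. \<Union>y\<in>carrier G. {x \<otimes> y \<otimes> inv x \<otimes> inv y}"
  have sub: "?L \<subseteq> carrier G" using Suc normal_imp_subgroup subgroup.subset by blast
  show ?case unfolding lower_central_series.simps
  proof (rule normal_generateI)
    show "?C \<subseteq> carrier G" using sub by auto
    fix h g assume h: "h \<in> ?C" and g: "g \<in> carrier G"
    then obtain x y where xy: "x \<in> ?L" "y \<in> carrier G" "h = x \<otimes> y \<otimes> inv x \<otimes> inv y" by auto
    then have x: "x \<in> carrier G" using sub by auto
    have "conj_by g h = conj_by g x \<otimes> conj_by g y \<otimes> inv (conj_by g x) \<otimes> inv (conj_by g y)"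
      using g x xy by (simp add: conj_by_mult conj_by_inv)
    then show "g \<otimes> h \<otimes> inv g \<in> ?C"
      using normal_conj_by_closed[OF Suc g xy(1)] g xy(2)
      by (auto simp flip: conj_by_def)
  qed
qed

lemma lower_central_series_Suc_subset:
  assumes "M \<lhd> G" and "\<And>x y. x \<in> lower_central_series G n \<Longrightarrow> y \<in> carrier G \<Longrightarrow> conj_by y x \<otimes> inv x \<in> M"
  shows "lower_central_series G (Suc n) \<subseteq> M"
proof -
  interpret M: subgroup M G using assms(1) by (rule normal_imp_subgroup)
  have "lower_central_series G n \<subseteq> carrier G" using lower_central_series_normal normal_imp_subgroup subgroup.subset by blast
  then have "(\<Union>x\<in>lower_central_series G n. \<Union>y\<in>carrier G. {x \<otimes> y \<otimes> inv x \<otimes> inv y}) \<subseteq> M"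
    using assms(2) by (auto simp: commutator_eq_conj_by subset_iff)
  then show ?thesis
    unfolding lower_central_series.simps by (rule generate_subgroup_incl) (rule M.subgroup_axioms)
qed

lemma lower_central_series_Suc_le: "lower_central_series G (Suc n) \<subseteq> lower_central_series G n"
proof (rule lower_central_series_Suc_subset[OF lower_central_series_normal])
  fix x y assume x: "x \<in> lower_central_series G n" and y: "y \<in> carrier G"
  interpret L: subgroup "lower_central_series G n" G
    using lower_central_series_normal by (rule normal_imp_subgroup)
  show "conj_by y x \<otimes> inv x \<in> lower_central_series G n"
    using normal_conj_by_closed[OF lower_central_series_normal y x] x by blast
qed

text \<open>A strict descent loses at least one element per step, so it cannot last for more steps
  than there are elements.\<close>

lemma nilpotentI_decreasing:
  assumes fin: "finite (carrier G)"
    and dec: "\<And>n. lower_central_series G n \<noteq> {\<one>} \<Longrightarrow> lower_central_series G (Suc n) \<noteq> lower_central_series G n"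
  shows "nilpotent_group G"
proof (rule ccontr)
  assume "\<not> nilpotent_group G"
  then have ne: "lower_central_series G n \<noteq> {\<one>}" for n by (auto simp: nilpotent_group_def)
  have "card (lower_central_series G n) + n \<le> order G" for n
  proof (induction n)
    case (Suc n)
    have "finite (lower_central_series G n)"
      using lower_central_series_normal normal_imp_subgroup subgroup.subset fin finite_subset by metis
    then have "card (lower_central_series G (Suc n)) < card (lower_central_series G n)"
      using lower_central_series_Suc_le dec[OF ne] by (intro psubset_card_mono) auto
    then show ?case using Suc by simp
  qed (simp add: order_def)
  from this[of "Suc (order G)"] show False by simp
qed

text \<open>The set is the preimage in \<open>N\<close> of the elements of N/M that are central in
  G/M. Expressing centrality by \<open>conj_by y x \<otimes> inv x \<in> M\<close> keeps all
  computations in \<open>G\<close>.\<close>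

lemma central_modulo_subgroup:
  assumes M: "M \<lhd> G" and N: "N \<lhd> G" and MN: "M \<subseteq> N"
  shows "{x \<in> N. \<forall>y\<in>carrier G. conj_by y x \<otimes> inv x \<in> M} \<lhd> G" (is "?M' \<lhd> G")
    and "M \<subseteq> {x \<in> N. \<forall>y\<in>carrier G. conj_by y x \<otimes> inv x \<in> M}"
proof -
  interpret M: subgroup M G using M by (rule normal_imp_subgroup)
  interpret N: subgroup N G using N by (rule normal_imp_subgroup)
  show "M \<subseteq> ?M'" using MN normal_conj_by_closed[OF M] by auto
  show "?M' \<lhd> G" unfolding normal_iff_conj_by
  proof (intro conjI ballI)
    show "subgroup ?M' G"
    proof (rule subgroupI)
      fix x assume x: "x \<in> ?M'"
      have "conj_by y (inv x) \<otimes> inv (inv x) = conj_by (inv x) (inv (conj_by y x \<otimes> inv x))" if "y \<in> carrier G" for y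
        using x that by (simp add: conj_by_def word_simps)
      then show "inv x \<in> ?M'" using x normal_conj_by_closed[OF M] by auto
      fix x' assume x': "x' \<in> ?M'"
      \<comment> \<open>The usual expansion of the commutator of a product: the second factor
        appears conjugated by x, which normality of \<open>M\<close> absorbs.\<close>
      have "conj_by y (x \<otimes> x') \<otimes> inv (x \<otimes> x') = (conj_by y x \<otimes> inv x) \<otimes> conj_by x (conj_by y x' \<otimes> inv x')"
        if "y \<in> carrier G" for y
        using x x' that by (simp add: conj_by_def word_simps)
      then show "x \<otimes> x' \<in> ?M'" using x x' normal_conj_by_closed[OF M] by auto
    qed (auto intro!: exI[of _ \<one>])
    fix g x assume g: "g \<in> carrier G" and x: "x \<in> ?M'"
    have "conj_by y (conj_by g x) \<otimes> inv (conj_by g x) = conj_by g (conj_by (inv g \<otimes> y \<otimes> g) x \<otimes> inv x)" if "y \<in> carrier G" for y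
      using x g that by (simp add: conj_by_def word_simps)
    then show "conj_by g x \<in> ?M'" using x g normal_conj_by_closed[OF M g] normal_conj_by_closed[OF N g] by auto
  qed
qed

text \<open>\<open>G\<close> acts by conjugation on the cosets of \<open>M\<close> in
  \<open>N\<close>. Their number is a multiple of \<open>p\<close> and the trivial coset is fixed,
  so another coset is fixed too; its elements are central modulo \<open>M\<close>.\<close>

lemma prime_power_order_central_modulo:
  assumes p: "Factorial_Ring.prime p" "order G = p ^ m"
    and M: "M \<lhd> G" and N: "N \<lhd> G" and MN: "M \<subset> N"
  shows "\<exists>x\<in>N - M. \<forall>y\<in>carrier G. conj_by y x \<otimes> inv x \<in> M"
proof -
  interpret M: subgroup M G using M by (rule normal_imp_subgroup)
  interpret N: subgroup N G using N by (rule normal_imp_subgroup)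
  have fin: "finite (carrier G)" using p order_gt_0_iff_finite prime_gt_0_nat by (metis zero_less_power)
  let ?G = "G\<lparr>carrier := N\<rparr>"
  interpret NG: group ?G by (rule N.subgroup_is_group) (rule is_group)
  have MNG: "subgroup M ?G" by (rule subgroup_incl[OF M.subgroup_axioms N.subgroup_axioms]) (use MN in auto)
  let ?C = "(\<lambda>x. M #> x) ` N"
  have C: "rcosets\<^bsub>?G\<^esub> M = ?C" by (auto simp: RCOSETS_def)
  have coset_eq: "M #> x = M #> y \<longleftrightarrow> y \<otimes> inv x \<in> M" if "x \<in> carrier G" "y \<in> carrier G" for x y
    using that M.rcos_module[OF is_group that] repr_independence[OF _ that(1) M.subgroup_axioms, of y] rcos_self[OF that(2) M.subgroup_axioms] by metis
  let ?act = "\<lambda>g S. conj_by g ` S"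
  have act: "?act g (M #> x) = M #> conj_by g x" if "g \<in> carrier G" "x \<in> carrier G" for g x
  proof
    show "?act g (M #> x) \<subseteq> M #> conj_by g x"
      using that normal_conj_by_closed[OF M] by (auto simp: r_coset_def conj_by_mult)
    show "M #> conj_by g x \<subseteq> ?act g (M #> x)"
    proof
      fix s assume "s \<in> M #> conj_by g x"
      then obtain m where m: "m \<in> M" "s = m \<otimes> conj_by g x" by (auto simp: r_coset_def)
      have "s = conj_by g (conj_by (inv g) m \<otimes> x)" using m that by (simp add: conj_by_mult)
      moreover have "conj_by (inv g) m \<in> M" using normal_conj_by_closed[OF M] m that by blast
      ultimately show "s \<in> ?act g (M #> x)" by (auto simp: r_coset_def)
    qed
  qed
  have "[card {S \<in> ?C. \<forall>g\<in>carrier G. ?act g S = S} = card ?C] (mod p)"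
  proof (rule prime_power_order_fixed_points[OF p])
    show "finite ?C" using fin N.subset finite_subset by blast
    fix g S assume g: "g \<in> carrier G" and S: "S \<in> ?C"
    then show "?act g S \<in> ?C" using act normal_conj_by_closed[OF N g] by auto
    fix h assume "h \<in> carrier G"
    moreover obtain x where "x \<in> carrier G" "S = M #> x" using S N.subset by blast
    ultimately show "?act (g \<otimes> h) S = ?act g (?act h S)" using g by (simp add: act conj_by_conj_by)
  next
    fix S assume "S \<in> ?C"
    then obtain x where "x \<in> carrier G" "S = M #> x" using N.subset by blast
    then show "?act \<one> S = S" by (simp add: act)
  qed
  moreover have "p dvd card ?C"
  proof -
    have e: "card ?C * card M = card N" using NG.lagrange[OF MNG] C by (simp add: order_def)
    have "card N dvd p ^ m" using card_subgroup_dvd[OF N.subgroup_axioms] p by simp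
    then have "card ?C dvd p ^ m" using e by (metis dvd_mult_left)
    then obtain i where i: "card ?C = p ^ i" using p by (auto simp: divides_primepow_nat)
    have "card M < card N" using MN fin N.subset finite_subset by (metis psubset_card_mono)
    then have "i \<noteq> 0" using e i by (cases i) auto
    then show ?thesis using i by simp
  qed
  ultimately have dvd: "p dvd card {S \<in> ?C. \<forall>g\<in>carrier G. ?act g S = S}" (is "p dvd card ?F")
    by (simp add: cong_dvd_iff)
  have "M #> \<one> \<in> ?F" using act[of _ \<one>] by auto
  moreover have "\<not> ?F \<subseteq> {M #> \<one>}"
  proof
    assume "?F \<subseteq> {M #> \<one>}"
    then have "?F = {M #> \<one>}" using \<open>M #> \<one> \<in> ?F\<close> by blast
    then have "card ?F = 1" by simp
    then show False using dvd p(1) by simp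
  qed
  ultimately obtain S where S: "S \<in> ?F" "S \<noteq> M #> \<one>" by blast
  then obtain x where x: "x \<in> N" "S = M #> x" by auto
  then have xG: "x \<in> carrier G" using N.subset by auto
  have "x \<notin> M" using S(2) x coset_eq[of \<one> x] xG by auto
  moreover have "conj_by y x \<otimes> inv x \<in> M" if y: "y \<in> carrier G" for y
  proof -
    have "M #> conj_by y x = M #> x" using S(1) x act[OF y xG] y by auto
    then show ?thesis using coset_eq[of x "conj_by y x"] xG y by simp
  qed
  ultimately show ?thesis using x by blast
qed

text \<open>Take \<open>M\<close> maximal among the normal subgroups of \<open>G\<close> properly
  inside a non-trivial term of the series. The elements of that term central modulo \<open>M\<close>
  form a strictly larger normal subgroup, hence the whole term, so the next term lies in
  \<open>M\<close>.\<close>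

theorem prime_power_order_nilpotent:
  assumes p: "Factorial_Ring.prime p" "order G = p ^ m"
  shows "nilpotent_group G"
proof (rule nilpotentI_decreasing)
  show fin: "finite (carrier G)" using p order_gt_0_iff_finite prime_gt_0_nat by (metis zero_less_power)
  fix n assume ne: "lower_central_series G n \<noteq> {\<one>}"
  let ?N = "lower_central_series G n"
  have N: "?N \<lhd> G" by (rule lower_central_series_normal)
  interpret N: subgroup ?N G using N by (rule normal_imp_subgroup)
  let ?S = "{M. M \<lhd> G \<and> M \<subset> ?N}"
  have "finite ?S" by (rule finite_subset[of _ "Pow (carrier G)"]) (use fin N.subset in auto)
  moreover have "{\<one>} \<in> ?S" using ne N.one_closed one_is_normal by auto
  ultimately obtain M where M: "M \<in> ?S" and max: "\<And>M'. M' \<in> ?S \<Longrightarrow> M \<subseteq> M' \<Longrightarrow> M' = M"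
    using finite_has_maximal[of ?S] by (metis (no_types, lifting) empty_iff)
  let ?M' = "{x \<in> ?N. \<forall>y\<in>carrier G. conj_by y x \<otimes> inv x \<in> M}"
  have "?M' \<lhd> G" "M \<subseteq> ?M'" using central_modulo_subgroup[of M ?N] M N by auto
  moreover have "?M' \<noteq> M" using prime_power_order_central_modulo[OF p, of M ?N] M N by blast
  ultimately have "?M' = ?N" using max[of ?M'] by blast
  then have "lower_central_series G (Suc n) \<subseteq> M"
    using M by (intro lower_central_series_Suc_subset) auto
  then show "lower_central_series G (Suc n) \<noteq> ?N" using M by blast
qed

text \<open>Central factors cancel in commutators, so every commutator of \<open>G\<close> is one of
  \<open>P\<close>, and the two lower central series can be compared.\<close>

lemma nilpotent_central_product:
  assumes P: "subgroup P G" and nil: "nilpotent_group (G\<lparr>carrier := P\<rparr>)"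
    and W: "W \<subseteq> carrier G" "\<And>w g. w \<in> W \<Longrightarrow> g \<in> carrier G \<Longrightarrow> w \<otimes> g = g \<otimes> w"
    and PW: "P <#> W = carrier G"
  shows "nilpotent_group G"
proof -
  interpret P: subgroup P G by fact
  let ?P = "G\<lparr>carrier := P\<rparr>"
  interpret PG: group ?P by (rule P.subgroup_is_group) (rule is_group)
  let ?L = "lower_central_series ?P"
  have LP: "?L n \<subseteq> P" for n
    using PG.lower_central_series_normal[of n] normal_imp_subgroup subgroup.subset by fastforce
  have drop: "x \<otimes> (p \<otimes> w) \<otimes> inv x \<otimes> inv (p \<otimes> w) = x \<otimes> p \<otimes> inv x \<otimes> inv p"
    if "x \<in> carrier G" "p \<in> carrier G" "w \<in> W" for x p w
  proof -
    have w: "w \<in> carrier G" using that W by auto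
    have "x \<otimes> (p \<otimes> w) \<otimes> inv x \<otimes> inv (p \<otimes> w) = x \<otimes> p \<otimes> (w \<otimes> inv x) \<otimes> inv w \<otimes> inv p"
      using that w by (simp add: word_simps)
    also have "w \<otimes> inv x = inv x \<otimes> w" using W(2)[of w "inv x"] that by simp
    finally show ?thesis using that w by (simp add: word_simps)
  qed
  have drop': "(p \<otimes> w) \<otimes> y \<otimes> inv (p \<otimes> w) \<otimes> inv y = p \<otimes> y \<otimes> inv p \<otimes> inv y"
    if "y \<in> carrier G" "p \<in> carrier G" "w \<in> W" for y p w
  proof -
    have w: "w \<in> carrier G" using that W by auto
    have "(p \<otimes> w) \<otimes> y \<otimes> inv (p \<otimes> w) \<otimes> inv y = p \<otimes> (w \<otimes> y) \<otimes> inv w \<otimes> inv p \<otimes> inv y"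
      using that w by (simp add: word_simps)
    also have "w \<otimes> y = y \<otimes> w" using W(2)[of w y] that by simp
    finally show ?thesis using that w by (simp add: word_simps)
  qed
  have split: "\<exists>p w. p \<in> P \<and> w \<in> W \<and> g = p \<otimes> w" if "g \<in> carrier G" for g
    using that PW by (auto simp: set_mult_def)
  have base: "x \<otimes> y \<otimes> inv x \<otimes> inv y \<in> ?L (Suc n)" if "x \<in> ?L n" "y \<in> P" for x y n
  proof -
    have "x \<in> P" using LP that by auto
    then have "x \<otimes> y \<otimes> inv x \<otimes> inv y = x \<otimes>\<^bsub>?P\<^esub> y \<otimes>\<^bsub>?P\<^esub> inv\<^bsub>?P\<^esub> x \<otimes>\<^bsub>?P\<^esub> inv\<^bsub>?P\<^esub> y"
      using that P.subgroup_axioms by simp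
    then have "x \<otimes> y \<otimes> inv x \<otimes> inv y \<in> (\<Union>x\<in>?L n. \<Union>y\<in>carrier ?P. {x \<otimes>\<^bsub>?P\<^esub> y \<otimes>\<^bsub>?P\<^esub> inv\<^bsub>?P\<^esub> x \<otimes>\<^bsub>?P\<^esub> inv\<^bsub>?P\<^esub> y})"
      using that by auto
    then show ?thesis unfolding lower_central_series.simps by (rule generate.incl)
  qed
  have sub: "subgroup (?L n) G" for n
    using PG.lower_central_series_normal[of n] normal_imp_subgroup incl_subgroup[OF P.subgroup_axioms] by blast
  \<comment> \<open>The comparison starts at index 1, since at index 0 the series of
    \<open>G\<close> is all of \<open>G\<close>.\<close>
  have incl: "lower_central_series G (Suc n) \<subseteq> ?L (Suc n)" for n
  proof (induction n)
    case 0
    have "x \<otimes> y \<otimes> inv x \<otimes> inv y \<in> ?L (Suc 0)" if xy: "x \<in> carrier G" "y \<in> carrier G" for x y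
    proof -
      obtain p w p' w' where *: "p \<in> P" "w \<in> W" "x = p \<otimes> w" "p' \<in> P" "w' \<in> W" "y = p' \<otimes> w'"
        using split[OF xy(1)] split[OF xy(2)] by blast
      then have pG: "p \<in> carrier G" "p' \<in> carrier G" using P.subset by auto
      have "x \<otimes> y \<otimes> inv x \<otimes> inv y = p \<otimes> y \<otimes> inv p \<otimes> inv y"
        unfolding *(3) by (rule drop'[OF xy(2) pG(1) *(2)])
      also have "\<dots> = p \<otimes> p' \<otimes> inv p \<otimes> inv p'"
        unfolding *(6) by (rule drop[OF pG *(5)])
      finally show ?thesis using base[of p 0 p'] * by simp
    qed
    then show ?case unfolding lower_central_series.simps(2)[of G]
      by (intro generate_subgroup_incl[OF _ sub]) auto
  next
    case (Suc n)
    have "x \<otimes> y \<otimes> inv x \<otimes> inv y \<in> ?L (Suc (Suc n))" if x: "x \<in> lower_central_series G (Suc n)" and y: "y \<in> carrier G" for x y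
    proof -
      obtain p' w' where *: "p' \<in> P" "w' \<in> W" "y = p' \<otimes> w'" using split[OF y] by blast
      have x': "x \<in> ?L (Suc n)" using Suc x by blast
      then have "x \<in> carrier G" "p' \<in> carrier G" using LP P.subset * by blast+
      then have "x \<otimes> y \<otimes> inv x \<otimes> inv y = x \<otimes> p' \<otimes> inv x \<otimes> inv p'"
        unfolding *(3) using *(2) by (rule drop)
      then show ?thesis using base[OF x', of p'] * by simp
    qed
    then show ?case unfolding lower_central_series.simps(2)[of G "Suc n"]
      by (intro generate_subgroup_incl[OF _ sub]) auto
  qed
  obtain n where "?L n = {\<one>}" using nil by (auto simp: nilpotent_group_def)
  then have "?L (Suc n) \<subseteq> {\<one>}" using PG.lower_central_series_Suc_le[of n] by simp
  then have "lower_central_series G (Suc n) \<subseteq> {\<one>}" using incl[of n] by blast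
  moreover have "\<one> \<in> lower_central_series G (Suc n)"
    using lower_central_series_normal[of "Suc n"] normal_imp_subgroup subgroup.one_closed by blast
  ultimately have "lower_central_series G (Suc n) = {\<one>}" by blast
  then show ?thesis unfolding nilpotent_group_def by blast
qed

text \<open>The case of trivial \<open>P\<close>, with the whole group as central factor.\<close>

lemma abelian_nilpotent:
  assumes "\<And>x y. x \<in> carrier G \<Longrightarrow> y \<in> carrier G \<Longrightarrow> x \<otimes> y = y \<otimes> x"
  shows "nilpotent_group G"
proof (rule nilpotent_central_product[OF triv_subgroup])
  interpret T: group "G\<lparr>carrier := {\<one>}\<rparr>" by (rule subgroup.subgroup_is_group[OF triv_subgroup]) (rule is_group)
  show "nilpotent_group (G\<lparr>carrier := {\<one>}\<rparr>)"
    unfolding nilpotent_group_def using T.is_group by (auto intro: exI[of _ 0])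
  show "{\<one>} <#> carrier G = carrier G" by (auto simp: set_mult_def)
qed (use assms in auto)

end

subsection \<open>Groups with a unique involution\<close>

lemma exists_last_failure:
  assumes "\<not> P 0" "P (n::nat)"
  shows "\<exists>t. \<not> P t \<and> P (Suc t)"
  using assms by (induction n) auto

text \<open>-1 is not a square modulo 4; hence no automorphism of a cyclic group whose order is
  divisible by 4 has inversion as its square.\<close>

lemma four_not_dvd_Suc_square: "\<not> 4 dvd 1 + u * (u::nat)"
proof (cases "even u")
  case True
  then obtain k where "u = 2 * k" by (elim evenE)
  then have "1 + u * u = 4 * (k * k) + 1" by simp
  then show ?thesis by presburger
next
  case False
  then obtain k where "u = 2 * k + 1" by (elim oddE)
  then have "1 + u * u = 4 * (k * k + k) + 2" by simp
  then show ?thesis by presburger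
qed

context group
begin

lemma generate_singleton_iff:
  assumes "finite (carrier G)" "x \<in> carrier G"
  shows "g \<in> generate G {x} \<longleftrightarrow> (\<exists>i::nat. g = x [^] i)"
  using generate_pow_nat[OF assms(2)] ord_ge_1[OF assms] by auto

lemma generate_singleton_normalI:
  assumes "finite (carrier G)" "x \<in> carrier G" "\<And>g. g \<in> carrier G \<Longrightarrow> conj_by g x \<in> generate G {x}"
  shows "generate G {x} \<lhd> G"
  unfolding normal_iff_conj_by
proof (intro conjI ballI)
  show sub: "subgroup (generate G {x}) G" using assms(2) by (intro generate_is_subgroup) auto
  fix g h assume g: "g \<in> carrier G" and "h \<in> generate G {x}"
  then obtain i :: nat where "h = x [^] i" using generate_singleton_iff assms by blast
  then show "conj_by g h \<in> generate G {x}"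
    using g assms(2) subgroup_pow_closed[OF sub assms(3)[OF g]] by (simp add: conj_by_pow)
qed

lemma conj_by_sq: "y \<in> carrier G \<Longrightarrow> conj_by y (y \<otimes> y) = y \<otimes> y"
  by (simp add: conj_by_def word_simps)

lemma mult_twisted_square:
  assumes "g \<in> carrier G" "y \<in> carrier G"
  shows "(g \<otimes> y) \<otimes> (g \<otimes> y) = g \<otimes> conj_by y g \<otimes> (y \<otimes> y)"
  using assms by (simp add: conj_by_def word_simps)

end

locale unique_involution = group +
  fixes z
  assumes fin: "finite (carrier G)"
    and z_closed [simp]: "z \<in> carrier G" and ord_z: "ord z = 2"
    and involution_eq: "\<And>x. x \<in> carrier G \<Longrightarrow> ord x = 2 \<Longrightarrow> x = z"
begin

lemma z_neq_one: "z \<noteq> \<one>" using ord_z ord_id by auto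

lemma z_sq [simp]: "z \<otimes> z = \<one>"
  using pow_ord_eq_1[OF z_closed] by (simp add: ord_z numeral_2_eq_2)

lemma sq_eq_one: "x \<in> carrier G \<Longrightarrow> x \<otimes> x = \<one> \<Longrightarrow> x = \<one> \<or> x = z"
proof -
  assume x: "x \<in> carrier G" "x \<otimes> x = \<one>"
  then have "x [^] (2::nat) = \<one>" by (simp add: numeral_2_eq_2)
  then have "ord x dvd 2" using x pow_eq_id by blast
  then have "ord x = 1 \<or> ord x = 2" using two_is_prime_nat prime_nat_iff by blast
  then show ?thesis using ord_eq_1 involution_eq x by blast
qed

lemma conj_by_z [simp]: "g \<in> carrier G \<Longrightarrow> conj_by g z = z"
  by (rule involution_eq) (auto simp: ord_z)

lemma z_central: "g \<in> carrier G \<Longrightarrow> g \<otimes> z = z \<otimes> g"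
  using conj_by_z conj_by_eq_iff_commute z_closed by blast

lemma half_power_eq_z:
  assumes "x \<in> carrier G" "ord x = 2 ^ Suc s"
  shows "x [^] (2 ^ s :: nat) = z"
  by (rule involution_eq) (use assms in \<open>auto simp: ord_pow\<close>)

lemma odd_exponent_of_conj:
  assumes "x \<in> carrier G" "ord x = 2 ^ s" "s > 0" "conj_by y x = x [^] (u::nat)" "y \<in> carrier G"
  shows "odd u"
proof -
  have "ord (x [^] u) = ord x" using assms by (metis ord_conj_by)
  then have "coprime u (2 ^ s)" using pow_ord_eq_ord_iff[OF fin assms(1)] assms(2) by simp
  then show ?thesis using assms(3) by simp
qed

lemma odd_power_recover:
  assumes "x \<in> carrier G" "ord x = 2 ^ s" "odd j"
  shows "\<exists>k. x = (x [^] (j::nat)) [^] (k::nat)"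
proof -
  have "coprime j (2 ^ s)" using assms(3) by simp
  then obtain k where "[j * k = 1] (mod 2 ^ s)" using cong_solve_coprime_nat[of j "2 ^ s"] by auto
  then have "x [^] (j * k) = x [^] (1::nat)" using pow_eq_pow_iff[OF assms(1), of "j * k" 1] assms(2) by simp
  then show ?thesis using assms(1) by (metis nat_pow_eone nat_pow_pow)
qed

text \<open>\<open>generate G {x}\<close> is a normal cyclic subgroup of maximal order; maximality makes it its own
  centralizer, and then every element outside it must invert it.\<close>

theorem two_group_dichotomy:
  assumes order: "order G = 2 ^ a"
  shows "(\<exists>c\<in>carrier G. ord c = 2 ^ a) \<or>
    (\<exists>x\<in>carrier G. \<exists>y\<in>carrier G. a \<ge> 3 \<and> ord x = 2 ^ (a - 1) \<and> y \<notin> generate G {x} \<and>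
       y \<otimes> y = z \<and> conj_by y x = inv x \<and> carrier G = generate G {x} \<union> (\<lambda>g. g \<otimes> y) ` generate G {x})"
proof -
  let ?S = "{x \<in> carrier G. generate G {x} \<lhd> G}"
  \<comment> \<open>The family over which the maximum is taken thus contains a subgroup of order 2,
    so the maximal order is at least 2.\<close>
  have "generate G {z} \<lhd> G"
    by (rule generate_singleton_normalI[OF fin]) (auto intro: generate.incl)
  then have zS: "z \<in> ?S" by simp
  have "finite (ord ` ?S)" "ord ` ?S \<noteq> {}" using fin zS by (simp, blast)
  then have "Max (ord ` ?S) \<in> ord ` ?S" "\<And>y. y \<in> ?S \<Longrightarrow> ord y \<le> Max (ord ` ?S)"
    using Max_in Max_ge by auto
  then obtain x where xS: "x \<in> ?S" and max: "\<And>y. y \<in> ?S \<Longrightarrow> ord y \<le> ord x"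
    by (metis (no_types, lifting) imageE)
  then have x [simp]: "x \<in> carrier G" by simp
  let ?A = "generate G {x}"
  have An: "?A \<lhd> G" using xS by simp
  interpret A: subgroup ?A G using An by (rule normal_imp_subgroup)
  have A_iff: "g \<in> ?A \<longleftrightarrow> (\<exists>i::nat. g = x [^] i)" for g by (rule generate_singleton_iff[OF fin x])
  have xA: "x \<in> ?A" by (auto intro: generate.incl)
  have cardA: "card ?A = ord x" using generate_pow_card[OF x] by simp
  have "ord x dvd 2 ^ a" using ord_dvd_group_order[OF x] order by simp
  then obtain s where s: "ord x = 2 ^ s" by (auto simp: divides_primepow_nat[OF two_is_prime_nat])
  have "ord x \<ge> 2" using max[OF zS] ord_z by simp
  then obtain s' where s': "s = Suc s'" using s by (cases s) auto
  have zA: "z \<in> ?A" using half_power_eq_z[OF x, of s'] s s' A_iff by metis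
  have sqA: "g \<in> ?A" if "g \<in> carrier G" "g \<otimes> g = \<one>" for g
    using sq_eq_one[OF that] zA A.one_closed by auto
  show ?thesis
  proof (cases "?A = carrier G")
    case True
    then have "ord x = 2 ^ a" using cardA order by (simp add: order_def)
    then show ?thesis using x by blast
  next
    case False
    \<comment> \<open>This is where maximality enters. If y^2 = x^j with j even, dividing y by
      x^(j/2) gives an element of square 1, which lies in \<open>?A\<close>. If j is odd, x is a
      power of y, so y generates a larger cyclic subgroup, normal because y is central modulo
      \<open>?A\<close>.\<close>
    have ext: False if y: "y \<in> carrier G" "y \<notin> ?A" "y \<otimes> y \<in> ?A" "y \<otimes> x = x \<otimes> y"
      and nrm: "\<And>g. g \<in> carrier G \<Longrightarrow> conj_by g y \<otimes> inv y \<in> ?A" for y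
    proof -
      obtain j :: nat where j: "y \<otimes> y = x [^] j" using y(3) A_iff by blast
      show False
      proof (cases "even j")
        case True
        then obtain l where l: "j = l + l" by (metis evenE mult_2)
        have c: "y \<otimes> x [^] l = x [^] l \<otimes> y" using commutes_imp_commutes_pow y by simp
        then have "conj_by y (x [^] l) = x [^] l" using y by (simp add: conj_by_eq_iff_commute)
        then have "conj_by y (inv (x [^] l)) = inv (x [^] l)" using y by (simp add: conj_by_inv)
        then have "(inv (x [^] l) \<otimes> y) \<otimes> (inv (x [^] l) \<otimes> y) = inv (x [^] l) \<otimes> inv (x [^] l) \<otimes> (y \<otimes> y)"
          using y by (simp add: mult_twisted_square)
        also have "\<dots> = \<one>" using l j by (simp add: word_simps flip: nat_pow_mult)
        finally have "inv (x [^] l) \<otimes> y \<in> ?A" using y by (intro sqA) auto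
        moreover have "x [^] l \<in> ?A" using A_iff by blast
        ultimately have "x [^] l \<otimes> (inv (x [^] l) \<otimes> y) \<in> ?A" by blast
        then show False using y by (simp add: mult_inv_cancel)
      next
        case False
        then obtain k :: nat where "x = (x [^] j) [^] k" using odd_power_recover[OF x s] by blast
        then have xk: "x = y [^] (2 * k)" using j y
          by (metis nat_pow_pow nat_pow_Suc nat_pow_eone numeral_2_eq_2 One_nat_def)
        have sub: "?A \<subseteq> generate G {y}"
        proof
          fix g assume "g \<in> ?A"
          then obtain i :: nat where "g = x [^] i" using A_iff by blast
          then have "g = y [^] (2 * k * i)" using xk y by (metis nat_pow_pow)
          then show "g \<in> generate G {y}" using generate_singleton_iff[OF fin y(1)] by blast
        qed
        interpret Y: subgroup "generate G {y}" G using y by (intro generate_is_subgroup) auto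
        have yY: "y \<in> generate G {y}" by (auto intro: generate.incl)
        have "generate G {y} \<lhd> G"
        proof (rule generate_singleton_normalI[OF fin y(1)])
          fix g assume g: "g \<in> carrier G"
          have "(conj_by g y \<otimes> inv y) \<otimes> y \<in> generate G {y}" using nrm[OF g] sub yY by blast
          then show "conj_by g y \<in> generate G {y}" using g y by (simp add: word_simps)
        qed
        then have "ord y \<le> ord x" using max y by simp
        moreover have "card ?A < card (generate G {y})"
          by (rule psubset_card_mono) (use sub y yY finite_subset[OF Y.subset fin] in auto)
        ultimately show False using generate_pow_card[OF y(1)] cardA by simp
      qed
    qed
    have squares_in_A: "\<exists>t. g [^] (2 ^ t :: nat) \<notin> ?A \<and> g [^] (2 ^ Suc t :: nat) \<in> ?A" if g: "g \<in> carrier G" "g \<notin> ?A" for g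
    proof (rule exists_last_failure[of "\<lambda>t. g [^] (2 ^ t :: nat) \<in> ?A" a])
      show "g [^] (2 ^ a :: nat) \<in> ?A" using pow_order_eq_1[OF g(1)] order A.one_closed by simp
    qed (use g in auto)
    have two_Suc: "g [^] (2 ^ Suc t :: nat) = g [^] (2 ^ t :: nat) \<otimes> g [^] (2 ^ t :: nat)" if "g \<in> carrier G" for g and t :: nat
      using that by (simp add: nat_pow_mult mult_2)
    let ?C = "{g \<in> carrier G. g \<otimes> x = x \<otimes> g}"
    have C_iff: "g \<in> ?C \<longleftrightarrow> g \<in> carrier G \<and> conj_by g x = x" for g
      using conj_by_eq_iff_commute by auto
    have Csub: "subgroup ?C G"
    proof (rule subgroupI)
      show "inv g \<in> ?C" if "g \<in> ?C" for g
        using that unfolding C_iff by (metis conj_by_inv_left inv_closed x)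
      show "g \<otimes> h \<in> ?C" if "g \<in> ?C" "h \<in> ?C" for g h
        using that unfolding C_iff by (metis conj_by_conj_by m_closed x)
    qed (auto intro!: exI[of _ \<one>])
    \<comment> \<open>The centralizer is normal. Were it larger, it would contain an element outside
      \<open>?A\<close> that is central modulo \<open>?A\<close>; its last 2-power outside
      \<open>?A\<close> contradicts \<open>ext\<close>.\<close>
    have CA: "?C \<subseteq> ?A"
    proof (rule ccontr)
      assume nC: "\<not> ?C \<subseteq> ?A"
      have AC: "?A \<subseteq> ?C"
      proof
        fix g assume "g \<in> ?A"
        then obtain i :: nat where "g = x [^] i" using A_iff by blast
        then show "g \<in> ?C" using commutes_imp_commutes_pow[of x x i] by simp
      qed
      have Cn: "?C \<lhd> G" unfolding normal_iff_conj_by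
      proof (intro conjI ballI Csub)
        fix g h assume g: "g \<in> carrier G" and h: "h \<in> ?C"
        obtain i :: nat where "conj_by (inv g) x = x [^] i"
          using normal_conj_by_closed[OF An inv_closed[OF g] xA] A_iff by blast
        then have "conj_by h (conj_by (inv g) x) = conj_by (inv g) x"
          using h C_iff by (simp add: conj_by_pow)
        then have "conj_by g (conj_by h (conj_by (inv g) x)) = x" using g by simp
        moreover have "conj_by g (conj_by h (conj_by (inv g) x)) = conj_by (conj_by g h) x"
          using g h by (simp add: conj_by_conj_by) (simp add: conj_by_def word_simps)
        ultimately show "conj_by g h \<in> ?C" using g h C_iff by auto
      qed
      let ?M = "{y \<in> ?C. \<forall>g\<in>carrier G. conj_by g y \<otimes> inv y \<in> ?A}"
      obtain y0 where y0: "y0 \<in> ?C" "y0 \<notin> ?A" "y0 \<in> ?M"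
        using prime_power_order_central_modulo[OF two_is_prime_nat order An Cn] AC nC by blast
      have Ms: "subgroup ?M G" by (rule normal_imp_subgroup[OF central_modulo_subgroup(1)[OF An Cn AC]])
      obtain t where t: "y0 [^] (2 ^ t :: nat) \<notin> ?A" "y0 [^] (2 ^ Suc t :: nat) \<in> ?A"
        using squares_in_A y0 by blast
      have "y0 [^] (2 ^ t :: nat) \<in> ?M" by (rule subgroup_pow_closed[OF Ms y0(3)])
      then show False using ext[of "y0 [^] (2 ^ t :: nat)"] t two_Suc y0(1) by auto
    qed
    have s2: "s \<ge> 2"
    proof (rule ccontr)
      assume "\<not> s \<ge> 2"
      then have "ord x = 2" using s s' by simp
      then have "x = z" using involution_eq by simp
      then have "carrier G \<subseteq> ?A" using CA z_central by auto
      then show False using False A.subset by blast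
    qed
    \<comment> \<open>Let y act on x as the exponent u and let y^2 = x^j; since y fixes its own
      square, uj = j modulo 2^s. The cases u = 1 and u = 3 modulo 4 are treated separately.\<close>
    have sq_z: "y \<otimes> y = z" if y: "y \<in> carrier G" "y \<notin> ?A" "y \<otimes> y \<in> ?A" for y
    proof -
      obtain j :: nat where j: "y \<otimes> y = x [^] j" using y(3) A_iff by blast
      obtain u :: nat where u: "conj_by y x = x [^] u"
        using normal_conj_by_closed[OF An y(1) xA] A_iff by blast
      have "odd u" by (rule odd_exponent_of_conj[OF x s _ u y(1)]) (use s' in simp)
      have conj_pow: "conj_by y (x [^] i) = x [^] (u * i)" for i :: nat
        using u y by (simp add: conj_by_pow nat_pow_pow)
      have "x [^] (u * j) = x [^] j" using conj_by_sq[OF y(1)] j conj_pow by metis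
      then have uj: "[u * j = j] (mod 2 ^ s)" using pow_eq_pow_iff[OF x] s by simp
      from \<open>odd u\<close> have "u mod 4 = 1 \<or> u mod 4 = 3" by presburger
      then consider "u mod 4 = 1" | "u mod 4 = 3" by blast
      then show ?thesis
      proof cases
        case 1
        then have "even (1 + u)" "odd ((1 + u) div 2)" by presburger+
        then obtain v where v: "1 + u = 2 * v" "odd v" by (metis dvd_mult_div_cancel)
        show ?thesis
        proof (cases "even j")
          case False
          then obtain k :: nat where k: "x = (x [^] j) [^] k" using odd_power_recover[OF x s] by blast
          have "conj_by y x = x"
            by (subst (1 2) k) (use conj_by_sq[OF y(1)] j y in \<open>simp add: conj_by_pow\<close>)
          then have "y \<in> ?A" using CA C_iff y by blast
          then show ?thesis using y by simp
        next
          case True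
          then obtain l where l: "j = 2 * l" by (auto elim!: evenE)
          have "coprime v (2 ^ s)" using v by simp
          then obtain k where k: "[v * k = 1] (mod 2 ^ s)" using cong_solve_coprime_nat[of v "2 ^ s"] by auto
          \<comment> \<open>Chosen so that x^i y has square 1, that is (1 + u)i + j = 0 modulo 2^s.
            With 1 + u = 2v and j = 2l this holds for i = -l/v; here k is the inverse of v, and 2^s
            - 1 stands for -1.\<close>
          define i where "i = k * ((2 ^ s - 1) * l)"
          have "[v * k * ((2 ^ s - 1) * l) + l = 1 * ((2 ^ s - 1) * l) + l] (mod 2 ^ s)"
            by (intro cong_add cong_mult k) auto
          also have "1 * ((2 ^ s - 1) * l) + l = 2 ^ s * l" by (simp add: algebra_simps)
          finally have "2 ^ s dvd v * i + l" by (simp add: i_def cong_dvd_iff mult.assoc)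
          moreover have "i + u * i + j = 2 * (v * i + l)" using v(1) l
            by (metis (no_types, lifting) add_mult_distrib distrib_left mult.assoc mult_1)
          ultimately have "2 ^ s dvd i + u * i + j" by (metis dvd_mult)
          then have "x [^] (i + u * i + j) = \<one>" using pow_eq_id[OF x] s by simp
          moreover have "(x [^] i \<otimes> y) \<otimes> (x [^] i \<otimes> y) = x [^] (i + u * i + j)"
            using y j conj_pow by (simp add: mult_twisted_square nat_pow_mult)
          ultimately have "x [^] i \<otimes> y \<in> ?A" using y by (intro sqA) auto
          moreover have "x [^] i \<in> ?A" using A_iff by blast
          ultimately have "inv (x [^] i) \<otimes> (x [^] i \<otimes> y) \<in> ?A" by blast
          then show ?thesis using y by (simp add: inv_mult_cancel)
        qed
      next
        case 2
        \<comment> \<open>Since u = 3 modulo 4, the number (u - 1)/2 is odd, so uj = j forces 2j = 0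
          modulo 2^s, and the square of y has order at most 2.\<close>
        define w where "w = (u - 1) div 2"
        have w: "u = 2 * w + 1" "odd w" using 2 unfolding w_def by presburger+
        have "[2 * w * j + j = 0 + j] (mod 2 ^ s)" using uj w by (simp add: algebra_simps)
        then have "[2 * w * j = 0] (mod 2 ^ s)" by (rule cong_add_rcancel_nat[THEN iffD1])
        then have "2 ^ s dvd w * (2 * j)" by (simp add: cong_0_iff mult_ac)
        then have "2 ^ s dvd 2 * j" using w(2) by (simp add: coprime_dvd_mult_right_iff)
        then have "x [^] (j + j) = \<one>" using pow_eq_id[OF x] s by (simp add: mult_2)
        then have "(y \<otimes> y) \<otimes> (y \<otimes> y) = \<one>" using j by (simp add: nat_pow_mult)
        then have "y \<otimes> y = \<one> \<or> y \<otimes> y = z" using sq_eq_one y by simp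
        then show ?thesis using sqA y by blast
      qed
    qed
    \<comment> \<open>Both y and x y square to z; expanding the square of x y then leaves x times
      the conjugate of x equal to 1.\<close>
    have inverts: "conj_by y x = inv x" if y: "y \<in> carrier G" "y \<notin> ?A" "y \<otimes> y \<in> ?A" for y
    proof -
      have "x \<otimes> y \<notin> ?A"
      proof
        assume "x \<otimes> y \<in> ?A"
        then have "inv x \<otimes> (x \<otimes> y) \<in> ?A" using xA by blast
        then show False using y by (simp add: inv_mult_cancel)
      qed
      moreover have "(x \<otimes> y) \<otimes> (x \<otimes> y) \<in> ?A"
        using y xA normal_conj_by_closed[OF An y(1) xA] by (simp add: mult_twisted_square)
      ultimately have "(x \<otimes> y) \<otimes> (x \<otimes> y) = y \<otimes> y" using sq_z[of "x \<otimes> y"] sq_z[OF y] y(1) by simp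
      then have "x \<otimes> conj_by y x \<otimes> (y \<otimes> y) = y \<otimes> y" using y by (simp add: mult_twisted_square)
      then have "x \<otimes> conj_by y x = \<one>" using y by simp
      then show ?thesis using y by (metis conj_by_closed inv_equality inv_comm x)
    qed
    \<comment> \<open>Otherwise the last 2-power of g outside \<open>?A\<close> would invert x while
      being the square of another element, so that u^2 = -1 modulo 2^s, where s >= 2.\<close>
    have sq_in_A: "g \<otimes> g \<in> ?A" if g: "g \<in> carrier G" "g \<notin> ?A" for g
    proof -
      obtain t where t: "g [^] (2 ^ t :: nat) \<notin> ?A" "g [^] (2 ^ Suc t :: nat) \<in> ?A" using squares_in_A[OF g] by blast
      show ?thesis
      proof (cases t)
        case 0 then show ?thesis using t(2) g by (simp add: numeral_2_eq_2)
      next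
        case (Suc t')
        let ?k = "g [^] (2 ^ t' :: nat)"
        have k: "?k \<in> carrier G" using g by simp
        obtain u :: nat where u: "conj_by ?k x = x [^] u"
          using normal_conj_by_closed[OF An k xA] A_iff by blast
        have "conj_by (?k \<otimes> ?k) x = x [^] (u * u)"
          using u k by (simp add: conj_by_conj_by[symmetric] conj_by_pow nat_pow_pow)
        moreover have "conj_by (?k \<otimes> ?k) x = inv x"
          using inverts[of "g [^] (2 ^ t :: nat)"] t two_Suc[OF g(1), of t] two_Suc[OF g(1), of t'] Suc g(1)
          by (metis nat_pow_closed)
        ultimately have "x \<otimes> x [^] (u * u) = \<one>" by (metis r_inv x)
        then have "x [^] (1 + u * u) = \<one>" using nat_pow_Suc2[OF x, of "u * u"] by simp
        then have "2 ^ s dvd 1 + u * u" using pow_eq_id[OF x] s by metis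
        moreover have "(2::nat) ^ 2 dvd 2 ^ s" by (rule le_imp_power_dvd[OF s2])
        ultimately have "4 dvd 1 + u * u" by (metis dvd_trans power2_eq_square mult_2 numeral_Bit0)
        then show ?thesis using four_not_dvd_Suc_square by blast
      qed
    qed
    obtain y where y: "y \<in> carrier G" "y \<notin> ?A" using False A.subset by blast
    have yx: "conj_by y x = inv x" "y \<otimes> y = z" using inverts sq_z sq_in_A y by auto
    \<comment> \<open>Two elements that invert x differ by one that centralizes x, and the
      centralizer of x is inside \<open>?A\<close>. So there is just one further coset.\<close>
    have cover: "g \<in> (\<lambda>g. g \<otimes> y) ` ?A" if g: "g \<in> carrier G" "g \<notin> ?A" for g
    proof -
      have "conj_by (inv y) (inv x) = x" using yx y conj_by_inv_left[of y x] by simp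
      then have "conj_by (inv y) x = inv x" using y conj_by_inv[of "inv y" "inv x"] by simp
      then have "conj_by (g \<otimes> inv y) x = x"
        using g y inverts[OF g sq_in_A[OF g]] by (simp add: conj_by_conj_by[symmetric] conj_by_inv)
      then have "g \<otimes> inv y \<in> ?A" using CA C_iff g y by auto
      then show ?thesis using g y by (intro image_eqI[of _ _ "g \<otimes> inv y"]) (auto simp: word_simps)
    qed
    have carrier: "carrier G = ?A \<union> (\<lambda>g. g \<otimes> y) ` ?A"
      using cover A.subset y by auto
    have disj: "?A \<inter> (\<lambda>g. g \<otimes> y) ` ?A = {}"
    proof -
      have False if "g \<in> ?A" "g \<otimes> y \<in> ?A" for g
      proof -
        have "inv g \<otimes> (g \<otimes> y) \<in> ?A" using that by blast
        then show False using that y by (simp add: inv_mult_cancel)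
      qed
      then show ?thesis by auto
    qed
    have "inj_on (\<lambda>g. g \<otimes> y) ?A" using inj_on_multc[OF y(1)] A.subset inj_on_subset by blast
    then have "card ((\<lambda>g. g \<otimes> y) ` ?A) = card ?A" by (rule card_image)
    moreover have "order G = card ?A + card ((\<lambda>g. g \<otimes> y) ` ?A)"
    proof -
      have "finite ?A" by (rule finite_subset[OF A.subset fin])
      then have "card (?A \<union> (\<lambda>g. g \<otimes> y) ` ?A) = card ?A + card ((\<lambda>g. g \<otimes> y) ` ?A)"
        using disj by (intro card_Un_disjoint) auto
      then show ?thesis unfolding order_def using arg_cong[OF carrier, of card] by (rule trans[rotated])
    qed
    ultimately have "(2::nat) ^ a = 2 ^ Suc s" using order cardA s by simp
    then have "a = Suc s" by (meson power_inject_exp one_less_numeral_iff semiring_norm(76))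
    then show ?thesis using s s2 y yx carrier x by (intro disjI2 bexI[of _ x] bexI[of _ y]) auto
  qed
qed

end

section \<open>Counting square roots of the involution, and transfer for a cyclic Sylow
  2-subgroup\<close>

context unique_involution
begin

text \<open>Elements whose square is neither 1 nor z fall into blocks consisting of g, gz and their
  inverses. Exactly then the four are distinct, so modulo 4 the order of the group counts only the
  roots of z together with 1 and z.\<close>

lemma card_roots_of_involution:
  assumes "4 dvd order G"
  shows "4 dvd card {g \<in> carrier G. g \<otimes> g = z} + 2"
proof -
  define U where "U = {g \<in> carrier G. g \<otimes> g \<noteq> \<one> \<and> g \<otimes> g \<noteq> z}"
  define cl where "cl g = {g, g \<otimes> z, inv g, inv g \<otimes> z}" for g
  let ?r = "{(g, h). g \<in> U \<and> h \<in> cl g}"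
  have zc: "z \<otimes> g = g \<otimes> z" if "g \<in> carrier G" for g using z_central that by simp
  have zcl: "z \<otimes> (g \<otimes> h) = g \<otimes> (z \<otimes> h)" if "g \<in> carrier G" "h \<in> carrier G" for g h
    using zc[of g] that by (metis m_assoc z_closed)
  have zz: "z \<otimes> (z \<otimes> g) = g" if "g \<in> carrier G" for g using that by (simp flip: m_assoc)
  have inv_z: "inv z = z" using z_sq by (rule inv_equality) auto
  have sqz: "(g \<otimes> z) \<otimes> (g \<otimes> z) = g \<otimes> g" if "g \<in> carrier G" for g
    using that by (simp add: m_assoc zcl zz zc)
  have sqi: "inv g \<otimes> inv g = inv (g \<otimes> g)" if "g \<in> carrier G" for g
    using that by (simp add: inv_mult_group)
  have Ui: "inv g \<in> U" if "g \<in> U" for g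
    using that sqi[of g] inv_inv[of "g \<otimes> g"] inv_z by (auto simp: U_def)
  have Uz: "g \<otimes> z \<in> U" if "g \<in> U" for g using that by (auto simp: U_def sqz)
  have UG: "g \<in> carrier G" if "g \<in> U" for g using that by (simp add: U_def)
  have closed: "h \<in> U" if "g \<in> U" "h \<in> cl g" for g h
    using that Ui Uz unfolding cl_def by auto
  have cc: "cl (g \<otimes> z) = cl g" "cl (inv g) = cl g" if "g \<in> carrier G" for g
    using that by (auto simp: cl_def inv_mult_group inv_z zc m_assoc)
  have ceq: "cl h = cl g" if g: "g \<in> U" "h \<in> cl g" for g h
  proof -
    have gc: "g \<in> carrier G" using UG g by blast
    consider "h = g" | "h = g \<otimes> z" | "h = inv g" | "h = inv g \<otimes> z" using g(2) by (auto simp: cl_def)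
    then show ?thesis
    proof cases
      case 4
      then show ?thesis using cc(1)[OF inv_closed[OF gc]] cc(2)[OF gc] by simp
    qed (use cc gc in simp_all)
  qed
  have self: "g \<in> cl g" for g by (simp add: cl_def)
  have "4 dvd card U"
  proof (rule equiv_imp_dvd_card[of U ?r])
    show "finite U" using fin by (auto simp: U_def)
    show "equiv U ?r"
    proof (rule equivI)
      show "?r \<subseteq> U \<times> U" using closed by blast
      show "refl_on U ?r" using self by (auto simp: refl_on_def)
      show "sym ?r"
      proof (rule symI)
        fix g h assume "(g, h) \<in> ?r"
        then show "(h, g) \<in> ?r" using closed[of g h] ceq[of g h] self[of g] by auto
      qed
      show "trans ?r"
      proof (rule transI)
        fix g h k assume "(g, h) \<in> ?r" "(h, k) \<in> ?r"
        then show "(g, k) \<in> ?r" using ceq[of g h] by auto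
      qed
    qed
    fix E assume "E \<in> U // ?r"
    then obtain g where g: "g \<in> U" "E = ?r `` {g}" by (auto elim: quotientE)
    then have E: "E = cl g" by blast
    have gc: "g \<in> carrier G" "g \<otimes> g \<noteq> \<one>" "g \<otimes> g \<noteq> z" using g(1) by (auto simp: U_def)
    have *: "g \<otimes> z \<noteq> g" "inv g \<otimes> z \<noteq> inv g" using gc(1) z_neq_one by auto
    have 1: "g \<noteq> inv g" using gc by (metis r_inv)
    have 2: "g \<noteq> inv g \<otimes> z"
    proof
      assume "g = inv g \<otimes> z"
      then have "g \<otimes> g = g \<otimes> (inv g \<otimes> z)" by simp
      then show False using gc by (simp add: mult_inv_cancel)
    qed
    have 3: "g \<otimes> z \<noteq> inv g"
    proof
      assume "g \<otimes> z = inv g"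
      then have "g \<otimes> (g \<otimes> z) = \<one>" using gc by simp
      then have "g \<otimes> g \<otimes> z = z \<otimes> z" using gc by (simp add: m_assoc)
      then have "g \<otimes> g = z" using gc by (metis m_closed right_cancel z_closed)
      then show False using gc by simp
    qed
    have 4: "g \<otimes> z \<noteq> inv g \<otimes> z" using 1 gc by (simp add: right_cancel[of z])
    have "card E = 4" unfolding E cl_def using * 1 2 3 4 by (auto simp: card_insert_if)
    then show "4 dvd card E" by simp
  qed
  moreover have "order G = card U + (card {g \<in> carrier G. g \<otimes> g = z} + 2)"
  proof -
    have "{g \<in> carrier G. g \<otimes> g = \<one>} = {\<one>, z}" using sq_eq_one by auto
    then have c2: "card {g \<in> carrier G. g \<otimes> g = \<one>} = 2" using z_neq_one by (simp add: card_insert_if)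
    have "carrier G = U \<union> ({g \<in> carrier G. g \<otimes> g = z} \<union> {g \<in> carrier G. g \<otimes> g = \<one>})"
      by (auto simp: U_def)
    then have "order G = card (U \<union> ({g \<in> carrier G. g \<otimes> g = z} \<union> {g \<in> carrier G. g \<otimes> g = \<one>}))"
      by (simp add: order_def)
    also have "\<dots> = card U + card ({g \<in> carrier G. g \<otimes> g = z} \<union> {g \<in> carrier G. g \<otimes> g = \<one>})"
      using fin by (intro card_Un_disjoint) (auto simp: U_def)
    also have "card ({g \<in> carrier G. g \<otimes> g = z} \<union> {g \<in> carrier G. g \<otimes> g = \<one>}) = card {g \<in> carrier G. g \<otimes> g = z} + 2"
      unfolding c2[symmetric] using fin z_neq_one by (intro card_Un_disjoint) auto
    finally show ?thesis .
  qed
  ultimately show ?thesis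
    using assms dvd_add_right_iff[of 4 "card U" "card {g \<in> carrier G. g \<otimes> g = z} + 2"] by metis
qed

text \<open>Transfer into the central subgroup \<open>{\<one>, z}\<close>, computed with respect to the transversal \<open>T\<close>
  of those elements whose \<open>c\<close>-exponent relative to a coset representative is small.\<close>

lemma sign_of_cyclic_sylow:
  assumes c: "c \<in> carrier G" "ord c = 2 ^ Suc a" and order: "order G = 2 ^ Suc a * m" and m: "odd m"
  shows "\<exists>\<epsilon> :: 'a \<Rightarrow> int. (\<forall>g\<in>carrier G. \<forall>h\<in>carrier G. \<epsilon> (g \<otimes> h) = \<epsilon> g * \<epsilon> h) \<and>
    (\<forall>g. \<epsilon> g = 1 \<or> \<epsilon> g = - 1) \<and> \<epsilon> c = - 1"
proof -
  let ?n = "2 ^ Suc a :: nat"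
  let ?C = "generate G {c}"
  interpret C: subgroup ?C G using c by (intro generate_is_subgroup) auto
  have C_iff: "g \<in> ?C \<longleftrightarrow> (\<exists>i::nat. g = c [^] i)" for g by (rule generate_singleton_iff[OF fin c(1)])
  have cC: "c [^] (i::nat) \<in> ?C" for i using C_iff by blast
  \<comment> \<open>The choice depends only on the coset of x, so it gives one representative for
    each right coset of the cyclic Sylow subgroup.\<close>
  define rep where "rep x = (SOME r. r \<in> ?C #> x)" for x
  have rep_mem: "rep x \<in> ?C #> x" if "x \<in> carrier G" for x
    unfolding rep_def by (rule someI[of _ x]) (rule rcos_self[OF that C.subgroup_axioms])
  have rep_closed: "rep x \<in> carrier G" if "x \<in> carrier G" for x
    using rep_mem[OF that] r_coset_subset_G[OF C.subset that] by auto
  have ex_j: "\<exists>j<?n. x = c [^] j \<otimes> rep x" if x: "x \<in> carrier G" for x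
  proof -
    obtain h where h: "h \<in> ?C" "rep x = h \<otimes> x" using rep_mem[OF x] by (auto simp: r_coset_def)
    then have "x = inv h \<otimes> rep x" using x C.subset by (simp add: inv_mult_cancel subset_iff)
    moreover obtain j :: nat where "inv h = c [^] j" using h C_iff by blast
    ultimately have "x = c [^] (j mod ?n) \<otimes> rep x" using pow_mod_ord[OF c(1), of j] c(2) by simp
    then show ?thesis by (intro exI[of _ "j mod ?n"]) auto
  qed
  define j where "j x = (SOME j. j < ?n \<and> x = c [^] j \<otimes> rep x)" for x
  have j: "j x < ?n" "x = c [^] j x \<otimes> rep x" if "x \<in> carrier G" for x
    using someI_ex[OF ex_j[OF that, unfolded]] unfolding j_def by (auto intro: someI2_ex[OF ex_j[OF that]])
  have rep_shift: "rep (c [^] (k::nat) \<otimes> x) = rep x" if x: "x \<in> carrier G" for k x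
  proof -
    have "?C #> (c [^] k \<otimes> x) = ?C #> x"
      using coset_mult_assoc[OF C.subset _ x, of "c [^] k"] C.rcos_const[OF is_group cC[of k]] c(1) by simp
    then show ?thesis by (simp add: rep_def)
  qed
  have j_shift: "j (c [^] (k::nat) \<otimes> x) = (j x + k) mod ?n" if x: "x \<in> carrier G" for k x
  proof -
    let ?y = "c [^] k \<otimes> x"
    have y: "?y \<in> carrier G" using x c by simp
    have "c [^] j ?y \<otimes> rep x = ?y" using j(2)[OF y] rep_shift[OF x] by simp
    also have "\<dots> = c [^] k \<otimes> (c [^] j x \<otimes> rep x)" using j(2)[OF x] by simp
    also have "\<dots> = c [^] (j x + k) \<otimes> rep x"
      using c(1) rep_closed[OF x] by (simp add: nat_pow_mult add.commute flip: m_assoc)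
    finally have "c [^] j ?y = c [^] (j x + k)" using c(1) rep_closed[OF x] by simp
    then have "[j ?y = j x + k] (mod ?n)" using pow_eq_pow_iff[OF c(1)] c(2) by simp
    then show ?thesis using j(1)[OF y] by (simp add: cong_def)
  qed
  have z: "z = c [^] (2 ^ a :: nat)" using half_power_eq_z[OF c(1,2)] by simp
  \<comment> \<open>Multiplication by z shifts the exponent \<open>j\<close> by half a period, so it
    reverses this sign; the elements of sign 1 therefore form a transversal of the subgroup
    generated by z.\<close>
  define chi :: "'a \<Rightarrow> int" where "chi x = (if j x < 2 ^ a then 1 else - 1)" for x
  have chi_sq: "chi x * chi x = 1" for x by (simp add: chi_def)
  have chi_z: "chi (z \<otimes> x) = - chi x" if x: "x \<in> carrier G" for x
  proof -
    have "j (z \<otimes> x) = (j x + 2 ^ a) mod ?n" using j_shift[OF x] z by simp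
    then show ?thesis using j(1)[OF x] by (auto simp: chi_def mod_if)
  qed
  define T where "T = {x \<in> carrier G. j x < 2 ^ a}"
  have T: "T \<subseteq> carrier G" "finite T" using fin by (auto simp: T_def)
  have chiT: "chi t = 1" if "t \<in> T" for t using that by (simp add: T_def chi_def)
  \<comment> \<open>The transfer of g: the product of the signs that bring the translates g t back
    into the transversal.\<close>
  define eps where "eps g = (\<Prod>t\<in>T. chi (g \<otimes> t))" for g
  \<comment> \<open>Independence of the transversal. The permutation \<open>p\<close> corrects each
    h t by 1 or z so that it returns to \<open>T\<close>, and \<open>f\<close> does not notice the
    correction.\<close>
  have reindex: "(\<Prod>t\<in>T. f (h \<otimes> t)) = (\<Prod>t\<in>T. f t)"
    if h: "h \<in> carrier G" and f: "\<And>x. x \<in> carrier G \<Longrightarrow> f (z \<otimes> x) = f x" for h and f :: "'a \<Rightarrow> int"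
  proof -
    define p where "p t = (if chi (h \<otimes> t) = 1 then h \<otimes> t else z \<otimes> (h \<otimes> t))" for t
    have pT: "p t \<in> T" if "t \<in> T" for t
    proof -
      have ht: "h \<otimes> t \<in> carrier G" using h that T by auto
      have "chi (p t) = 1" using chi_z[OF ht] by (auto simp: p_def) (auto simp: chi_def split: if_splits)
      moreover have "p t \<in> carrier G" using ht by (simp add: p_def)
      ultimately show ?thesis by (auto simp: T_def chi_def split: if_splits)
    qed
    have "inj_on p T"
    proof (rule inj_onI)
      fix t t' assume t: "t \<in> T" "t' \<in> T" "p t = p t'"
      then have tc: "t \<in> carrier G" "t' \<in> carrier G" using T by auto
      have zh: "z \<otimes> (h \<otimes> t) = h \<otimes> (z \<otimes> t)" if "t \<in> carrier G" for t
        using z_central[OF h] that h by (simp flip: m_assoc)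
      have zz: "z \<otimes> (z \<otimes> t) = t" if "t \<in> carrier G" for t using that by (simp flip: m_assoc)
      have "t = t' \<or> t = z \<otimes> t' \<or> z \<otimes> t = t'"
        using t(3) tc h zh unfolding p_def by (auto split: if_splits)
      moreover have "z \<otimes> t' \<notin> T" "z \<otimes> t \<notin> T" using chi_z tc chiT t by fastforce+
      ultimately show "t = t'" using t by auto
    qed
    then have "bij_betw p T T" using pT T(2) by (simp add: bij_betw_def endo_inj_surj image_subset_iff)
    then have "(\<Prod>t\<in>T. f t) = (\<Prod>t\<in>T. f (p t))" using prod.reindex_bij_betw[of p T T f] by simp
    also have "\<dots> = (\<Prod>t\<in>T. f (h \<otimes> t))"
      using h T f by (intro prod.cong) (auto simp: p_def)
    finally show ?thesis by simp
  qed
  have hom: "eps (g \<otimes> h) = eps g * eps h" if g: "g \<in> carrier G" and h: "h \<in> carrier G" for g h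
  proof -
    \<comment> \<open>The sign of h t is inserted twice. One copy makes the first factor invariant
      under z, so that it can be reindexed; the other yields the transfer of h.\<close>
    have "eps (g \<otimes> h) = (\<Prod>t\<in>T. (chi (g \<otimes> (h \<otimes> t)) * chi (h \<otimes> t)) * chi (h \<otimes> t))"
      unfolding eps_def by (rule prod.cong) (use g h T chi_sq in \<open>auto simp: m_assoc mult.assoc subset_iff\<close>)
    also have "\<dots> = (\<Prod>t\<in>T. chi (g \<otimes> (h \<otimes> t)) * chi (h \<otimes> t)) * eps h"
      by (simp add: prod.distrib eps_def)
    also have "(\<Prod>t\<in>T. chi (g \<otimes> (h \<otimes> t)) * chi (h \<otimes> t)) = (\<Prod>t\<in>T. chi (g \<otimes> t) * chi t)"
    proof (rule reindex[OF h])
      fix x assume x: "x \<in> carrier G"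
      have "g \<otimes> (z \<otimes> x) = z \<otimes> (g \<otimes> x)" using z_central[OF g] g x by (simp flip: m_assoc)
      then show "chi (g \<otimes> (z \<otimes> x)) * chi (z \<otimes> x) = chi (g \<otimes> x) * chi x" using chi_z g x by simp
    qed
    also have "\<dots> = eps g" unfolding eps_def by (rule prod.cong) (auto simp: chiT)
    finally show ?thesis .
  qed
  \<comment> \<open>Each level has as many elements as there are cosets, namely m. Left
    multiplication by c raises the exponent by one, so of the levels in \<open>T\<close> only the
    top one changes sign, which gives (-1)^m = -1.\<close>
  define L where "L k = {x \<in> carrier G. j x = k}" for k
  have cardL: "card (L k) = card (L 0)" if k: "k < ?n" for k
  proof -
    have "bij_betw (\<lambda>x. c [^] k \<otimes> x) (L 0) (L k)"
    proof (rule bij_betw_byWitness[where f' = "\<lambda>x. c [^] (?n - k) \<otimes> x"])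
      have id: "c [^] (?n - k) \<otimes> (c [^] k \<otimes> x) = x" "c [^] k \<otimes> (c [^] (?n - k) \<otimes> x) = x" if "x \<in> carrier G" for x
      proof -
        have "c [^] (?n - k) \<otimes> c [^] k = \<one>" "c [^] k \<otimes> c [^] (?n - k) = \<one>"
          using k c pow_ord_eq_1[OF c(1)] by (simp_all add: nat_pow_mult del: power_Suc pow_ord_eq_1)
        then show "c [^] (?n - k) \<otimes> (c [^] k \<otimes> x) = x" "c [^] k \<otimes> (c [^] (?n - k) \<otimes> x) = x"
          using that c by (simp_all flip: m_assoc)
      qed
      show "\<forall>x\<in>L 0. c [^] (?n - k) \<otimes> (c [^] k \<otimes> x) = x" "\<forall>x\<in>L k. c [^] k \<otimes> (c [^] (?n - k) \<otimes> x) = x"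
        using id by (auto simp: L_def)
      show "(\<lambda>x. c [^] k \<otimes> x) ` L 0 \<subseteq> L k"
        using c k j_shift by (auto simp: L_def simp del: power_Suc)
      show "(\<lambda>x. c [^] (?n - k) \<otimes> x) ` L k \<subseteq> L 0"
        using c k j_shift by (auto simp: L_def simp del: power_Suc)
    qed
    then show ?thesis by (simp add: bij_betw_same_card)
  qed
  have "order G = card (\<Union>k<?n. L k)"
    unfolding order_def by (rule arg_cong[where f = card]) (use j(1) in \<open>auto simp: L_def simp del: power_Suc\<close>)
  also have "\<dots> = (\<Sum>k<?n. card (L k))"
    by (rule card_UN_disjoint) (use fin in \<open>auto simp: L_def\<close>)
  also have "\<dots> = (\<Sum>k<?n. card (L 0))" by (rule sum.cong[OF refl], rule cardL) (simp del: power_Suc)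
  also have "\<dots> = ?n * card (L 0)" by (simp only: sum_constant card_lessThan of_nat_id)
  finally have "?n * m = ?n * card (L 0)" using order by (simp only:)
  then have mL: "card (L 0) = m" by simp
  have "eps c = (\<Prod>t\<in>T. if j t = 2 ^ a - 1 then - 1 else 1)"
    unfolding eps_def
  proof (rule prod.cong)
    fix t assume t: "t \<in> T"
    then have tc: "t \<in> carrier G" "j t < 2 ^ a" by (auto simp: T_def)
    have "j (c \<otimes> t) = j t + 1" using j_shift[OF tc(1), of 1] tc(2) c(1) by simp
    then show "chi (c \<otimes> t) = (if j t = 2 ^ a - 1 then - 1 else 1)" using tc(2) by (auto simp: chi_def)
  qed simp
  also have "\<dots> = (\<Prod>t\<in>T \<inter> {t. j t = 2 ^ a - 1}. - 1)"
    using T(2) by (subst prod.inter_restrict) (auto intro!: prod.cong)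
  also have "T \<inter> {t. j t = 2 ^ a - 1} = L (2 ^ a - 1)"
    by (auto simp: T_def L_def)
  also have "(\<Prod>t\<in>L (2 ^ a - 1). - 1 :: int) = - 1"
  proof -
    have "card (L (2 ^ a - 1)) = m" using cardL[of "2 ^ a - 1"] mL by (simp add: less_imp_diff_less)
    then show ?thesis using m by simp
  qed
  finally have "eps c = - 1" .
  moreover have "eps g = 1 \<or> eps g = - 1" for g
    unfolding eps_def using T(2) by (induction T rule: finite_induct) (auto simp: chi_def)
  ultimately show ?thesis using hom by blast
qed

text \<open>The subgroup is the kernel of the sign homomorphism: a square has sign 1, and so does
  every solution of x^m = 1 because m is odd.\<close>

lemma cyclic_sylow_index_two:
  assumes c: "c \<in> carrier G" "ord c = 2 ^ Suc a" and order: "order G = 2 ^ Suc a * m" and m: "odd m"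
  shows "\<exists>N. subgroup N G \<and> card N = 2 ^ a * m \<and> c \<otimes> c \<in> N \<and> (\<forall>x\<in>carrier G. x [^] m = \<one> \<longrightarrow> x \<in> N)"
proof -
  obtain \<epsilon> :: "_ \<Rightarrow> int" where hom: "\<And>g h. g \<in> carrier G \<Longrightarrow> h \<in> carrier G \<Longrightarrow> \<epsilon> (g \<otimes> h) = \<epsilon> g * \<epsilon> h"
    and pm: "\<And>g. \<epsilon> g = 1 \<or> \<epsilon> g = - 1" and \<epsilon>c: "\<epsilon> c = - 1"
    using sign_of_cyclic_sylow[OF c order m] by blast
  have \<epsilon>1: "\<epsilon> \<one> = 1" using hom[of \<one> \<one>] pm[of \<one>] by auto
  have pow: "\<epsilon> (g [^] n) = \<epsilon> g ^ n" if "g \<in> carrier G" for g and n :: nat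
    using that by (induction n) (auto simp: \<epsilon>1 hom)
  let ?N = "{g \<in> carrier G. \<epsilon> g = 1}"
  have N: "subgroup ?N G"
  proof (rule subgroupI)
    fix g assume g: "g \<in> ?N"
    have "\<epsilon> (inv g) * \<epsilon> g = 1" using hom[of "inv g" g] g \<epsilon>1 by auto
    then show "inv g \<in> ?N" using g by auto
    fix h assume "h \<in> ?N"
    then show "g \<otimes> h \<in> ?N" using g hom[of g h] by simp
  next
    show "?N \<noteq> {}" using \<epsilon>1 one_closed by blast
  qed blast
  have "bij_betw (\<lambda>g. c \<otimes> g) ?N (carrier G - ?N)"
  proof (rule bij_betw_byWitness[where f' = "\<lambda>g. inv c \<otimes> g"])
    have "\<epsilon> (inv c) * \<epsilon> c = 1" using hom[OF inv_closed[OF c(1)] c(1)] \<epsilon>1 l_inv[OF c(1)] by simp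
    then have ic: "\<epsilon> (inv c) = - 1" using \<epsilon>c by simp
    show "(\<lambda>g. inv c \<otimes> g) ` (carrier G - ?N) \<subseteq> ?N"
    proof
      fix k assume "k \<in> (\<lambda>g. inv c \<otimes> g) ` (carrier G - ?N)"
      then obtain g where g: "g \<in> carrier G" "\<epsilon> g \<noteq> 1" "k = inv c \<otimes> g" by auto
      then show "k \<in> ?N" using hom[OF inv_closed[OF c(1)] g(1)] ic pm[of g] c(1) by auto
    qed
    show "(\<lambda>g. c \<otimes> g) ` ?N \<subseteq> carrier G - ?N"
    proof
      fix k assume "k \<in> (\<lambda>g. c \<otimes> g) ` ?N"
      then obtain g where g: "g \<in> carrier G" "\<epsilon> g = 1" "k = c \<otimes> g" by auto
      then show "k \<in> carrier G - ?N" using hom[OF c(1) g(1)] \<epsilon>c c(1) by auto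
    qed
  qed (simp_all add: c(1) inv_mult_cancel mult_inv_cancel)
  then have "card (carrier G - ?N) = card ?N" by (simp add: bij_betw_same_card)
  moreover have "order G = card ?N + card (carrier G - ?N)"
  proof -
    have "card (carrier G - ?N) = card (carrier G) - card ?N" using fin by (intro card_Diff_subset) auto
    moreover have "card ?N \<le> card (carrier G)" using fin by (intro card_mono) auto
    ultimately show ?thesis by (simp add: order_def)
  qed
  ultimately have cardN: "card ?N = 2 ^ a * m" using order by simp
  have "\<epsilon> x = 1" if "x \<in> carrier G" "x [^] m = \<one>" for x
  proof (rule ccontr)
    assume "\<epsilon> x \<noteq> 1"
    then have "\<epsilon> x ^ m = - 1" using pm[of x] m by auto
    then show False using pow[OF that(1), of m] that(2) \<epsilon>1 by simp
  qed
  moreover have "c \<otimes> c \<in> ?N" using hom[OF c(1) c(1)] \<epsilon>c c(1) by simp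
  ultimately show ?thesis using N cardN by (intro exI[of _ ?N]) auto
qed

end

text \<open>Each passage to the index-two subgroup replaces c by its square, halving the cyclic
  Sylow subgroup while keeping all solutions of x^m = 1. The condition on involutions says at most
  one, so it passes to subgroups even when the induction ends at odd order.\<close>

lemma cyclic_sylow_two_complement:
  assumes "group G" "finite (carrier G)"
    and "\<And>x y. x \<in> carrier G \<Longrightarrow> y \<in> carrier G \<Longrightarrow> group.ord G x = 2 \<Longrightarrow> group.ord G y = 2 \<Longrightarrow> x = y"
    and "c \<in> carrier G" "group.ord G c = 2 ^ a" "order G = 2 ^ a * m" "odd m"
  shows "subgroup {x \<in> carrier G. x [^]\<^bsub>G\<^esub> m = \<one>\<^bsub>G\<^esub>} G \<and> card {x \<in> carrier G. x [^]\<^bsub>G\<^esub> m = \<one>\<^bsub>G\<^esub>} = m"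
  using assms
proof (induction a arbitrary: G c)
  case 0
  interpret group G by fact
  have "{x \<in> carrier G. x [^]\<^bsub>G\<^esub> m = \<one>\<^bsub>G\<^esub>} = carrier G" using pow_order_eq_1 0 by auto
  then show ?case using subgroup_self 0 by (simp add: order_def)
next
  case (Suc a)
  interpret group G by fact
  note fin = \<open>finite (carrier G)\<close>
  have c: "c \<in> carrier G" "ord c = 2 ^ Suc a" by fact+
  define z where "z = c [^]\<^bsub>G\<^esub> (2 ^ a :: nat)"
  have z: "z \<in> carrier G" "ord z = 2" using c by (auto simp: z_def ord_pow)
  interpret unique_involution G z
    by unfold_locales (use z fin Suc.prems(3) in auto)
  obtain N where N: "subgroup N G" and cardN: "card N = 2 ^ a * m" and ccN: "c \<otimes>\<^bsub>G\<^esub> c \<in> N"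
    and odd_part: "\<And>x. x \<in> carrier G \<Longrightarrow> x [^]\<^bsub>G\<^esub> m = \<one>\<^bsub>G\<^esub> \<Longrightarrow> x \<in> N"
    using cyclic_sylow_index_two[OF c Suc.prems(6,7)] by blast
  interpret N: subgroup N G by fact
  let ?G = "G\<lparr>carrier := N\<rparr>"
  have NG: "group ?G" by (rule N.subgroup_is_group) (rule is_group)
  have "subgroup {x \<in> carrier ?G. x [^]\<^bsub>?G\<^esub> m = \<one>\<^bsub>?G\<^esub>} ?G \<and> card {x \<in> carrier ?G. x [^]\<^bsub>?G\<^esub> m = \<one>\<^bsub>?G\<^esub>} = m"
  proof (rule Suc.IH[OF NG, of "c \<otimes>\<^bsub>G\<^esub> c"])
    show "c \<otimes>\<^bsub>G\<^esub> c \<in> carrier ?G" using ccN by simp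
    have "ord (c [^]\<^bsub>G\<^esub> (2::nat)) = 2 ^ a" using c by (subst ord_pow) auto
    then have "ord (c \<otimes>\<^bsub>G\<^esub> c) = 2 ^ a" using c by (simp add: numeral_2_eq_2)
    then show "group.ord ?G (c \<otimes>\<^bsub>G\<^esub> c) = 2 ^ a" by (simp add: ord_subgroup[OF N])
    show "order ?G = 2 ^ a * m" using cardN by (simp add: order_def)
    show "x = y" if "x \<in> carrier ?G" "y \<in> carrier ?G" "group.ord ?G x = 2" "group.ord ?G y = 2" for x y
      using that Suc.prems(3)[of x y] N.subset by (auto simp: ord_subgroup[OF N])
    show "finite (carrier ?G)" using finite_subset[OF N.subset fin] by simp
  qed (rule Suc.prems(7))
  then have S: "subgroup {x \<in> N. x [^]\<^bsub>G\<^esub> m = \<one>\<^bsub>G\<^esub>} ?G" "card {x \<in> N. x [^]\<^bsub>G\<^esub> m = \<one>\<^bsub>G\<^esub>} = m"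
    by (auto simp: nat_pow_consistent[symmetric])
  have "{x \<in> carrier G. x [^]\<^bsub>G\<^esub> m = \<one>\<^bsub>G\<^esub>} = {x \<in> N. x [^]\<^bsub>G\<^esub> m = \<one>\<^bsub>G\<^esub>}"
    using odd_part N.subset by auto
  then show ?case using S incl_subgroup[OF N] by simp
qed

lemma (in group) generate_restrict:
  assumes "subgroup P G" "x \<in> P"
  shows "generate (G\<lparr>carrier := P\<rparr>) {x} = generate G {x}"
  using generate_consistent[of "{x}" P] assms by simp

section \<open>Generalized quaternion Sylow 2-subgroups\<close>

context unique_involution
begin

lemma inv_z: "inv z = z" using z_sq by (rule inv_equality) auto

lemma unique_involution_subgroup:
  assumes P: "subgroup P G" and ev: "even (card P)"
  shows "unique_involution (G\<lparr>carrier := P\<rparr>) z"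
proof -
  interpret P: subgroup P G by fact
  interpret PG: group "G\<lparr>carrier := P\<rparr>" by (rule P.subgroup_is_group) (rule is_group)
  have finP: "finite P" using finite_subset[OF P.subset fin] .
  obtain x where x: "x \<in> P" "ord x = 2"
    using PG.exists_elem_of_prime_order[of 2] finP ev ord_subgroup[OF P] by (auto simp: order_def)
  then have "z \<in> P" using involution_eq P.subset by blast
  then show ?thesis
    by unfold_locales (use finP ord_z involution_eq P.subset in \<open>auto simp: ord_subgroup[OF P]\<close>)
qed

lemma inverts_power:
  assumes x: "x \<in> carrier G" and y: "y \<in> carrier G" "conj_by y x = inv x" and g: "g \<in> generate G {x}"
  shows "conj_by y g = inv g"
proof -
  obtain i :: nat where "g = x [^] i" using g generate_singleton_iff[OF fin x] by blast
  then show ?thesis using x y by (simp add: conj_by_pow nat_pow_inv)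
qed

lemma twisted_square:
  assumes x: "x \<in> carrier G" and y: "y \<in> carrier G" "conj_by y x = inv x" and g: "g \<in> generate G {x}"
  shows "(g \<otimes> y) \<otimes> (g \<otimes> y) = y \<otimes> y"
proof -
  have "g \<in> carrier G" using g x generate_incl[of "{x}"] by auto
  then show ?thesis using y inverts_power[OF x y g] by (simp add: mult_twisted_square)
qed

text \<open>All elements in the non-cyclic coset of a Sylow subgroup \<open>P\<close> are square
  roots of z, and two more lie in its cyclic part, so there are at least 2^(a-1) + 2. The total is
  twice an odd divisor of m, hence at most 2m. The bound \<open>le\<close> makes both estimates
  sharp: every root lies in \<open>P\<close>, and \<open>P\<close> is generated by the roots, which
  conjugation permutes.\<close>

theorem quaternion_sylow_normal:
  assumes order: "order G = 2 ^ a * m" and m: "odd m" and a: "a \<ge> 2"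
    and not_cyclic: "\<And>c. c \<in> carrier G \<Longrightarrow> ord c \<noteq> 2 ^ a"
    and dvd: "card {g \<in> carrier G. g \<otimes> g = z} dvd order G"
    and le: "m \<le> 2 ^ (a - 2) + 1"
  shows "\<exists>x\<in>carrier G. \<exists>y\<in>carrier G. a \<ge> 3 \<and> m = 2 ^ (a - 2) + 1 \<and> ord x = 2 ^ (a - 1) \<and> y \<notin> generate G {x} \<and>
       y \<otimes> y = z \<and> conj_by y x = inv x \<and> (generate G {x} \<union> (\<lambda>g. g \<otimes> y) ` generate G {x}) \<lhd> G \<and>
       card (generate G {x} \<union> (\<lambda>g. g \<otimes> y) ` generate G {x}) = 2 ^ a"
proof -
  obtain P where P: "subgroup P G" and cardP: "card P = 2 ^ a"
    using sylow_thm[OF two_is_prime_nat is_group order fin] by blast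
  interpret P: subgroup P G by fact
  let ?PG = "G\<lparr>carrier := P\<rparr>"
  interpret PU: unique_involution ?PG z
    by (rule unique_involution_subgroup[OF P]) (use cardP a in simp)
  have "order ?PG = 2 ^ a" using cardP by (simp add: order_def)
  from PU.two_group_dichotomy[OF this] obtain x y where xP: "x \<in> P" and yP: "y \<in> P" and a3: "a \<ge> 3"
    and ox: "ord x = 2 ^ (a - 1)" and yx: "y \<notin> generate G {x}" and yy: "y \<otimes> y = z"
    and cyx: "conj_by y x = inv x" and Peq: "P = generate G {x} \<union> (\<lambda>g. g \<otimes> y) ` generate G {x}"
  proof -
    have no: "PU.ord c \<noteq> 2 ^ a" if "c \<in> P" for c
      using that not_cyclic P.subset by (auto simp: ord_subgroup[OF P])
    assume *: "\<And>x y. x \<in> P \<Longrightarrow> y \<in> P \<Longrightarrow> 3 \<le> a \<Longrightarrow> ord x = 2 ^ (a - 1) \<Longrightarrow> y \<notin> generate G {x} \<Longrightarrow>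
       y \<otimes> y = z \<Longrightarrow> conj_by y x = inv x \<Longrightarrow> P = generate G {x} \<union> (\<lambda>g. g \<otimes> y) ` generate G {x} \<Longrightarrow> thesis"
    from PU.two_group_dichotomy[OF \<open>order ?PG = 2 ^ a\<close>] no
    obtain x y where xy: "x \<in> P" "y \<in> P" "a \<ge> 3" "PU.ord x = 2 ^ (a - 1)" "y \<notin> generate ?PG {x}"
       "y \<otimes> y = z" "PU.conj_by y x = inv\<^bsub>?PG\<^esub> x"
       "P = generate ?PG {x} \<union> (\<lambda>g. g \<otimes> y) ` generate ?PG {x}" by auto
    show thesis
      by (rule *[of x y]) (use xy P in \<open>simp_all add: ord_subgroup[OF P] conj_by_subgroup[OF P] generate_restrict[OF P]\<close>)
  qed
  have x: "x \<in> carrier G" and y: "y \<in> carrier G" using xP yP P.subset by auto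
  let ?A = "generate G {x}"
  interpret A: subgroup ?A G using x by (intro generate_is_subgroup) auto
  let ?S = "{g \<in> carrier G. g \<otimes> g = z}"
  let ?B = "(\<lambda>g. g \<otimes> y) ` ?A"
  \<comment> \<open>The order of x is 2^(a-1), so e has square z; e and its inverse are the two
    roots in the cyclic part.\<close>
  define e where "e = x [^] (2 ^ (a - 3) :: nat)"
  have e: "e \<in> carrier G" "e \<in> ?A" using x generate_singleton_iff[OF fin x] by (auto simp: e_def)
  have "a - 1 = Suc (a - 2)" "a - 2 = Suc (a - 3)" using a3 by auto
  then have "x [^] (2 ^ Suc (a - 3) :: nat) = z" using half_power_eq_z[OF x, of "a - 2"] ox by simp
  then have ee: "e \<otimes> e = z" using x by (simp add: e_def nat_pow_mult mult_2)
  have BS: "?B \<subseteq> ?S" using twisted_square[OF x y cyx] yy A.subset y by auto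
  have eS: "{e, inv e} \<subseteq> ?S"
  proof -
    have "inv e \<otimes> inv e = inv (e \<otimes> e)" using e by (simp add: inv_mult_group)
    then show ?thesis using e ee inv_z by simp
  qed
  have e2: "card {e, inv e} = 2"
  proof -
    have "e \<noteq> inv e" using ee e z_neq_one by (metis r_inv)
    then show ?thesis by simp
  qed
  have disjAB: "?A \<inter> ?B = {}"
  proof -
    have False if "g \<in> ?A" "g \<otimes> y \<in> ?A" for g
    proof -
      have "inv g \<otimes> (g \<otimes> y) \<in> ?A" using that by blast
      then show False using that y yx by (simp add: inv_mult_cancel)
    qed
    then show ?thesis by auto
  qed
  have "inv e \<in> ?A" by (rule A.m_inv_closed[OF e(2)])
  then have "{e, inv e} \<subseteq> ?A" using e by simp
  moreover have "\<And>U V W :: 'a set. W \<subseteq> U \<Longrightarrow> U \<inter> V = {} \<Longrightarrow> V \<inter> W = {}" by blast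
  ultimately have "?B \<inter> {e, inv e} = {}" using disjAB by metis
  moreover have finB: "finite ?B" using finite_subset[OF A.subset fin] by blast
  ultimately have cu: "card (?B \<union> {e, inv e}) = card ?B + 2" using e2 by (subst card_Un_disjoint) auto
  have "inj_on (\<lambda>g. g \<otimes> y) ?A" using inj_on_multc[OF y] A.subset inj_on_subset by blast
  then have cB: "card ?B = 2 ^ (a - 1)" using generate_pow_card[OF x] ox by (simp add: card_image)
  have finS: "finite ?S" using fin by auto
  have lower: "2 ^ (a - 1) + 2 \<le> card ?S"
    using card_mono[OF finS, of "?B \<union> {e, inv e}"] BS eS cu cB by simp
  have upper: "card ?S \<le> 2 * m"
  proof -
    have "(2::nat) ^ 2 dvd 2 ^ a" by (rule le_imp_power_dvd) fact
    then have "4 dvd order G" using order by simp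
    then have "4 dvd card ?S + 2" by (rule card_roots_of_involution)
    then obtain l where l: "card ?S + 2 = 4 * l" by blast
    then obtain l' where l': "l = Suc l'" by (cases l) auto
    then have k: "card ?S = 2 * (2 * l' + 1)" using l by simp
    then have "2 * l' + 1 dvd card ?S" by (metis dvd_triv_right)
    then have "2 * l' + 1 dvd 2 ^ a * m" using dvd order dvd_trans by metis
    moreover have "coprime (2 * l' + 1) (2 ^ a)" by simp
    ultimately have "2 * l' + 1 dvd m" by (simp only: coprime_dvd_mult_right_iff)
    moreover have "m > 0" using m by (rule odd_pos)
    ultimately have "2 * l' + 1 \<le> m" by (rule dvd_imp_le)
    then show ?thesis using k by simp
  qed
  have two: "(2::nat) ^ (a - 1) = 2 * 2 ^ (a - 2)" using \<open>a - 1 = Suc (a - 2)\<close> by simp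
  then have meq: "m = 2 ^ (a - 2) + 1" and cSe: "card (?B \<union> {e, inv e}) = card ?S"
    using lower upper le cu cB by linarith+
  have "?B \<union> {e, inv e} = ?S" by (rule card_subset_eq[OF finS Un_least[OF BS eS] cSe])
  moreover have "?B \<union> {e, inv e} \<subseteq> P" using Peq e \<open>inv e \<in> ?A\<close> by auto
  ultimately have SP: "?S \<subseteq> P" by metis
  have conjS: "conj_by h g \<in> P" if "h \<in> carrier G" "g \<in> ?S" for h g
  proof -
    have "conj_by h g \<otimes> conj_by h g = z" using that by (simp flip: conj_by_mult)
    then show ?thesis using SP that by auto
  qed
  have "P \<lhd> G" unfolding normal_iff_conj_by
  proof (intro conjI ballI P)
    fix h g assume h: "h \<in> carrier G" and g: "g \<in> P"
    show "conj_by h g \<in> P"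
    proof (cases "g \<in> ?B")
      case True
      then show ?thesis using conjS[OF h] BS by blast
    next
      case False
      \<comment> \<open>An element of the cyclic part is a product of two roots of z, namely g y and
        the inverse of y.\<close>
      then have gA: "g \<in> ?A" using g Peq by blast
      have gc: "g \<in> carrier G" using g P.subset by auto
      have "g \<otimes> y \<in> ?S" using gA BS by blast
      moreover have "inv y \<otimes> inv y = z" using y yy inv_z by (simp flip: inv_mult_group)
      ultimately have "conj_by h (g \<otimes> y) \<otimes> conj_by h (inv y) \<in> P"
        using conjS[OF h] y by auto
      moreover have "g = (g \<otimes> y) \<otimes> inv y" using gc y by (simp add: m_assoc)
      ultimately show ?thesis using conj_by_mult[of h "g \<otimes> y" "inv y"] h gc y by auto
    qed
  qed
  then show ?thesis using x y a3 meq ox yx yy cyx Peq cardP by (intro bexI[of _ x] bexI[of _ y]) auto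
qed

text \<open>On the cyclic part w acts as a unit modulo 2^s; the units have 2-power order and w has
  odd order, so the action is trivial. Then y goes to c y with c fixed by w, and iterating shows
  that the order of c divides both an odd number and a power of two.\<close>

lemma odd_order_centralizes_quaternion:
  assumes x: "x \<in> carrier G" and ox: "ord x = 2 ^ s" and y: "y \<in> carrier G" "y \<notin> generate G {x}"
    and P: "(generate G {x} \<union> (\<lambda>g. g \<otimes> y) ` generate G {x}) \<lhd> G"
    and w: "w \<in> carrier G" "odd (ord w)" and wx: "conj_by w x \<in> generate G {x}" and s: "s > 0"
  shows "conj_by w x = x" "conj_by w y = y"
proof -
  let ?A = "generate G {x}" and ?m = "ord w"
  interpret A: subgroup ?A G using x by (intro generate_is_subgroup) auto
  have A_iff: "g \<in> ?A \<longleftrightarrow> (\<exists>i::nat. g = x [^] i)" for g by (rule generate_singleton_iff[OF fin x])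
  obtain u :: nat where u: "conj_by w x = x [^] u" using wx A_iff by blast
  have "odd u" by (rule odd_exponent_of_conj[OF x ox s u w(1)])
  have it: "conj_by (w [^] k) x = x [^] (u ^ k)" for k :: nat
  proof (induction k)
    case (Suc k)
    have "conj_by (w [^] Suc k) x = conj_by (w [^] k) (conj_by w x)" using w x by (simp add: conj_by_conj_by)
    also have "\<dots> = x [^] (u ^ k * u)" using u w x Suc by (simp add: conj_by_pow nat_pow_pow)
    finally show ?case by (simp add: mult.commute)
  qed (use x in simp)
  have "x [^] (u ^ ?m) = x [^] (1::nat)" using it[of ?m] w x nat_pow_eone[OF x] by simp
  then have "[u ^ ?m = 1] (mod 2 ^ s)" using pow_eq_pow_iff[OF x, of "u ^ ?m" 1] ox by metis
  then have d1: "Pocklington.ord (2 ^ s) u dvd ?m" by (simp only: ord_divides)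
  have "coprime u (2 ^ s)" using \<open>odd u\<close> by simp
  then have "[u ^ totient (2 ^ s) = 1] (mod 2 ^ s)" by (rule euler_theorem)
  moreover have "totient (2 ^ s) = 2 ^ (s - 1)"
    using s by (simp add: totient_prime_power[OF two_is_prime_nat])
  ultimately have d2: "Pocklington.ord (2 ^ s) u dvd 2 ^ (s - 1)" by (simp only: ord_divides)
  have "coprime ?m (2 ^ (s - 1))" using w by simp
  then have "Pocklington.ord (2 ^ s) u = 1" using d1 d2 by (meson coprime_common_divisor_nat)
  then have "[u = 1] (mod 2 ^ s)" using ord_works[of u "2 ^ s"] by simp
  then have "x [^] u = x [^] (1::nat)" using pow_eq_pow_iff[OF x, of u 1] ox by metis
  then show cx: "conj_by w x = x" using u nat_pow_eone[OF x] by simp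
  have cA: "conj_by w g = g" if gA: "g \<in> ?A" for g
  proof -
    obtain i :: nat where "g = x [^] i" using gA A_iff by blast
    then show ?thesis using cx x w by (simp add: conj_by_pow)
  qed
  have "y \<in> ?A \<union> (\<lambda>g. g \<otimes> y) ` ?A"
    using y A.one_closed by (intro UnI2 image_eqI[of _ _ \<one>]) auto
  then have "conj_by w y \<in> ?A \<union> (\<lambda>g. g \<otimes> y) ` ?A" using normal_conj_by_closed[OF P w(1)] by blast
  moreover have "conj_by w y \<notin> ?A"
  proof
    assume "conj_by w y \<in> ?A"
    then have "conj_by w (conj_by w y) = conj_by w y" by (rule cA)
    then have "conj_by w y = y" using w y by simp
    then show False using \<open>conj_by w y \<in> ?A\<close> y by simp
  qed
  ultimately obtain c where c: "c \<in> ?A" "conj_by w y = c \<otimes> y" by blast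
  have cG: "c \<in> carrier G" using c A.subset by blast
  have it2: "conj_by (w [^] k) y = c [^] k \<otimes> y" for k :: nat
  proof (induction k)
    case (Suc k)
    have "conj_by (w [^] Suc k) y = conj_by w (conj_by (w [^] k) y)"
      using w y nat_pow_Suc2[OF w(1), of k] by (simp add: conj_by_conj_by)
    also have "\<dots> = conj_by w (c [^] k) \<otimes> (c \<otimes> y)" using Suc c w y cG by (simp add: conj_by_mult)
    also have "conj_by w (c [^] k) = c [^] k" using cA[OF c(1)] w cG by (simp add: conj_by_pow)
    finally show ?case using cG y by (simp add: m_assoc)
  qed (use y in simp)
  have "c [^] ?m = \<one>" using it2[of ?m] w y cG by (metis one_conj_by pow_ord_eq_1 l_cancel_one nat_pow_closed right_cancel l_one one_closed)
  then have "ord c dvd ?m" using pow_eq_id[OF cG] by simp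
  moreover have "ord c dvd 2 ^ s"
  proof -
    obtain i :: nat where i: "c = x [^] i" using c A_iff by blast
    have "c [^] (2 ^ s :: nat) = (x [^] ord x) [^] i"
      unfolding i ox using x by (simp add: nat_pow_pow mult.commute)
    then show ?thesis using x pow_eq_id[OF cG] by simp
  qed
  moreover have "coprime ?m (2 ^ s)" using w by simp
  ultimately have "ord c = 1" by (meson coprime_common_divisor_nat)
  then show "conj_by w y = y" using c cG y ord_eq_1 by simp
qed

text \<open>All elements of the non-cyclic coset have square z, but x does not once its order
  exceeds 4; the same then holds for its conjugates. In the quaternion group of order 8 this
  argument fails, which is what leaves room for SL(2,3).\<close>

lemma conj_mem_cyclic_of_large_order:
  assumes x: "x \<in> carrier G" and ox: "ord x = 2 ^ s" and s: "s \<ge> 3"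
    and y: "y \<in> carrier G" "y \<otimes> y = z" "conj_by y x = inv x"
    and P: "(generate G {x} \<union> (\<lambda>g. g \<otimes> y) ` generate G {x}) \<lhd> G" and w: "w \<in> carrier G"
  shows "conj_by w x \<in> generate G {x}"
proof (rule ccontr)
  assume n: "\<not> ?thesis"
  have "x \<in> generate G {x}" by (auto intro: generate.incl)
  then have "conj_by w x \<in> generate G {x} \<union> (\<lambda>g. g \<otimes> y) ` generate G {x}"
    using normal_conj_by_closed[OF P w] by blast
  then obtain g where "g \<in> generate G {x}" "conj_by w x = g \<otimes> y" using n by blast
  then have "conj_by w x \<otimes> conj_by w x = z" using twisted_square[OF x y(1,3)] y(2) by simp
  then have "conj_by w (x \<otimes> x) = conj_by w z" using w x by (simp add: conj_by_mult)
  then have "x \<otimes> x = z" using w x by (metis conj_by_cancel m_closed z_closed)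
  then have "x [^] (4::nat) = \<one>" using x by (simp add: numeral_eq_Suc m_assoc)
  then have "2 ^ s dvd (2::nat) ^ 2" using pow_eq_id[OF x] ox by simp
  then have "s \<le> 2" by (rule power_dvd_imp_le) simp
  then show False using s by simp
qed

text \<open>An element of order 3 that does not normalize one cyclic subgroup of order 4 permutes
  the three of them cyclically. Putting j for the conjugate of x makes one relation hold by
  definition; only the sign in the next conjugate, x j or its inverse counterpart, must be
  adjusted.\<close>

lemma binary_tetrahedral_relations:
  assumes x: "x \<in> carrier G" and ox: "ord x = 4"
    and y: "y \<in> carrier G" "y \<notin> generate G {x}" "y \<otimes> y = z" "conj_by y x = inv x"
    and P: "(generate G {x} \<union> (\<lambda>g. g \<otimes> y) ` generate G {x}) \<lhd> G" (is "?P \<lhd> G")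
    and w: "w \<in> carrier G" "ord w = 3" and wx: "conj_by w x \<notin> generate G {x}"
  shows "\<exists>j\<in>carrier G. \<exists>v\<in>carrier G. ord v = 3 \<and> j \<otimes> j = z \<and> conj_by j x = inv x \<and> conj_by v x = j \<and> conj_by v j = x \<otimes> j \<and>
     ?P = generate G {x} \<union> (\<lambda>g. g \<otimes> j) ` generate G {x} \<and> j \<notin> generate G {x}"
proof -
  let ?A = "generate G {x}"
  interpret A: subgroup ?A G using x by (intro generate_is_subgroup) auto
  have xA: "x \<in> ?A" by (auto intro: generate.incl)
  have xx: "x \<otimes> x = z" using half_power_eq_z[OF x, of 1] ox x by (simp add: numeral_2_eq_2)
  have zA: "z \<in> ?A" using xx xA by blast
  have A4: "?A = {\<one>, x, z, inv x}"
  proof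
    show "?A \<subseteq> {\<one>, x, z, inv x}"
    proof
      fix g assume "g \<in> ?A"
      then obtain i :: nat where "g = x [^] i" using generate_singleton_iff[OF fin x] by blast
      then have g: "g = x [^] (i mod 4)" using pow_mod_ord[OF x, of i] ox by simp
      have inv3: "inv x = x [^] (3::nat)"
      proof (rule inv_equality)
        have "x [^] (4::nat) = \<one>" using pow_ord_eq_1[OF x] ox by simp
        then show "x [^] (3::nat) \<otimes> x = \<one>" by (simp add: numeral_eq_Suc)
      qed (use x in auto)
      have "i mod 4 = 0 \<or> i mod 4 = 1 \<or> i mod 4 = 2 \<or> i mod 4 = 3" by presburger
      then show "g \<in> {\<one>, x, z, inv x}" using g inv3 x xx by (auto simp: numeral_2_eq_2)
    qed
  qed (use xA zA A.one_closed in auto)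
  have coset: "?A \<union> (\<lambda>g. g \<otimes> (c \<otimes> y)) ` ?A = ?P" "c \<otimes> y \<notin> ?A" if c: "c \<in> ?A" for c
  proof -
    have "(\<lambda>g. g \<otimes> (c \<otimes> y)) ` ?A = (\<lambda>g. g \<otimes> y) ` ?A"
    proof
      show "(\<lambda>g. g \<otimes> (c \<otimes> y)) ` ?A \<subseteq> (\<lambda>g. g \<otimes> y) ` ?A"
        using c y A.subset by (auto simp: m_assoc[symmetric] subset_iff)
      show "(\<lambda>g. g \<otimes> y) ` ?A \<subseteq> (\<lambda>g. g \<otimes> (c \<otimes> y)) ` ?A"
      proof
        fix k assume "k \<in> (\<lambda>g. g \<otimes> y) ` ?A"
        then obtain g where g: "g \<in> ?A" "k = g \<otimes> y" by blast
        then have "k = (g \<otimes> inv c) \<otimes> (c \<otimes> y)" using c y A.subset by (simp add: subset_iff m_assoc inv_mult_cancel)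
        then show "k \<in> (\<lambda>g. g \<otimes> (c \<otimes> y)) ` ?A" using g c by blast
      qed
    qed
    then show "?A \<union> (\<lambda>g. g \<otimes> (c \<otimes> y)) ` ?A = ?P" by simp
    show "c \<otimes> y \<notin> ?A"
    proof
      assume "c \<otimes> y \<in> ?A"
      then have "inv c \<otimes> (c \<otimes> y) \<in> ?A" using c by blast
      then show False using c y A.subset by (simp add: subset_iff inv_mult_cancel)
    qed
  qed
  define j where "j = conj_by w x"
  have j: "j \<in> carrier G" "j \<notin> ?A" using x w wx by (auto simp: j_def)
  have "j \<in> ?P" using normal_conj_by_closed[OF P w(1)] xA unfolding j_def by blast
  then obtain c where c: "c \<in> ?A" "j = c \<otimes> y" using j by blast
  have cG: "c \<in> carrier G" using c A.subset by blast
  have jj: "j \<otimes> j = z" using xx w x by (simp add: j_def flip: conj_by_mult)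
  have cx: "conj_by c x = x"
  proof -
    obtain i :: nat where "c = x [^] i" using c generate_singleton_iff[OF fin x] by blast
    then show ?thesis using commutes_imp_commutes_pow[of x x i] x conj_by_eq_iff_commute by simp
  qed
  have jx: "conj_by j x = inv x" using c y cG x cx by (simp add: conj_by_conj_by[symmetric] conj_by_inv)
  have Pj: "?P = ?A \<union> (\<lambda>g. g \<otimes> j) ` ?A" using coset[OF c(1)] c(2) by simp
  define t where "t = conj_by w j"
  have t: "t \<in> carrier G" using w j by (simp add: t_def)
  have wt: "conj_by w t = x"
  proof -
    have "conj_by w t = conj_by (w \<otimes> w \<otimes> w) x" using w x by (simp add: t_def j_def conj_by_conj_by m_assoc)
    also have "w \<otimes> w \<otimes> w = w [^] (3::nat)" using w by (simp add: numeral_eq_Suc)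
    also have "\<dots> = \<one>" using pow_ord_eq_1[OF w(1)] w(2) by simp
    finally show ?thesis using x by simp
  qed
  have w_inj: "u = v" if "conj_by w u = conj_by w v" "u \<in> carrier G" "v \<in> carrier G" for u v
    using that w by simp
  have tx: "t \<noteq> x" using wt j xA by (auto simp: j_def)
  have tx': "t \<noteq> inv x"
  proof
    assume "t = inv x"
    then have "inv j = x" using wt w x by (simp add: j_def conj_by_inv)
    then have "j = inv x" using j by auto
    then show False using j A4 by blast
  qed
  have tt: "t \<otimes> t = z" using jj w j by (simp add: t_def flip: conj_by_mult)
  have tA: "t \<notin> ?A"
  proof
    assume "t \<in> ?A"
    then have "t = \<one> \<or> t = z" using A4 tx tx' by blast
    then show False using tt z_neq_one by (metis l_one one_closed z_sq)
  qed
  have "j \<in> ?P" by fact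
  then have "t \<in> ?P" using normal_conj_by_closed[OF P w(1)] unfolding t_def by blast
  then obtain g where g: "g \<in> ?A" "t = g \<otimes> j" using Pj tA by blast
  have "g \<noteq> \<one>"
  proof
    assume "g = \<one>"
    then have "conj_by w t = j" using g j t_def by simp
    then show False using wt j xA by auto
  qed
  moreover have "g \<noteq> z"
  proof
    assume "g = z"
    then have "conj_by w t = z \<otimes> t" using g w j by (simp add: conj_by_mult t_def)
    then have "x = z \<otimes> t" using wt by simp
    then have "z \<otimes> x = t" using t by (simp flip: m_assoc)
    then show False using tA zA xA by blast
  qed
  ultimately consider (A) "g = x" | (B) "g = inv x" using g A4 by blast
  then show ?thesis
  proof cases
    case A
    then show ?thesis using w j jj jx Pj g t_def j_def by (intro bexI[of _ j] bexI[of _ w]) auto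
  next
    \<comment> \<open>With the other sign, the inverse of w and the element t in place of w and j
      satisfy the required relations.\<close>
    case B
    have tj: "t = inv x \<otimes> j" using g B by simp
    have "t = (inv x \<otimes> c) \<otimes> y" using tj c cG x y by (simp add: m_assoc)
    moreover have "inv x \<otimes> c \<in> ?A" using c xA by blast
    ultimately have Pt: "?P = ?A \<union> (\<lambda>g. g \<otimes> t) ` ?A" using coset[of "inv x \<otimes> c"] by simp
    have "conj_by t x = conj_by (inv x) (inv x)" using tj jx j x by (simp add: conj_by_conj_by[symmetric])
    moreover have "conj_by (inv x) (inv x) = inv x" using x by (simp add: conj_by_def m_assoc)
    ultimately have txc: "conj_by t x = inv x" by simp
    have "conj_by (inv w) x = t" using wt w t by (metis conj_by_inv_left)
    moreover have "conj_by (inv w) t = j" using w j by (simp add: t_def)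
    moreover have "j = x \<otimes> t" using tj x j by (simp add: mult_inv_cancel)
    ultimately show ?thesis using w t tt txc Pt tA by (intro bexI[of _ t] bexI[of _ "inv w"]) auto
  qed
qed

end

subsection \<open>The binary tetrahedral group\<close>

text \<open>Right multiplication by \<open>w\<close>, \<open>i\<close> and \<open>j = w i w\<^sup>-\<^sup>1\<close> on the exponents of
  \<open>i\<^sup>a j\<^sup>b w\<^sup>c\<close>.\<close>

fun times_w :: "nat \<times> nat \<times> nat \<Rightarrow> nat \<times> nat \<times> nat" where
  "times_w (a, b, c) = (a, b, Suc c)"

fun times_i :: "nat \<times> nat \<times> nat \<Rightarrow> nat \<times> nat \<times> nat" where
  "times_i (a, b, c) =
     (if c mod 3 = 1 then (a, Suc b, c)
      else (a + (if even b then 1 else 3), (if c mod 3 = 0 then b else Suc b), c))"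

definition times_j :: "nat \<times> nat \<times> nat \<Rightarrow> nat \<times> nat \<times> nat" where
  "times_j s = times_w (times_w (times_i (times_w s)))"

fun times_exponents :: "nat \<times> nat \<times> nat \<Rightarrow> nat \<times> nat \<times> nat \<Rightarrow> nat \<times> nat \<times> nat" where
  "times_exponents s (a, b, c) = (times_w ^^ c) ((times_j ^^ b) ((times_i ^^ a) s))"

text \<open>Even powers of \<open>j\<close> are absorbed by \<open>i\<close> through j^2 = i^2; the
  other reductions are i^4 = 1 and w^3 = 1.\<close>

fun reduce_exponents :: "nat \<times> nat \<times> nat \<Rightarrow> nat \<times> nat \<times> nat" where
  "reduce_exponents (a, b, c) = ((a + 2 * (b div 2)) mod 4, b mod 2, c mod 3)"

text \<open>The relations tell how to multiply words i^a j^b w^c, while the cardinality and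
  \<open>carrier_subset\<close> make the 24 reduced words distinct. Together they fix the
  multiplication table, so any two models can be compared through the same exponent
  arithmetic.\<close>

locale binary_tetrahedral = group +
  fixes i j w
  assumes i [simp]: "i \<in> carrier G" and j [simp]: "j \<in> carrier G" and w [simp]: "w \<in> carrier G"
    and i4: "i [^] (4::nat) = \<one>" and jj: "j \<otimes> j = i \<otimes> i" and ji: "j \<otimes> i = i [^] (3::nat) \<otimes> j"
    and w3: "w [^] (3::nat) = \<one>" and wi: "w \<otimes> i = j \<otimes> w" and wj: "w \<otimes> j = i \<otimes> j \<otimes> w"
    and card_carrier: "card (carrier G) = 24"
    and carrier_subset: "carrier G \<subseteq> (\<lambda>(a, b, c). i [^] a \<otimes> j [^] b \<otimes> w [^] c) ` ({..<4::nat} \<times> {..<2::nat} \<times> {..<3::nat})"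
begin

fun normal_form :: "nat \<times> nat \<times> nat \<Rightarrow> 'a" where
  "normal_form (a, b, c) = i [^] a \<otimes> j [^] b \<otimes> w [^] c"

lemma normal_form_closed [simp]: "normal_form s \<in> carrier G"
  by (cases s) simp

lemma i_pow_mod: "i [^] (a mod 4) = i [^] (a :: nat)"
proof -
  have "[a mod 4 = a] (mod ord i)"
    using i4 pow_eq_id[OF i, of 4] by (metis cong_dvd_modulus_nat cong_mod_left cong_refl)
  then show ?thesis by (simp add: pow_eq_pow_iff)
qed

lemma w_pow_mod: "w [^] (c mod 3) = w [^] (c :: nat)"
proof -
  have "[c mod 3 = c] (mod ord w)"
    using w3 pow_eq_id[OF w, of 3] by (metis cong_dvd_modulus_nat cong_mod_left cong_refl)
  then show ?thesis by (simp add: pow_eq_pow_iff)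
qed

lemma j_pow: "j [^] (b :: nat) = i [^] (2 * (b div 2)) \<otimes> j [^] (b mod 2)"
proof -
  have "j [^] (2::nat) = i [^] (2::nat)" using jj by (simp add: numeral_2_eq_2)
  then have "j [^] (2 * (b div 2)) = i [^] (2 * (b div 2))" by (metis nat_pow_pow i j)
  then have "j [^] (2 * (b div 2)) \<otimes> j [^] (b mod 2) = i [^] (2 * (b div 2)) \<otimes> j [^] (b mod 2)" by simp
  then show ?thesis by (simp add: nat_pow_mult)
qed

lemma j_i_pow: "j \<otimes> i [^] (a :: nat) = i [^] (3 * a) \<otimes> j"
proof (induction a)
  case (Suc a)
  have "j \<otimes> i [^] Suc a = j \<otimes> i [^] a \<otimes> i" by (simp add: m_assoc)
  also have "\<dots> = i [^] (3 * a) \<otimes> (i [^] (3::nat) \<otimes> j)" unfolding Suc by (simp add: m_assoc ji)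
  also have "\<dots> = i [^] (3 * a + 3) \<otimes> j" by (simp add: nat_pow_mult[symmetric] m_assoc)
  finally show ?case by (simp add: add.commute)
qed simp

lemma j_pow_i: "j [^] (b :: nat) \<otimes> i = i [^] (if even b then 1 else 3 :: nat) \<otimes> j [^] b"
proof (induction b)
  case (Suc b)
  have "j [^] Suc b \<otimes> i = j \<otimes> (j [^] b \<otimes> i)" using nat_pow_Suc2[OF j, of b] by (simp add: m_assoc)
  also have "\<dots> = j \<otimes> i [^] (if even b then 1 else 3 :: nat) \<otimes> j [^] b" unfolding Suc by (simp add: m_assoc)
  also have "\<dots> = i [^] (3 * (if even b then 1 else 3 :: nat)) \<otimes> j [^] Suc b"
    unfolding j_i_pow using nat_pow_Suc2[OF j, of b] by (simp add: m_assoc)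
  also have "i [^] (3 * (if even b then 1 else 3 :: nat)) = i [^] (if even (Suc b) then 1 else 3 :: nat)"
    using i_pow_mod[of 9] by simp
  finally show ?case .
qed (simp add: nat_pow_eone)

text \<open>Conjugation by \<open>w\<close> cycles through i, j and ij; that ij returns to i follows
  from the other relations.\<close>

lemma w_pow_i: "w [^] (c :: nat) \<otimes> i = (if c mod 3 = 0 then i else if c mod 3 = 1 then j else i \<otimes> j) \<otimes> w [^] c"
proof (induction c)
  case (Suc c)
  let ?r = "\<lambda>c::nat. if c mod 3 = 0 then i else if c mod 3 = 1 then j else i \<otimes> j"
  have "w \<otimes> (i \<otimes> j) = i \<otimes> w"
  proof -
    have "w \<otimes> (i \<otimes> j) = (w \<otimes> i) \<otimes> j" by (simp add: m_assoc)
    also have "\<dots> = j \<otimes> (w \<otimes> j)" unfolding wi by (simp add: m_assoc)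
    also have "\<dots> = (j \<otimes> i) \<otimes> j \<otimes> w" unfolding wj by (simp add: m_assoc)
    also have "\<dots> = i [^] (3::nat) \<otimes> (j \<otimes> j) \<otimes> w" unfolding ji by (simp add: m_assoc)
    also have "i [^] (3::nat) \<otimes> (j \<otimes> j) = i [^] (5::nat)" unfolding jj by (simp add: numeral_eq_Suc m_assoc)
    also have "i [^] (5::nat) = i" using i_pow_mod[of 5] by (simp add: nat_pow_eone)
    finally show ?thesis .
  qed
  then have step: "w \<otimes> ?r c = ?r (Suc c) \<otimes> w" using wi wj by (auto simp: mod_Suc)
  have "w [^] Suc c \<otimes> i = w \<otimes> (w [^] c \<otimes> i)" using nat_pow_Suc2[OF w, of c] by (simp add: m_assoc)
  also have "\<dots> = w \<otimes> ?r c \<otimes> w [^] c" unfolding Suc by (simp add: m_assoc)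
  also have "\<dots> = ?r (Suc c) \<otimes> (w \<otimes> w [^] c)" unfolding step by (simp add: m_assoc)
  finally show ?case using nat_pow_Suc2[OF w, of c] by simp
qed simp

lemma normal_form_times_w: "normal_form s \<otimes> w = normal_form (times_w s)"
  by (cases s) (simp add: m_assoc)

lemma normal_form_times_i: "normal_form s \<otimes> i = normal_form (times_i s)"
proof -
  obtain a b c where s: "s = (a, b, c)" by (cases s)
  have A: "i [^] a \<otimes> j [^] b \<otimes> i = i [^] (a + (if even b then 1 else 3 :: nat)) \<otimes> j [^] b"
    by (simp only: m_assoc j_pow_i nat_pow_mult[symmetric] nat_pow_closed i j)
  have "normal_form s \<otimes> i = i [^] a \<otimes> j [^] b \<otimes> (w [^] c \<otimes> i)" by (simp add: s m_assoc)
  also have "\<dots> = i [^] a \<otimes> j [^] b \<otimes> (if c mod 3 = 0 then i else if c mod 3 = 1 then j else i \<otimes> j) \<otimes> w [^] c"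
    unfolding w_pow_i by (simp add: m_assoc)
  also have "\<dots> = normal_form (times_i s)"
  proof -
    consider "c mod 3 = 1" | "c mod 3 = 0" | "c mod 3 \<noteq> 1" "c mod 3 \<noteq> 0" by blast
    then show ?thesis
    proof cases
      case 1 then show ?thesis by (simp add: s m_assoc)
    next
      case 2 then show ?thesis using A by (simp add: s del: nat_pow_Suc)
    next
      case 3
      then have "i [^] a \<otimes> j [^] b \<otimes> (if c mod 3 = 0 then i else if c mod 3 = 1 then j else i \<otimes> j) = i [^] a \<otimes> j [^] b \<otimes> i \<otimes> j"
        by (simp add: m_assoc)
      then show ?thesis using 3 unfolding A by (simp add: s m_assoc)
    qed
  qed
  finally show ?thesis .
qed

lemma normal_form_times_j: "normal_form s \<otimes> j = normal_form (times_j s)"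
proof -
  have "w \<otimes> i \<otimes> w \<otimes> w = j \<otimes> (w \<otimes> w \<otimes> w)" unfolding wi by (simp add: m_assoc)
  also have "w \<otimes> w \<otimes> w = \<one>" using w3 by (simp add: numeral_eq_Suc)
  finally have "w \<otimes> i \<otimes> w \<otimes> w = j" by simp
  then have "normal_form s \<otimes> j = normal_form s \<otimes> (w \<otimes> i \<otimes> w \<otimes> w)" by (simp only:)
  also have "\<dots> = normal_form s \<otimes> w \<otimes> i \<otimes> w \<otimes> w" by (simp add: m_assoc)
  finally have "normal_form s \<otimes> j = normal_form s \<otimes> w \<otimes> i \<otimes> w \<otimes> w" .
  then show ?thesis by (simp add: times_j_def normal_form_times_w normal_form_times_i)
qed

lemma normal_form_mult: "normal_form s \<otimes> normal_form t = normal_form (times_exponents s t)"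
proof -
  have pow: "normal_form s \<otimes> g [^] n = normal_form ((f ^^ n) s)"
    if "\<And>s. normal_form s \<otimes> g = normal_form (f s)" "g \<in> carrier G" for s g f and n :: nat
    using that by (induction n) (simp_all flip: m_assoc)
  obtain a b c where t: "t = (a, b, c)" by (cases t)
  have "normal_form s \<otimes> normal_form t = normal_form s \<otimes> i [^] a \<otimes> j [^] b \<otimes> w [^] c" by (simp add: t m_assoc)
  then show ?thesis
    by (simp add: t pow[of i times_i] pow[of j times_j] pow[of w times_w]
        normal_form_times_i normal_form_times_j normal_form_times_w)
qed

lemma normal_form_reduce: "normal_form (reduce_exponents s) = normal_form s"
proof -
  obtain a b c where s: "s = (a, b, c)" by (cases s)
  have "normal_form (reduce_exponents s) = i [^] ((a + 2 * (b div 2)) mod 4) \<otimes> j [^] (b mod 2) \<otimes> w [^] (c mod 3)"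
    by (simp add: s)
  also have "\<dots> = i [^] a \<otimes> (i [^] (2 * (b div 2)) \<otimes> j [^] (b mod 2)) \<otimes> w [^] c"
    unfolding i_pow_mod w_pow_mod by (simp add: m_assoc nat_pow_mult[symmetric])
  also have "\<dots> = normal_form s" unfolding j_pow[symmetric] by (simp add: s)
  finally show ?thesis .
qed

lemma normal_form_bij: "bij_betw normal_form ({..<4} \<times> {..<2} \<times> {..<3}) (carrier G)"
proof -
  have "normal_form = (\<lambda>(a, b, c). i [^] a \<otimes> j [^] b \<otimes> w [^] c)" by (auto simp: fun_eq_iff)
  then have im: "normal_form ` ({..<4} \<times> {..<2} \<times> {..<3}) = carrier G"
    using carrier_subset by auto
  then have "inj_on normal_form ({..<4} \<times> {..<2} \<times> {..<3})"
    by (intro eq_card_imp_inj_on) (simp_all add: card_cartesian_product card_carrier)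
  then show ?thesis using im by (simp add: bij_betw_def)
qed

lemma reduce_exponents_bounds: "reduce_exponents s \<in> {..<4} \<times> {..<2} \<times> {..<3}"
  by (cases s) simp

lemma normal_form_eq_iff: "normal_form s = normal_form t \<longleftrightarrow> reduce_exponents s = reduce_exponents t"
  using normal_form_bij reduce_exponents_bounds normal_form_reduce
  by (metis bij_betw_def inj_on_eq_iff)

lemma ex_normal_form: "x \<in> carrier G \<Longrightarrow> \<exists>s. x = normal_form s"
  using normal_form_bij by (metis bij_betw_def imageE)

end

text \<open>Matching equal exponents is well defined and injective because in both groups equality
  of words is decided by \<open>reduce_exponents\<close>, and multiplicative because both multiply
  by \<open>times_exponents\<close>.\<close>

theorem binary_tetrahedral_unique:
  assumes "binary_tetrahedral G i j w" "binary_tetrahedral G' i' j' w'"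
  shows "G \<cong> G'"
proof -
  interpret A: binary_tetrahedral G i j w by fact
  interpret B: binary_tetrahedral G' i' j' w' by fact
  define F where "F x = B.normal_form (SOME s. x = A.normal_form s)" for x
  have F: "F (A.normal_form s) = B.normal_form s" for s
  proof -
    have "A.normal_form s = A.normal_form (SOME s'. A.normal_form s = A.normal_form s')"
      by (rule someI_ex) blast
    then show ?thesis unfolding F_def A.normal_form_eq_iff B.normal_form_eq_iff by simp
  qed
  have "F \<in> iso G G'"
  proof (rule isoI)
    show "F \<in> hom G G'"
    proof (rule homI)
      fix x assume x: "x \<in> carrier G"
      then obtain s where s: "x = A.normal_form s" using A.ex_normal_form by blast
      show "F x \<in> carrier G'" by (simp add: s F)
      fix y assume "y \<in> carrier G"
      then obtain t where "y = A.normal_form t" using A.ex_normal_form by blast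
      then show "F (x \<otimes>\<^bsub>G\<^esub> y) = F x \<otimes>\<^bsub>G'\<^esub> F y" by (simp only: s A.normal_form_mult B.normal_form_mult F)
    qed
    show "bij_betw F (carrier G) (carrier G')"
      unfolding bij_betw_def
    proof
      show "inj_on F (carrier G)"
      proof (rule inj_onI)
        fix x y assume "x \<in> carrier G" "y \<in> carrier G" "F x = F y"
        then obtain s t where st: "x = A.normal_form s" "y = A.normal_form t" using A.ex_normal_form by metis
        then show "x = y" using \<open>F x = F y\<close> by (simp only: F A.normal_form_eq_iff B.normal_form_eq_iff)
      qed
      show "F ` carrier G = carrier G'"
      proof
        show "carrier G' \<subseteq> F ` carrier G"
        proof
          fix y assume "y \<in> carrier G'"
          then obtain s where "y = B.normal_form s" using B.ex_normal_form by blast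
          then have "y = F (A.normal_form s)" by (simp only: F)
          then show "y \<in> F ` carrier G" using A.normal_form_closed by blast
        qed
        show "F ` carrier G \<subseteq> carrier G'"
        proof
          fix y assume "y \<in> F ` carrier G"
          then obtain s where "y = F (A.normal_form s)" using A.ex_normal_form by blast
          then show "y \<in> carrier G'" by (simp only: F B.normal_form_closed)
        qed
      qed
    qed
  qed
  then show ?thesis by (rule is_isoI)
qed

section \<open>Matrix computations in SL(2,3)\<close>

definition mat2 :: "3 \<Rightarrow> 3 \<Rightarrow> 3 \<Rightarrow> 3 \<Rightarrow> 3 ^ 2 ^ 2" where
  "mat2 a b c d = (\<chi> r s. if r = 1 then if s = 1 then a else b else if s = 1 then c else d)"

lemma mat2_nth [simp]: "mat2 a b c d $ 1 $ 1 = a" "mat2 a b c d $ 1 $ 2 = b" "mat2 a b c d $ 2 $ 1 = c" "mat2 a b c d $ 2 $ 2 = d"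
  by (simp_all add: mat2_def)

lemma mat2_eq_iff [simp]: "mat2 a b c d = mat2 a' b' c' d' \<longleftrightarrow> a = a' \<and> b = b' \<and> c = c' \<and> d = d'"
  by (metis mat2_nth)

lemma ex_mat2: "\<exists>a b c d. M = mat2 a b c d"
  by (rule exI[of _ "M $ 1 $ 1"], rule exI[of _ "M $ 1 $ 2"], rule exI[of _ "M $ 2 $ 1"], rule exI[of _ "M $ 2 $ 2"])
    (simp add: vec_eq_iff forall_2)

lemma mat2_mult: "mat2 a b c d ** mat2 a' b' c' d' = mat2 (a * a' + b * c') (a * b' + b * d') (c * a' + d * c') (c * b' + d * d')"
  by (simp add: vec_eq_iff forall_2 matrix_matrix_mult_def sum_2)

lemma mat2_one: "mat 1 = mat2 1 0 0 1"
  by (simp add: vec_eq_iff forall_2 mat_def)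

lemma det_mat2: "det (mat2 a b c d) = a * d - b * c"
  by (simp add: det_2)

lemma mod3_cases: "(x :: 3) = 0 \<or> x = 1 \<or> x = 2"
proof (cases x)
  case (of_int n)
  then have "n = 0 \<or> n = 1 \<or> n = 2" by auto
  then show ?thesis using of_int by auto
qed

lemma mod3_numerals: "(3 :: 3) = 0" "(4 :: 3) = 1" "(5 :: 3) = 2" "(6 :: 3) = 0" "(7 :: 3) = 1" "(8 :: 3) = 2" "(- 1 :: 3) = 2"
  by simp_all

lemma SL_2_3_simps [simp]:
  "mat2 a b c d \<in> carrier SL_2_3 \<longleftrightarrow> a * d - b * c = 1"
  "M \<otimes>\<^bsub>SL_2_3\<^esub> N = M ** N" "\<one>\<^bsub>SL_2_3\<^esub> = mat2 1 0 0 1"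
  by (simp_all add: SL_2_3_def det_mat2 mat2_one)

lemma SL_2_3_group: "group SL_2_3"
proof (rule groupI)
  fix M assume M: "M \<in> carrier SL_2_3"
  obtain a b c d where m: "M = mat2 a b c d" using ex_mat2 by blast
  have "mat2 d (- b) (- c) a \<in> carrier SL_2_3" using M by (simp add: m mult.commute)
  moreover have "mat2 d (- b) (- c) a ** M = mat2 1 0 0 1" using M by (simp add: m mat2_mult algebra_simps)
  ultimately show "\<exists>N\<in>carrier SL_2_3. N \<otimes>\<^bsub>SL_2_3\<^esub> M = \<one>\<^bsub>SL_2_3\<^esub>" by auto
qed (simp_all add: SL_2_3_def det_mul matrix_mul_assoc)

text \<open>The matrices appear in the lexicographic order of the exponents in i^a j^b w^c, for the
  generators i, j, w chosen below.\<close>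

lemma SL_2_3_carrier:
  "carrier SL_2_3 = (\<lambda>(a, b, c, d). mat2 a b c d) `
    {(1, 0, 0, 1), (1, 1, 0, 1), (1, 2, 0, 1), (1, 1, 1, 2), (1, 2, 1, 0), (1, 0, 1, 1), (0, 2, 1, 0), (0, 2, 1, 1), (0, 2, 1, 2), (2, 1, 1, 1), (2, 0, 1, 2), (2, 2, 1, 0), (2, 0, 0, 2), (2, 2, 0, 2), (2, 1, 0, 2), (2, 2, 2, 1), (2, 1, 2, 0), (2, 0, 2, 2), (0, 1, 2, 0), (0, 1, 2, 2), (0, 1, 2, 1), (1, 2, 2, 2), (1, 0, 2, 1), (1, 1, 2, 0)}" (is "_ = ?f ` ?T")
proof
  show "carrier SL_2_3 \<subseteq> ?f ` ?T"
  proof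
    fix M assume M: "M \<in> carrier SL_2_3"
    obtain a b c d where m: "M = mat2 a b c d" using ex_mat2 by blast
    have "a * d - b * c = 1" using M m by simp
    then have "(a, b, c, d) \<in> ?T"
      using mod3_cases[of a] mod3_cases[of b] mod3_cases[of c] mod3_cases[of d]
      by (elim disjE) (simp_all add: mod3_numerals)
    then show "M \<in> ?f ` ?T" by (auto simp only: m intro!: image_eqI[of _ _ "(a, b, c, d)"] split: prod.split)
  qed
qed (simp add: mod3_numerals)

lemma SL_2_3_card: "card (carrier SL_2_3) = 24"
  unfolding SL_2_3_carrier by (subst card_image) (auto simp: inj_on_def)

text \<open>The first two matrices have trace 0 and generate the quaternion subgroup; the third is a
  transvection, hence of order 3, and carries the first to the second by conjugation.\<close>

lemma SL_2_3_binary_tetrahedral: "binary_tetrahedral SL_2_3 (mat2 0 2 1 0) (mat2 1 1 1 2) (mat2 1 1 0 1)"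
proof -
  interpret group SL_2_3 by (rule SL_2_3_group)
  show ?thesis
  proof unfold_locales
    let ?i = "mat2 0 2 1 0" and ?j = "mat2 1 1 1 2" and ?w = "mat2 1 1 0 1"
    let ?B = "{..<4::nat} \<times> {..<2::nat} \<times> {..<3::nat}"
    let ?nf = "\<lambda>(a::nat, b::nat, c::nat). ?i [^]\<^bsub>SL_2_3\<^esub> a \<otimes>\<^bsub>SL_2_3\<^esub> ?j [^]\<^bsub>SL_2_3\<^esub> b \<otimes>\<^bsub>SL_2_3\<^esub> ?w [^]\<^bsub>SL_2_3\<^esub> c"
    note s = numeral_eq_Suc mat2_mult mod3_numerals
    have mem: "M \<in> ?nf ` ?B" if "M = ?nf t" "t \<in> ?B" for M t
      unfolding that(1) using that(2) by (rule imageI)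
    have *:
      "mat2 1 0 0 1 \<in> ?nf ` ?B" "mat2 1 1 0 1 \<in> ?nf ` ?B" "mat2 1 2 0 1 \<in> ?nf ` ?B"
      "mat2 1 1 1 2 \<in> ?nf ` ?B" "mat2 1 2 1 0 \<in> ?nf ` ?B" "mat2 1 0 1 1 \<in> ?nf ` ?B"
      "mat2 0 2 1 0 \<in> ?nf ` ?B" "mat2 0 2 1 1 \<in> ?nf ` ?B" "mat2 0 2 1 2 \<in> ?nf ` ?B"
      "mat2 2 1 1 1 \<in> ?nf ` ?B" "mat2 2 0 1 2 \<in> ?nf ` ?B" "mat2 2 2 1 0 \<in> ?nf ` ?B"
      "mat2 2 0 0 2 \<in> ?nf ` ?B" "mat2 2 2 0 2 \<in> ?nf ` ?B" "mat2 2 1 0 2 \<in> ?nf ` ?B"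
      "mat2 2 2 2 1 \<in> ?nf ` ?B" "mat2 2 1 2 0 \<in> ?nf ` ?B" "mat2 2 0 2 2 \<in> ?nf ` ?B"
      "mat2 0 1 2 0 \<in> ?nf ` ?B" "mat2 0 1 2 2 \<in> ?nf ` ?B" "mat2 0 1 2 1 \<in> ?nf ` ?B"
      "mat2 1 2 2 2 \<in> ?nf ` ?B" "mat2 1 0 2 1 \<in> ?nf ` ?B" "mat2 1 1 2 0 \<in> ?nf ` ?B"
      by ((rule mem[of _ "(0, 0, 0)"]; simp add: s),
      (rule mem[of _ "(0, 0, 1)"]; simp add: s),
      (rule mem[of _ "(0, 0, 2)"]; simp add: s),
      (rule mem[of _ "(0, 1, 0)"]; simp add: s),
      (rule mem[of _ "(0, 1, 1)"]; simp add: s),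
      (rule mem[of _ "(0, 1, 2)"]; simp add: s),
      (rule mem[of _ "(1, 0, 0)"]; simp add: s),
      (rule mem[of _ "(1, 0, 1)"]; simp add: s),
      (rule mem[of _ "(1, 0, 2)"]; simp add: s),
      (rule mem[of _ "(1, 1, 0)"]; simp add: s),
      (rule mem[of _ "(1, 1, 1)"]; simp add: s),
      (rule mem[of _ "(1, 1, 2)"]; simp add: s),
      (rule mem[of _ "(2, 0, 0)"]; simp add: s),
      (rule mem[of _ "(2, 0, 1)"]; simp add: s),
      (rule mem[of _ "(2, 0, 2)"]; simp add: s),
      (rule mem[of _ "(2, 1, 0)"]; simp add: s),
      (rule mem[of _ "(2, 1, 1)"]; simp add: s),
      (rule mem[of _ "(2, 1, 2)"]; simp add: s),
      (rule mem[of _ "(3, 0, 0)"]; simp add: s),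
      (rule mem[of _ "(3, 0, 1)"]; simp add: s),
      (rule mem[of _ "(3, 0, 2)"]; simp add: s),
      (rule mem[of _ "(3, 1, 0)"]; simp add: s),
      (rule mem[of _ "(3, 1, 1)"]; simp add: s),
      (rule mem[of _ "(3, 1, 2)"]; simp add: s))
    show "carrier SL_2_3 \<subseteq> ?nf ` ?B"
    proof
      fix M assume "M \<in> carrier SL_2_3"
      then show "M \<in> ?nf ` ?B" unfolding SL_2_3_carrier
        by (elim imageE insertE emptyE) (simp_all only: prod.case *)
    qed
  qed (use SL_2_3_card in \<open>simp_all add: numeral_eq_Suc mat2_mult mod3_numerals\<close>)
qed

subsection \<open>Frobenius groups\<close>

locale frobenius = group +
  fixes K H
  assumes fin: "finite (carrier G)" and frobenius: "frobenius_product G K H"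
begin

lemma K_normal: "K \<lhd> G" and H_subgroup: "subgroup H G" and K_Int_H: "K \<inter> H = {\<one>}" and K_mult_H: "K <#> H = carrier G"
  and H_nontrivial: "H \<noteq> {\<one>}" and H_proper: "H \<noteq> carrier G" and K_eq: "K = frobenius_kernel G H"
  using frobenius unfolding frobenius_product_def internal_semidirect_def frobenius_complement_def by blast+

lemma K_subgroup: "subgroup K G" using K_normal by (rule normal_imp_subgroup)

sublocale K: subgroup K G by (rule K_subgroup)
sublocale H: subgroup H G by (rule H_subgroup)

lemma H_group: "group (G\<lparr>carrier := H\<rparr>)" by (rule H.subgroup_is_group) (rule is_group)
lemma K_group: "group (G\<lparr>carrier := K\<rparr>)" by (rule K.subgroup_is_group) (rule is_group)

lemma finite_K: "finite K" and finite_H: "finite H"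
  using fin K.subset H.subset finite_subset by blast+

lemma order_eq: "order G = card K * card H"
  using cardinality_set_mult[OF K_subgroup H_subgroup K_Int_H fin] by (simp add: K_mult_H order_def)

lemma decompose: "g \<in> carrier G \<Longrightarrow> \<exists>k\<in>K. \<exists>h\<in>H. g = k \<otimes> h"
  unfolding K_mult_H[symmetric] set_mult_def by blast

lemma conj_by_mem_complement:
  assumes "h \<in> H" "h \<noteq> \<one>" "g \<in> carrier G" "conj_by g h \<in> H"
  shows "g \<in> H"
proof (rule ccontr)
  assume g: "g \<notin> H"
  have "inv g \<notin> H" using g assms(3) H.m_inv_closed[of "inv g"] by auto
  then have "H \<inter> conj_subgroup G H (inv g) = {\<one>}"
    using frobenius assms(3) unfolding frobenius_product_def frobenius_complement_def by blast
  moreover have "conj_by g h \<in> conj_subgroup G H (inv g)"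
    using assms unfolding conj_subgroup_def conj_by_def by (intro image_eqI[of _ _ h]) auto
  ultimately have "conj_by g h = \<one>" using assms(4) by blast
  then have "h = \<one>" using conj_by_cancel[of g h \<one>] assms by simp
  then show False using assms by simp
qed

lemma centralizer_in_complement:
  assumes "h \<in> H" "h \<noteq> \<one>" "g \<in> carrier G" "g \<otimes> h = h \<otimes> g"
  shows "g \<in> H"
  using conj_by_mem_complement[OF assms(1-3)] conj_by_eq_iff_commute[of g h] assms by simp

lemma free:
  assumes "h \<in> H" "k \<in> K" "k \<noteq> \<one>" "conj_by h k = k"
  shows "h = \<one>"
proof (rule ccontr)
  assume "h \<noteq> \<one>"
  moreover have "k \<otimes> h = h \<otimes> k" using assms conj_by_eq_iff_commute[of h k] by simp
  ultimately have "k \<in> H" using centralizer_in_complement[OF assms(1) _ K.mem_carrier[OF assms(2)]] by blast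
  then show False using K_Int_H assms by blast
qed

lemma conj_by_K: "g \<in> carrier G \<Longrightarrow> k \<in> K \<Longrightarrow> conj_by g k \<in> K"
  by (rule normal_conj_by_closed[OF K_normal])

lemma card_H_dvd_invariant:
  assumes S: "S \<subseteq> K - {\<one>}" and inv: "\<And>h s. h \<in> H \<Longrightarrow> s \<in> S \<Longrightarrow> conj_by h s \<in> S"
  shows "card H dvd card S"
proof -
  interpret HG: group "G\<lparr>carrier := H\<rparr>" by (rule H_group)
  have "order (G\<lparr>carrier := H\<rparr>) dvd card S"
  proof (rule HG.order_dvd_card_if_free[of S conj_by])
    show "finite S" using S finite_K finite_subset by blast
    show "g = \<one>\<^bsub>G\<lparr>carrier := H\<rparr>\<^esub>" if "g \<in> carrier (G\<lparr>carrier := H\<rparr>)" "x \<in> S" "conj_by g x = x" for g x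
      using free[of g x] that S by auto
    show "conj_by (g \<otimes>\<^bsub>G\<lparr>carrier := H\<rparr>\<^esub> h) x = conj_by g (conj_by h x)"
      if "g \<in> carrier (G\<lparr>carrier := H\<rparr>)" "h \<in> carrier (G\<lparr>carrier := H\<rparr>)" "x \<in> S" for g h x
      using that S K.subset by (auto simp: conj_by_conj_by subset_iff)
    show "conj_by \<one>\<^bsub>G\<lparr>carrier := H\<rparr>\<^esub> x = x" if "x \<in> S" for x
      using that S K.subset by auto
  qed (use inv in auto)
  then show ?thesis by (simp add: order_def)
qed

lemma card_H_gt_one: "card H > 1"
proof -
  have "card H \<noteq> 0" using finite_H H.one_closed by (metis card_0_eq empty_iff)
  moreover have "card H \<noteq> 1" using H_nontrivial H.one_closed by (metis card_1_singletonE singletonD)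
  ultimately show ?thesis by simp
qed

text \<open>The free action on the non-trivial elements of \<open>K\<close> makes |H| a divisor of
  |K| - 1.\<close>

lemma coprime_card: "coprime (card K) (card H)"
proof -
  have "card H dvd card (K - {\<one>})"
  proof (rule card_H_dvd_invariant)
    fix h s assume "h \<in> H" "s \<in> K - {\<one>}"
    then show "conj_by h s \<in> K - {\<one>}"
      using conj_by_K[of h s] conj_by_cancel[of h s \<one>] by auto
  qed auto
  then have "card H dvd card K - 1" using finite_K by simp
  moreover have "coprime (card K - 1) (card K)"
    using finite_K K.one_closed by (intro coprime_diff_one_left_nat) (metis card_gt_0_iff empty_iff)
  ultimately show ?thesis by (meson coprime_commute coprime_divisors dvd_refl)
qed

lemma K_nontrivial: "\<exists>k\<in>K. k \<noteq> \<one>"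
proof (rule ccontr)
  assume "\<not> ?thesis"
  then have "K = {\<one>}" using K.one_closed by blast
  then have "carrier G = H" using K_mult_H H.subset by (auto simp: set_mult_def)
  then show False using H_proper by simp
qed

lemma ord_H_dvd: "h \<in> H \<Longrightarrow> ord h dvd card H"
  using group.ord_dvd_group_order[OF H_group, of h] ord_subgroup[OF H_subgroup] by (simp add: order_def)

lemma ord_K_dvd: "k \<in> K \<Longrightarrow> ord k dvd card K"
  using group.ord_dvd_group_order[OF K_group, of k] ord_subgroup[OF K_subgroup] by (simp add: order_def)

text \<open>A conjugating element splits as a kernel part times a complement part, and the latter
  can be absorbed into \<open>H\<close>.\<close>

lemma outside_kernel:
  assumes "x \<in> carrier G" "x \<notin> K"
  shows "\<exists>k\<in>K. \<exists>h\<in>H. x = conj_by k h"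
proof -
  have "x \<in> (\<Union>g\<in>carrier G. conj_subgroup G H g)"
    using assms K_eq unfolding frobenius_kernel_def by blast
  then obtain g h where g: "g \<in> carrier G" "h \<in> H" "x = conj_by (inv g) h"
    by (auto simp: conj_subgroup_def conj_by_def)
  obtain k h0 where k: "k \<in> K" "h0 \<in> H" "inv g = k \<otimes> h0" using decompose[of "inv g"] g by auto
  have "x = conj_by k (conj_by h0 h)" using g k by (simp add: conj_by_conj_by)
  moreover have "conj_by h0 h \<in> H" using k g by (simp add: conj_by_def)
  ultimately show ?thesis using k by blast
qed

lemma conj_by_inj:
  assumes "k \<in> K" "k' \<in> K" "h \<in> H" "h' \<in> H" "h \<noteq> \<one>" "conj_by k h = conj_by k' h'"
  shows "k = k' \<and> h = h'"
proof -
  have c: "k \<in> carrier G" "k' \<in> carrier G" "h \<in> carrier G" "h' \<in> carrier G" using assms by auto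
  have "conj_by (inv k' \<otimes> k) h = conj_by (inv k') (conj_by k h)" using c by (simp add: conj_by_conj_by)
  also have "\<dots> = h'" using assms(6) c by simp
  finally have e: "conj_by (inv k' \<otimes> k) h = h'" .
  have "inv k' \<otimes> k \<in> H"
    by (rule conj_by_mem_complement[OF assms(3,5)]) (use c in simp, simp only: e assms(4))
  then have "inv k' \<otimes> k = \<one>"
    using K_Int_H K.m_closed[OF K.m_inv_closed[OF assms(2)] assms(1)] by blast
  then have "k = k'" using c by (metis inv_closed inv_equality inv_inv)
  then show ?thesis using assms(6) c by simp
qed

text \<open>Elements outside \<open>K\<close> correspond bijectively to pairs of an element of
  \<open>K\<close> and a non-trivial element of \<open>H\<close>, the conjugation preserving
  orders.\<close>

lemma card_order_class:
  assumes n: "n \<noteq> 1" and none: "\<And>k. k \<in> K \<Longrightarrow> ord k \<noteq> n"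
  shows "card {x \<in> carrier G. ord x = n} = card K * card {h \<in> H. ord h = n}"
proof -
  have "bij_betw (\<lambda>(k, h). conj_by k h) (K \<times> {h \<in> H. ord h = n}) {x \<in> carrier G. ord x = n}"
    unfolding bij_betw_def
  proof
    show "inj_on (\<lambda>(k, h). conj_by k h) (K \<times> {h \<in> H. ord h = n})"
    proof (rule inj_onI, clarsimp)
      fix k h k' h' assume *: "k \<in> K" "h \<in> H" "k' \<in> K" "h' \<in> H" "conj_by k h = conj_by k' h'" "n = ord h"
      have "h \<noteq> \<one>" using *(6) n ord_id by metis
      then show "k = k' \<and> h = h'" using conj_by_inj * by blast
    qed
    show "(\<lambda>(k, h). conj_by k h) ` (K \<times> {h \<in> H. ord h = n}) = {x \<in> carrier G. ord x = n}"
    proof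
      show "{x \<in> carrier G. ord x = n} \<subseteq> (\<lambda>(k, h). conj_by k h) ` (K \<times> {h \<in> H. ord h = n})"
      proof
        fix x assume x: "x \<in> {x \<in> carrier G. ord x = n}"
        then have "x \<notin> K" using none by blast
        then obtain k h where kh: "k \<in> K" "h \<in> H" "x = conj_by k h" using outside_kernel x by blast
        moreover have "ord h = n" using x kh by auto
        ultimately show "x \<in> (\<lambda>(k, h). conj_by k h) ` (K \<times> {h \<in> H. ord h = n})"
          by (intro image_eqI[of _ _ "(k, h)"]) auto
      qed
    qed auto
  qed
  then have "card (K \<times> {h \<in> H. ord h = n}) = card {x \<in> carrier G. ord x = n}" by (rule bij_betw_same_card)
  then show ?thesis by (simp add: card_cartesian_product)
qed

lemma order_class_in_kernel:
  assumes n: "n \<noteq> 1" and k: "k \<in> K" "ord k = n"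
  shows "{x \<in> carrier G. ord x = n} = {x \<in> K. ord x = n}"
proof -
  have "x \<in> K" if x: "x \<in> carrier G" "ord x = n" for x
  proof (rule ccontr)
    assume "x \<notin> K"
    then obtain k' h where kh: "k' \<in> K" "h \<in> H" "x = conj_by k' h" using outside_kernel[OF x(1)] by blast
    then have "ord h = n" using x(2) ord_conj_by[OF K.mem_carrier H.mem_carrier] by metis
    then have "n dvd card H" "n dvd card K" using ord_H_dvd[OF kh(2)] ord_K_dvd[OF k(1)] k(2) by simp_all
    then have "n = 1" using coprime_card by (meson coprime_common_divisor_nat)
    then show False using n by simp
  qed
  then show ?thesis by auto
qed

text \<open>A class outside \<open>K\<close> is |K| times the corresponding class of
  \<open>H\<close>, and |G| = |K| |H|, so |K| cancels.\<close>

lemma perfect_order_classes_complement: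
  assumes "perfect_order_classes G"
  shows "perfect_order_classes (G\<lparr>carrier := H\<rparr>)"
  unfolding perfect_order_classes_def
proof (intro allI impI)
  fix n :: nat assume n0: "n > 0"
  let ?S = "{h \<in> H. ord h = n}"
  have "card ?S = 0 \<or> card ?S dvd card H"
  proof (cases "n = 1 \<or> card ?S = 0")
    case True
    have "{h \<in> H. ord h = 1} = {\<one>}" using ord_eq_1 by auto
    then show ?thesis using True by auto
  next
    case False
    then have "?S \<noteq> {}" by (metis card.empty)
    then obtain h where h: "h \<in> H" "ord h = n" by blast
    have none: "ord k \<noteq> n" if "k \<in> K" for k
    proof
      assume "ord k = n"
      then have "n dvd card H" "n dvd card K" using ord_H_dvd[of h] ord_K_dvd[of k] h that by auto
      then show False using False coprime_card by (metis coprime_common_divisor_nat)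
    qed
    have e: "card {x \<in> carrier G. ord x = n} = card K * card ?S" using card_order_class[OF _ none] False by blast
    have "card K \<noteq> 0" using finite_K K.one_closed by (metis card_0_eq empty_iff)
    moreover have "card {x \<in> carrier G. ord x = n} = 0 \<or> card {x \<in> carrier G. ord x = n} dvd order G"
      using assms n0 by (simp add: perfect_order_classes_def)
    ultimately show ?thesis using e order_eq by auto
  qed
  then show "card {x \<in> carrier (G\<lparr>carrier := H\<rparr>). group.ord (G\<lparr>carrier := H\<rparr>) x = n} = 0 \<or>
     card {x \<in> carrier (G\<lparr>carrier := H\<rparr>). group.ord (G\<lparr>carrier := H\<rparr>) x = n} dvd order (G\<lparr>carrier := H\<rparr>)"
    by (simp add: ord_subgroup[OF H_subgroup] order_def)
qed

text \<open>The map sending k to its inverse times its conjugate by z is injective on the finite set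
  \<open>K\<close> because z fixes no non-trivial k; so it is onto, and z visibly inverts each of
  its values.\<close>

lemma involution_inverts:
  assumes z: "z \<in> H" "ord z = 2" and k: "k \<in> K"
  shows "conj_by z k = inv k"
proof -
  have zc: "z \<in> carrier G" and z1: "z \<noteq> \<one>" using z ord_id by auto
  have zz: "z \<otimes> z = \<one>" using pow_ord_eq_1[OF zc] z by (simp add: numeral_2_eq_2)
  let ?f = "\<lambda>k. inv k \<otimes> conj_by z k"
  have "inj_on ?f K"
  proof (rule inj_onI)
    fix k k' assume k: "k \<in> K" "k' \<in> K" "?f k = ?f k'"
    have c: "k \<in> carrier G" "k' \<in> carrier G" using k by auto
    have "k' \<otimes> (inv k \<otimes> conj_by z k) \<otimes> inv (conj_by z k) = k' \<otimes> (inv k' \<otimes> conj_by z k') \<otimes> inv (conj_by z k)"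
      using k(3) by simp
    then have e: "k' \<otimes> inv k = conj_by z k' \<otimes> inv (conj_by z k)" using c zc by (simp add: word_simps)
    have "conj_by z (k' \<otimes> inv k) = conj_by z k' \<otimes> inv (conj_by z k)" using c zc by (simp add: conj_by_mult conj_by_inv)
    then have "conj_by z (k' \<otimes> inv k) = k' \<otimes> inv k" by (simp only: e)
    then have "k' \<otimes> inv k = \<one>" using free[OF z(1), of "k' \<otimes> inv k"] k z1 by auto
    then show "k = k'" using c by (metis inv_closed inv_equality inv_inv)
  qed
  moreover have "?f ` K \<subseteq> K" using conj_by_K[OF zc] by auto
  ultimately have "?f ` K = K" by (rule endo_inj_surj[OF finite_K, rotated])
  then obtain k' where k': "k' \<in> K" "k = ?f k'" using k by (metis (no_types, lifting) imageE)
  have "conj_by z k = conj_by z (inv k') \<otimes> conj_by z (conj_by z k')" using k' zc by (simp add: conj_by_mult)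
  also have "\<dots> = inv (conj_by z k') \<otimes> k'" using k' zc zz by (simp add: conj_by_conj_by conj_by_inv)
  also have "\<dots> = inv k" using k' zc by (simp add: inv_mult_group)
  finally show ?thesis .
qed

text \<open>The product of two involutions of \<open>H\<close> fixes \<open>K\<close> pointwise, so
  it is trivial. Inversion on \<open>K\<close> is conjugation by an involution, hence a
  homomorphism, which forces \<open>K\<close> to be abelian.\<close>

lemma even_complement:
  assumes "even (card H)"
  shows "\<exists>z\<in>H. unique_involution (G\<lparr>carrier := H\<rparr>) z \<and> ord z = 2"
    and "\<And>k k'. k \<in> K \<Longrightarrow> k' \<in> K \<Longrightarrow> k \<otimes> k' = k' \<otimes> k"
proof -
  interpret HG: group "G\<lparr>carrier := H\<rparr>" by (rule H_group)
  obtain z where z: "z \<in> H" "ord z = 2"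
    using HG.exists_elem_of_prime_order[of 2] finite_H assms by (auto simp: order_def ord_subgroup[OF H_subgroup])
  have uniq: "z' = z" if z': "z' \<in> H" "ord z' = 2" for z'
  proof -
    obtain k where k: "k \<in> K" "k \<noteq> \<one>" using K_nontrivial by blast
    have c: "z \<in> carrier G" "z' \<in> carrier G" "k \<in> carrier G" using z(1) z'(1) k(1) by auto
    have "conj_by (z \<otimes> z') k = conj_by z (conj_by z' k)" by (simp add: c conj_by_conj_by)
    also have "\<dots> = inv (inv k)"
      unfolding involution_inverts[OF z' k(1)] by (rule involution_inverts[OF z K.m_inv_closed[OF k(1)]])
    also have "\<dots> = k" by (simp add: c)
    finally have e: "z \<otimes> z' = \<one>" by (rule free[OF H.m_closed[OF z(1) z'(1)] k])
    have "z [^] (2::nat) = \<one>" using pow_ord_eq_1[OF c(1)] z(2) by simp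
    then have "z \<otimes> z = z \<otimes> z'" using e c by (simp add: numeral_2_eq_2)
    then show ?thesis using c by simp
  qed
  have "unique_involution (G\<lparr>carrier := H\<rparr>) z"
  proof (intro unique_involution.intro unique_involution_axioms.intro HG.is_group)
    fix x assume "x \<in> carrier (G\<lparr>carrier := H\<rparr>)" "group.ord (G\<lparr>carrier := H\<rparr>) x = 2"
    then show "x = z" by (intro uniq) (simp_all add: ord_subgroup[OF H_subgroup])
  qed (simp_all add: z finite_H ord_subgroup[OF H_subgroup])
  then show "\<exists>z\<in>H. unique_involution (G\<lparr>carrier := H\<rparr>) z \<and> ord z = 2" using z by blast
  fix k k' assume k: "k \<in> K" "k' \<in> K"
  then have c: "k \<in> carrier G" "k' \<in> carrier G" by auto
  have "inv (k \<otimes> k') = conj_by z (k \<otimes> k')" using involution_inverts[OF z K.m_closed[OF k]] by simp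
  also have "\<dots> = inv k \<otimes> inv k'" using involution_inverts[OF z k(1)] involution_inverts[OF z k(2)] c H.mem_carrier[OF z(1)]
    by (simp add: conj_by_mult)
  also have "\<dots> = inv (k' \<otimes> k)" using c by (simp add: inv_mult_group)
  finally show "k \<otimes> k' = k' \<otimes> k" using c by (metis inv_inv m_closed)
qed

text \<open>If \<open>x\<close>, \<open>y\<close> generated an elementary abelian group of order 9, then over the ring of endomorphisms of \<open>K\<close>
  one would have \<open>(x - y)(x - y\<^sup>2) = x\<^sup>2 + x + 1 = 0\<close> with both factors injective.\<close>

lemma no_elementary_abelian_nine:
  assumes abelian: "\<And>k k'. k \<in> K \<Longrightarrow> k' \<in> K \<Longrightarrow> k \<otimes> k' = k' \<otimes> k"
    and x: "x \<in> H" "ord x = 3" and y: "y \<in> H" "ord y = 3" and xy: "x \<otimes> y = y \<otimes> x"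
  shows "y = x \<or> y = x \<otimes> x"
proof (rule ccontr)
  assume n: "\<not> ?thesis"
  interpret HG: group "G\<lparr>carrier := H\<rparr>" by (rule H_group)
  interpret KC: comm_group "G\<lparr>carrier := K\<rparr>"
    by (rule group.group_comm_groupI[OF K_group]) (use abelian in auto)
  have cube: "g \<otimes> (g \<otimes> g) = \<one>" "g \<noteq> \<one>" if "g \<in> H" "ord g = 3" for g
  proof -
    show "g \<otimes> (g \<otimes> g) = \<one>" using pow_ord_eq_1[of g] that by (simp add: numeral_3_eq_3 m_assoc)
    show "g \<noteq> \<one>" using that ord_id by auto
  qed
  have c: "x \<in> carrier G" "y \<in> carrier G" using x y by auto
  \<comment> \<open>The product is invariant under g, which permutes its three factors; a fixed
    element of \<open>K\<close> is trivial. Additively this is 1 + g + g^2 = 0.\<close>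
  have trace: "k \<otimes> conj_by g k \<otimes> conj_by (g \<otimes> g) k = \<one>" if g: "g \<in> H" "ord g = 3" and k: "k \<in> K" for g k
  proof -
    let ?t = "k \<otimes> conj_by g k \<otimes> conj_by (g \<otimes> g) k"
    have gc: "g \<in> carrier G" "k \<in> carrier G" using g k by auto
    have K3: "conj_by g k \<in> K" "conj_by (g \<otimes> g) k \<in> K" using conj_by_K gc k by auto
    have "conj_by g ?t = conj_by g k \<otimes> conj_by (g \<otimes> g) k \<otimes> conj_by (g \<otimes> (g \<otimes> g)) k"
      using gc by (simp add: conj_by_mult conj_by_conj_by)
    also have "\<dots> = conj_by g k \<otimes> conj_by (g \<otimes> g) k \<otimes> k" using cube[OF g] gc by simp
    also have "\<dots> = ?t" using abelian[of "conj_by g k \<otimes> conj_by (g \<otimes> g) k" k] K3 k gc by (simp add: m_assoc)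
    finally show "?t = \<one>" using free[OF g(1), of ?t] cube(2)[OF g] K3 k by blast
  qed
  obtain v where v: "v \<in> K" "v \<noteq> \<one>" using K_nontrivial by blast
  have vc: "v \<in> carrier G" using v by auto
  \<comment> \<open>Additively u = (x - y)v. It is non-zero since x and y differ, and the vanishing
    product gives x u = y^2 u, so freeness yields x = y^2.\<close>
  define u where "u = conj_by x v \<otimes> inv (conj_by y v)"
  have uK: "u \<in> K" using v c conj_by_K unfolding u_def by blast
  have inj: "g = g'" if "g \<in> H" "g' \<in> H" "k \<in> K" "k \<noteq> \<one>" "conj_by g k = conj_by g' k" for g g' k
  proof -
    have gc: "g \<in> carrier G" "g' \<in> carrier G" "k \<in> carrier G" using that by auto
    have "conj_by (inv g' \<otimes> g) k = conj_by (inv g') (conj_by g k)" using gc by (simp add: conj_by_conj_by)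
    then have "conj_by (inv g' \<otimes> g) k = k" using that(5) gc by simp
    then have "inv g' \<otimes> g = \<one>" using free[of "inv g' \<otimes> g" k] that by blast
    then show ?thesis using gc by (metis inv_closed inv_equality inv_inv)
  qed
  have u1: "u \<noteq> \<one>"
  proof
    assume "u = \<one>"
    then have "conj_by x v = conj_by y v" using c vc unfolding u_def by (metis conj_by_closed inv_closed inv_equality inv_inv)
    then have "x = y" using inj x y v by blast
    then show False using n by simp
  qed
  let ?a = "conj_by (x \<otimes> x) v" and ?b = "conj_by x v" and ?p = "conj_by (x \<otimes> y) v" and ?q = "conj_by (x \<otimes> (y \<otimes> y)) v"
  have cl: "?a \<in> K" "?b \<in> K" "?p \<in> K" "?q \<in> K" using conj_by_K c v by auto
  have clG: "?a \<in> carrier G" "?b \<in> carrier G" "?p \<in> carrier G" "?q \<in> carrier G" using cl by auto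
  have "conj_by x u = ?a \<otimes> inv ?p" using c vc unfolding u_def by (simp add: conj_by_mult conj_by_inv conj_by_conj_by)
  moreover have "conj_by (y \<otimes> y) u = ?q \<otimes> inv v"
  proof -
    have "y \<otimes> y \<otimes> x = x \<otimes> (y \<otimes> y)" using xy c by (metis m_assoc)
    moreover have "y \<otimes> y \<otimes> y = \<one>" using cube[OF y] c by (simp add: m_assoc)
    ultimately show ?thesis using c vc unfolding u_def by (simp add: conj_by_mult conj_by_inv conj_by_conj_by)
  qed
  moreover have "?a \<otimes> inv ?p = ?q \<otimes> inv v"
  proof -
    have bpq: "?b \<otimes> ?p \<otimes> ?q = \<one>"
    proof -
      have "?b \<otimes> ?p \<otimes> ?q = conj_by x (v \<otimes> conj_by y v \<otimes> conj_by (y \<otimes> y) v)"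
        using c vc by (simp add: conj_by_mult conj_by_conj_by)
      then show ?thesis using trace[OF y v(1)] c by simp
    qed
    have vba: "v \<otimes> ?b \<otimes> ?a = \<one>" using trace[OF x v(1)] .
    have e1: "inv ?p = ?b \<otimes> ?q"
    proof (rule inv_equality)
      have "?b \<otimes> ?q \<otimes> ?p = ?b \<otimes> ?p \<otimes> ?q" using abelian[of ?q ?p] cl clG by (simp add: m_assoc)
      then show "?b \<otimes> ?q \<otimes> ?p = \<one>" using bpq by simp
    qed (use clG in auto)
    have e2: "inv v = ?a \<otimes> ?b"
    proof (rule inv_equality)
      have "?a \<otimes> ?b \<otimes> v = v \<otimes> ?b \<otimes> ?a"
        using abelian[of ?a ?b] abelian[of "?b \<otimes> ?a" v] cl clG v vc by (simp add: m_assoc)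
      then show "?a \<otimes> ?b \<otimes> v = \<one>" using vba by simp
    qed (use clG vc in auto)
    have "?a \<otimes> (?b \<otimes> ?q) = ?q \<otimes> (?a \<otimes> ?b)"
      using abelian[of "?a \<otimes> ?b" ?q] cl clG by (simp add: m_assoc)
    then show ?thesis unfolding e1 e2 .
  qed
  ultimately have "conj_by x u = conj_by (y \<otimes> y) u" by simp
  then have "x = y \<otimes> y" using inj[of x "y \<otimes> y" u] x y uK u1 by blast
  then have "x \<otimes> x = y \<otimes> (y \<otimes> (y \<otimes> y))" using c by (simp add: m_assoc)
  then have "x \<otimes> x = y" using cube[OF y] c by simp
  then show False using n by simp
qed

end

subsection \<open>Homocyclic groups\<close>

lemma prime_powerI:
  fixes n p :: nat
  assumes "n > 0" "Factorial_Ring.prime p" "\<And>l. Factorial_Ring.prime l \<Longrightarrow> l dvd n \<Longrightarrow> l = p"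
  shows "\<exists>m. n = p ^ m"
proof -
  have "prime_factors n \<subseteq> {p}" using assms by (auto simp: prime_factors_dvd)
  then have "n = p ^ multiplicity p n"
    using prime_factorization_nat[of n] assms(1,2)
    by (cases "prime_factors n = {}") (auto simp: subset_singleton_iff prime_factorization_empty_iff)
  then show ?thesis by blast
qed

lemma product_le_eq:
  fixes a b m n :: nat
  assumes "m * n \<le> a * b" "a \<le> m" "b \<le> n" "m > 0" "n > 0"
  shows "a = m \<and> b = n"
proof -
  have "a * b \<le> a * n" "a * b \<le> m * b" using assms by simp_all
  then have "m * n \<le> a * n" "m * n \<le> m * b" using assms(1) by linarith+
  then show ?thesis using assms by simp
qed

lemma (in group) ord_mult_coprime:
  assumes x: "x \<in> carrier G" and y: "y \<in> carrier G" and xy: "x \<otimes> y = y \<otimes> x" and cop: "coprime (ord x) (ord y)"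
  shows "ord (x \<otimes> y) = ord x * ord y"
proof (rule dvd_antisym)
  show "ord (x \<otimes> y) dvd ord x * ord y" using ord_mul_divides[OF xy x y] .
  let ?k = "ord (x \<otimes> y)"
  have k: "x [^] (?k * n) \<otimes> y [^] (?k * n) = \<one>" for n
  proof -
    have "(x \<otimes> y) [^] (?k * n) = \<one>" using x y pow_eq_id[of "x \<otimes> y"] by simp
    then show ?thesis unfolding pow_mult_distrib[OF xy x y] .
  qed
  have "y [^] (?k * ord y) = \<one>" using y pow_eq_id by simp
  then have "x [^] (?k * ord y) = \<one>" using k[of "ord y"] x by simp
  then have "ord x dvd ?k" using pow_eq_id[OF x] cop by (simp add: coprime_dvd_mult_left_iff)
  moreover have "x [^] (?k * ord x) = \<one>" using x pow_eq_id by simp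
  then have "y [^] (?k * ord x) = \<one>" using k[of "ord x"] y by simp
  then have "ord y dvd ?k" using pow_eq_id[OF y] cop by (simp add: coprime_dvd_mult_left_iff coprime_commute)
  ultimately show "ord x * ord y dvd ?k" using cop by (simp add: divides_mult)
qed

context comm_group
begin

lemma card_order_class_mult:
  assumes fin: "finite (carrier G)" and cop: "coprime m n" and pos: "m > 0" "n > 0"
  shows "card {x \<in> carrier G. ord x = m * n} = card {x \<in> carrier G. ord x = m} * card {x \<in> carrier G. ord x = n}"
proof -
  let ?A = "{x \<in> carrier G. ord x = m}" and ?B = "{x \<in> carrier G. ord x = n}"
  \<comment> \<open>The Chinese remainder exponents u and v pick out the components of order m and n
    as powers of the product.\<close>
  obtain u where u: "[u = 1] (mod m)" "[u = 0] (mod n)" using binary_chinese_remainder_nat[OF cop] by blast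
  obtain v where v: "[v = 0] (mod m)" "[v = 1] (mod n)" using binary_chinese_remainder_nat[OF cop] by blast
  have proj: "(x \<otimes> y) [^] u = x" "(x \<otimes> y) [^] v = y" if "x \<in> ?A" "y \<in> ?B" for x y
  proof -
    have "x [^] u = x [^] (1::nat)" "x [^] v = x [^] (0::nat)" "y [^] u = y [^] (0::nat)" "y [^] v = y [^] (1::nat)"
      using u v that pow_eq_pow_iff[of x] pow_eq_pow_iff[of y] by blast+
    then show "(x \<otimes> y) [^] u = x" "(x \<otimes> y) [^] v = y" using that by (simp_all add: nat_pow_distrib nat_pow_eone)
  qed
  have "bij_betw (\<lambda>(x, y). x \<otimes> y) (?A \<times> ?B) {x \<in> carrier G. ord x = m * n}"
  proof (rule bij_betw_byWitness[where f' = "\<lambda>g. (g [^] u, g [^] v)"])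
    show "\<forall>a\<in>?A \<times> ?B. (\<lambda>g. (g [^] u, g [^] v)) (case a of (x, y) \<Rightarrow> x \<otimes> y) = a"
      using proj by auto
    have uv: "g [^] u \<otimes> g [^] v = g" if g: "g \<in> carrier G" "ord g = m * n" for g
    proof -
      have "[u + v = 1 + 0] (mod m)" "[u + v = 0 + 1] (mod n)" using u v by (intro cong_add; simp)+
      then have "[u + v = 1] (mod m * n)" using cop by (intro coprime_cong_mult_nat) simp_all
      then have "g [^] (u + v) = g [^] (1::nat)" using pow_eq_pow_iff[OF g(1)] g(2) by metis
      then show ?thesis using g by (simp add: nat_pow_mult nat_pow_eone)
    qed
    then show "\<forall>g\<in>{x \<in> carrier G. ord x = m * n}. (case (g [^] u, g [^] v) of (x, y) \<Rightarrow> x \<otimes> y) = g" by simp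
    show "(\<lambda>(x, y). x \<otimes> y) ` (?A \<times> ?B) \<subseteq> {x \<in> carrier G. ord x = m * n}"
      using ord_mult_coprime m_comm cop by auto
    show "(\<lambda>g. (g [^] u, g [^] v)) ` {x \<in> carrier G. ord x = m * n} \<subseteq> ?A \<times> ?B"
    proof
      fix a assume "a \<in> (\<lambda>g. (g [^] u, g [^] v)) ` {x \<in> carrier G. ord x = m * n}"
      then obtain g where g: "g \<in> carrier G" "ord g = m * n" "a = (g [^] u, g [^] v)" by blast
      have "n dvd u" "m dvd v" using u v by (simp_all add: cong_0_iff)
      then have "ord g dvd u * m" "ord g dvd v * n" using g(2) by (auto simp: mult_ac)
      then have "(g [^] u) [^] m = \<one>" "(g [^] v) [^] n = \<one>" using g(1) pow_eq_id by (simp_all add: nat_pow_pow)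
      then have d: "ord (g [^] u) dvd m" "ord (g [^] v) dvd n" using g(1) pow_eq_id by simp_all
      have "m * n dvd ord (g [^] u) * ord (g [^] v)"
        using abelian_ord_mul_divides[of "g [^] u" "g [^] v"] uv[OF g(1,2)] g by simp
      then have "m * n \<le> ord (g [^] u) * ord (g [^] v)" using d pos by (intro dvd_imp_le) (auto intro: Nat.gr0I)
      moreover have "ord (g [^] u) \<le> m" "ord (g [^] v) \<le> n" using d pos by (auto intro: dvd_imp_le)
      ultimately have "ord (g [^] u) = m \<and> ord (g [^] v) = n"
        using product_le_eq pos by blast
      then show "a \<in> ?A \<times> ?B" using g by simp
    qed
  qed
  then have "card (?A \<times> ?B) = card {x \<in> carrier G. ord x = m * n}" by (rule bij_betw_same_card)
  then show ?thesis by (simp add: card_cartesian_product)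
qed

lemma roots_subgroup: "subgroup {x \<in> carrier G. x [^] (n::nat) = \<one>} G"
  by (rule subgroupI) (auto simp: nat_pow_distrib nat_pow_inv intro!: exI[of _ \<one>])

end

lemma product_group_pow:
  assumes "\<And>i. i \<in> I \<Longrightarrow> group (A i)" "x \<in> carrier (product_group I A)"
  shows "x [^]\<^bsub>product_group I A\<^esub> (n::nat) = (\<lambda>i\<in>I. x i [^]\<^bsub>A i\<^esub> n)"
  by (induction n) (auto simp: fun_eq_iff restrict_def)

lemma cyclic_power_group: "comm_group (cyclic_power n r)"
proof (rule group.group_comm_groupI)
  show "group (cyclic_power n r)" by simp
qed (auto simp: add.commute)

lemma cyclic_power_carrier: "n > 0 \<Longrightarrow> carrier (cyclic_power n r) = ({..<r} \<rightarrow>\<^sub>E {0..<int n})"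
  by (simp add: carrier_integer_mod_group)

lemma card_multiples:
  fixes c d :: int
  assumes d: "d > 0"
  shows "card {m \<in> {0..<d * c}. d dvd m} = nat c"
proof -
  have "bij_betw (\<lambda>m. d * m) {0..<c} {m \<in> {0..<d * c}. d dvd m}"
    unfolding bij_betw_def
  proof
    show "inj_on (\<lambda>m. d * m) {0..<c}" using d by (simp add: inj_on_def)
    show "(\<lambda>m. d * m) ` {0..<c} = {m \<in> {0..<d * c}. d dvd m}"
      using d by (auto simp: zero_le_mult_iff elim!: dvdE)
  qed
  then have "card {0..<c} = card {m \<in> {0..<d * c}. d dvd m}" by (rule bij_betw_same_card)
  then show ?thesis by simp
qed

text \<open>The condition splits over coordinates, and in each one it says that the entry is a
  multiple of p^(k-i).\<close>

lemma cyclic_power_roots: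
  fixes p :: nat
  assumes p: "p > 0" and i: "i \<le> k"
  shows "card {x \<in> carrier (cyclic_power (p ^ k) r). x [^]\<^bsub>cyclic_power (p ^ k) r\<^esub> (p ^ i) = \<one>\<^bsub>cyclic_power (p ^ k) r\<^esub>} = p ^ (i * r)"
proof -
  let ?S = "{m \<in> {0..<int (p ^ k)}. int (p ^ (k - i)) dvd m}"
  have k: "p ^ k = p ^ i * p ^ (k - i)" using i by (simp flip: power_add)
  have dvd: "int (p ^ k) dvd int (p ^ i) * m \<longleftrightarrow> int (p ^ (k - i)) dvd m" for m
    using p unfolding k by simp
  have "{x \<in> carrier (cyclic_power (p ^ k) r). x [^]\<^bsub>cyclic_power (p ^ k) r\<^esub> (p ^ i) = \<one>\<^bsub>cyclic_power (p ^ k) r\<^esub>}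
    = ({..<r} \<rightarrow>\<^sub>E ?S)" (is "?L = ?R")
  proof -
    have "x [^]\<^bsub>cyclic_power (p ^ k) r\<^esub> (p ^ i) = \<one>\<^bsub>cyclic_power (p ^ k) r\<^esub> \<longleftrightarrow> (\<forall>j<r. int (p ^ (k - i)) dvd x j)"
      if x: "x \<in> carrier (cyclic_power (p ^ k) r)" for x
    proof -
      have a: "x [^]\<^bsub>cyclic_power (p ^ k) r\<^esub> (p ^ i) = (\<lambda>j\<in>{..<r}. (int (p ^ i) * x j) mod int (p ^ k))"
        using product_group_pow[OF _ x, of "p ^ i"] by (simp add: restrict_def fun_eq_iff)
      have "(\<lambda>j\<in>{..<r}. (int (p ^ i) * x j) mod int (p ^ k)) = \<one>\<^bsub>cyclic_power (p ^ k) r\<^esub>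
          \<longleftrightarrow> (\<forall>j<r. (int (p ^ i) * x j) mod int (p ^ k) = 0)"
        by (auto simp: fun_eq_iff restrict_def)
      then show ?thesis unfolding a by (simp only: mod_eq_0_iff_dvd dvd)
    qed
    note roots = this
    have pk: "p ^ k > 0" using p by (rule zero_less_power)
    show ?thesis
    proof (rule Set.set_eqI)
      fix x
      have "x \<in> ?L \<longleftrightarrow> x \<in> carrier (cyclic_power (p ^ k) r) \<and> (\<forall>j<r. int (p ^ (k - i)) dvd x j)"
        using roots by blast
      then show "x \<in> ?L \<longleftrightarrow> x \<in> ?R"
        unfolding cyclic_power_carrier[OF pk] by (auto simp: PiE_iff)
    qed
  qed
  moreover have "card ?S = p ^ i"
  proof -
    have "int (p ^ k) = int (p ^ (k - i)) * int (p ^ i)"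
      unfolding k of_nat_mult by (rule mult.commute)
    then show ?thesis using card_multiples[of "int (p ^ (k - i))" "int (p ^ i)"] p
      by (simp only: nat_int of_nat_0_less_iff zero_less_power)
  qed
  ultimately show ?thesis by (simp only: card_PiE finite_lessThan prod_constant card_lessThan power_mult)
qed

lemma cyclic_power_card: "p > 0 \<Longrightarrow> card (carrier (cyclic_power (p ^ k) r)) = (p::nat) ^ (k * r)"
  by (simp add: cyclic_power_carrier card_PiE power_mult del: carrier_product_group of_nat_power)

context comm_group
begin

text \<open>An embedding of \<open>(\<int>/p\<^sup>k)\<^sup>n\<close> extends by one more generator \<open>e\<close> as long as its image misses some element
  \<open>w = e\<^bsup>p^(k-1)\<^esup>\<close> of order \<open>p\<close>.\<close>

lemma extend_homocyclic_embedding: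
  assumes fin: "finite (carrier G)" and p: "Factorial_Ring.prime p" and k: "k > 0"
    and exponent: "\<And>x. x \<in> carrier G \<Longrightarrow> x [^] (p ^ k) = \<one>"
    and f: "f \<in> hom (cyclic_power (p ^ k) n) G" "inj_on f (carrier (cyclic_power (p ^ k) n))"
    and e: "e \<in> carrier G" and w: "e [^] (p ^ (k - 1)) \<notin> f ` carrier (cyclic_power (p ^ k) n)"
  shows "\<exists>f'\<in>hom (cyclic_power (p ^ k) (Suc n)) G. inj_on f' (carrier (cyclic_power (p ^ k) (Suc n)))"
proof -
  let ?C = "cyclic_power (p ^ k) n" and ?C' = "cyclic_power (p ^ k) (Suc n)"
  have C: "group ?C" "group ?C'" by simp_all
  interpret f: group_hom ?C G f
    by (intro group_hom.intro group_hom_axioms.intro C is_group f(1))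
  note carrier_product_group [simp del] one_product_group [simp del] mult_product_group [simp del] of_nat_power [simp del]
  have pk: "p ^ k > 0" using p prime_gt_0_nat by simp
  note carr = cyclic_power_carrier[OF pk]
  \<comment> \<open>The new last coordinate becomes the exponent of \<open>e\<close>.\<close>
  define f' where "f' a = f (restrict a {..<n}) \<otimes> e [^] (a n)" for a :: "nat \<Rightarrow> int"
  have restr: "restrict a {..<n} \<in> carrier ?C" if "a \<in> carrier ?C'" for a
    using that unfolding carr by (auto simp: PiE_iff)
  have "ord e dvd p ^ k" by (rule pow_eq_id[OF e, THEN iffD1, OF exponent[OF e]])
  then have e_mod: "e [^] (m mod int (p ^ k)) = e [^] m" for m :: int
  proof -
    have "int (ord e) dvd int (p ^ k)" using \<open>ord e dvd p ^ k\<close> by (simp only: int_dvd_int_iff)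
    then have "int (ord e) dvd m - m mod int (p ^ k)" using dvd_minus_mod dvd_trans by blast
    then show ?thesis using int_pow_eq[OF e, of "m mod int (p ^ k)" m] by blast
  qed
  have hom: "f' \<in> hom ?C' G"
  proof (rule homI)
    fix a b assume a: "a \<in> carrier ?C'" and b: "b \<in> carrier ?C'"
    have r: "restrict (a \<otimes>\<^bsub>?C'\<^esub> b) {..<n} = restrict a {..<n} \<otimes>\<^bsub>?C\<^esub> restrict b {..<n}"
      by (auto simp: fun_eq_iff mult_product_group)
    have rn: "(a \<otimes>\<^bsub>?C'\<^esub> b) n = (a n + b n) mod int (p ^ k)" by (simp add: mult_product_group)
    have "f' (a \<otimes>\<^bsub>?C'\<^esub> b) = f (restrict a {..<n} \<otimes>\<^bsub>?C\<^esub> restrict b {..<n}) \<otimes> e [^] ((a n + b n) mod int (p ^ k))"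
      unfolding f'_def r rn by (rule refl)
    also have "\<dots> = f (restrict a {..<n}) \<otimes> f (restrict b {..<n}) \<otimes> (e [^] a n \<otimes> e [^] b n)"
      using restr[OF a] restr[OF b] e by (simp only: f.hom_mult e_mod int_pow_mult)
    also have "\<dots> = f' a \<otimes> f' b"
      using f.hom_closed[OF restr[OF a]] f.hom_closed[OF restr[OF b]] e unfolding f'_def by (simp add: m_ac)
    finally show "f' (a \<otimes>\<^bsub>?C'\<^esub> b) = f' a \<otimes> f' b" .
  next
    fix a assume "a \<in> carrier ?C'"
    then show "f' a \<in> carrier G"
      unfolding f'_def by (intro m_closed f.hom_closed restr int_pow_closed e)
  qed
  interpret f': group_hom ?C' G f'
    by (intro group_hom.intro group_hom_axioms.intro C is_group hom)
  have I: "subgroup (f ` carrier ?C) G" by (rule f.img_is_subgroup)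
  have "inj_on f' (carrier ?C')"
    unfolding f'.inj_on_one_iff
  proof (intro allI impI)
    fix a assume a: "a \<in> carrier ?C'" and "f' a = \<one>"
    have an: "0 \<le> a n" "a n < int (p ^ k)" using a by (auto simp: carr PiE_iff)
    then obtain c where c: "a n = int c" "c < p ^ k" by (metis nonneg_int_cases of_nat_less_iff)
    have fa: "f (restrict a {..<n}) \<in> f ` carrier ?C" using restr[OF a] by blast
    have faG: "f (restrict a {..<n}) \<in> carrier G" using f.hom_closed[OF restr[OF a]] .
    have eq: "f (restrict a {..<n}) \<otimes> e [^] c = \<one>" using \<open>f' a = \<one>\<close> c by (simp add: f'_def int_pow_int)
    \<comment> \<open>If c = p^j c' with c' prime to p and j < k, the relation puts e^c into the
      image. Raising to the power p^(k-1-j) gives w^c', and since c' is invertible modulo the order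
      of w, also w itself.\<close>
    have c0: "c = 0"
    proof (rule ccontr)
      assume "c \<noteq> 0"
      have np: "\<not> is_unit p" using p by auto
      obtain c' where c': "c = p ^ multiplicity p c * c'" "\<not> p dvd c'"
        using multiplicity_decompose'[OF _ np, of c] \<open>c \<noteq> 0\<close> by metis
      let ?j = "multiplicity p c"
      have "p ^ ?j dvd c" by (rule multiplicity_dvd)
      then have "p ^ ?j \<le> c" using \<open>c \<noteq> 0\<close> by (intro dvd_imp_le) auto
      then have "p ^ ?j < p ^ k" using c by simp
      then have jk: "?j < k" using p prime_gt_1_nat power_less_imp_less_exp by blast
      have "e [^] c = inv (f (restrict a {..<n}))" using eq faG e by (metis inv_equality inv_inv inv_closed m_comm nat_pow_closed)
      then have "e [^] c \<in> f ` carrier ?C" using subgroup.m_inv_closed[OF I fa] by simp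
      then have "(e [^] c) [^] (p ^ (k - 1 - ?j)) \<in> f ` carrier ?C" by (rule subgroup_pow_closed[OF I])
      moreover have "c * p ^ (k - 1 - ?j) = p ^ (k - 1) * c'"
      proof -
        have "c * p ^ (k - 1 - ?j) = (p ^ ?j * p ^ (k - 1 - ?j)) * c'" by (subst c'(1)) (simp only: mult_ac)
        then show ?thesis using jk by (simp flip: power_add)
      qed
      ultimately have wc: "(e [^] (p ^ (k - 1))) [^] c' \<in> f ` carrier ?C" using e by (simp add: nat_pow_pow)
      let ?w = "e [^] (p ^ (k - 1))"
      have "?w [^] p = \<one>" using exponent[OF e] e by (simp only: nat_pow_pow power_minus_mult[OF k])
      then have "ord ?w dvd p" using pow_eq_id e by simp
      moreover have "coprime c' p" using c'(2) p by (metis coprime_commute prime_imp_coprime)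
      ultimately have "coprime c' (ord ?w)" by (meson coprime_divisors dvd_refl)
      then obtain d where "[c' * d = 1] (mod ord ?w)" using cong_solve_coprime_nat[of c' "ord ?w"] by auto
      then have "?w [^] (c' * d) = ?w [^] (1::nat)" using pow_eq_pow_iff[of ?w] e by blast
      then have "(?w [^] c') [^] d = ?w" using e by (simp add: nat_pow_pow nat_pow_eone mult.assoc)
      then show False using subgroup_pow_closed[OF I wc, of d] w by simp
    qed
    then have "f (restrict a {..<n}) = \<one>" using eq faG by simp
    then have r: "restrict a {..<n} = \<one>\<^bsub>?C\<^esub>"
      using f(2) restr[OF a] f.inj_on_one_iff by blast
    show "a = \<one>\<^bsub>?C'\<^esub>"
    proof (rule extensionalityI[of _ "{..<Suc n}"])
      fix l assume l: "l \<in> {..<Suc n}"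
      show "a l = \<one>\<^bsub>?C'\<^esub> l"
      proof (cases "l = n")
        case True then show ?thesis using c c0 by (simp add: one_product_group)
      next
        case False
        then have "l < n" using l by simp
        then show ?thesis using fun_cong[OF r, of l] by (simp add: one_product_group)
      qed
    qed (use a in \<open>auto simp: carr PiE_iff one_product_group\<close>)
  qed
  then show ?thesis using hom by blast
qed

text \<open>An embedded power of rank n < r contains only p^n solutions of x^p = 1, so it misses
  one, and by counting every such solution is a p^(k-1)-th power. The embedding can thus be extended
  until the rank is r, where the cardinalities agree.\<close>

theorem homocyclic_iso:
  assumes fin: "finite (carrier G)" and p: "Factorial_Ring.prime p" and k: "k > 0"
    and card: "\<And>i. i \<le> k \<Longrightarrow> card {x \<in> carrier G. x [^] (p ^ i) = \<one>} = p ^ (i * r)"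
    and order: "order G = p ^ (k * r)"
  shows "cyclic_power (p ^ k) r \<cong> G"
proof -
  have p0: "p > 0" and p1: "p > 1" using p prime_gt_0_nat prime_gt_1_nat by auto
  have "{x \<in> carrier G. x [^] (p ^ k) = \<one>} = carrier G"
    using card[of k] order fin by (intro card_subset_eq) (auto simp: order_def)
  then have exponent: "x [^] (p ^ k) = \<one>" if "x \<in> carrier G" for x using that by blast
  let ?O = "\<lambda>i. {x \<in> carrier G. x [^] (p ^ i) = \<one>}"
  \<comment> \<open>The kernel of the power map has p^((k-1)r) elements, so the image has p^r, as
    many as there are solutions of x^p = 1.\<close>
  have im: "(\<lambda>x. x [^] (p ^ (k - 1))) ` carrier G = ?O 1"
  proof -
    let ?h = "\<lambda>x. x [^] (p ^ (k - 1))"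
    interpret h: group_hom G G ?h by unfold_locales (auto simp: hom_def nat_pow_distrib)
    have "card (?h ` carrier G) * card (?O (k - 1)) = order G"
    proof -
      have "card (carrier (G Mod kernel G G ?h)) * card (kernel G G ?h) = order G"
        using lagrange[OF h.subgroup_kernel] by (simp add: FactGroup_def)
      moreover have "card (carrier (G Mod kernel G G ?h)) = card (?h ` carrier G)"
      proof -
        interpret h': group_hom G "G\<lparr>carrier := ?h ` carrier G\<rparr>" ?h
          by (intro group_hom.intro group_hom_axioms.intro is_group
              subgroup.subgroup_is_group[OF h.img_is_subgroup is_group]) (auto simp: hom_def nat_pow_distrib)
        have "kernel G (G\<lparr>carrier := ?h ` carrier G\<rparr>) ?h = kernel G G ?h" by (simp add: kernel_def)
        then show ?thesis using iso_same_card[OF h'.FactGroup_iso] by simp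
      qed
      ultimately show ?thesis by (simp add: kernel_def)
    qed
    moreover have "p ^ (k * r) = p ^ r * p ^ ((k - 1) * r)"
      using k by (simp add: algebra_simps flip: power_add)
    ultimately have "card (?h ` carrier G) = p ^ r" using card[of "k - 1"] order p0 by simp
    moreover have "?h ` carrier G \<subseteq> ?O 1"
    proof
      fix y assume "y \<in> ?h ` carrier G"
      then obtain x where x: "x \<in> carrier G" "y = x [^] (p ^ (k - 1))" by blast
      then have "y [^] p = x [^] (p ^ (k - 1) * p)" by (simp add: nat_pow_pow)
      also have "\<dots> = \<one>" using exponent[OF x(1)] by (simp only: power_minus_mult[OF k])
      finally show "y \<in> ?O 1" using x by simp
    qed
    moreover have "card (?O 1) = p ^ r" using card[of 1] k by simp
    moreover have "finite (?O 1)" using fin by simp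
    ultimately show ?thesis by (intro card_subset_eq) simp_all
  qed
  have "\<exists>f\<in>hom (cyclic_power (p ^ k) n) G. inj_on f (carrier (cyclic_power (p ^ k) n))" if "n \<le> r" for n
    using that
  proof (induction n)
    case 0
    have "(\<lambda>_. \<one>) \<in> hom (cyclic_power (p ^ k) 0) G" by (rule homI) simp_all
    then show ?case by (rule bexI[rotated]) (simp add: inj_on_def)
  next
    case (Suc n)
    from Suc.prems have "n \<le> r" by simp
    from Suc.IH[OF this] obtain f
      where f: "f \<in> hom (cyclic_power (p ^ k) n) G" "inj_on f (carrier (cyclic_power (p ^ k) n))" by blast
    let ?C = "cyclic_power (p ^ k) n"
    have C: "group ?C" by simp
    interpret f: group_hom ?C G f
      by (intro group_hom.intro group_hom_axioms.intro C is_group f(1))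
    have "\<not> ?O 1 \<subseteq> f ` carrier ?C"
    proof
      assume sub: "?O 1 \<subseteq> f ` carrier ?C"
      have "?O 1 \<subseteq> f ` {x \<in> carrier ?C. x [^]\<^bsub>?C\<^esub> (p ^ 1) = \<one>\<^bsub>?C\<^esub>}"
      proof
        fix y assume y: "y \<in> ?O 1"
        then obtain x where x: "x \<in> carrier ?C" "y = f x" using sub by blast
        have "f (x [^]\<^bsub>?C\<^esub> (p ^ 1)) = \<one>" using y x f.hom_nat_pow[OF x(1), of "p ^ 1"] by simp
        then have "x [^]\<^bsub>?C\<^esub> (p ^ 1) = \<one>\<^bsub>?C\<^esub>" using f(2) f.inj_on_one_iff monoid.nat_pow_closed[OF group.is_monoid[OF C] x(1)] by blast
        then show "y \<in> f ` {x \<in> carrier ?C. x [^]\<^bsub>?C\<^esub> (p ^ 1) = \<one>\<^bsub>?C\<^esub>}" using x by blast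
      qed
      moreover have "card {x \<in> carrier ?C. x [^]\<^bsub>?C\<^esub> (p ^ 1) = \<one>\<^bsub>?C\<^esub>} = p ^ (1 * n)"
        by (rule cyclic_power_roots[OF p0]) (use k in simp)
      moreover have "finite {x \<in> carrier ?C. x [^]\<^bsub>?C\<^esub> (p ^ 1) = \<one>\<^bsub>?C\<^esub>}"
        by (rule card_ge_0_finite) (use calculation(2) p0 in simp)
      ultimately have "card (?O 1) \<le> p ^ n"
        by (metis (no_types, lifting) card_image_le card_mono finite_imageI le_trans mult_1)
      then have "p ^ r \<le> p ^ n" using card[of 1] k by simp
      then have "r \<le> n" using p1 power_le_imp_le_exp by blast
      then show False using Suc by simp
    qed
    then obtain w where w: "w \<in> ?O 1" "w \<notin> f ` carrier ?C" by blast
    then obtain e where e: "e \<in> carrier G" "w = e [^] (p ^ (k - 1))" using im by blast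
    show ?case using extend_homocyclic_embedding[OF fin p k exponent f e(1)] w(2) e(2) by blast
  qed
  then obtain f where f: "f \<in> hom (cyclic_power (p ^ k) r) G" "inj_on f (carrier (cyclic_power (p ^ k) r))" by blast
  have "f ` carrier (cyclic_power (p ^ k) r) = carrier G"
  proof (rule card_subset_eq[OF fin])
    show "f ` carrier (cyclic_power (p ^ k) r) \<subseteq> carrier G" using f(1) by (rule hom_carrier)
    show "card (f ` carrier (cyclic_power (p ^ k) r)) = card (carrier G)"
      using card_image[OF f(2)] cyclic_power_card[OF p0, where k = k and r = r] order unfolding order_def by (simp only:)
  qed
  then have "f \<in> iso (cyclic_power (p ^ k) r) G"
    by (intro isoI bij_betw_imageI f)
  then show ?thesis by (rule is_isoI)
qed

end

section \<open>Perfect order classes and the structure of the kernel\<close>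

context frobenius
begin

lemma card_H_dvd_order_class:
  assumes "n \<noteq> 1"
  shows "card H dvd card {k \<in> K. ord k = n}"
proof (rule card_H_dvd_invariant)
  show "{k \<in> K. ord k = n} \<subseteq> K - {\<one>}" using assms ord_id by auto
qed (use conj_by_K in auto)

text \<open>With two primes l and p dividing |K|, the class of order lp is counted by a product of
  two numbers divisible by |H|. Then |H|^2 divides |K| |H|, against coprimality.\<close>

lemma kernel_prime_power:
  assumes poc: "perfect_order_classes G" and abelian: "\<And>k k'. k \<in> K \<Longrightarrow> k' \<in> K \<Longrightarrow> k \<otimes> k' = k' \<otimes> k"
  shows "\<exists>p N. Factorial_Ring.prime p \<and> card K = p ^ N"
proof -
  interpret KC: comm_group "G\<lparr>carrier := K\<rparr>"
    by (rule group.group_comm_groupI[OF K_group]) (use abelian in auto)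
  have cK: "card K > 1"
  proof -
    have "{\<one>} \<subset> K" using K_nontrivial K.one_closed by blast
    then have "card {\<one>} < card K" by (rule psubset_card_mono[OF finite_K])
    then show ?thesis by simp
  qed
  then obtain p where p: "Factorial_Ring.prime p" "p dvd card K" by (metis less_irrefl prime_factor_nat)
  have elem: "\<exists>x\<in>K. ord x = l" if "Factorial_Ring.prime l" "l dvd card K" for l
    using KC.exists_elem_of_prime_order[of l] finite_K that by (auto simp: order_def ord_subgroup[OF K_subgroup])
  have "l = p" if l: "Factorial_Ring.prime l" "l dvd card K" for l
  proof (rule ccontr)
    assume "l \<noteq> p"
    then have cop: "coprime l p" using l p by (simp add: primes_coprime)
    obtain x y where x: "x \<in> K" "ord x = l" and y: "y \<in> K" "ord y = p" using elem l p by metis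
    have l0: "l > 0" "p > 0" and l1: "l \<noteq> 1" "p \<noteq> 1" "l * p \<noteq> 1" using l p prime_gt_0_nat by auto
    have "ord (x \<otimes> y) = l * p" using KC.ord_mult_coprime[of x y] x y cop abelian[of x y] by (simp add: ord_subgroup[OF K_subgroup])
    then have oc: "{g \<in> carrier G. ord g = l * p} = {g \<in> K. ord g = l * p}"
      using order_class_in_kernel[OF l1(3), of "x \<otimes> y"] x y by blast
    have e: "card {g \<in> K. ord g = l * p} = card {g \<in> K. ord g = l} * card {g \<in> K. ord g = p}"
      using KC.card_order_class_mult[OF _ cop l0] finite_K by (simp add: ord_subgroup[OF K_subgroup])
    have "card H * card H dvd card {g \<in> K. ord g = l * p}"
      unfolding e by (intro mult_dvd_mono card_H_dvd_order_class l1)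
    moreover have "card {g \<in> K. ord g = l * p} dvd order G"
    proof -
      have "x \<otimes> y \<in> {g \<in> K. ord g = l * p}" using x y \<open>ord (x \<otimes> y) = l * p\<close> by simp
      moreover have "finite {g \<in> K. ord g = l * p}" using finite_K by simp
      ultimately have "card {g \<in> K. ord g = l * p} \<noteq> 0" by (metis (no_types, lifting) card_0_eq empty_iff)
      moreover have "l * p > 0" using l0 by simp
      then have "card {g \<in> carrier G. ord g = l * p} = 0 \<or> card {g \<in> carrier G. ord g = l * p} dvd order G"
        using poc unfolding perfect_order_classes_def by blast
      ultimately show ?thesis unfolding oc by (elim disjE) simp_all
    qed
    ultimately have "card H * card H dvd card K * card H" using order_eq dvd_trans by metis
    then have "card H dvd card K" using card_H_gt_one by simp
    then have "card H = 1" using coprime_card by (meson coprime_common_divisor_nat dvd_refl)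
    then show False using card_H_gt_one by simp
  qed
  then show ?thesis using prime_powerI[OF _ p(1), of "card K"] cK p(1) by (metis gr_implies_not0 neq0_conv)
qed

text \<open>Elements of order p^(i+1) form the difference of two consecutive layers and number p^u
  (p^t - 1). Freeness gives |H| dvd p^t - 1, as |H| is prime to p, and perfect order classes give
  the converse. Hence every layer grows by the same factor p^r, and counting roots identifies the
  group.\<close>

theorem kernel_homocyclic:
  assumes poc: "perfect_order_classes G" and abelian: "\<And>k k'. k \<in> K \<Longrightarrow> k' \<in> K \<Longrightarrow> k \<otimes> k' = k' \<otimes> k"
  shows "\<exists>p r k. Factorial_Ring.prime p \<and> k > 0 \<and> r > 0 \<and> card H = p ^ r - 1 \<and> card {x \<in> K. x [^] p = \<one>} = p ^ r \<and>
    cyclic_power (p ^ k) r \<cong> G\<lparr>carrier := K\<rparr>"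
proof -
  let ?KG = "G\<lparr>carrier := K\<rparr>"
  interpret KC: comm_group ?KG
    by (rule group.group_comm_groupI[OF K_group]) (use abelian in auto)
  obtain p N where p: "Factorial_Ring.prime p" and N: "card K = p ^ N" using kernel_prime_power[OF assms] by blast
  have p0: "p > 0" and p1: "p > 1" using p prime_gt_0_nat prime_gt_1_nat by auto
  define Om where "Om i = {x \<in> K. x [^] (p ^ i) = \<one>}" for i :: nat
  have Om_sub: "subgroup (Om i) ?KG" for i
    using KC.roots_subgroup[of "p ^ i"] by (simp add: Om_def nat_pow_consistent[symmetric])
  have "\<exists>u. card (Om i) = p ^ u" for i
    using KC.card_subgroup_dvd[OF Om_sub, of i] N p by (auto simp: order_def divides_primepow_nat)
  then obtain u where u: "card (Om i) = p ^ u i" for i by metis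
  have finOm: "finite (Om i)" for i using finite_K by (simp add: Om_def)
  have Om_mono: "Om i \<subseteq> Om (Suc i)" for i by (auto simp: Om_def nat_pow_pow[symmetric] mult.commute[of p])
  have cls: "{x \<in> K. ord x = p ^ Suc i} = Om (Suc i) - Om i" for i
  proof -
    have "ord x = p ^ Suc i \<longleftrightarrow> ord x dvd p ^ Suc i \<and> \<not> ord x dvd p ^ i" for x
    proof
      assume "ord x = p ^ Suc i"
      then show "ord x dvd p ^ Suc i \<and> \<not> ord x dvd p ^ i" using p1 by (auto dest: dvd_imp_le)
    next
      assume a: "ord x dvd p ^ Suc i \<and> \<not> ord x dvd p ^ i"
      then obtain m where m: "ord x = p ^ m" "m \<le> Suc i" using divides_primepow_nat[OF p] by blast
      then have "\<not> m \<le> i" using a le_imp_power_dvd by metis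
      then show "ord x = p ^ Suc i" using m by (simp add: le_Suc_eq)
    qed
    then show ?thesis unfolding Om_def using pow_eq_id K.subset by auto
  qed
  have Om0: "Om 0 = {\<one>}" by (auto simp: Om_def)
  have cop: "coprime (p ^ t - 1) p" if "t > 0" for t
  proof -
    have "coprime (p ^ t - 1) (p ^ t)" using p0 by (intro coprime_diff_one_left_nat) simp
    then show ?thesis using that by simp
  qed
  have copH: "coprime (card H) p"
  proof -
    have "N > 0"
    proof (rule ccontr)
      assume "\<not> N > 0"
      then have "card K = 1" using N by simp
      then show False using K_nontrivial K.one_closed by (metis card_1_singletonE singletonD)
    qed
    then show ?thesis using coprime_card N by (simp add: coprime_commute)
  qed
  have step: "\<exists>t>0. u (Suc i) = u i + t \<and> p ^ t - 1 = card H" if ne: "Om (Suc i) \<noteq> Om i" for i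
  proof -
    have "card (Om i) < card (Om (Suc i))" using Om_mono ne finOm by (intro psubset_card_mono) auto
    then have lt: "u i < u (Suc i)" using u p1 by simp
    define t where "t = u (Suc i) - u i"
    have t: "t > 0" "u (Suc i) = u i + t" using lt by (auto simp: t_def)
    have c: "card {x \<in> K. ord x = p ^ Suc i} = p ^ u i * (p ^ t - 1)"
      unfolding cls using card_Diff_subset[OF finOm Om_mono] u t by (simp add: power_add diff_mult_distrib2)
    have n1: "p ^ Suc i \<noteq> 1" using p1 by simp
    have "card H dvd p ^ u i * (p ^ t - 1)" using card_H_dvd_order_class[OF n1] c by simp
    moreover have "coprime (card H) (p ^ u i)" using copH by simp
    ultimately have d1: "card H dvd p ^ t - 1" by (simp add: coprime_dvd_mult_right_iff)
    obtain x where x: "x \<in> K" "ord x = p ^ Suc i" using ne Om_mono[of i] cls[of i] by blast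
    have "p ^ t > 1" using one_less_power[OF p1 t(1)] .
    then have "p ^ u i * (p ^ t - 1) \<noteq> 0" using p0 by simp
    moreover have "card {x \<in> carrier G. ord x = p ^ Suc i} = p ^ u i * (p ^ t - 1)"
      using order_class_in_kernel[OF n1 x] c by simp
    moreover have "p ^ Suc i > 0" using p0 by simp
    then have "card {x \<in> carrier G. ord x = p ^ Suc i} = 0 \<or> card {x \<in> carrier G. ord x = p ^ Suc i} dvd order G"
      using poc unfolding perfect_order_classes_def by blast
    ultimately have "p ^ u i * (p ^ t - 1) dvd order G" by (simp only: simp_thms)
    then have "p ^ t - 1 dvd p ^ N * card H" using order_eq N by (metis dvd_mult_right)
    moreover have "coprime (p ^ t - 1) (p ^ N)" using cop[OF t(1)] by simp
    ultimately have d2: "p ^ t - 1 dvd card H" by (simp add: coprime_dvd_mult_right_iff)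
    show ?thesis using d1 d2 t dvd_antisym by blast
  qed
  have OmN: "Om N = K"
  proof -
    have "x [^] (p ^ N) = \<one>" if "x \<in> K" for x
      using ord_K_dvd[OF that] N pow_eq_id[of x] that by simp
    then show ?thesis by (auto simp: Om_def)
  qed
  \<comment> \<open>The exponent of \<open>K\<close> is p^k for this least k.\<close>
  define k where "k = (LEAST k. Om k = K)"
  have Omk: "Om k = K" unfolding k_def by (rule LeastI[of _ N]) (rule OmN)
  have kmin: "Om i \<noteq> K" if "i < k" for i using that not_less_Least unfolding k_def by blast
  have k0: "k > 0" using Omk Om0 K_nontrivial by (cases k) auto
  \<comment> \<open>Once two consecutive layers agree, all later ones do, because x lies in a layer
    exactly when x^p lies in the previous one.\<close>
  have strict: "Om (Suc i) \<noteq> Om i" if "i < k" for i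
  proof
    assume eq: "Om (Suc i) = Om i"
    have "Om (i + d) = Om i" for d
    proof (induction d)
      case (Suc d)
      have "Om (Suc (i + d)) \<subseteq> Om (Suc i)"
      proof
        fix x assume x: "x \<in> Om (Suc (i + d))"
        then have xK: "x \<in> K" by (simp add: Om_def)
        then have "x [^] p \<in> Om (i + d)" using x subgroup_pow_closed[OF K_subgroup, of x p] by (simp add: Om_def nat_pow_pow)
        then have "x [^] p \<in> Om i" using Suc by simp
        then show "x \<in> Om (Suc i)" using xK by (simp add: Om_def nat_pow_pow)
      qed
      then show ?case using eq Om_mono Suc by (metis add_Suc_right subset_antisym)
    qed simp
    from this[of "k - i"] have "Om k = Om i" using that by simp
    then show False using kmin[OF that] Omk by simp
  qed
  obtain r where r: "r > 0" "p ^ r - 1 = card H" using step[OF strict[OF k0]] by blast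
  have ur: "u (Suc i) = u i + r" if ik: "i < k" for i
  proof -
    obtain t where t: "t > 0" "u (Suc i) = u i + t" "p ^ t - 1 = card H" using step[OF strict[OF ik]] by blast
    have "p ^ t = p ^ r" using t(3) r(2) p0 by (metis Suc_diff_1 zero_less_power)
    then show ?thesis using t p1 by (simp add: power_inject_exp)
  qed
  have u0: "u 0 = 0" using u[of 0] Om0 p1 by (cases "u 0") auto
  have ui: "u i = i * r" if "i \<le> k" for i using that by (induction i) (auto simp: u0 ur)
  have "cyclic_power (p ^ k) r \<cong> ?KG"
  proof (rule KC.homocyclic_iso[OF _ p k0])
    show "card {x \<in> carrier ?KG. x [^]\<^bsub>?KG\<^esub> (p ^ i) = \<one>\<^bsub>?KG\<^esub>} = p ^ (i * r)" if "i \<le> k" for i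
      using u[of i] ui[OF that] by (simp add: Om_def nat_pow_consistent[symmetric])
    show "order ?KG = p ^ (k * r)" using Omk u[of k] ui[of k] by (simp add: order_def)
  qed (simp add: finite_K)
  moreover have "card {x \<in> K. x [^] p = \<one>} = p ^ r" using u[of 1] ui[of 1] k0 by (simp add: Om_def)
  ultimately show ?thesis using p k0 r(1) r(2)[symmetric] by blast
qed

end

subsection \<open>Order classes of the groups in the classification\<close>

lemma (in group) cyclic_iso:
  assumes t: "t \<in> carrier G" and n: "ord t = n" "n > 0"
  shows "(\<lambda>m::int. t [^] m) \<in> iso (integer_mod_group n) (G\<lparr>carrier := generate G {t}\<rparr>)"
proof -
  have mod: "t [^] (m mod int n) = t [^] m" for m :: int
  proof -
    have "int n dvd m - m mod int n" by (rule dvd_minus_mod)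
    then show ?thesis using int_pow_eq[OF t, of "m mod int n" m] n(1) by blast
  qed
  have carr: "carrier (integer_mod_group n) = {0..<int n}" using n(2) by (simp add: carrier_integer_mod_group)
  have gen: "generate G {t} = range (\<lambda>m::int. t [^] m)" using generate_pow[OF t] by auto
  show ?thesis
  proof (rule isoI)
    show "(\<lambda>m::int. t [^] m) \<in> hom (integer_mod_group n) (G\<lparr>carrier := generate G {t}\<rparr>)"
      by (rule homI) (use t in \<open>auto simp: gen mod int_pow_mult\<close>)
    have "inj_on (\<lambda>m::int. t [^] m) {0..<int n}"
    proof (rule inj_onI)
      fix l m assume lm: "l \<in> {0..<int n}" "m \<in> {0..<int n}" "t [^] l = t [^] m"
      then have "int n dvd m - l" using int_pow_eq[OF t] n(1) by blast
      then have "m mod int n = l mod int n" by (simp add: mod_eq_dvd_iff)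
      then show "l = m" using lm by simp
    qed
    moreover have "(\<lambda>m::int. t [^] m) ` {0..<int n} = generate G {t}"
    proof
      show "generate G {t} \<subseteq> (\<lambda>m::int. t [^] m) ` {0..<int n}"
      proof
        fix g assume "g \<in> generate G {t}"
        then obtain m :: int where "g = t [^] m" using gen by auto
        then have "g = t [^] (m mod int n)" using mod by simp
        then show "g \<in> (\<lambda>m::int. t [^] m) ` {0..<int n}" using n(2) by (intro image_eqI) auto
      qed
    qed (auto simp: gen)
    ultimately show "bij_betw (\<lambda>m::int. t [^] m) (carrier (integer_mod_group n)) (carrier (G\<lparr>carrier := generate G {t}\<rparr>))"
      unfolding carr by (simp add: bij_betw_def)
  qed
qed

lemma iso_pow_eq_one:
  assumes G: "group G" "group G'" and f: "f \<in> iso G G'" and x: "x \<in> carrier G"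
  shows "f x [^]\<^bsub>G'\<^esub> (n::nat) = \<one>\<^bsub>G'\<^esub> \<longleftrightarrow> x [^]\<^bsub>G\<^esub> n = \<one>\<^bsub>G\<^esub>"
proof -
  interpret G: group G by fact
  interpret G': group G' by fact
  interpret f: group_hom G G' f using f by unfold_locales (simp add: iso_def)
  have inj: "inj_on f (carrier G)" using f by (simp add: iso_def bij_betw_def)
  have "f x [^]\<^bsub>G'\<^esub> n = f (x [^]\<^bsub>G\<^esub> n)" using f.hom_nat_pow[OF x] by simp
  then show ?thesis using inj x by (metis G.nat_pow_closed G.one_closed f.hom_one inj_on_eq_iff)
qed

lemma iso_ord:
  assumes G: "group G" "group G'" and f: "f \<in> iso G G'" and x: "x \<in> carrier G"
  shows "group.ord G' (f x) = group.ord G x"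
proof -
  interpret G: group G by fact
  interpret G': group G' by fact
  have "f x \<in> carrier G'" using f x by (auto simp: iso_def hom_def)
  then show ?thesis using iso_pow_eq_one[OF G f x] x by (simp add: G'.ord_unique G.pow_eq_id)
qed

lemma iso_card_order_class:
  assumes G: "group G" "group G'" and f: "f \<in> iso G G'"
  shows "card {x \<in> carrier G'. group.ord G' x = n} = card {x \<in> carrier G. group.ord G x = n}"
proof -
  have f': "inj_on f (carrier G)" "f ` carrier G = carrier G'" using f by (auto simp: iso_def bij_betw_def)
  have "{x \<in> carrier G'. group.ord G' x = n} = f ` {x \<in> carrier G. group.ord G x = n}"
    using iso_ord[OF G f] unfolding f'(2)[symmetric] by auto
  moreover have "inj_on f {x \<in> carrier G. group.ord G x = n}" using f'(1) by (rule inj_on_subset) auto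
  ultimately show ?thesis by (simp add: card_image)
qed

lemma iso_card_roots:
  assumes G: "group G" "group G'" and f: "f \<in> iso G G'"
  shows "card {x \<in> carrier G'. x [^]\<^bsub>G'\<^esub> (n::nat) = \<one>\<^bsub>G'\<^esub>} = card {x \<in> carrier G. x [^]\<^bsub>G\<^esub> n = \<one>\<^bsub>G\<^esub>}"
proof -
  have f': "inj_on f (carrier G)" "f ` carrier G = carrier G'" using f by (auto simp: iso_def bij_betw_def)
  have "{x \<in> carrier G'. x [^]\<^bsub>G'\<^esub> n = \<one>\<^bsub>G'\<^esub>} = f ` {x \<in> carrier G. x [^]\<^bsub>G\<^esub> n = \<one>\<^bsub>G\<^esub>}"
    using iso_pow_eq_one[OF G f] unfolding f'(2)[symmetric] by auto
  moreover have "inj_on f {x \<in> carrier G. x [^]\<^bsub>G\<^esub> n = \<one>\<^bsub>G\<^esub>}" using f'(1) by (rule inj_on_subset) auto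
  ultimately show ?thesis by (simp add: card_image)
qed

lemma (in group) prime_power_order_class:
  assumes p: "Factorial_Ring.prime p" and S: "S \<subseteq> carrier G"
  shows "{x \<in> S. ord x = p ^ Suc i} = {x \<in> S. x [^] (p ^ Suc i) = \<one>} - {x \<in> S. x [^] (p ^ i) = \<one>}"
proof -
  have "ord x = p ^ Suc i \<longleftrightarrow> ord x dvd p ^ Suc i \<and> \<not> ord x dvd p ^ i" for x
  proof
    assume "ord x = p ^ Suc i"
    moreover have "\<not> p ^ Suc i dvd p ^ i" using prime_gt_1_nat[OF p] power_dvd_imp_le[of p "Suc i" i] by auto
    ultimately show "ord x dvd p ^ Suc i \<and> \<not> ord x dvd p ^ i" by simp
  next
    assume a: "ord x dvd p ^ Suc i \<and> \<not> ord x dvd p ^ i"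
    then obtain m where m: "ord x = p ^ m" "m \<le> Suc i" using divides_primepow_nat[OF p] by blast
    then have "\<not> m \<le> i" using a le_imp_power_dvd by metis
    then show "ord x = p ^ Suc i" using m by (simp add: le_Suc_eq)
  qed
  then show ?thesis using pow_eq_id S by auto
qed

text \<open>This is Euler's totient of p^(i+1), obtained as the difference of two root
  counts.\<close>

lemma (in group) cyclic_card_order_class:
  assumes fin: "finite (carrier G)" and t: "t \<in> carrier G" and p: "Factorial_Ring.prime p" and n: "ord t = p ^ b" and i: "Suc i \<le> b"
  shows "card {x \<in> generate G {t}. ord x = p ^ Suc i} = p ^ i * (p - 1)"
proof -
  have p0: "p > 0" using p prime_gt_0_nat by blast
  have sub: "subgroup (generate G {t}) G" using t by (intro generate_is_subgroup) auto
  then have T: "group (G\<lparr>carrier := generate G {t}\<rparr>)" by (rule subgroup.subgroup_is_group) (rule is_group)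
  have roots: "card {x \<in> generate G {t}. x [^] (p ^ i) = \<one>} = p ^ i" if ib: "i \<le> b" for i
  proof -
    have pb: "p ^ b = p ^ i * p ^ (b - i)" using ib by (simp flip: power_add)
    have "card {x \<in> carrier (G\<lparr>carrier := generate G {t}\<rparr>). x [^]\<^bsub>G\<lparr>carrier := generate G {t}\<rparr>\<^esub> (p ^ i) = \<one>\<^bsub>G\<lparr>carrier := generate G {t}\<rparr>\<^esub>}
       = card {x \<in> carrier (integer_mod_group (p ^ b)). x [^]\<^bsub>integer_mod_group (p ^ b)\<^esub> (p ^ i) = \<one>\<^bsub>integer_mod_group (p ^ b)\<^esub>}"
      by (rule iso_card_roots[OF _ T cyclic_iso[OF t n]]) (use p0 in simp_all)
    then have "card {x \<in> generate G {t}. x [^] (p ^ i) = \<one>} = card {m \<in> carrier (integer_mod_group (p ^ b)). int (p ^ i) * m mod int (p ^ b) = 0}"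
      by (simp add: nat_pow_consistent[symmetric])
    also have "{m \<in> carrier (integer_mod_group (p ^ b)). int (p ^ i) * m mod int (p ^ b) = 0}
        = {m \<in> {0..<int (p ^ (b - i)) * int (p ^ i)}. int (p ^ (b - i)) dvd m}"
    proof -
      have "carrier (integer_mod_group (p ^ b)) = {0..<int (p ^ b)}" using p0 by (simp add: carrier_integer_mod_group)
      moreover have "int (p ^ b) = int (p ^ (b - i)) * int (p ^ i)" unfolding pb of_nat_mult by (rule mult.commute)
      moreover have "int (p ^ i) * m mod int (p ^ b) = 0 \<longleftrightarrow> int (p ^ (b - i)) dvd m" for m
        unfolding mod_eq_0_iff_dvd pb of_nat_mult using p0 by simp
      ultimately show ?thesis by simp
    qed
    also have "card \<dots> = nat (int (p ^ i))" by (rule card_multiples) (use p0 in simp)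
    finally show ?thesis by (simp only: nat_int)
  qed
  have sub': "{x \<in> generate G {t}. x [^] (p ^ i) = \<one>} \<subseteq> {x \<in> generate G {t}. x [^] (p ^ Suc i) = \<one>}"
    using subgroup.subset[OF sub] by (auto simp: nat_pow_pow[symmetric] mult.commute[of p])
  have "finite (generate G {t})" using finite_subset[OF subgroup.subset[OF sub] fin] .
  then have "card {x \<in> generate G {t}. ord x = p ^ Suc i} = p ^ Suc i - p ^ i"
    unfolding prime_power_order_class[OF p subgroup.subset[OF sub]]
    using roots[of i] roots[OF i] i sub' by (subst card_Diff_subset) auto
  then show ?thesis by (simp add: diff_mult_distrib2 mult.commute)
qed

text \<open>Units modulo q^b that are 1 modulo q have no 2-torsion: if u^2 = 1 then u + 1 is 2
  modulo q, hence invertible, and u - 1 must vanish.\<close>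

lemma odd_cong_one_of_two_power:
  fixes u q n m :: nat
  assumes q: "odd q" and u: "[u ^ (2 ^ n) = 1] (mod m)" "[u = 1] (mod q)" and m: "m = q ^ b"
  shows "[u = 1] (mod m)"
  using u
proof (induction n arbitrary: u)
  case (Suc n)
  have "[(u\<^sup>2) ^ (2 ^ n) = 1] (mod m)" using Suc.prems(1) by (simp add: power_mult[symmetric] mult.commute)
  moreover have "[u\<^sup>2 = 1\<^sup>2] (mod q)" by (rule cong_pow) fact
  ultimately have "[u\<^sup>2 = 1] (mod m)" using Suc.IH by simp
  then have "[int u ^ 2 = 1] (mod int m)" by (metis cong_int_iff of_nat_1 of_nat_power)
  then have "int m dvd (int u)\<^sup>2 - 1" by (simp only: cong_iff_dvd_diff)
  then have d: "int m dvd (int u + 1) * (int u - 1)" by (simp add: power2_eq_square algebra_simps)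
  have "[u + 1 = 1 + 1] (mod q)" by (rule cong_add) (use Suc.prems(2) in auto)
  then have "gcd (u + 1) q = gcd 2 q" by (metis cong_gcd_eq one_add_one)
  moreover have "coprime 2 q" using q by simp
  ultimately have "coprime (u + 1) q" by (metis coprime_iff_gcd_eq_1)
  then have "coprime (q ^ b) (u + 1)" by (metis coprime_commute coprime_power_left_iff)
  then have "coprime (int m) (int (u + 1))" unfolding m by (simp only: coprime_int_iff)
  then have "coprime (int m) (int u + 1)" by (simp only: of_nat_add of_nat_1)
  then have "int m dvd int u - 1" using d coprime_dvd_mult_right_iff by blast
  then have "[int u = int 1] (mod int m)" by (simp add: cong_iff_dvd_diff)
  then show ?case by (simp only: cong_int_iff)
qed simp

context group
begin

text \<open>An element \<open>x y\<close> with \<open>y\<close> not centralizing \<open>t\<close> has the order of \<open>y\<close>, since \<open>y\<close> then acts without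
  fixed points on \<open>\<langle>t\<rangle>\<close>.\<close>

theorem metacyclic_perfect_order_classes:
  assumes fin: "finite (carrier G)" and q: "Factorial_Ring.prime q" "odd q" "q - 1 = 2 ^ e"
    and t: "t \<in> carrier G" "ord t = q ^ b" and c: "c \<in> carrier G" "ord c = 2 ^ a"
    and S: "internal_semidirect G (generate G {t}) (generate G {c})"
    and e: "e \<le> 1 \<or> e = 2 \<and> c \<otimes> t \<noteq> t \<otimes> c" and ea: "e \<le> a"
  shows "perfect_order_classes G"
proof -
  let ?Q = "generate G {t}" and ?P = "generate G {c}"
  have Qn: "?Q \<lhd> G" and QP: "?Q \<inter> ?P = {\<one>}" and cov: "?Q <#> ?P = carrier G"
    using S by (auto simp: internal_semidirect_def)
  interpret Q: subgroup ?Q G using t by (intro generate_is_subgroup) auto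
  interpret P: subgroup ?P G using c by (intro generate_is_subgroup) auto
  have Q_iff: "g \<in> ?Q \<longleftrightarrow> (\<exists>i::nat. g = t [^] i)" for g by (rule generate_singleton_iff[OF fin t(1)])
  have P_iff: "g \<in> ?P \<longleftrightarrow> (\<exists>i::nat. g = c [^] i)" for g by (rule generate_singleton_iff[OF fin c(1)])
  have tQ: "t \<in> ?Q" by (auto intro: generate.incl)
  have order: "order G = 2 ^ a * q ^ b"
    using cardinality_set_mult[OF Q.subgroup_axioms P.subgroup_axioms QP fin] cov
      generate_pow_card[OF t(1)] generate_pow_card[OF c(1)] t c by (simp add: order_def)
  have Qcomm: "x \<otimes> y = y \<otimes> x" if xy: "x \<in> ?Q" "y \<in> ?Q" for x y
  proof -
    obtain i j :: nat where "x = t [^] i" "y = t [^] j" using xy Q_iff by blast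
    then show ?thesis using t by (simp add: nat_pow_mult add.commute)
  qed
  have ordQ: "ord x dvd q ^ b" if x: "x \<in> ?Q" for x
  proof -
    obtain i :: nat where "x = t [^] i" using x Q_iff by blast
    then have "x [^] (q ^ b) = (t [^] (q ^ b)) [^] i" using t by (simp add: nat_pow_pow mult.commute)
    then have "x [^] (q ^ b) = \<one>" using t pow_ord_eq_1[OF t(1)] by simp
    then show ?thesis using pow_eq_id Q.mem_carrier[OF x] by blast
  qed
  have ordP: "ord y dvd 2 ^ a" if y: "y \<in> ?P" for y
  proof -
    obtain i :: nat where "y = c [^] i" using y P_iff by blast
    then have "y [^] (2 ^ a :: nat) = (c [^] (2 ^ a :: nat)) [^] i" using c by (simp add: nat_pow_pow mult.commute)
    then have "y [^] (2 ^ a :: nat) = \<one>" using c pow_ord_eq_1[OF c(1)] by simp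
    then show ?thesis using pow_eq_id P.mem_carrier[OF y] by blast
  qed
  have central_iff: "y \<otimes> x = x \<otimes> y" if y: "y \<in> carrier G" "y \<otimes> t = t \<otimes> y" and x: "x \<in> ?Q" for x y
  proof -
    obtain i :: nat where "x = t [^] i" using x Q_iff by blast
    then show ?thesis using commutes_imp_commutes_pow[OF y(2,1) t(1), of i] by simp
  qed
  have ord_central: "ord (x \<otimes> y) = ord x * ord y" if x: "x \<in> ?Q" and y: "y \<in> ?P" "y \<otimes> t = t \<otimes> y" for x y
  proof (rule ord_mult_coprime)
    show "x \<otimes> y = y \<otimes> x" using central_iff[OF P.mem_carrier[OF y(1)] y(2) x] by simp
    have "coprime (q ^ b) (2 ^ a)" using q(2) by simp
    then show "coprime (ord x) (ord y)" using ordQ[OF x] ordP[OF y(1)] coprime_divisors by blast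
  qed (use x y in auto)
  \<comment> \<open>The power x' of x y commutes with x y and with x, hence with y. If x' is
    non-trivial, the exponent u by which y acts on t must be 1 modulo q; having 2-power order modulo
    q^b, it is then 1, and y would centralize t.\<close>
  have ord_noncentral: "ord (x \<otimes> y) = ord y" if x: "x \<in> ?Q" and y: "y \<in> ?P" "y \<otimes> t \<noteq> t \<otimes> y" for x y
  proof -
    have xG: "x \<in> carrier G" and yG: "y \<in> carrier G" using x y by auto
    have pw: "\<exists>x'\<in>?Q. (x \<otimes> y) [^] n = x' \<otimes> y [^] n" for n :: nat
    proof (induction n)
      case (Suc n)
      then obtain x' where x': "x' \<in> ?Q" "(x \<otimes> y) [^] n = x' \<otimes> y [^] n" by blast
      have "(x \<otimes> y) [^] Suc n = x' \<otimes> y [^] n \<otimes> (x \<otimes> y)" using x' by simp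
      also have "\<dots> = (x' \<otimes> conj_by (y [^] n) x) \<otimes> y [^] Suc n"
        using xG yG Q.mem_carrier[OF x'(1)] by (simp add: conj_by_def word_simps)
      finally show ?case
        using x' normal_conj_by_closed[OF Qn nat_pow_closed[OF yG] x] by blast
    qed (auto intro: bexI[of _ \<one>])
    have one_if: "y [^] n = \<one> \<and> x' = \<one>" if eq: "x' \<otimes> y [^] n = \<one>" and x': "x' \<in> ?Q" for x' and n :: nat
    proof -
      have yn: "y [^] n \<in> ?P" by (rule subgroup_pow_closed[OF P.subgroup_axioms y(1)])
      then have "x' = inv (y [^] n)" using eq x' yG Q.mem_carrier[OF x'] by (metis inv_equality nat_pow_closed inv_inv)
      then have "x' \<in> ?Q \<inter> ?P" using yn x' by blast
      then have "x' = \<one>" using QP by blast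
      then show ?thesis using eq yG by simp
    qed
    obtain x' where x': "x' \<in> ?Q" "(x \<otimes> y) [^] ord y = x' \<otimes> y [^] ord y" using pw by blast
    then have x'eq: "(x \<otimes> y) [^] ord y = x'" using yG Q.mem_carrier[OF x'(1)] by simp
    have "x' = \<one>"
    proof (rule ccontr)
      assume n1: "x' \<noteq> \<one>"
      have x'G: "x' \<in> carrier G" using x' by auto
      have "(x \<otimes> y) \<otimes> x' = x' \<otimes> (x \<otimes> y)"
        using commutes_imp_commutes_pow[of "x \<otimes> y" "x \<otimes> y" "ord y"] x'eq xG yG by simp
      then have "x \<otimes> (y \<otimes> x') = x \<otimes> (x' \<otimes> y)" using Qcomm[OF x x'(1)] xG yG x'G by (metis m_assoc)
      then have cy: "conj_by y x' = x'" using xG yG x'G by (simp add: conj_by_eq_iff_commute)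
      obtain j :: nat where j: "x' = t [^] j" using x'(1) Q_iff by blast
      obtain u :: nat where u: "conj_by y t = t [^] u" using normal_conj_by_closed[OF Qn yG tQ] Q_iff by blast
      have it: "conj_by (y [^] k) t = t [^] (u ^ k)" for k :: nat
      proof (induction k)
        case (Suc k)
        have "conj_by (y [^] Suc k) t = conj_by (y [^] k) (conj_by y t)" using yG t by (simp add: conj_by_conj_by)
        also have "\<dots> = t [^] (u ^ k * u)" using u yG t Suc by (simp add: conj_by_pow nat_pow_pow)
        finally show ?case by (simp add: mult.commute)
      qed (use t in \<open>simp add: nat_pow_eone\<close>)
      obtain i where i: "ord y = 2 ^ i" using ordP[OF y(1)] divides_primepow_nat[OF two_is_prime_nat] by blast
      have "t [^] (u ^ ord y) = t" using it[of "ord y"] yG t(1) by simp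
      then have "t [^] (u ^ (2 ^ i)) = t [^] (1::nat)" using i t(1) by (simp add: nat_pow_eone)
      then have c1: "[u ^ (2 ^ i) = 1] (mod q ^ b)" using pow_eq_pow_iff[OF t(1)] t(2) by metis
      have "t [^] (u * j) = t [^] j" using cy u j yG t by (simp add: conj_by_pow nat_pow_pow)
      then have "[u * j = 1 * j] (mod q ^ b)" using pow_eq_pow_iff[OF t(1)] t(2) by simp
      then have "[int u * int j = 1 * int j] (mod int (q ^ b))" by (metis cong_int_iff of_nat_mult of_nat_1)
      then have d: "int (q ^ b) dvd (int u - 1) * int j" by (simp add: cong_iff_dvd_diff algebra_simps)
      have "[u = 1] (mod q)"
      proof (rule ccontr)
        assume "\<not> [u = 1] (mod q)"
        then have "\<not> [int u = int 1] (mod int q)" by (metis cong_int_iff)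
        then have "\<not> int q dvd int u - 1" by (simp add: cong_iff_dvd_diff)
        moreover have "Factorial_Ring.prime (int q)" using q(1) by simp
        ultimately have "coprime (int q ^ b) (int u - 1)" by (simp add: prime_imp_coprime)
        then have "int (q ^ b) dvd int j" using d by (simp add: coprime_dvd_mult_right_iff)
        then have "q ^ b dvd j" by (simp only: int_dvd_int_iff)
        then have "x' = \<one>" using j pow_eq_id[OF t(1)] t(2) by simp
        then show False using n1 by simp
      qed
      then have "[u = 1] (mod q ^ b)" using odd_cong_one_of_two_power[OF q(2) c1] by blast
      then have "t [^] u = t [^] (1::nat)" using pow_eq_pow_iff[OF t(1), of u 1] t(2) by metis
      then have "conj_by y t = t" using u t by (simp add: nat_pow_eone)
      then show False using y(2) conj_by_eq_iff_commute yG t by blast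
    qed
    then have "(x \<otimes> y) [^] ord y = \<one>" using x'eq by simp
    then have "ord (x \<otimes> y) dvd ord y" using pow_eq_id xG yG by simp
    moreover have "ord y dvd ord (x \<otimes> y)"
    proof -
      obtain x'' where x'': "x'' \<in> ?Q" "(x \<otimes> y) [^] ord (x \<otimes> y) = x'' \<otimes> y [^] ord (x \<otimes> y)" using pw by blast
      then have "x'' \<otimes> y [^] ord (x \<otimes> y) = \<one>" using pow_ord_eq_1[of "x \<otimes> y"] xG yG by simp
      then have "y [^] ord (x \<otimes> y) = \<one>" using one_if[OF _ x''(1)] by blast
      then show ?thesis using pow_eq_id yG by blast
    qed
    ultimately show ?thesis by (rule dvd_antisym)
  qed
  have inj: "inj_on (\<lambda>(x, y). x \<otimes> y) (?Q \<times> ?P)"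
  proof (rule eq_card_imp_inj_on)
    have fQ: "finite ?Q" "finite ?P" using fin Q.subset P.subset finite_subset by blast+
    then show "finite (?Q \<times> ?P)" by simp
    have "(\<lambda>(x, y). x \<otimes> y) ` (?Q \<times> ?P) = ?Q <#> ?P" by (auto simp: set_mult_def)
    then show "card ((\<lambda>(x, y). x \<otimes> y) ` (?Q \<times> ?P)) = card (?Q \<times> ?P)"
      using cardinality_set_mult[OF Q.subgroup_axioms P.subgroup_axioms QP fin] by (simp add: card_cartesian_product)
  qed
  have split: "\<exists>x\<in>?Q. \<exists>y\<in>?P. g = x \<otimes> y" if "g \<in> carrier G" for g
    using that unfolding cov[symmetric] set_mult_def by blast
  have card_prod: "card ((\<lambda>(x, y). x \<otimes> y) ` (A \<times> B)) = card A * card B" if "A \<subseteq> ?Q" "B \<subseteq> ?P" for A B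
  proof -
    have "inj_on (\<lambda>(x, y). x \<otimes> y) (A \<times> B)" by (rule inj_on_subset[OF inj]) (use that in auto)
    then show ?thesis by (simp add: card_image card_cartesian_product)
  qed
  \<comment> \<open>Elements of equal order in a cyclic group generate the same subgroup. So whether
    an element of \<open>?P\<close> centralizes t depends only on its order, and the classes below
    are full products.\<close>
  have same_order: "y' \<otimes> t = t \<otimes> y'"
    if y: "y \<in> ?P" "y \<otimes> t = t \<otimes> y" and y': "y' \<in> ?P" "ord y' = ord y" for y y'
  proof -
    have yG: "y \<in> carrier G" "y' \<in> carrier G" using y y' by auto
    obtain i :: nat where i: "y = c [^] i" using y(1) P_iff by blast
    obtain i' :: nat where i': "y' = c [^] i'" using y'(1) P_iff by blast
    have "gcd (ord c) i = gcd (ord c) i'"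
    proof -
      have "ord y = ord c div gcd (ord c) i" using ord_pow_gen[OF c(1), of i] i c(2) by (cases "i = 0") auto
      moreover have "ord y' = ord c div gcd (ord c) i'" using ord_pow_gen[OF c(1), of i'] i' c(2) by (cases "i' = 0") auto
      ultimately have "ord c div gcd (ord c) i = ord c div gcd (ord c) i'" using y'(2) by simp
      moreover have "ord c \<noteq> 0" using c by simp
      ultimately show ?thesis
        by (metis dvd_div_eq_cancel dvd_div_mult_self gcd_dvd1 gcd_pos_nat mult_left_cancel mult_eq_0_iff dvd_mult_div_cancel)
    qed
    then have "gcd (ord c) i dvd i'" by (metis gcd_dvd2)
    then have "gcd i (ord c) dvd i'" by (simp only: gcd.commute)
    then obtain k where "[i * k = i'] (mod ord c)" using cong_solve_dvd_nat by blast
    then have "y' = y [^] k" using pow_eq_pow_iff[OF c(1)] i i' c(1) by (metis nat_pow_pow)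
    then show ?thesis using commutes_imp_commutes_pow[of t y k] y t yG by simp
  qed
  \<comment> \<open>At i = 0 the truncated subtraction gives 2^0 = 1, which matches the class of the
    identity.\<close>
  have cP: "card {y \<in> ?P. ord y = 2 ^ i} dvd 2 ^ (i - 1)" if i: "i \<le> a" for i
  proof (cases i)
    case 0
    have "{y \<in> ?P. ord y = 1} = {\<one>}" using ord_eq_1 P.mem_carrier P.one_closed by auto
    then show ?thesis using 0 by simp
  next
    case (Suc i')
    then show ?thesis using cyclic_card_order_class[OF fin c(1) two_is_prime_nat c(2), of i'] i by simp
  qed
  have cQ: "card {x \<in> ?Q. ord x = q ^ l} dvd q ^ b * 2 ^ e" and cQ0: "card {x \<in> ?Q. ord x = q ^ 0} = 1" if l: "l \<le> b" for l
  proof -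
    have Q0: "{x \<in> ?Q. ord x = 1} = {\<one>}" using ord_eq_1 Q.mem_carrier Q.one_closed by auto
    then show "card {x \<in> ?Q. ord x = q ^ 0} = 1" by simp
    show "card {x \<in> ?Q. ord x = q ^ l} dvd q ^ b * 2 ^ e"
    proof (cases l)
      case 0
      then show ?thesis using Q0 by simp
    next
      case (Suc l')
      then have "card {x \<in> ?Q. ord x = q ^ l} = q ^ l' * 2 ^ e"
        using cyclic_card_order_class[OF fin t(1) q(1) t(2), of l'] l q(3) by simp
      moreover have "q ^ l' dvd q ^ b" using Suc l by (intro le_imp_power_dvd) simp
      ultimately show ?thesis by (simp add: mult_dvd_mono)
    qed
  qed
  show ?thesis unfolding perfect_order_classes_def
  proof (intro allI impI)
    fix d :: nat
    let ?D = "{g \<in> carrier G. ord g = d}"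
    show "card ?D = 0 \<or> card ?D dvd order G"
    proof (cases "?D = {}")
      case True
      then have "card ?D = 0" by (simp only: card.empty)
      then show ?thesis by blast
    next
      case False
      then obtain g where g: "g \<in> carrier G" "ord g = d" by blast
      obtain x y where xy: "x \<in> ?Q" "y \<in> ?P" "g = x \<otimes> y" using split[OF g(1)] by blast
      obtain l where l: "ord x = q ^ l" "l \<le> b" using ordQ[OF xy(1)] divides_primepow_nat[OF q(1)] by blast
      obtain i where i: "ord y = 2 ^ i" "i \<le> a" using ordP[OF xy(2)] divides_primepow_nat[OF two_is_prime_nat] by blast
      have two_q: "2 ^ i1 = (2 ^ i2 :: nat) \<and> q ^ l1 = q ^ l2" if eq: "q ^ l1 * 2 ^ i1 = q ^ l2 * 2 ^ i2" for l1 l2 i1 i2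
      proof -
        have cop: "coprime (q ^ m) (2 ^ n :: nat)" for m n using q(2) by simp
        have "(2 ^ i1 :: nat) dvd q ^ l2 * 2 ^ i2" "(2 ^ i2 :: nat) dvd q ^ l1 * 2 ^ i1" by (metis eq dvd_triv_right)+
        then have "(2 ^ i1 :: nat) dvd 2 ^ i2" "(2 ^ i2 :: nat) dvd 2 ^ i1"
          using cop by (metis coprime_commute coprime_dvd_mult_right_iff)+
        then have "2 ^ i1 = (2 ^ i2 :: nat)" by (rule dvd_antisym)
        then show ?thesis using eq by simp
      qed
      show ?thesis
      proof (cases "y \<otimes> t = t \<otimes> y")
        case True
        then have d: "d = q ^ l * 2 ^ i" using ord_central[OF xy(1,2) True] g xy l i by simp
        have Deq: "?D = (\<lambda>(x, y). x \<otimes> y) ` ({x \<in> ?Q. ord x = q ^ l} \<times> {y \<in> ?P. ord y = 2 ^ i})"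
        proof
          show "?D \<subseteq> (\<lambda>(x, y). x \<otimes> y) ` ({x \<in> ?Q. ord x = q ^ l} \<times> {y \<in> ?P. ord y = 2 ^ i})"
          proof
            fix g' assume g': "g' \<in> ?D"
            then have "g' \<in> carrier G" by simp
            then obtain x' y' where xy': "x' \<in> ?Q" "y' \<in> ?P" "g' = x' \<otimes> y'" using split by blast
            have og: "ord (x' \<otimes> y') = d" using g' xy'(3) by blast
            obtain l' where l': "ord x' = q ^ l'" using ordQ[OF xy'(1)] divides_primepow_nat[OF q(1)] by blast
            obtain i' where i': "ord y' = 2 ^ i'" using ordP[OF xy'(2)] divides_primepow_nat[OF two_is_prime_nat] by blast
            have "ord x' = q ^ l \<and> ord y' = 2 ^ i"
            proof (cases "y' \<otimes> t = t \<otimes> y'")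
              case True
              then have "d = q ^ l' * 2 ^ i'" using ord_central[OF xy'(1,2)] og l' i' by metis
              then have "q ^ l' * 2 ^ i' = q ^ l * 2 ^ i" using d by (rule trans[OF sym])
              then show ?thesis using two_q[of l' i' l i] l' i' by metis
            next
              case False
              then have "d = ord y'" using ord_noncentral[OF xy'(1,2)] og by metis
              then have "q ^ 0 * 2 ^ i' = q ^ l * 2 ^ i" using d i' by (metis power_0 mult_1)
              then have "ord y' = ord y" using two_q i' i by metis
              then show ?thesis using same_order[OF xy(2) True xy'(2)] False by blast
            qed
            then show "g' \<in> (\<lambda>(x, y). x \<otimes> y) ` ({x \<in> ?Q. ord x = q ^ l} \<times> {y \<in> ?P. ord y = 2 ^ i})"
              using xy' by (intro image_eqI[of _ _ "(x', y')"]) auto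
          qed
          show "(\<lambda>(x, y). x \<otimes> y) ` ({x \<in> ?Q. ord x = q ^ l} \<times> {y \<in> ?P. ord y = 2 ^ i}) \<subseteq> ?D"
          proof
            fix g' assume "g' \<in> (\<lambda>(x, y). x \<otimes> y) ` ({x \<in> ?Q. ord x = q ^ l} \<times> {y \<in> ?P. ord y = 2 ^ i})"
            then obtain x' y' where xy': "x' \<in> ?Q" "ord x' = q ^ l" "y' \<in> ?P" "ord y' = 2 ^ i" "g' = x' \<otimes> y'" by auto
            have "y' \<otimes> t = t \<otimes> y'" using same_order[OF xy(2) True xy'(3)] xy'(4) i(1) by metis
            then have "ord (x' \<otimes> y') = d" using ord_central[OF xy'(1,3)] xy'(2,4) d by metis
            moreover have "x' \<otimes> y' \<in> carrier G" using xy'(1,3) by auto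
            ultimately show "g' \<in> ?D" unfolding xy'(5) by blast
          qed
        qed
        have card: "card ?D = card {x \<in> ?Q. ord x = q ^ l} * card {y \<in> ?P. ord y = 2 ^ i}"
          unfolding Deq by (rule card_prod) auto
        \<comment> \<open>The class size has 2-part dividing 2^(e + i - 1). For e = 2 this fits only
          when i < a; if i = a, then c would have the order of the centralizing element y and
          commute with t.\<close>
        have ei: "e + (i - 1) \<le> a"
        proof (cases "i = 0")
          case True then show ?thesis using ea by simp
        next
          case i0: False
          show ?thesis
          proof (cases "e \<le> 1")
            case True then show ?thesis using i i0 by simp
          next
            case False
            then have nc: "e = 2" "c \<otimes> t \<noteq> t \<otimes> c" using e by auto
            have "c \<in> ?P" by (auto intro: generate.incl)
            then have "ord c \<noteq> ord y" using same_order[OF xy(2) True, of c] nc by metis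
            then have "i \<noteq> a" using c i by auto
            then show ?thesis using i(2) i0 nc(1) by arith
          qed
        qed
        have "card ?D dvd (q ^ b * 2 ^ e) * 2 ^ (i - 1)" unfolding card by (intro mult_dvd_mono cQ cP l i)
        also have "\<dots> = q ^ b * 2 ^ (e + (i - 1))" by (simp add: power_add)
        also have "\<dots> dvd q ^ b * 2 ^ a" using ei by (intro mult_dvd_mono le_imp_power_dvd) auto
        finally show ?thesis using order by (simp add: mult.commute)
      next
        case False
        then have d: "d = 2 ^ i" using ord_noncentral[OF xy(1,2)] g xy i by simp
        have Deq: "?D = (\<lambda>(x, y). x \<otimes> y) ` (?Q \<times> {y \<in> ?P. ord y = 2 ^ i})"
        proof
          show "?D \<subseteq> (\<lambda>(x, y). x \<otimes> y) ` (?Q \<times> {y \<in> ?P. ord y = 2 ^ i})"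
          proof
            fix g' assume g': "g' \<in> ?D"
            then have "g' \<in> carrier G" by simp
            then obtain x' y' where xy': "x' \<in> ?Q" "y' \<in> ?P" "g' = x' \<otimes> y'" using split by blast
            have og: "ord (x' \<otimes> y') = d" using g' xy'(3) by blast
            obtain l' where l': "ord x' = q ^ l'" using ordQ[OF xy'(1)] divides_primepow_nat[OF q(1)] by blast
            obtain i' where i': "ord y' = 2 ^ i'" using ordP[OF xy'(2)] divides_primepow_nat[OF two_is_prime_nat] by blast
            have "ord y' = 2 ^ i"
            proof (cases "y' \<otimes> t = t \<otimes> y'")
              case True
              then have "d = q ^ l' * 2 ^ i'" using ord_central[OF xy'(1,2)] og l' i' by metis
              then have "q ^ l' * 2 ^ i' = q ^ 0 * 2 ^ i" using d by (metis power_0 mult_1)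
              then show ?thesis using two_q[of l' i' 0 i] i' by metis
            next
              case False
              then show ?thesis using ord_noncentral[OF xy'(1,2)] og d by metis
            qed
            then show "g' \<in> (\<lambda>(x, y). x \<otimes> y) ` (?Q \<times> {y \<in> ?P. ord y = 2 ^ i})"
              using xy' by (intro image_eqI[of _ _ "(x', y')"]) auto
          qed
          show "(\<lambda>(x, y). x \<otimes> y) ` (?Q \<times> {y \<in> ?P. ord y = 2 ^ i}) \<subseteq> ?D"
          proof
            fix g' assume "g' \<in> (\<lambda>(x, y). x \<otimes> y) ` (?Q \<times> {y \<in> ?P. ord y = 2 ^ i})"
            then obtain x' y' where xy': "x' \<in> ?Q" "y' \<in> ?P" "ord y' = 2 ^ i" "g' = x' \<otimes> y'" by auto
            have "y' \<otimes> t \<noteq> t \<otimes> y'" using same_order[OF xy'(2) _ xy(2)] xy' i False by metis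
            then have "ord (x' \<otimes> y') = d" using ord_noncentral[OF xy'(1,2)] xy'(3) d by metis
            moreover have "x' \<otimes> y' \<in> carrier G" using xy'(1,2) by auto
            ultimately show "g' \<in> ?D" unfolding xy'(4) by blast
          qed
        qed
        have "card ?D = card ?Q * card {y \<in> ?P. ord y = 2 ^ i}"
          unfolding Deq by (rule card_prod) auto
        then have "card ?D dvd q ^ b * 2 ^ (i - 1)"
          using cP[OF i(2)] generate_pow_card[OF t(1)] t(2) by (simp add: mult_dvd_mono)
        also have "\<dots> dvd q ^ b * 2 ^ a" using i by (intro mult_dvd_mono le_imp_power_dvd) auto
        finally show ?thesis using order by (simp add: mult.commute)
      qed
    qed
  qed
qed

end

text \<open>By Cayley-Hamilton a matrix of determinant 1 and trace T satisfies M^2 = T M - 1. Over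
  the field with three elements the polynomials for T = 2 and T = 1 are the squares of X - 1 and X +
  1, so the cube of M is 1 or -1 respectively.\<close>

lemma mat2_trace_zero: "a * d - b * c = 1 \<Longrightarrow> a + d = 0 \<Longrightarrow> mat2 a b c d ** mat2 a b c d = mat2 2 0 0 2"
  using mod3_cases[of a] mod3_cases[of b] mod3_cases[of c] mod3_cases[of d]
  by (elim disjE) (simp_all add: mat2_mult mod3_numerals)

lemma mat2_trace_two:
  "a * d - b * c = 1 \<Longrightarrow> a + d = 2 \<Longrightarrow> mat2 a b c d ** mat2 a b c d ** mat2 a b c d = mat2 1 0 0 1"
  using mod3_cases[of a] mod3_cases[of b] mod3_cases[of c] mod3_cases[of d]
  by (elim disjE) (simp_all add: mat2_mult mod3_numerals)

lemma mat2_trace_one: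
  "a * d - b * c = 1 \<Longrightarrow> a + d = 1 \<Longrightarrow> mat2 a b c d ** mat2 a b c d ** mat2 a b c d = mat2 2 0 0 2"
  using mod3_cases[of a] mod3_cases[of b] mod3_cases[of c] mod3_cases[of d]
  by (elim disjE) (simp_all add: mat2_mult mod3_numerals)

lemma card_filter: "finite A \<Longrightarrow> card {x \<in> A. P x} = (\<Sum>x\<in>A. if P x then 1 else 0)"
  by (simp add: sum.inter_filter[symmetric])

lemma SL_2_3_card_trace:
  "card {M \<in> carrier SL_2_3. M $ 1 $ 1 + M $ 2 $ 2 = 0} = 6"
  "card {M \<in> carrier SL_2_3. M $ 1 $ 1 + M $ 2 $ 2 = 1} = 9"
  "card {M \<in> carrier SL_2_3. M $ 1 $ 1 + M $ 2 $ 2 = 2} = 9"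
proof -
  have fin: "finite (carrier SL_2_3)" by (rule card_ge_0_finite) (simp add: SL_2_3_card)
  show "card {M \<in> carrier SL_2_3. M $ 1 $ 1 + M $ 2 $ 2 = 0} = 6"
    unfolding card_filter[OF fin] unfolding SL_2_3_carrier by (simp add: mod3_numerals)
  show "card {M \<in> carrier SL_2_3. M $ 1 $ 1 + M $ 2 $ 2 = 1} = 9"
    unfolding card_filter[OF fin] unfolding SL_2_3_carrier by (simp add: mod3_numerals)
  show "card {M \<in> carrier SL_2_3. M $ 1 $ 1 + M $ 2 $ 2 = 2} = 9"
    unfolding card_filter[OF fin] unfolding SL_2_3_carrier by (simp add: mod3_numerals)
qed

text \<open>The trace determines the order up to the two scalar matrices: trace 0 means order 4,
  trace 2 order 1 or 3, trace 1 order 2 or 6. The classes of order 1, 2, 3, 4, 6 have sizes 1, 1, 8,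
  6, 8.\<close>

lemma SL_2_3_perfect_order_classes: "perfect_order_classes SL_2_3"
proof -
  interpret group SL_2_3 by (rule SL_2_3_group)
  let ?C = "carrier SL_2_3" and ?I = "mat2 1 0 0 1" and ?Z = "mat2 2 0 0 2"
  let ?tr = "\<lambda>M :: 3 ^ 2 ^ 2. M $ 1 $ 1 + M $ 2 $ 2"
  have fin: "finite ?C" by (rule card_ge_0_finite) (simp add: SL_2_3_card)
  have Z: "?Z \<in> ?C" "?Z ** ?Z = ?I" by (simp_all add: mat2_mult mod3_numerals)
  have I: "?I \<in> ?C" by simp
  have ord_dvd: "ord M dvd n \<longleftrightarrow> M [^]\<^bsub>SL_2_3\<^esub> n = ?I" if "M \<in> ?C" for M and n :: nat
    using pow_eq_id[OF that, of n] by simp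
  have pow2: "M [^]\<^bsub>SL_2_3\<^esub> (2::nat) = M ** M" if "M \<in> ?C" for M using that by (simp add: numeral_2_eq_2 mat2_one[symmetric])
  have pow3: "M [^]\<^bsub>SL_2_3\<^esub> (3::nat) = M ** M ** M" if "M \<in> ?C" for M using that by (simp add: numeral_3_eq_3 mat2_one[symmetric])
  have sq: "M [^]\<^bsub>SL_2_3\<^esub> (n * 2) = M [^]\<^bsub>SL_2_3\<^esub> n ** M [^]\<^bsub>SL_2_3\<^esub> n" if "M \<in> ?C" for M and n :: nat
    using nat_pow_mult[OF that, of n n] by (simp add: mult_2_right)
  have tr0: "ord M = 4" if M: "M \<in> ?C" "?tr M = 0" for M
  proof -
    obtain a b c d where m: "M = mat2 a b c d" using ex_mat2 by blast
    have MM: "M ** M = ?Z" using mat2_trace_zero[of a d b c] M by (simp add: m)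
    have "M [^]\<^bsub>SL_2_3\<^esub> (2 * 2 :: nat) = ?I" unfolding sq[OF M(1)] pow2[OF M(1)] MM by (rule Z(2))
    then have "ord M dvd 2 ^ 2" using ord_dvd[OF M(1), of 4] by simp
    then obtain i where i: "ord M = 2 ^ i" "i \<le> 2" using divides_primepow_nat[OF two_is_prime_nat] by blast
    have "\<not> ord M dvd 2 ^ 1" using ord_dvd[OF M(1), of 2] pow2[OF M(1)] MM by simp
    then have "\<not> i \<le> 1" using i le_imp_power_dvd by metis
    then have "i = 2" using i by simp
    then show ?thesis using i by simp
  qed
  have tr2: "ord M = 1 \<or> ord M = 3" if M: "M \<in> ?C" "?tr M = 2" for M
  proof -
    obtain a b c d where m: "M = mat2 a b c d" using ex_mat2 by blast
    have "M ** M ** M = ?I" using mat2_trace_two[of a d b c] M by (simp add: m)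
    then have "ord M dvd 3" using ord_dvd[OF M(1)] pow3[OF M(1)] by simp
    moreover have "Factorial_Ring.prime (3::nat)" by simp
    ultimately show ?thesis using prime_nat_iff by blast
  qed
  have tr1: "ord M = 2 \<and> M = ?Z \<or> ord M = 6" if M: "M \<in> ?C" "?tr M = 1" for M
  proof -
    obtain a b c d where m: "M = mat2 a b c d" using ex_mat2 by blast
    have M3: "M ** M ** M = ?Z" using mat2_trace_one[of a d b c] M by (simp add: m)
    have "M [^]\<^bsub>SL_2_3\<^esub> (3 * 2 :: nat) = ?I" unfolding sq[OF M(1)] pow3[OF M(1)] M3 by (rule Z(2))
    then have d6: "ord M dvd 6" using ord_dvd[OF M(1), of 6] by simp
    have "\<not> ord M dvd 3" using ord_dvd[OF M(1), of 3] pow3[OF M(1)] M3 by simp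
    moreover have "ord M \<le> 6" using d6 by (rule dvd_imp_le) simp
    moreover have "\<not> 0 dvd (6::nat)" "\<not> 4 dvd (6::nat)" "\<not> 5 dvd (6::nat)" by presburger+
    moreover have "ord M \<in> {0, 1, 2, 3, 4, 5, 6}" using \<open>ord M \<le> 6\<close> by auto
    ultimately have "ord M = 2 \<or> ord M = 6" using d6 by auto
    moreover have "M = ?Z" if o2: "ord M = 2"
    proof -
      have "M ** M = ?I" using ord_dvd[OF M(1), of 2] pow2[OF M(1)] o2 by simp
      then have "M ** M ** M = ?I ** M" by simp
      then show ?thesis using M3 by (simp add: m mat2_mult)
    qed
    ultimately show ?thesis by blast
  qed
  have trace: "?tr M = 0 \<or> ?tr M = 1 \<or> ?tr M = 2" for M by (rule mod3_cases)
  have Z2: "ord ?Z = 2" "?tr ?Z = 1"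
  proof -
    have "ord ?Z dvd 2" using ord_dvd[OF Z(1), of 2] pow2[OF Z(1)] Z(2) by simp
    moreover have "ord ?Z \<noteq> 1" using ord_eq_1[OF Z(1)] by simp
    ultimately show "ord ?Z = 2" using two_is_prime_nat prime_nat_iff by blast
    show "?tr ?Z = 1" by (simp add: mod3_numerals)
  qed
  have I2: "?tr ?I = 2" "ord ?I = 1" using ord_id by simp_all
  have classes: "{M \<in> ?C. ord M = 1} = {?I}" "{M \<in> ?C. ord M = 2} = {?Z}" "{M \<in> ?C. ord M = 4} = {M \<in> ?C. ?tr M = 0}"
    "{M \<in> ?C. ord M = 3} = {M \<in> ?C. ?tr M = 2} - {?I}" "{M \<in> ?C. ord M = 6} = {M \<in> ?C. ?tr M = 1} - {?Z}"
  proof -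
    have o1: "M = ?I" if "M \<in> ?C" "ord M = 1" for M using ord_eq_1 that by simp
    have total: "ord M = 4 \<and> ?tr M = 0 \<or> ord M = 1 \<and> M = ?I \<or> ord M = 3 \<and> ?tr M = 2 \<or> ord M = 2 \<and> M = ?Z \<or> ord M = 6 \<and> ?tr M = 1"
      if "M \<in> ?C" for M using trace[of M] tr0[OF that] tr1[OF that] tr2[OF that] o1[OF that] by blast
    have ne: "?tr M \<noteq> 2 \<or> ?tr M \<noteq> 0" "?tr M \<noteq> 1 \<or> ?tr M \<noteq> 0" "?tr M \<noteq> 1 \<or> ?tr M \<noteq> 2" for M by auto
    show "{M \<in> ?C. ord M = 1} = {?I}" using o1 I I2 by blast
    show "{M \<in> ?C. ord M = 2} = {?Z}"
    proof
      show "{M \<in> ?C. ord M = 2} \<subseteq> {?Z}"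
      proof
        fix M assume "M \<in> {M \<in> ?C. ord M = 2}"
        then show "M \<in> {?Z}" using total[of M] by auto
      qed
    qed (use Z Z2 in simp)
    show "{M \<in> ?C. ord M = 4} = {M \<in> ?C. ?tr M = 0}"
    proof
      show "{M \<in> ?C. ord M = 4} \<subseteq> {M \<in> ?C. ?tr M = 0}"
      proof
        fix M assume "M \<in> {M \<in> ?C. ord M = 4}"
        then show "M \<in> {M \<in> ?C. ?tr M = 0}" using total[of M] by auto
      qed
    qed (use tr0 in blast)
    show "{M \<in> ?C. ord M = 3} = {M \<in> ?C. ?tr M = 2} - {?I}"
    proof
      show "{M \<in> ?C. ord M = 3} \<subseteq> {M \<in> ?C. ?tr M = 2} - {?I}"
      proof
        fix M assume "M \<in> {M \<in> ?C. ord M = 3}"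
        then show "M \<in> {M \<in> ?C. ?tr M = 2} - {?I}" using total[of M] I2 by auto
      qed
      show "{M \<in> ?C. ?tr M = 2} - {?I} \<subseteq> {M \<in> ?C. ord M = 3}" using tr2 o1 by blast
    qed
    show "{M \<in> ?C. ord M = 6} = {M \<in> ?C. ?tr M = 1} - {?Z}"
    proof
      show "{M \<in> ?C. ord M = 6} \<subseteq> {M \<in> ?C. ?tr M = 1} - {?Z}"
      proof
        fix M assume "M \<in> {M \<in> ?C. ord M = 6}"
        then show "M \<in> {M \<in> ?C. ?tr M = 1} - {?Z}" using total[of M] Z2 by auto
      qed
      show "{M \<in> ?C. ?tr M = 1} - {?Z} \<subseteq> {M \<in> ?C. ord M = 6}" using tr1 by blast
    qed
  qed
  have cards: "card {M \<in> ?C. ord M = 1} = 1" "card {M \<in> ?C. ord M = 2} = 1" "card {M \<in> ?C. ord M = 4} = 6"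
    "card {M \<in> ?C. ord M = 3} = 8" "card {M \<in> ?C. ord M = 6} = 8"
  proof -
    have "?I \<in> {M \<in> ?C. ?tr M = 2}" "?Z \<in> {M \<in> ?C. ?tr M = 1}" using I I2 Z Z2 by blast+
    then show "card {M \<in> ?C. ord M = 3} = 8" "card {M \<in> ?C. ord M = 6} = 8"
      unfolding classes using SL_2_3_card_trace by (simp_all only: card_Diff_singleton)
    show "card {M \<in> ?C. ord M = 1} = 1" "card {M \<in> ?C. ord M = 2} = 1" unfolding classes by simp_all
    show "card {M \<in> ?C. ord M = 4} = 6" unfolding classes by (rule SL_2_3_card_trace(1))
  qed
  have orders: "ord M \<in> {1, 2, 3, 4, 6}" if "M \<in> ?C" for M
    using trace[of M] tr0[OF that] tr1[OF that] tr2[OF that] by blast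
  have o24: "order SL_2_3 = 24" by (simp add: order_def SL_2_3_card)
  show ?thesis unfolding perfect_order_classes_def o24
  proof (intro allI impI)
    fix n :: nat
    show "card {M \<in> ?C. ord M = n} = 0 \<or> card {M \<in> ?C. ord M = n} dvd 24"
    proof (cases "n \<in> {1, 2, 3, 4, 6}")
      case True
      then show ?thesis using cards by (elim insertE emptyE) simp_all
    next
      case False
      then have "{M \<in> ?C. ord M = n} = {}" using orders by blast
      then show ?thesis by (simp only: card.empty simp_thms)
    qed
  qed
qed

text \<open>Inside the kernel a class of order p^(i+1) has p^(ir) (p^r - 1) elements, which is
  p^(ir) |H|; outside, classes are |K| times classes of the complement. Kernel and complement are
  those provided by the form.\<close>

theorem frobenius_form_perfect_order_classes:
  fixes G :: "('a, 'c) monoid_scheme" and B :: "('b, 'd) monoid_scheme"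
  assumes G: "group G" "finite (carrier G)" and B: "group B"
    and form: "has_frobenius_form G (cyclic_power (p ^ k) r) B"
    and p: "Factorial_Ring.prime p" and cB: "card (carrier B) = p ^ r - 1" and poc: "perfect_order_classes B"
  shows "perfect_order_classes G"
proof -
  interpret G: group G by fact
  have A: "group (cyclic_power (p ^ k) r)" by simp
  obtain K H where fr: "frobenius_product G K H" and isoA: "cyclic_power (p ^ k) r \<cong> G\<lparr>carrier := K\<rparr>"
    and isoB: "B \<cong> G\<lparr>carrier := H\<rparr>"
    by (rule has_frobenius_formD[OF G(1) A B form])
  interpret F: frobenius G K H by unfold_locales (rule G(2), rule fr)
  have p0: "p > 0" using p prime_gt_0_nat by blast
  obtain f where f: "f \<in> iso (cyclic_power (p ^ k) r) (G\<lparr>carrier := K\<rparr>)" using isoA by (auto simp: is_iso_def)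
  obtain g where g: "g \<in> iso B (G\<lparr>carrier := H\<rparr>)" using isoB by (auto simp: is_iso_def)
  have cK: "card K = p ^ (k * r)"
  proof -
    have "card (carrier (cyclic_power (p ^ k) r)) = card (carrier (G\<lparr>carrier := K\<rparr>))" by (rule iso_same_card[OF isoA])
    then show ?thesis unfolding cyclic_power_card[OF p0, where k = k and r = r] by simp
  qed
  have cH: "card H = p ^ r - 1" using iso_same_card[OF isoB] cB by simp
  have roots: "card {x \<in> K. x [^]\<^bsub>G\<^esub> (p ^ i) = \<one>\<^bsub>G\<^esub>} = p ^ (i * r)" if "i \<le> k" for i
    using iso_card_roots[OF A F.K_group f, of "p ^ i"] cyclic_power_roots[OF p0 that, of r]
    by (simp add: G.nat_pow_consistent[symmetric] del: carrier_product_group one_product_group)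
  have classH: "card {h \<in> H. G.ord h = n} = 0 \<or> card {h \<in> H. G.ord h = n} dvd card H" if "n > 0" for n
    using iso_card_order_class[OF B F.H_group g, of n] poc that cB cH
    by (simp add: perfect_order_classes_def G.ord_subgroup[OF F.H_subgroup] order_def)
  show ?thesis unfolding perfect_order_classes_def
  proof (intro allI impI)
    fix n :: nat assume n0: "n > 0"
    let ?D = "{x \<in> carrier G. G.ord x = n}"
    consider (one) "n = 1" | (kernel) x where "n \<noteq> 1" "x \<in> K" "G.ord x = n" | (outside) "n \<noteq> 1" "\<And>x. x \<in> K \<Longrightarrow> G.ord x \<noteq> n"
      by blast
    then show "card ?D = 0 \<or> card ?D dvd order G"
    proof cases
      case one
      have "?D = {\<one>\<^bsub>G\<^esub>}" using one G.ord_eq_1 by auto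
      then show ?thesis by simp
    next
      case kernel
      have D: "?D = {x \<in> K. G.ord x = n}" by (rule F.order_class_in_kernel[OF kernel])
      have Kk: "{x \<in> K. x [^]\<^bsub>G\<^esub> (p ^ k) = \<one>\<^bsub>G\<^esub>} = K"
        using roots[of k] cK F.finite_K by (intro card_subset_eq) auto
      then have "x [^]\<^bsub>G\<^esub> (p ^ k) = \<one>\<^bsub>G\<^esub>" using kernel(2) by blast
      then have "n dvd p ^ k" using G.pow_eq_id[of x "p ^ k"] kernel by simp
      then obtain m where m: "n = p ^ m" "m \<le> k" using divides_primepow_nat[OF p] by blast
      then obtain i where i: "m = Suc i" using kernel(1) by (cases m) auto
      let ?R = "\<lambda>i. {x \<in> K. x [^]\<^bsub>G\<^esub> (p ^ i) = \<one>\<^bsub>G\<^esub>}"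
      have sub: "?R i \<subseteq> ?R (Suc i)"
      proof
        fix y assume y: "y \<in> ?R i"
        then have yG: "y \<in> carrier G" by auto
        have "y [^]\<^bsub>G\<^esub> (p ^ Suc i) = (y [^]\<^bsub>G\<^esub> (p ^ i)) [^]\<^bsub>G\<^esub> p"
          by (simp add: G.nat_pow_pow[OF yG] mult.commute)
        then show "y \<in> ?R (Suc i)" using y by simp
      qed
      have "?D = ?R (Suc i) - ?R i"
        unfolding D unfolding m(1) i by (rule G.prime_power_order_class[OF p F.K.subset])
      then have "card ?D = p ^ (Suc i * r) - p ^ (i * r)"
        using card_Diff_subset[OF _ sub] F.finite_K roots[of i] roots[of "Suc i"] m i by simp
      also have "\<dots> = p ^ (i * r) * (p ^ r - 1)" by (simp add: power_add diff_mult_distrib2 mult.commute)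
      finally have "card ?D = p ^ (i * r) * card H" using cH by simp
      moreover have "p ^ (i * r) dvd card K" unfolding cK using m i by (intro le_imp_power_dvd) simp
      ultimately have "card ?D dvd card K * card H" by (simp add: mult_dvd_mono)
      then show ?thesis using F.order_eq by simp
    next
      case outside
      have c: "card ?D = card K * card {h \<in> H. G.ord h = n}" by (rule F.card_order_class) (rule outside)+
      show ?thesis using classH[OF n0]
      proof
        assume "card {h \<in> H. G.ord h = n} = 0"
        then show ?thesis unfolding c by simp
      next
        assume "card {h \<in> H. G.ord h = n} dvd card H"
        then show ?thesis unfolding c F.order_eq by (simp add: mult_dvd_mono)
      qed
    qed
  qed
qed

subsection \<open>Complements of order \<open>2\<^sup>a q\<^sup>b\<close>\<close>

context group
begin

lemma centralizer_subgroup: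
  assumes "S \<subseteq> carrier G"
  shows "subgroup {g \<in> carrier G. \<forall>x\<in>S. g \<otimes> x = x \<otimes> g} G" (is "subgroup ?C G")
proof (rule subgroupI)
  show "?C \<subseteq> carrier G" "?C \<noteq> {}" using assms by (auto intro!: exI[of _ \<one>])
  fix g assume g: "g \<in> ?C"
  have "inv g \<otimes> x = x \<otimes> inv g" if "x \<in> S" for x
  proof -
    have xG: "x \<in> carrier G" using that assms by blast
    have "conj_by g x = x" using g that xG conj_by_eq_iff_commute by simp
    then have "conj_by (inv g) x = x" using conj_by_inv_left[of g x] g xG by simp
    then show ?thesis using conj_by_eq_iff_commute[of "inv g" x] g xG by simp
  qed
  then show "inv g \<in> ?C" using g by simp
  fix h assume h: "h \<in> ?C"
  have "g \<otimes> h \<otimes> x = x \<otimes> (g \<otimes> h)" if "x \<in> S" for x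
  proof -
    have c: "x \<in> carrier G" "g \<in> carrier G" "h \<in> carrier G" "g \<otimes> x = x \<otimes> g" "h \<otimes> x = x \<otimes> h"
      using that assms g h by auto
    have "g \<otimes> h \<otimes> x = g \<otimes> x \<otimes> h" using c(1,2,3,5) by (simp add: m_assoc)
    then show ?thesis using c(1,2,3) unfolding c(4) by (simp add: m_assoc)
  qed
  then show "g \<otimes> h \<in> ?C" using g h by simp
qed

text \<open>The centre is non-trivial. If x is not central, its centralizer is strictly larger than
  the centre, hence of order at least p^2, hence everything.\<close>

lemma prime_square_order_abelian:
  assumes p: "Factorial_Ring.prime p" and order: "order G = p ^ b" "b \<le> 2"
    and x: "x \<in> carrier G" and y: "y \<in> carrier G"
  shows "x \<otimes> y = y \<otimes> x"
proof (rule ccontr)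
  assume nc: "x \<otimes> y \<noteq> y \<otimes> x"
  let ?Z = "{g \<in> carrier G. \<forall>h\<in>carrier G. g \<otimes> h = h \<otimes> g}" and ?C = "{g \<in> carrier G. \<forall>h\<in>{x}. g \<otimes> h = h \<otimes> g}"
  have "order G > 0" using order p prime_gt_0_nat by simp
  then have fin: "finite (carrier G)" using order_gt_0_iff_finite by blast
  have Z: "subgroup ?Z G" by (rule centralizer_subgroup) simp
  have C: "subgroup ?C G" by (rule centralizer_subgroup) (use x in simp)
  have "{\<one>} \<lhd> G" "carrier G \<lhd> G" using one_is_normal normal_self by blast+
  moreover have "carrier G \<noteq> {\<one>}"
  proof
    assume "carrier G = {\<one>}"
    then have "x = \<one>" "y = \<one>" using x y by blast+
    then show False using nc by simp
  qed
  then have "{\<one>} \<subset> carrier G" by blast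
  ultimately have "\<exists>c\<in>carrier G - {\<one>}. \<forall>h\<in>carrier G. conj_by h c \<otimes> inv c \<in> {\<one>}"
    by (intro prime_power_order_central_modulo[OF p order(1)])
  then obtain c where c: "c \<in> carrier G - {\<one>}" "\<And>h. h \<in> carrier G \<Longrightarrow> conj_by h c \<otimes> inv c \<in> {\<one>}"
    by blast
  have cZ: "c \<in> ?Z"
  proof -
    have "c \<otimes> h = h \<otimes> c" if "h \<in> carrier G" for h
    proof -
      have "conj_by h c \<otimes> inv c = \<one>" using c(2)[OF that] by blast
      then have "conj_by h c = c" using c(1) that inv_equality[of "conj_by h c" "inv c"] by simp
      then show ?thesis using conj_by_eq_iff_commute[of h c] c(1) that by simp
    qed
    then show ?thesis using c(1) by blast
  qed
  have "card ?Z dvd p ^ b" "card ?C dvd p ^ b" using card_subgroup_dvd[OF Z] card_subgroup_dvd[OF C] unfolding order(1) .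
  then obtain i j where i: "card ?Z = p ^ i" and j: "card ?C = p ^ j" "j \<le> b"
    unfolding divides_primepow_nat[OF p] by blast
  have "{\<one>, c} \<subseteq> ?Z" using cZ by auto
  then have "card {\<one>, c} \<le> card ?Z" by (rule card_mono[rotated]) (use fin in simp)
  then have "i \<noteq> 0" using c i by (cases i) auto
  have "?Z \<subset> ?C"
  proof
    show "?Z \<subseteq> ?C" using x by auto
    have "x \<in> ?C" "x \<notin> ?Z" using x y nc by auto
    then show "?Z \<noteq> ?C" by blast
  qed
  then have "card ?Z < card ?C" by (rule psubset_card_mono[rotated]) (use fin in simp)
  then have "i < j" using i j p prime_gt_1_nat by (simp add: power_strict_increasing_iff)
  then have "j = b" using \<open>i \<noteq> 0\<close> j(2) order(2) by simp
  then have "?C = carrier G" using fin j order by (intro card_subset_eq) (auto simp: order_def)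
  then have "y \<in> ?C" using y by blast
  then show False using nc by simp
qed

text \<open>If no element had full order, then for b = 2 all elements would have order 1 or p and
  lie in a single subgroup of order p.\<close>

lemma prime_square_order_cyclic:
  assumes p: "Factorial_Ring.prime p" and order: "order G = p ^ b" "b \<le> 2"
    and unique: "\<And>x y. b = 2 \<Longrightarrow> x \<in> carrier G \<Longrightarrow> y \<in> carrier G \<Longrightarrow> ord x = p \<Longrightarrow> ord y = p \<Longrightarrow> y \<in> generate G {x}"
  shows "\<exists>t\<in>carrier G. ord t = p ^ b"
proof (rule ccontr)
  assume none: "\<not> ?thesis"
  have p1: "p > 1" using p prime_gt_1_nat by blast
  have "order G > 0" using order p1 by simp
  then have fin: "finite (carrier G)" using order_gt_0_iff_finite by blast
  have "b \<noteq> 0"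
  proof
    assume "b = 0"
    then have "ord \<one> = p ^ b" using ord_id by simp
    then show False using none one_closed by blast
  qed
  then have "p dvd order G" using order by simp
  then obtain x where x: "x \<in> carrier G" "ord x = p" using exists_elem_of_prime_order[OF fin p] by blast
  have "b \<noteq> 1" using none x by auto
  then have b2: "b = 2" using \<open>b \<noteq> 0\<close> order(2) by simp
  have "y \<in> generate G {x}" if y: "y \<in> carrier G" for y
  proof -
    have "ord y dvd p ^ b" using ord_dvd_group_order[OF y] order by simp
    then obtain i where i: "ord y = p ^ i" "i \<le> b" using divides_primepow_nat[OF p] by blast
    then have "i \<noteq> b" using none y by blast
    then have "i = 0 \<or> i = 1" using i order(2) by linarith
    then show ?thesis
    proof
      assume "i = 0"
      then have "y = \<one>" using i ord_eq_1[OF y] by simp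
      then show ?thesis using generate.one by simp
    next
      assume "i = 1"
      then show ?thesis using unique[OF b2 x(1) y x(2)] i by simp
    qed
  qed
  then have "carrier G \<subseteq> generate G {x}" by blast
  then have "card (carrier G) \<le> card (generate G {x})"
    by (rule card_mono[rotated]) (rule finite_subset[OF generate_incl fin], use x in simp)
  then have "p ^ b \<le> p ^ 1" using order generate_pow_card[OF x(1)] x(2) by (simp add: order_def)
  then show False using p1 b2 by (simp only: power_increasing_iff)
qed

text \<open>Elements of order q are grouped by the subgroup they generate, each of which has q - 1
  generators.\<close>

lemma prime_minus_one_dvd_order_class:
  assumes fin: "finite (carrier G)" and q: "Factorial_Ring.prime q"
  shows "(q - 1) dvd card {x \<in> carrier G. ord x = q}"
proof (rule equiv_imp_dvd_card)
  let ?S = "{x \<in> carrier G. ord x = q}"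
  let ?r = "{(x, y). x \<in> ?S \<and> y \<in> ?S \<and> generate G {x} = generate G {y}}"
  show "finite ?S" using fin by simp
  show "equiv ?S ?r" by (rule equivI) (auto simp: refl_on_def sym_def trans_def)
  fix E assume "E \<in> ?S // ?r"
  then obtain x where x: "x \<in> carrier G" "ord x = q" and E: "E = ?r `` {x}" by (auto simp: quotient_def)
  have finx: "finite (generate G {x})" by (rule finite_subset[OF generate_incl fin]) (use x in simp)
  have "E = generate G {x} - {\<one>}"
  proof
    show "E \<subseteq> generate G {x} - {\<one>}"
    proof
      fix y assume "y \<in> E"
      then have y: "y \<in> carrier G" "ord y = q" "generate G {x} = generate G {y}" using E by auto
      have "y \<noteq> \<one>" using y(2) ord_id q not_prime_1 by metis
      then show "y \<in> generate G {x} - {\<one>}" unfolding y(3) by (auto intro: generate.incl)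
    qed
    show "generate G {x} - {\<one>} \<subseteq> E"
    proof
      fix y assume y: "y \<in> generate G {x} - {\<one>}"
      interpret A: subgroup "generate G {x}" G using x by (intro generate_is_subgroup) auto
      have yG: "y \<in> carrier G" using y by auto
      have sub: "generate G {y} \<subseteq> generate G {x}" by (rule generate_subgroup_incl) (use y A.subgroup_axioms in auto)
      have "card (generate G {y}) dvd card (generate G {x})"
      proof -
        interpret A': group "G\<lparr>carrier := generate G {x}\<rparr>" by (rule A.subgroup_is_group) (rule is_group)
        have "subgroup (generate G {y}) (G\<lparr>carrier := generate G {x}\<rparr>)"
          by (rule subgroup_incl[OF generate_is_subgroup A.subgroup_axioms sub]) (use yG in simp)
        from A'.card_subgroup_dvd[OF this] show ?thesis by (simp add: order_def)
      qed
      then have "ord y dvd q" using generate_pow_card[OF yG] generate_pow_card[OF x(1)] x(2) by simp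
      moreover have "ord y \<noteq> 1" using ord_eq_1[OF yG] y by simp
      ultimately have oy: "ord y = q" using q prime_nat_iff by blast
      have "generate G {y} = generate G {x}"
        by (rule card_subset_eq[OF finx sub]) (use generate_pow_card[OF yG] generate_pow_card[OF x(1)] x(2) oy in simp)
      then show "y \<in> E" using E x yG oy by auto
    qed
  qed
  then have "card E = card (generate G {x}) - 1" using finx by (simp add: card_Diff_singleton generate.one)
  then show "(q - 1) dvd card E" using generate_pow_card[OF x(1)] x(2) by simp
qed

lemma coprime_subgroups_Int:
  assumes A: "subgroup A G" and B: "subgroup B G" and cop: "coprime (card A) (card B)"
  shows "A \<inter> B = {\<one>}"
proof -
  have "x = \<one>" if x: "x \<in> A" "x \<in> B" for x
  proof -
    have xG: "x \<in> carrier G" using x subgroup.mem_carrier[OF A] by blast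
    have "ord x dvd card S" if S: "subgroup S G" "x \<in> S" for S
    proof -
      interpret S: group "G\<lparr>carrier := S\<rparr>" by (rule subgroup.subgroup_is_group[OF S(1)]) (rule is_group)
      show ?thesis using S.ord_dvd_group_order[of x] S by (simp add: ord_subgroup order_def)
    qed
    then have "ord x dvd 1" using A B x cop coprime_common_divisor_nat by (metis nat_dvd_1_iff_1)
    then show ?thesis using ord_eq_1[OF xG] by simp
  qed
  then show ?thesis using subgroup.one_closed[OF A] subgroup.one_closed[OF B] by blast
qed

lemma coprime_subgroups_mult:
  assumes fin: "finite (carrier G)" and A: "subgroup A G" and B: "subgroup B G" and cop: "coprime (card A) (card B)"
    and order: "order G = card A * card B"
  shows "A <#> B = carrier G"
proof (rule card_subset_eq[OF fin])
  show "A <#> B \<subseteq> carrier G" using subgroup.subset[OF A] subgroup.subset[OF B] by (auto simp: set_mult_def)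
  show "card (A <#> B) = card (carrier G)"
    using cardinality_set_mult[OF A B coprime_subgroups_Int[OF A B cop] fin] order by (simp add: order_def)
qed

end

context unique_involution
begin

text \<open>The 2-complement is the solution set of a power equation, hence invariant under
  conjugation. Its order is at most q^2, so it is abelian, and the hypothesis \<open>unique\<close>
  for commuting elements makes it cyclic.\<close>

theorem cyclic_sylow_semidirect:
  assumes q: "Factorial_Ring.prime q" "odd q" and order: "order G = 2 ^ a * q ^ b" and b: "b \<le> 2"
    and c: "c \<in> carrier G" "ord c = 2 ^ a"
    and unique: "\<And>x y. b = 2 \<Longrightarrow> x \<in> carrier G \<Longrightarrow> y \<in> carrier G \<Longrightarrow> ord x = q \<Longrightarrow> ord y = q \<Longrightarrow> x \<otimes> y = y \<otimes> x \<Longrightarrow> y \<in> generate G {x}"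
  shows "\<exists>\<psi>\<in>hom (integer_mod_group (2 ^ a)) (AutoGroup (integer_mod_group (q ^ b))).
    semidirect (integer_mod_group (q ^ b)) (integer_mod_group (2 ^ a)) \<psi> \<cong> G"
proof -
  let ?Q = "{x \<in> carrier G. x [^] (q ^ b) = \<one>}"
  have q0: "q ^ b > 0" using q prime_gt_0_nat by simp
  have inv_unique: "x = y" if "x \<in> carrier G" "y \<in> carrier G" "ord x = 2" "ord y = 2" for x y
    using involution_eq that by metis
  have "odd (q ^ b)" using q by simp
  then have "subgroup ?Q G \<and> card ?Q = q ^ b"
    by (intro cyclic_sylow_two_complement[OF is_group fin _ c order]) (rule inv_unique)
  then have Q: "subgroup ?Q G" "card ?Q = q ^ b" by blast+
  interpret Q: group "G\<lparr>carrier := ?Q\<rparr>" by (rule subgroup.subgroup_is_group[OF Q(1)]) (rule is_group)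
  have oQ: "order (G\<lparr>carrier := ?Q\<rparr>) = q ^ b" using Q(2) by (simp add: order_def)
  have "\<exists>t\<in>carrier (G\<lparr>carrier := ?Q\<rparr>). Q.ord t = q ^ b"
  proof (rule Q.prime_square_order_cyclic[OF q(1) oQ b])
    fix x y assume b2: "b = 2" and xy: "x \<in> carrier (G\<lparr>carrier := ?Q\<rparr>)" "y \<in> carrier (G\<lparr>carrier := ?Q\<rparr>)" "Q.ord x = q" "Q.ord y = q"
    have xQ: "x \<in> ?Q" using xy(1) by simp
    have "x \<otimes> y = y \<otimes> x" using Q.prime_square_order_abelian[OF q(1) oQ b xy(1,2)] by simp
    then have "y \<in> generate G {x}" using unique[of x y] b2 xy ord_subgroup[OF Q(1)] by simp
    then show "y \<in> generate (G\<lparr>carrier := ?Q\<rparr>) {x}" unfolding generate_restrict[OF Q(1) xQ] .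
  qed
  then obtain t where t: "t \<in> ?Q" "ord t = q ^ b" using ord_subgroup[OF Q(1)] by auto
  have tG: "t \<in> carrier G" using t(1) by blast
  let ?T = "generate G {t}" and ?P = "generate G {c}"
  have TQ: "?T = ?Q"
  proof (rule card_subset_eq)
    show "finite ?Q" using fin by simp
    show "?T \<subseteq> ?Q" by (rule generate_subgroup_incl[OF _ Q(1)]) (use t in blast)
    show "card ?T = card ?Q" using generate_pow_card[OF tG] t(2) Q(2) by simp
  qed
  have P: "subgroup ?P G" "card ?P = 2 ^ a" using c generate_pow_card[OF c(1)] by (auto intro: generate_is_subgroup)
  have Qn: "?Q \<lhd> G" unfolding normal_iff_conj_by using Q(1) by (auto simp: conj_by_pow[symmetric])
  have cop: "coprime (card ?Q) (card ?P)" using Q(2) P(2) q(2) by simp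
  have S: "internal_semidirect G ?T ?P" unfolding internal_semidirect_def TQ
    using Qn P(1) coprime_subgroups_Int[OF Q(1) P(1) cop] coprime_subgroups_mult[OF fin Q(1) P(1) cop] order Q(2) P(2)
    by (simp add: mult.commute)
  have A: "group (integer_mod_group (q ^ b))" and B: "group (integer_mod_group (2 ^ a))" by simp_all
  have "\<exists>\<phi>\<in>hom (integer_mod_group (2 ^ a)) (AutoGroup (integer_mod_group (q ^ b))).
    (\<lambda>(m, n). t [^] m \<otimes> c [^] n) \<in> iso (semidirect (integer_mod_group (q ^ b)) (integer_mod_group (2 ^ a)) \<phi>) G"
    by (rule internal_semidirect_iso[OF S A B cyclic_iso[OF tG t(2) q0] cyclic_iso[OF c]]) simp
  then show ?thesis unfolding is_iso_def by blast
qed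

text \<open>The normal quaternion subgroup \<open>?P\<close> is nilpotent, so a Sylow q-subgroup
  \<open>W\<close> cannot centralize it. Some element of \<open>W\<close> therefore moves the cyclic
  part, which is possible only when that part has order 4; then a = 3, and the sharp count gives q^b
  = 3.\<close>

theorem quaternion_sylow_cases:
  assumes q: "Factorial_Ring.prime q" "odd q" and order: "order G = 2 ^ a * q ^ b" and b: "b \<le> 2" and a: "a \<ge> 2"
    and not_cyclic: "\<And>c. c \<in> carrier G \<Longrightarrow> ord c \<noteq> 2 ^ a"
    and poc: "perfect_order_classes G" and le: "q ^ b \<le> 2 ^ (a - 2) + 1"
    and not_nilpotent: "\<not> nilpotent_group G"
  shows "a = 3 \<and> q ^ b = 3 \<and> SL_2_3 \<cong> G"
proof -
  have m: "odd (q ^ b)" using q by simp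
  have roots: "g \<otimes> g = z \<longleftrightarrow> ord g = 4" if g: "g \<in> carrier G" for g
  proof
    assume gg: "g \<otimes> g = z"
    have g2: "g [^] (2 * 2 :: nat) = \<one>" unfolding nat_pow_pow[OF g, symmetric] using g gg by (simp add: numeral_2_eq_2)
    then have "ord g dvd 2 ^ 2" using pow_eq_id[OF g, of 4] by simp
    then obtain i where i: "ord g = 2 ^ i" "i \<le> 2" using divides_primepow_nat[OF two_is_prime_nat] by blast
    have "\<not> ord g dvd 2" using pow_eq_id[OF g, of 2] gg z_neq_one g by (simp add: numeral_2_eq_2)
    then have "\<not> i \<le> 1" using i le_imp_power_dvd[of i 1 "2::nat"] by (metis power_one_right)
    then have "i = 2" using i by simp
    then show "ord g = 4" using i by simp
  next
    assume "ord g = 4"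
    then show "g \<otimes> g = z" using half_power_eq_z[OF g, of 1] g by (simp add: numeral_2_eq_2)
  qed
  have N4: "{g \<in> carrier G. g \<otimes> g = z} = {g \<in> carrier G. ord g = 4}" using roots by blast
  have "(2::nat) ^ 2 dvd 2 ^ a" using a by (rule le_imp_power_dvd)
  then have "4 dvd order G" using order by simp
  then have "4 dvd card {g \<in> carrier G. g \<otimes> g = z} + 2" by (rule card_roots_of_involution)
  then have "card {g \<in> carrier G. g \<otimes> g = z} \<noteq> 0" by (intro notI) (simp add: numeral_2_eq_2[symmetric])
  then have dvd: "card {g \<in> carrier G. g \<otimes> g = z} dvd order G" unfolding N4
    using poc[unfolded perfect_order_classes_def, rule_format, of 4] by simp
  obtain x y where x: "x \<in> carrier G" "ord x = 2 ^ (a - 1)" and a3: "a \<ge> 3" and mq: "q ^ b = 2 ^ (a - 2) + 1"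
    and y: "y \<in> carrier G" "y \<notin> generate G {x}" "y \<otimes> y = z" "conj_by y x = inv x"
    and P: "(generate G {x} \<union> (\<lambda>g. g \<otimes> y) ` generate G {x}) \<lhd> G" (is "?P \<lhd> G")
    and cP: "card (generate G {x} \<union> (\<lambda>g. g \<otimes> y) ` generate G {x}) = 2 ^ a"
    using quaternion_sylow_normal[OF order m a not_cyclic dvd le] by blast
  have Psub: "subgroup ?P G" using P by (rule normal_imp_subgroup)
  obtain W where W: "subgroup W G" "card W = q ^ b"
    using sylow_thm[of q G b "2 ^ a"] q(1) is_group order fin by (auto simp: mult.commute)
  interpret W: subgroup W G by (rule W(1))
  interpret WG: group "G\<lparr>carrier := W\<rparr>" by (rule W.subgroup_is_group) (rule is_group)
  have oW: "order (G\<lparr>carrier := W\<rparr>) = q ^ b" using W(2) by (simp add: order_def)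
  have ordW: "ord w dvd q ^ b" if "w \<in> W" for w
    using WG.ord_dvd_group_order[of w] that oW by (simp add: ord_subgroup[OF W(1)])
  have Wab: "v \<otimes> w = w \<otimes> v" if "v \<in> W" "w \<in> W" for v w
    using WG.prime_square_order_abelian[OF q(1) oW b] that by simp
  have cop: "coprime (card ?P) (card W)" using W(2) cP q(2) by simp
  have PW: "?P <#> W = carrier G"
    by (rule coprime_subgroups_mult[OF fin Psub W(1) cop]) (use order cP W(2) in simp)
  have A_iff: "g \<in> generate G {x} \<longleftrightarrow> (\<exists>i::nat. g = x [^] i)" for g by (rule generate_singleton_iff[OF fin x(1)])
  \<comment> \<open>If all of \<open>W\<close> normalized the cyclic part, having odd order it would
    centralize x and y; being abelian, it would be central in the product of \<open>?P\<close> and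
    \<open>W\<close>, and the group would be nilpotent.\<close>
  have "\<exists>w\<in>W. conj_by w x \<notin> generate G {x}"
  proof (rule ccontr)
    assume "\<not> ?thesis"
    then have wx: "conj_by w x \<in> generate G {x}" if "w \<in> W" for w using that by blast
    have cent: "w \<otimes> g = g \<otimes> w" if w: "w \<in> W" and g: "g \<in> carrier G" for w g
    proof -
      have wG: "w \<in> carrier G" using w by simp
      have odd: "odd (ord w)" using ordW[OF w] m dvd_trans by blast
      note c = odd_order_centralizes_quaternion[OF x y(1,2) P wG odd wx[OF w]]
      have "a - 1 > 0" using a by simp
      then have "w \<otimes> x = x \<otimes> w" "w \<otimes> y = y \<otimes> w" using c conj_by_eq_iff_commute[OF wG x(1)] conj_by_eq_iff_commute[OF wG y(1)] by blast+
      then have "?P <#> W \<subseteq> {g \<in> carrier G. w \<otimes> g = g \<otimes> w}"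
      proof -
        have "subgroup {g \<in> carrier G. \<forall>h\<in>{w}. g \<otimes> h = h \<otimes> g} G" by (rule centralizer_subgroup) (use wG in simp)
        moreover have "{g \<in> carrier G. \<forall>h\<in>{w}. g \<otimes> h = h \<otimes> g} = {g \<in> carrier G. w \<otimes> g = g \<otimes> w}" (is "_ = ?C") by auto
        ultimately have C: "subgroup ?C G" by (simp only:)
        have "x \<in> ?C" "y \<in> ?C" using \<open>w \<otimes> x = x \<otimes> w\<close> \<open>w \<otimes> y = y \<otimes> w\<close> x y by blast+
        then have "generate G {x} \<subseteq> ?C" using generate_subgroup_incl[OF _ C, of "{x}"] by blast
        then have "?P \<subseteq> ?C" using subgroup.m_closed[OF C _ \<open>y \<in> ?C\<close>] by blast
        moreover have "W \<subseteq> ?C" using Wab[OF w] by auto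
        ultimately show ?thesis using subgroup.m_closed[OF C] unfolding set_mult_def by blast
      qed
      then show ?thesis using g unfolding PW by blast
    qed
    interpret PG: group "G\<lparr>carrier := ?P\<rparr>" by (rule subgroup.subgroup_is_group[OF Psub]) (rule is_group)
    have "order (G\<lparr>carrier := ?P\<rparr>) = 2 ^ a" using cP by (simp add: order_def)
    then have "nilpotent_group (G\<lparr>carrier := ?P\<rparr>)" by (rule PG.prime_power_order_nilpotent[OF two_is_prime_nat])
    then show False using nilpotent_central_product[OF Psub _ W.subset cent PW] not_nilpotent by blast
  qed
  then obtain w where w: "w \<in> W" "conj_by w x \<notin> generate G {x}" by blast
  have wG: "w \<in> carrier G" using w by simp
  have "\<not> a - 1 \<ge> 3" using conj_mem_cyclic_of_large_order[OF x _ y(1,3,4) P wG] w(2) by blast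
  then have a: "a = 3" using a3 by simp
  have q3: "q ^ b = 3" using mq a by simp
  have ox: "ord x = 4" using x a by simp
  have "ord w \<noteq> 1" using w(2) ord_eq_1[OF wG] x generate.incl[of x "{x}" G] by auto
  moreover have "Factorial_Ring.prime (3::nat)" by simp
  ultimately have ow: "ord w = 3" using ordW[OF w(1)] q3 prime_nat_iff by metis
  obtain j v where j: "j \<in> carrier G" and v: "v \<in> carrier G" and rel: "ord v = 3" "j \<otimes> j = z" "conj_by j x = inv x"
      "conj_by v x = j" "conj_by v j = x \<otimes> j" and Pj: "?P = generate G {x} \<union> (\<lambda>g. g \<otimes> j) ` generate G {x}"
    using binary_tetrahedral_relations[OF x(1) ox y P wG ow w(2)] by blast
  have xx: "x \<otimes> x = z" using half_power_eq_z[OF x(1), of 1] ox x by (simp add: numeral_2_eq_2)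
  have "binary_tetrahedral G x j v"
  proof unfold_locales
    show x4: "x [^] (4::nat) = \<one>" using pow_ord_eq_1[OF x(1)] ox by simp
    show "j \<otimes> j = x \<otimes> x" unfolding rel(2) xx ..
    have "x [^] (3::nat) \<otimes> x = \<one>" using x4 nat_pow_Suc[of x 3] by simp
    then have "inv x = x [^] (3::nat)" using x by (intro inv_equality) auto
    then have "conj_by j x = x [^] (3::nat)" using rel(3) by simp
    then show "j \<otimes> x = x [^] (3::nat) \<otimes> j" using conj_by_eq_iff[OF j x(1), of "x [^] (3::nat)"] x by simp
    show "v [^] (3::nat) = \<one>" using pow_ord_eq_1[OF v] rel(1) by simp
    show "v \<otimes> x = j \<otimes> v" using conj_by_eq_iff[OF v x(1) j] rel(4) by blast
    have "x \<otimes> j \<in> carrier G" using x j by simp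
    then show "v \<otimes> j = x \<otimes> j \<otimes> v" using conj_by_eq_iff[OF v j] rel(5) by blast
    show "card (carrier G) = 24" using order a q3 by (simp add: order_def)
    show "carrier G \<subseteq> (\<lambda>(a, b, c). x [^] a \<otimes> j [^] b \<otimes> v [^] c) ` ({..<4::nat} \<times> {..<2::nat} \<times> {..<3::nat})"
    proof
      fix g assume g: "g \<in> carrier G"
      have V: "subgroup (generate G {v}) G" "card (generate G {v}) = 3"
        using v rel(1) generate_pow_card[OF v] by (auto intro: generate_is_subgroup)
      have "?P <#> generate G {v} = carrier G"
        by (rule coprime_subgroups_mult[OF fin Psub V(1)]) (use order cop cP W(2) V(2) q3 a in simp_all)
      then obtain h u where h: "h \<in> ?P" and u: "u \<in> generate G {v}" and ghu: "g = h \<otimes> u"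
        using g unfolding set_mult_def by blast
      obtain k :: nat where "u = v [^] k" using u generate_singleton_iff[OF fin v] by blast
      then have u: "u = v [^] (k mod 3)" using pow_mod_ord[OF v, of k] rel(1) by simp
      obtain b where b: "b \<in> {..<2::nat}" "\<exists>f\<in>generate G {x}. h = f \<otimes> j [^] b"
      proof (cases "h \<in> generate G {x}")
        case True
        then have "h \<in> carrier G" using generate_in_carrier[of "{x}" h] x by simp
        then have "h = h \<otimes> j [^] (0::nat)" by simp
        then show ?thesis using True by (intro that[of 0]) auto
      next
        case False
        then obtain f where "f \<in> generate G {x}" "h = f \<otimes> j" using h unfolding Pj by blast
        then show ?thesis using j by (intro that[of 1]) auto
      qed
      then obtain f where "f \<in> generate G {x}" "h = f \<otimes> j [^] b" by blast
      then obtain i :: nat where "h = x [^] i \<otimes> j [^] b" unfolding A_iff by blast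
      then have "h = x [^] (i mod 4) \<otimes> j [^] b" using pow_mod_ord[OF x(1), of i] ox by simp
      then have g_eq: "g = (\<lambda>(a, b, c). x [^] a \<otimes> j [^] b \<otimes> v [^] c) (i mod 4, b, k mod 3)" unfolding ghu u by simp
      show "g \<in> (\<lambda>(a, b, c). x [^] a \<otimes> j [^] b \<otimes> v [^] c) ` ({..<4::nat} \<times> {..<2::nat} \<times> {..<3::nat})"
        unfolding g_eq by (rule imageI) (use b(1) in simp)
    qed
  qed (rule x(1) j v)+
  then have "SL_2_3 \<cong> G" by (rule binary_tetrahedral_unique[OF SL_2_3_binary_tetrahedral])
  then show ?thesis using a q3 by simp
qed

end

subsection \<open>The classification\<close>

lemma two_prime_factors:
  fixes n q :: nat
  assumes "n > 0" and sub: "prime_factors n \<subseteq> {2, q}" and q: "Factorial_Ring.prime q"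
  shows "\<exists>a b. n = 2 ^ a * q ^ b"
proof -
  obtain a m where m: "n = 2 ^ a * m" "\<not> 2 dvd m"
    using multiplicity_decompose'[of n "2::nat"] \<open>n > 0\<close> by (metis not_gr0 odd_one)
  have "\<exists>b. m = q ^ b"
  proof (rule prime_powerI[OF _ q])
    show "m > 0" using m(2) by (intro gr0I) simp
    fix l :: nat assume l: "Factorial_Ring.prime l" "l dvd m"
    have "l dvd n" unfolding m(1) using l(2) by simp
    then have "l \<in> prime_factors n" using l(1) \<open>n > 0\<close> by (simp add: in_prime_factors_iff)
    then have "l = 2 \<or> l = q" using sub by blast
    then show "l = q" using l(2) m(2) by auto
  qed
  then show ?thesis using m(1) by blast
qed

context frobenius
begin

lemma nonabelian_complement_of_form:
  assumes not_nilpotent: "\<not> nilpotent_group (G\<lparr>carrier := H\<rparr>)" and form: "has_frobenius_form G A B"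
    and A: "comm_group A" and B: "group B"
  shows "\<exists>b\<in>carrier B. \<exists>b'\<in>carrier B. b \<otimes>\<^bsub>B\<^esub> b' \<noteq> b' \<otimes>\<^bsub>B\<^esub> b"
proof (rule ccontr)
  assume "\<not> ?thesis"
  then have Bab: "b \<otimes>\<^bsub>B\<^esub> b' = b' \<otimes>\<^bsub>B\<^esub> b" if "b \<in> carrier B" "b' \<in> carrier B" for b b' using that by blast
  have Ag: "group A" using A by (rule comm_group.axioms(2))
  obtain L M where LM: "frobenius_product G L M" and isoA: "A \<cong> G\<lparr>carrier := L\<rparr>" and isoB: "B \<cong> G\<lparr>carrier := M\<rparr>"
    by (rule has_frobenius_formD[OF is_group Ag B form])
  interpret F: frobenius G L M by unfold_locales (rule fin, rule LM)
  have image: "x \<otimes> y = y \<otimes> x"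
    if im: "C \<cong> G\<lparr>carrier := S\<rparr>" "\<And>b b'. b \<in> carrier C \<Longrightarrow> b' \<in> carrier C \<Longrightarrow> b \<otimes>\<^bsub>C\<^esub> b' = b' \<otimes>\<^bsub>C\<^esub> b" "x \<in> S" "y \<in> S"
    for C :: "('x, 'y) monoid_scheme" and S x y
  proof -
    obtain f where f: "f \<in> hom C (G\<lparr>carrier := S\<rparr>)" "bij_betw f (carrier C) S"
      using im(1) by (auto simp: is_iso_def iso_def)
    then obtain b b' where b: "b \<in> carrier C" "b' \<in> carrier C" "x = f b" "y = f b'"
      using im(3,4) bij_betw_imp_surj_on by blast
    show ?thesis using im(2)[OF b(1,2)] hom_mult[OF f(1) b(1,2)] hom_mult[OF f(1) b(2,1)] b(3,4) by simp
  qed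
  have Lab: "x \<otimes> y = y \<otimes> x" if "x \<in> L" "y \<in> L" for x y
    by (rule image[OF isoA _ that]) (rule comm_groupE(4)[OF A])
  have Mab: "x \<otimes> y = y \<otimes> x" if "x \<in> M" "y \<in> M" for x y by (rule image[OF isoB Bab that])
  \<comment> \<open>A non-trivial common element x is centralized by the abelian \<open>L\<close>,
    so \<open>L\<close> lies in \<open>H\<close>. Then all conjugates of x lie in \<open>L\<close>,
    thus in \<open>H\<close>, and \<open>H\<close> would be the whole group.\<close>
  have L_Int_H: "x = \<one>" if x: "x \<in> L" "x \<in> H" for x
  proof (rule ccontr)
    assume x1: "x \<noteq> \<one>"
    have LH: "g \<in> H" if "g \<in> L" for g
      by (rule centralizer_in_complement[OF x(2) x1 _ Lab[OF that x(1)]]) (use that in simp)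
    have "g \<in> H" if "g \<in> carrier G" for g
      by (rule conj_by_mem_complement[OF x(2) x1 that]) (rule LH[OF F.conj_by_K[OF that x(1)]])
    then show False using H_proper by auto
  qed
  \<comment> \<open>As \<open>M\<close> is abelian, its contributions cancel modulo
    \<open>L\<close>; this is the statement that the quotient by \<open>L\<close> is
    abelian.\<close>
  have comm_L: "conj_by g h \<otimes> inv h \<in> L" if g: "g \<in> carrier G" and h: "h \<in> carrier G" for g h
  proof -
    obtain l m where l: "l \<in> L" and m: "m \<in> M" and gl: "g = l \<otimes> m" using F.decompose[OF g] by blast
    obtain l' m' where l': "l' \<in> L" and m': "m' \<in> M" and hl: "h = l' \<otimes> m'" using F.decompose[OF h] by blast
    have c: "l \<in> carrier G" "m \<in> carrier G" "l' \<in> carrier G" "m' \<in> carrier G" using l m l' m' by simp_all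
    have mm: "conj_by m m' = m'" using conj_by_eq_iff_commute[OF c(2,4)] Mab[OF m m'] by blast
    have "conj_by g h = conj_by l (conj_by m (l' \<otimes> m'))" unfolding gl hl using c by (simp add: conj_by_conj_by)
    also have "\<dots> = conj_by l (conj_by m l' \<otimes> m')" using c mm by (simp add: conj_by_mult)
    finally have "conj_by g h \<otimes> inv h = l \<otimes> conj_by m l' \<otimes> conj_by m' (inv l) \<otimes> inv l'"
      unfolding hl using c by (simp add: conj_by_def word_simps)
    moreover have "conj_by m l' \<in> L" "conj_by m' (inv l) \<in> L" using F.conj_by_K[OF c(2) l'] F.conj_by_K[OF c(4)] l by auto
    ultimately show ?thesis using l l' by simp
  qed
  interpret HG: group "G\<lparr>carrier := H\<rparr>" by (rule H_group)
  have "x \<otimes> y = y \<otimes> x" if x: "x \<in> H" and y: "y \<in> H" for x y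
  proof -
    have c: "x \<in> carrier G" "y \<in> carrier G" using x y by simp_all
    have "conj_by x y \<otimes> inv y \<in> H" unfolding conj_by_def using x y by simp
    then have "conj_by x y \<otimes> inv y = \<one>" by (rule L_Int_H[OF comm_L[OF c]])
    then have "conj_by x y = y" using inv_equality[of "conj_by x y" "inv y"] c by simp
    then show ?thesis using conj_by_eq_iff_commute[OF c] by simp
  qed
  then have "nilpotent_group (G\<lparr>carrier := H\<rparr>)" by (intro HG.abelian_nilpotent) simp_all
  then show False using not_nilpotent by blast
qed

text \<open>The solutions of k^p = 1 in \<open>K\<close> form a group generated by one element k, on
  which \<open>H\<close> acts by raising to powers. Such actions commute, and freeness at k turns
  this into commutation in \<open>H\<close>.\<close>

lemma abelian_complement_of_cyclic_socle:
  assumes p: "Factorial_Ring.prime p" and socle: "card {x \<in> K. x [^] p = \<one>} = p"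
    and x: "x \<in> H" and y: "y \<in> H"
  shows "x \<otimes> y = y \<otimes> x"
proof -
  let ?S = "{k \<in> K. k [^] p = \<one>}"
  have c: "x \<in> carrier G" "y \<in> carrier G" using x y by simp_all
  have finS: "finite ?S" using finite_K by simp
  have "\<not> ?S \<subseteq> {\<one>}"
  proof
    assume "?S \<subseteq> {\<one>}"
    then have "card ?S \<le> card {\<one>}" by (rule card_mono[rotated]) simp
    then show False using socle p prime_gt_1_nat[of p] by simp
  qed
  then obtain k where k: "k \<in> K" "k [^] p = \<one>" "k \<noteq> \<one>" by blast
  have kG: "k \<in> carrier G" using k(1) by simp
  have "ord k dvd p" using pow_eq_id[OF kG] k(2) by blast
  moreover have "ord k \<noteq> 1" using ord_eq_1[OF kG] k(3) by simp
  ultimately have ok: "ord k = p" using p prime_nat_iff by blast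
  have mem: "g \<in> ?S" if g: "g \<in> generate G {k}" for g
  proof -
    obtain i :: nat where i: "g = k [^] i" using g unfolding generate_singleton_iff[OF fin kG] by blast
    have "g [^] p = (k [^] p) [^] i" unfolding i by (simp only: nat_pow_pow[OF kG] mult.commute)
    then show ?thesis using k(1,2) subgroup_pow_closed[OF K_subgroup, of k i] i by simp
  qed
  have "card (generate G {k}) = card ?S" using generate_pow_card[OF kG] ok socle by simp
  then have S: "generate G {k} = ?S" by (intro card_subset_eq[OF finS] subsetI mem)
  have powers: "\<exists>i::nat. conj_by h k = k [^] i" if h: "h \<in> H" for h
  proof -
    have hG: "h \<in> carrier G" using h by simp
    have "conj_by h k \<in> ?S" using conj_by_K[OF hG k(1)] k(2) conj_by_pow[OF hG kG, of p] hG by simp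
    then show ?thesis unfolding S[symmetric] generate_singleton_iff[OF fin kG] .
  qed
  obtain i j :: nat where i: "conj_by x k = k [^] i" and j: "conj_by y k = k [^] j" using powers[OF x] powers[OF y] by blast
  have "conj_by (x \<otimes> y) k = conj_by x (conj_by y k)" using c kG by (simp add: conj_by_conj_by)
  also have "\<dots> = k [^] (i * j)" unfolding j using c kG by (simp add: conj_by_pow i nat_pow_pow)
  finally have xy: "conj_by (x \<otimes> y) k = k [^] (i * j)" .
  have "conj_by (y \<otimes> x) k = conj_by y (conj_by x k)" using c kG by (simp add: conj_by_conj_by)
  also have "\<dots> = k [^] (i * j)" unfolding i using c kG by (simp add: conj_by_pow j nat_pow_pow mult.commute)
  finally have yx: "conj_by (y \<otimes> x) k = k [^] (i * j)" .
  have "conj_by (inv (y \<otimes> x) \<otimes> (x \<otimes> y)) k = conj_by (inv (y \<otimes> x)) (conj_by (x \<otimes> y) k)"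
    using c kG by (intro conj_by_conj_by[symmetric]) simp_all
  also have "\<dots> = conj_by (inv (y \<otimes> x)) (conj_by (y \<otimes> x) k)" unfolding xy yx ..
  also have "\<dots> = k" by (rule conj_by_inv_left) (use c kG in simp_all)
  finally have "inv (y \<otimes> x) \<otimes> (x \<otimes> y) = \<one>"
    by (intro free[OF _ k(1,3)]) (use x y in simp_all)
  then show ?thesis using c by (metis inv_mult_cancel m_closed inv_solve_left' r_one one_closed)
qed

theorem perfect_order_classes_imp_form:
  assumes poc: "perfect_order_classes G" and q: "Factorial_Ring.prime q" "odd q"
    and factors: "prime_factors (card H) \<subseteq> {2, q}" and not_nilpotent: "\<not> nilpotent_group (G\<lparr>carrier := H\<rparr>)"
  shows "\<exists>p r k a b. (q, p, r, a, b) \<in> {(3, 5, 2, 3, 1), (3, 7, 2, 4, 1), (3, 17, 2, 5, 2), (5, 3, 4, 4, 1)} \<and> k > 0 \<and>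
    (p = 5 \<and> q = 3 \<and> has_frobenius_form G (cyclic_power (p ^ k) r) SL_2_3 \<or>
     (\<exists>\<psi>\<in>hom (integer_mod_group (2 ^ a)) (AutoGroup (integer_mod_group (q ^ b))).
        has_frobenius_form G (cyclic_power (p ^ k) r) (semidirect (integer_mod_group (q ^ b)) (integer_mod_group (2 ^ a)) \<psi>)))"
proof -
  let ?H = "G\<lparr>carrier := H\<rparr>"
  interpret HG: group ?H by (rule H_group)
  have oH: "order ?H = card H" by (simp add: order_def)
  have "card H > 0" using card_H_gt_one by simp
  then obtain a b where cH: "card H = 2 ^ a * q ^ b" using two_prime_factors[OF _ factors q(1)] by blast
  have a0: "a > 0"
  proof (rule ccontr)
    assume "\<not> ?thesis"
    then have "order ?H = q ^ b" using oH cH by simp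
    then show False using HG.prime_power_order_nilpotent[OF q(1)] not_nilpotent by blast
  qed
  have b0: "b > 0"
  proof (rule ccontr)
    assume "\<not> ?thesis"
    then have "order ?H = 2 ^ a" using oH cH by simp
    then show False using HG.prime_power_order_nilpotent[OF two_is_prime_nat] not_nilpotent by blast
  qed
  have even: "even (card H)" using cH a0 by simp
  obtain z where "unique_involution ?H z" using even_complement(1)[OF even] by blast
  then interpret U: unique_involution ?H z .
  note K_abelian = even_complement(2)[OF even]
  have pocH: "perfect_order_classes ?H" by (rule perfect_order_classes_complement[OF poc])
  obtain p r k where p: "Factorial_Ring.prime p" and k: "k > 0" and r0: "r > 0" and cHp: "card H = p ^ r - 1"
    and socle: "card {x \<in> K. x [^] p = \<one>} = p ^ r" and isoK: "cyclic_power (p ^ k) r \<cong> G\<lparr>carrier := K\<rparr>"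
    using kernel_homocyclic[OF poc K_abelian] by blast
  have qdvd: "q - 1 dvd 2 ^ a * q ^ b"
  proof -
    let ?E = "{x \<in> carrier ?H. HG.ord x = q}"
    have "q dvd order ?H" using cH b0 oH by simp
    then obtain x where "x \<in> ?E" using HG.exists_elem_of_prime_order[OF U.fin q(1)] by blast
    then have "card ?E \<noteq> 0" using U.fin by (auto simp: card_eq_0_iff)
    moreover have "card ?E = 0 \<or> card ?E dvd order ?H"
      by (rule pocH[unfolded perfect_order_classes_def, rule_format]) (rule prime_gt_0_nat[OF q(1)])
    ultimately have "card ?E dvd order ?H" by simp
    then have "q - 1 dvd order ?H" by (rule dvd_trans[OF HG.prime_minus_one_dvd_order_class[OF U.fin q(1)]])
    then show ?thesis unfolding oH cH .
  qed
  have "r \<noteq> 1"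
  proof
    assume "r = 1"
    then have "card {x \<in> K. x [^] p = \<one>} = p" using socle by simp
    note comm = abelian_complement_of_cyclic_socle[OF p this]
    have "nilpotent_group ?H" by (rule HG.abelian_nilpotent) (simp, rule comm, simp_all)
    then show False using not_nilpotent by blast
  qed
  then have r2: "r \<ge> 2" using r0 by simp
  have eq: "p ^ r - 1 = 2 ^ a * q ^ b" using cH cHp by simp
  have tuple: "(q, p, r, a, b) \<in> {(3, 5, 2, 3, 1), (3, 7, 2, 4, 1), (3, 17, 2, 5, 2), (5, 3, 4, 4, 1)}"
    by (rule two_prime_order_cases[OF p q eq a0 b0 r2 qdvd])
  \<comment> \<open>These three bounds are read off the four cases; the last is an equality in all
    of them except (3, 7, 2, 4, 1).\<close>
  have b2: "b \<le> 2" and a2: "a \<ge> 2" and le: "q ^ b \<le> 2 ^ (a - 2) + 1" using tuple by auto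
  have oH': "order ?H = 2 ^ a * q ^ b" using oH cH by simp
  have fr: "frobenius_product G K H" by (rule frobenius)
  have A: "group (cyclic_power (p ^ k) r)" by simp
  show ?thesis
  proof (cases "\<exists>c\<in>carrier ?H. HG.ord c = 2 ^ a")
    case True
    then obtain c where c: "c \<in> carrier ?H" "HG.ord c = 2 ^ a" by blast
    \<comment> \<open>The exponent b = 2 occurs only with q = 3, where
      \<open>no_elementary_abelian_nine\<close> applies.\<close>
    have unique: "y \<in> generate ?H {x}"
      if b: "b = 2" and xy: "x \<in> carrier ?H" "y \<in> carrier ?H" "HG.ord x = q" "HG.ord y = q" "x \<otimes>\<^bsub>?H\<^esub> y = y \<otimes>\<^bsub>?H\<^esub> x" for x y
    proof -
      have q3: "q = 3" using tuple b by auto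
      have H: "x \<in> H" "y \<in> H" "ord x = 3" "ord y = 3" "x \<otimes> y = y \<otimes> x" using xy q3 by (simp_all add: ord_subgroup[OF H_subgroup])
      have "y = x \<or> y = x \<otimes> x" by (rule no_elementary_abelian_nine[OF K_abelian H(1,3,2,4,5)])
      then show ?thesis unfolding generate_restrict[OF H_subgroup H(1)]
        by (elim disjE) (auto intro: generate.incl generate.eng)
    qed
    obtain \<psi> where \<psi>: "\<psi> \<in> hom (integer_mod_group (2 ^ a)) (AutoGroup (integer_mod_group (q ^ b)))"
      and iso: "semidirect (integer_mod_group (q ^ b)) (integer_mod_group (2 ^ a)) \<psi> \<cong> ?H"
      using U.cyclic_sylow_semidirect[OF q oH' b2 c unique] by blast
    have B: "group (semidirect (integer_mod_group (q ^ b)) (integer_mod_group (2 ^ a)) \<psi>)"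
      by (rule semidirect_group[OF _ _ \<psi>]) simp_all
    show ?thesis using tuple k \<psi> has_frobenius_formI[OF is_group A B fr isoK iso] by blast
  next
    case False
    then have no: "HG.ord c \<noteq> 2 ^ a" if "c \<in> carrier ?H" for c using that by blast
    have Q: "a = 3 \<and> q ^ b = 3 \<and> SL_2_3 \<cong> ?H"
      by (rule U.quaternion_sylow_cases[OF q oH' b2 a2 no pocH le not_nilpotent])
    then have "p = 5 \<and> q = 3" using tuple by auto
    then show ?thesis using tuple k Q has_frobenius_formI[OF is_group A SL_2_3_group fr isoK] by blast
  qed
qed

end

section \<open>From the listed forms back to perfect order classes\<close>

lemma (in group) cyclic_subgroup_generator:
  assumes S: "subgroup S G" and iso: "integer_mod_group n \<cong> G\<lparr>carrier := S\<rparr>" and n: "n > 1" and fin: "finite (carrier G)"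
  shows "\<exists>t\<in>carrier G. ord t = n \<and> generate G {t} = S"
proof -
  let ?Z = "integer_mod_group n"
  interpret Z: group ?Z by simp
  have SG: "group (G\<lparr>carrier := S\<rparr>)" by (rule subgroup.subgroup_is_group[OF S]) (rule is_group)
  obtain f where f: "f \<in> iso ?Z (G\<lparr>carrier := S\<rparr>)" using iso by (auto simp: is_iso_def)
  \<comment> \<open>The generator will be the image of 1, which belongs to the carrier because n >
    1.\<close>
  have one: "1 \<in> carrier ?Z" using n by simp
  have "Z.ord 1 = n"
  proof (rule dvd_antisym)
    have "(1::int) [^]\<^bsub>?Z\<^esub> n = \<one>\<^bsub>?Z\<^esub>" by simp
    then show "Z.ord 1 dvd n" using Z.pow_eq_id[OF one] by blast
    have "(1::int) [^]\<^bsub>?Z\<^esub> Z.ord 1 = \<one>\<^bsub>?Z\<^esub>" by (rule Z.pow_ord_eq_1[OF one])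
    then have "int n dvd int (Z.ord 1)" by (simp add: mod_eq_0_iff_dvd)
    then show "n dvd Z.ord 1" by simp
  qed
  then have t: "ord (f 1) = n" using iso_ord[OF Z.is_group SG f one] ord_subgroup[OF S] by simp
  have fS: "f 1 \<in> S" using f one by (auto simp: iso_def hom_def)
  then have fG: "f 1 \<in> carrier G" using subgroup.mem_carrier[OF S] by blast
  have "generate G {f 1} = S"
  proof (rule card_subset_eq)
    show "finite S" by (rule finite_subset[OF subgroup.subset[OF S] fin])
    show "generate G {f 1} \<subseteq> S" by (rule generate_subgroup_incl[OF _ S]) (use fS in simp)
    have "card S = n" using iso_same_card[OF iso] n by (simp add: carrier_integer_mod_group)
    then show "card (generate G {f 1}) = card S" using generate_pow_card[OF fG] t by simp
  qed
  then show ?thesis using fG t by blast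
qed

lemma cyclic_semidirect_perfect_order_classes:
  fixes q a b e :: nat
  defines "A \<equiv> integer_mod_group (q ^ b)" and "B \<equiv> integer_mod_group (2 ^ a)"
  assumes \<psi>: "\<psi> \<in> hom B (AutoGroup A)" and q: "Factorial_Ring.prime q" "odd q" "q - 1 = 2 ^ e" and b: "b > 0" and a: "a > 0"
    and e: "e \<le> 1 \<or> e = 2 \<and> (\<exists>x\<in>carrier (semidirect A B \<psi>). \<exists>y\<in>carrier (semidirect A B \<psi>).
      x \<otimes>\<^bsub>semidirect A B \<psi>\<^esub> y \<noteq> y \<otimes>\<^bsub>semidirect A B \<psi>\<^esub> x)" and ea: "e \<le> a"
  shows "perfect_order_classes (semidirect A B \<psi>)" and "card (carrier (semidirect A B \<psi>)) = q ^ b * 2 ^ a"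
proof -
  let ?S = "semidirect A B \<psi>"
  have A: "group A" and B: "group B" by (simp_all add: A_def B_def)
  interpret S: group ?S by (rule semidirect_group[OF A B \<psi>])
  have q0: "q > 1" using q(1) prime_gt_1_nat by blast
  have "card (carrier (integer_mod_group n)) = n" if "n > 0" for n using that by (simp add: carrier_integer_mod_group)
  then show card: "card (carrier ?S) = q ^ b * 2 ^ a" using q0 unfolding A_def B_def by (simp add: card_cartesian_product)
  have fin: "finite (carrier ?S)" by (rule card_ge_0_finite) (use card q0 in simp)
  let ?K = "carrier A \<times> {\<one>\<^bsub>B\<^esub>}" and ?H = "{\<one>\<^bsub>A\<^esub>} \<times> carrier B"
  note int = semidirect_internal[OF A B \<psi>]
  have K: "subgroup ?K ?S" and H: "subgroup ?H ?S" using int(1) normal_imp_subgroup by (auto simp: internal_semidirect_def)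
  have "integer_mod_group (q ^ b) \<cong> ?S\<lparr>carrier := ?K\<rparr>" using int(2) unfolding is_iso_def A_def by blast
  from S.cyclic_subgroup_generator[OF K this one_less_power[OF q0 b] fin]
  obtain t where t: "t \<in> carrier ?S" "S.ord t = q ^ b" "generate ?S {t} = ?K" by blast
  have iso_c: "integer_mod_group (2 ^ a) \<cong> ?S\<lparr>carrier := ?H\<rparr>" using int(3) unfolding is_iso_def B_def by blast
  have "1 < (2::nat) ^ a" using a by (intro one_less_power) simp_all
  from S.cyclic_subgroup_generator[OF H iso_c this fin]
  obtain c where c: "c \<in> carrier ?S" "S.ord c = 2 ^ a" "generate ?S {c} = ?H" by blast
  have tc: "internal_semidirect ?S (generate ?S {t}) (generate ?S {c})" unfolding t(3) c(3) by (rule int(1))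
  \<comment> \<open>If the two generators commuted, their common centralizer would be everything, so
    both would be central and the whole product abelian.\<close>
  have e': "e \<le> 1 \<or> e = 2 \<and> c \<otimes>\<^bsub>?S\<^esub> t \<noteq> t \<otimes>\<^bsub>?S\<^esub> c"
  proof (rule ccontr)
    assume "\<not> ?thesis"
    then have ct: "c \<otimes>\<^bsub>?S\<^esub> t = t \<otimes>\<^bsub>?S\<^esub> c" using e by blast
    have all: "carrier ?S \<subseteq> U" if U: "subgroup U ?S" "t \<in> U" "c \<in> U" for U
    proof -
      have "generate ?S {t} \<subseteq> U" "generate ?S {c} \<subseteq> U" using S.generate_subgroup_incl[OF _ U(1)] U(2,3) by simp_all
      then have "generate ?S {t} <#>\<^bsub>?S\<^esub> generate ?S {c} \<subseteq> U" using subgroup.m_closed[OF U(1)] unfolding set_mult_def by blast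
      then show ?thesis using tc unfolding internal_semidirect_def by blast
    qed
    let ?C = "{g \<in> carrier ?S. \<forall>x\<in>{t, c}. g \<otimes>\<^bsub>?S\<^esub> x = x \<otimes>\<^bsub>?S\<^esub> g}"
    let ?Z = "{g \<in> carrier ?S. \<forall>x\<in>carrier ?S. g \<otimes>\<^bsub>?S\<^esub> x = x \<otimes>\<^bsub>?S\<^esub> g}"
    have "subgroup ?C ?S" by (rule S.centralizer_subgroup) (use t(1) c(1) in blast)
    moreover have "t \<in> ?C" "c \<in> ?C" using t(1) c(1) ct by auto
    ultimately have "carrier ?S \<subseteq> ?C" by (rule all)
    then have "x \<otimes>\<^bsub>?S\<^esub> t = t \<otimes>\<^bsub>?S\<^esub> x \<and> x \<otimes>\<^bsub>?S\<^esub> c = c \<otimes>\<^bsub>?S\<^esub> x" if "x \<in> carrier ?S" for x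
      using that by blast
    note comm = this[THEN conjunct1, symmetric] this[THEN conjunct2, symmetric]
    have "t \<in> ?Z" "c \<in> ?Z" by (intro CollectI conjI ballI t(1) c(1) comm; assumption)+
    moreover have "subgroup ?Z ?S" by (rule S.centralizer_subgroup) simp
    ultimately have Z: "carrier ?S \<subseteq> ?Z" by (intro all)
    have "x \<otimes>\<^bsub>?S\<^esub> y = y \<otimes>\<^bsub>?S\<^esub> x" if "x \<in> carrier ?S" "y \<in> carrier ?S" for x y using subsetD[OF Z that(1)] that(2) by blast
    then have "e \<le> 1" using e by blast
    then show False using \<open>\<not> (e \<le> 1 \<or> e = 2 \<and> c \<otimes>\<^bsub>?S\<^esub> t \<noteq> t \<otimes>\<^bsub>?S\<^esub> c)\<close> by blast
  qed
  show "perfect_order_classes ?S"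
    by (rule S.metacyclic_perfect_order_classes[OF fin q t(1,2) c(1,2) tc e' ea])
qed

lemma form_perfect_order_classes:
  fixes q a b e :: nat and G :: "('a, 'b) monoid_scheme"
  assumes fr: "frobenius G K H" and not_nilpotent: "\<not> nilpotent_group (G\<lparr>carrier := H\<rparr>)"
    and \<psi>: "\<psi> \<in> hom (integer_mod_group (2 ^ a)) (AutoGroup (integer_mod_group (q ^ b)))"
    and form: "has_frobenius_form G (cyclic_power (p ^ k) r) (semidirect (integer_mod_group (q ^ b)) (integer_mod_group (2 ^ a)) \<psi>)"
    and q: "Factorial_Ring.prime q" "odd q" "q - 1 = 2 ^ e" and b: "b > 0" and e: "e \<le> 2" and ea: "e \<le> a" "a > 0"
    and p: "Factorial_Ring.prime p" and eq: "p ^ r - 1 = q ^ b * 2 ^ a"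
  shows "perfect_order_classes G"
proof -
  interpret frobenius G K H by (rule fr)
  let ?B = "semidirect (integer_mod_group (q ^ b)) (integer_mod_group (2 ^ a)) \<psi>"
  have B: "group ?B" by (rule semidirect_group[OF _ _ \<psi>]) simp_all
  have nonabelian: "\<exists>x\<in>carrier ?B. \<exists>y\<in>carrier ?B. x \<otimes>\<^bsub>?B\<^esub> y \<noteq> y \<otimes>\<^bsub>?B\<^esub> x"
    by (rule nonabelian_complement_of_form[OF not_nilpotent form cyclic_power_group B])
  have "e \<le> 1 \<or> e = 2" using e by linarith
  then have e': "e \<le> 1 \<or> e = 2 \<and> (\<exists>x\<in>carrier ?B. \<exists>y\<in>carrier ?B. x \<otimes>\<^bsub>?B\<^esub> y \<noteq> y \<otimes>\<^bsub>?B\<^esub> x)" using nonabelian by blast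
  note B' = cyclic_semidirect_perfect_order_classes[OF \<psi> q b ea(2) e' ea(1)]
  show ?thesis
    by (rule frobenius_form_perfect_order_classes[OF is_group fin B form p _ B'(1)]) (simp only: B'(2) eq)
qed

theorem theoremD:
  fixes G :: "('a, 'b) monoid_scheme" and K H :: "'a set" and q :: nat
  assumes "group G" and "finite (carrier G)"
    and "frobenius_product G K H"
    and "Factorial_Ring.prime q" and "odd q"
    and "prime_factors (Coset.order (G\<lparr>carrier := H\<rparr>)) \<subseteq> {2, q}"
    and "\<not> nilpotent_group (G\<lparr>carrier := H\<rparr>)"
  shows "perfect_order_classes G \<longleftrightarrow>
    (q = 3 \<or> q = 5) \<and>
    (\<exists>k::nat. k > 0 \<and>
      (has_frobenius_form G (cyclic_power (5 ^ k) 2) SL_2_3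
     \<or> (\<exists>\<psi> \<in> hom (integer_mod_group 8) (AutoGroup (integer_mod_group 3)).
          has_frobenius_form G (cyclic_power (5 ^ k) 2)
            (semidirect (integer_mod_group 3) (integer_mod_group 8) \<psi>))
     \<or> (\<exists>\<psi> \<in> hom (integer_mod_group 16) (AutoGroup (integer_mod_group 3)).
          has_frobenius_form G (cyclic_power (7 ^ k) 2)
            (semidirect (integer_mod_group 3) (integer_mod_group 16) \<psi>))
     \<or> (\<exists>\<psi> \<in> hom (integer_mod_group 32) (AutoGroup (integer_mod_group 9)).
          has_frobenius_form G (cyclic_power (17 ^ k) 2)
            (semidirect (integer_mod_group 9) (integer_mod_group 32) \<psi>))
     \<or> (\<exists>\<psi> \<in> hom (integer_mod_group 16) (AutoGroup (integer_mod_group 5)).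
          has_frobenius_form G (cyclic_power (3 ^ k) 4)
            (semidirect (integer_mod_group 5) (integer_mod_group 16) \<psi>))))" (is "_ \<longleftrightarrow> ?q \<and> (\<exists>k. ?form k)")
proof -
  interpret group G by fact
  interpret frobenius G K H by unfold_locales fact+
  have fr: "frobenius G K H" by unfold_locales
  show ?thesis
  proof
    assume poc: "perfect_order_classes G"
    have "prime_factors (card H) \<subseteq> {2, q}" using assms(6) by (simp add: order_def)
    from perfect_order_classes_imp_form[OF poc assms(4,5) this assms(7)]
    obtain p r k a b where tuple: "(q, p, r, a, b) \<in> {(3, 5, 2, 3, 1), (3, 7, 2, 4, 1), (3, 17, 2, 5, 2), (5, 3, 4, 4, 1)}"
      and k: "k > 0"
      and form: "p = 5 \<and> q = 3 \<and> has_frobenius_form G (cyclic_power (p ^ k) r) SL_2_3 \<or>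
        (\<exists>\<psi>\<in>hom (integer_mod_group (2 ^ a)) (AutoGroup (integer_mod_group (q ^ b))).
        has_frobenius_form G (cyclic_power (p ^ k) r) (semidirect (integer_mod_group (q ^ b)) (integer_mod_group (2 ^ a)) \<psi>))"
      by blast
    have "?form k"
    proof -
      consider "q = 3" "p = 5" "r = 2" "a = 3" "b = 1" | "q = 3" "p = 7" "r = 2" "a = 4" "b = 1"
        | "q = 3" "p = 17" "r = 2" "a = 5" "b = 2" | "q = 5" "p = 3" "r = 4" "a = 4" "b = 1" using tuple by auto
      then show ?thesis
      proof cases
        case 1
        have "has_frobenius_form G (cyclic_power (5 ^ k) 2) SL_2_3 \<or>
          (\<exists>\<psi> \<in> hom (integer_mod_group 8) (AutoGroup (integer_mod_group 3)).
          has_frobenius_form G (cyclic_power (5 ^ k) 2) (semidirect (integer_mod_group 3) (integer_mod_group 8) \<psi>))"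
          using form unfolding 1 by simp
        then show ?thesis using k by blast
      next
        case 2
        have "\<exists>\<psi> \<in> hom (integer_mod_group 16) (AutoGroup (integer_mod_group 3)).
          has_frobenius_form G (cyclic_power (7 ^ k) 2) (semidirect (integer_mod_group 3) (integer_mod_group 16) \<psi>)"
          using form unfolding 2 by simp
        then show ?thesis using k by blast
      next
        case 3
        have "\<exists>\<psi> \<in> hom (integer_mod_group 32) (AutoGroup (integer_mod_group 9)).
          has_frobenius_form G (cyclic_power (17 ^ k) 2) (semidirect (integer_mod_group 9) (integer_mod_group 32) \<psi>)"
          using form unfolding 3 by simp
        then show ?thesis using k by blast
      next
        case 4
        have "\<exists>\<psi> \<in> hom (integer_mod_group 16) (AutoGroup (integer_mod_group 5)).
          has_frobenius_form G (cyclic_power (3 ^ k) 4) (semidirect (integer_mod_group 5) (integer_mod_group 16) \<psi>)"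
          using form unfolding 4 by simp
        then show ?thesis using k by blast
      qed
    qed
    moreover have ?q using tuple by auto
    ultimately show "?q \<and> (\<exists>k. ?form k)" by blast
  next
    assume "?q \<and> (\<exists>k. ?form k)"
    then obtain k where "?form k" by blast
    have prime: "Factorial_Ring.prime (3::nat)" "Factorial_Ring.prime (5::nat)" "Factorial_Ring.prime (7::nat)"
      "Factorial_Ring.prime (17::nat)" by simp_all
    \<comment> \<open>Below, \<open>e\<close> is the exponent in q - 1 = 2^e: 1 for q = 3 and 2 for
      q = 5.\<close>
    note result = form_perfect_order_classes[OF fr assms(7)]
    from \<open>?form k\<close> consider
        "has_frobenius_form G (cyclic_power (5 ^ k) 2) SL_2_3"
      | \<psi> where "\<psi> \<in> hom (integer_mod_group 8) (AutoGroup (integer_mod_group 3))"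
          "has_frobenius_form G (cyclic_power (5 ^ k) 2) (semidirect (integer_mod_group 3) (integer_mod_group 8) \<psi>)"
      | \<psi> where "\<psi> \<in> hom (integer_mod_group 16) (AutoGroup (integer_mod_group 3))"
          "has_frobenius_form G (cyclic_power (7 ^ k) 2) (semidirect (integer_mod_group 3) (integer_mod_group 16) \<psi>)"
      | \<psi> where "\<psi> \<in> hom (integer_mod_group 32) (AutoGroup (integer_mod_group 9))"
          "has_frobenius_form G (cyclic_power (17 ^ k) 2) (semidirect (integer_mod_group 9) (integer_mod_group 32) \<psi>)"
      | \<psi> where "\<psi> \<in> hom (integer_mod_group 16) (AutoGroup (integer_mod_group 5))"
          "has_frobenius_form G (cyclic_power (3 ^ k) 4) (semidirect (integer_mod_group 5) (integer_mod_group 16) \<psi>)"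
      by blast
    then show "perfect_order_classes G"
    proof cases
      case 1
      then show ?thesis
        by (rule frobenius_form_perfect_order_classes[OF is_group fin SL_2_3_group _ prime(2) _ SL_2_3_perfect_order_classes])
          (simp add: SL_2_3_card)
    next
      case (2 \<psi>)
      then show ?thesis using result[where \<psi> = \<psi> and a = 3 and q = 3 and b = 1 and p = 5 and r = 2 and e = 1 and k = k] prime by simp
    next
      case (3 \<psi>)
      then show ?thesis using result[where \<psi> = \<psi> and a = 4 and q = 3 and b = 1 and p = 7 and r = 2 and e = 1 and k = k] prime by simp
    next
      case (4 \<psi>)
      then show ?thesis using result[where \<psi> = \<psi> and a = 5 and q = 3 and b = 2 and p = 17 and r = 2 and e = 1 and k = k] prime by simp
    next
      case (5 \<psi>)
      then show ?thesis using result[where \<psi> = \<psi> and a = 4 and q = 5 and b = 1 and p = 3 and r = 4 and e = 2 and k = k] prime by simp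
    qed
  qed
qed

end
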